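(* Let $d\ge 1$ be an integer, $p\ge 1$ a real number, and let $\Omega\subset\mathbb{R}^d$ be a nonempty, open, proper subset. (a) Let $f\in C_c^2(\overline{\Omega})$ and let $U\subset\mathbb{R}^2$ be a nonempty open set. Assume that there is $s_0\in(0,1)$ such that $[f]_{W^{s,p}_{\alpha,\beta}(\Omega)}<\infty$ for all $(\alpha,\beta)\in U$ and all $s\in(s_0,1)$. Then, for all $(\alpha,\beta)\in U$, $$\lim_{s\to 1^-}(1-s)\int_{\Omega}\int_{\Omega}\frac{|f(x)-f(y)|^p}{|x-y|^{d+sp}}\,d_{\Omega}(x)^{-\alpha}d_{\Omega}(y)^{-\beta}\,dy\,dx=K_{d,p}\int_{\Omega}\frac{|\nabla f(x)|^p}{d_{\Omega}(x)^{\alpha+\beta}}\,dx.\qquad( * )$$ (b) Let $p>1$ and $\alpha,\beta\in\mathbb{R}$. Suppose that $\Omega$ is a $W^{1,p}_{\alpha+\beta}$-extension domain, that $d_\Omega^{-\alpha-\beta}\in A_p$, and that at least one of the following two conditions holds: (i) $d_\Omega^{-\alpha}\in A_1$ and $d_\Omega^{-\beta}\in A_1$; (ii) $\alpha\beta\ge 0$ and $d_\Omega^{-\alpha-\beta}\in A_1$. Then $( * )$ holds for all $f\in L^p(\Omega,d_\Omega^{-\alpha-\beta})$, with the convention that the right-hand side is $+\infty$ if $f\notin W^{1,p}_{\alpha+\beta}(\Omega)$. Moreover, for $f\in L^p(\Omega,d_\Omega^{-\alpha-\beta})$, one has $f\in W^{1,p}_{\alpha+\beta}(\Omega)$ if and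 only if $$\liminf_{s\to 1^-}(1-s)\int_{\Omega}\int_{\Omega}\frac{|f(x)-f(y)|^p}{|x-y|^{d+sp}}\,d_{\Omega}(x)^{-\alpha}d_{\Omega}(y)^{-\beta}\,dy\,dx<\infty.$$ (c) Let $p=1$ and $\alpha,\beta\in\mathbb{R}$. Suppose that $\Omega$ is a $W^{1,1}_{\alpha+\beta}$-extension domain, that $d_\Omega^{-\alpha-\beta}\in A_1$, and that (i) or (ii) above holds. Then $( * )$ holds (with $p=1$) for all $f\in W^{1,1}_{\alpha+\beta}(\Omega)$.
   Context: All functions are real-valued. For a nonempty, open, proper subset $\Omega\subset\mathbb{R}^d$, $d_\Omega(x)=\operatorname{dist}(x,\partial\Omega)=\inf_{y\in\partial\Omega}|x-y|$ for $x\in\mathbb{R}^d$ (so $d_\Omega$ is defined also outside $\Omega$). For measurable $f:\Omega\to\mathbb{R}$, $p\ge1$, $0\le s<1$, $\alpha,\beta\in\mathbb{R}$, $$[f]_{W^{s,p}_{\alpha,\beta}(\Omega)}=\left(\int_{\Omega}\int_{\Omega}\frac{|f(x)-f(y)|^p}{|x-y|^{d+sp}}\,d_{\Omega}(x)^{-\alpha}d_{\Omega}(y)^{-\beta}\,dy\,dx\right)^{1/p}.$$ The constant is $$K_{d,p}=\frac{2\pi^{\frac{d-1}{2}}}{p}\,\frac{\Gamma\left(\frac{p+1}{2}\right)}{\Gamma\left(\frac{p+d}{2}\right)}.$$ $C_c^2(\overline\Omega)$ denotes the $C^2$ functions on $\overline\Omega$ with compact support in $\overline\Omega$ (restrictions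 to $\overline\Omega$ of functions in $C_c^2(\mathbb{R}^d)$); they need not vanish on $\partial\Omega$. For an open set $G$ and weight $w\ge0$, $L^p(G,w)$ is the space of measurable $f$ with $\int_G|f|^pw\,dx<\infty$, and $W^{1,p}(G,w)$ is the space of $f\in L^p(G,w)$ whose distributional gradient satisfies $\int_G|\nabla f|^pw\,dx<\infty$, with the natural norm $\|f\|_{L^p(G,w)}+\left(\int_G|\nabla f|^pw\,dx\right)^{1/p}$. For $\gamma\in\mathbb{R}$, $W^{1,p}_\gamma(\Omega)=W^{1,p}(\Omega,d_\Omega^{-\gamma})$. $\Omega$ is a $W^{1,p}_\gamma$-extension domain if there is a bounded linear operator $\Lambda:W^{1,p}_\gamma(\Omega)\to W^{1,p}(\mathbb{R}^d,d_\Omega^{-\gamma})$ with $\Lambda f|_\Omega=f$ for all $f\in W^{1,p}_\gamma(\Omega)$. Muckenhoupt classes: for $p>1$, a weight $w$ on $\mathbb{R}^d$ is in $A_p$ if $$\sup_Q\frac1{|Q|}\left(\int_Qw\,dx\right)^{1/p}\left(\int_Qw^{-\frac1{p-1}}\,dx\right)^{\frac{p-1}{p}}<\infty,$$ the supremum being over all cubes $Q\subset\mathbb{R}^d$; $w\in A_1$ if there is a constant $C$ with $\frac1{|Q|}\int_Qw\,dx\le Cw(y)$ for almost all $y\in Q$, for all cubes $Q$. *)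

theory Defs
  imports "HOL-Analysis.Analysis"
begin

text \<open>
  The space $\mathbf{R}^d$ is an arbitrary type of class \<^class>\<open>euclidean_space\<close>, with
  $d$ its \<open>DIM\<close>. Functions on \<open>\<Omega>\<close> are represented by total functions of which only the
  values on \<open>\<Omega>\<close> matter. Weights and integrals of nonnegative functions take values in
  $[0,\infty]$, so that no convergence has to be assumed to write them down. All integrals are
  with respect to Lebesgue measure on the Lebesgue sigma-algebra.
\<close>

text \<open>
  Real powers on $[0,\infty]$, with $x^0 = 1$, and $0^a = \infty$, $\infty^a = 0$ for $a < 0$.
  In contrast, \<^term>\<open>(0::real) powr a\<close> is \<open>0\<close> for every \<open>a\<close>, which would give
  $d_\Omega^{-\gamma}$ the wrong value on the boundary of \<open>\<Omega>\<close>.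
\<close>

definition epowr :: "ennreal \<Rightarrow> real \<Rightarrow> ennreal" where
  "epowr x a =
     (if a = 0 then 1
      else if x = 0 then (if a < 0 then \<infinity> else 0)
      else if x = \<infinity> then (if a < 0 then 0 else \<infinity>)
      else ennreal (enn2real x powr a))"

definition bdist :: "'a::euclidean_space set \<Rightarrow> 'a \<Rightarrow> real" where
  "bdist \<Omega> x = infdist x (frontier \<Omega>)"

definition dist_weight :: "'a::euclidean_space set \<Rightarrow> real \<Rightarrow> 'a \<Rightarrow> ennreal" where
  "dist_weight \<Omega> \<gamma> x = epowr (ennreal (bdist \<Omega> x)) (- \<gamma>)"

definition gagliardo_energy ::
  "'a::euclidean_space set \<Rightarrow> real \<Rightarrow> real \<Rightarrow> real \<Rightarrow> real \<Rightarrow> ('a \<Rightarrow> real) \<Rightarrow> ennreal" where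
  "gagliardo_energy \<Omega> s p \<alpha> \<beta> f =
     (\<integral>\<^sup>+x\<in>\<Omega>. (\<integral>\<^sup>+y\<in>\<Omega>.
         ennreal (\<bar>f x - f y\<bar> powr p / norm (x - y) powr (real DIM('a) + s * p))
           * dist_weight \<Omega> \<alpha> x * dist_weight \<Omega> \<beta> y \<partial>lebesgue) \<partial>lebesgue)"

definition gagliardo_seminorm ::
  "'a::euclidean_space set \<Rightarrow> real \<Rightarrow> real \<Rightarrow> real \<Rightarrow> real \<Rightarrow> ('a \<Rightarrow> real) \<Rightarrow> ennreal" where
  "gagliardo_seminorm \<Omega> s p \<alpha> \<beta> f = epowr (gagliardo_energy \<Omega> s p \<alpha> \<beta> f) (1 / p)"

definition K_const :: "nat \<Rightarrow> real \<Rightarrow> real" where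
  "K_const d p =
     2 * pi powr ((real d - 1) / 2) / p * (Gamma ((p + 1) / 2) / Gamma ((p + real d) / 2))"

definition partial_deriv :: "'a::euclidean_space \<Rightarrow> ('a \<Rightarrow> real) \<Rightarrow> 'a \<Rightarrow> real" where
  "partial_deriv b f x = frechet_derivative f (at x) b"

definition grad :: "('a::euclidean_space \<Rightarrow> real) \<Rightarrow> 'a \<Rightarrow> 'a" where
  "grad f x = (\<Sum>b\<in>Basis. partial_deriv b f x *\<^sub>R b)"

primrec C_k :: "nat \<Rightarrow> ('a::euclidean_space \<Rightarrow> real) \<Rightarrow> bool" where
  "C_k 0 f \<longleftrightarrow> continuous_on UNIV f"
| "C_k (Suc k) f \<longleftrightarrow>
     (\<forall>x. f differentiable (at x)) \<and> (\<forall>b\<in>Basis. C_k k (partial_deriv b f))"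

definition supp :: "('a::euclidean_space \<Rightarrow> real) \<Rightarrow> 'a set" where
  "supp f = closure {x. f x \<noteq> 0}"

text \<open>$C_c^2(\overline\Omega)$: restrictions to the closure of functions in
  $C_c^2(\mathbf{R}^d)$; they need not vanish on the boundary.\<close>

definition C2c_closure :: "'a::euclidean_space set \<Rightarrow> ('a \<Rightarrow> real) set" where
  "C2c_closure \<Omega> =
     {f. \<exists>F. C_k 2 F \<and> compact (supp F) \<and> (\<forall>x\<in>closure \<Omega>. f x = F x)}"

definition test_functions :: "'a::euclidean_space set \<Rightarrow> ('a \<Rightarrow> real) set" where
  "test_functions G = {\<phi>. (\<forall>k. C_k k \<phi>) \<and> compact (supp \<phi>) \<and> supp \<phi> \<subseteq> G}"

definition locally_integrable_on ::
  "'a::euclidean_space set \<Rightarrow> ('a \<Rightarrow> 'b::euclidean_space) \<Rightarrow> bool" where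
  "locally_integrable_on G f \<longleftrightarrow> (\<forall>K. compact K \<and> K \<subseteq> G \<longrightarrow> set_integrable lebesgue K f)"

definition has_weak_gradient ::
  "'a::euclidean_space set \<Rightarrow> ('a \<Rightarrow> real) \<Rightarrow> ('a \<Rightarrow> 'a) \<Rightarrow> bool" where
  "has_weak_gradient G f g \<longleftrightarrow>
     locally_integrable_on G f \<and> locally_integrable_on G g \<and>
     (\<forall>\<phi>\<in>test_functions G. \<forall>b\<in>Basis.
        (LINT x:G|lebesgue. f x * partial_deriv b \<phi> x) = - (LINT x:G|lebesgue. (g x \<bullet> b) * \<phi> x))"

text \<open>The distributional gradient is determined up to a null set.\<close>

definition weak_grad :: "'a::euclidean_space set \<Rightarrow> ('a \<Rightarrow> real) \<Rightarrow> 'a \<Rightarrow> 'a" where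
  "weak_grad G f = (SOME g. has_weak_gradient G f g)"

definition weighted_energy ::
  "'a::euclidean_space set \<Rightarrow> real \<Rightarrow> ('a \<Rightarrow> ennreal) \<Rightarrow> ('a \<Rightarrow> 'b::real_normed_vector) \<Rightarrow> ennreal"
  where
  "weighted_energy G p w h = (\<integral>\<^sup>+x\<in>G. ennreal (norm (h x) powr p) * w x \<partial>lebesgue)"

definition weighted_Lp ::
  "'a::euclidean_space set \<Rightarrow> real \<Rightarrow> ('a \<Rightarrow> ennreal) \<Rightarrow> ('a \<Rightarrow> real) set" where
  "weighted_Lp G p w = {f. f \<in> borel_measurable (lebesgue_on G) \<and> weighted_energy G p w f < \<infinity>}"

definition weighted_W1p ::
  "'a::euclidean_space set \<Rightarrow> real \<Rightarrow> ('a \<Rightarrow> ennreal) \<Rightarrow> ('a \<Rightarrow> real) set" where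
  "weighted_W1p G p w =
     {f \<in> weighted_Lp G p w. \<exists>g. has_weak_gradient G f g \<and> weighted_energy G p w g < \<infinity>}"

definition W1p_norm ::
  "'a::euclidean_space set \<Rightarrow> real \<Rightarrow> ('a \<Rightarrow> ennreal) \<Rightarrow> ('a \<Rightarrow> real) \<Rightarrow> ennreal" where
  "W1p_norm G p w f =
     epowr (weighted_energy G p w f) (1 / p) + epowr (weighted_energy G p w (weak_grad G f)) (1 / p)"

definition W1p_dist :: "'a::euclidean_space set \<Rightarrow> real \<Rightarrow> real \<Rightarrow> ('a \<Rightarrow> real) set" where
  "W1p_dist \<Omega> p \<gamma> = weighted_W1p \<Omega> p (dist_weight \<Omega> \<gamma>)"

text \<open>
  Elements of Sobolev spaces are functions rather than classes modulo equality almost everywhere.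
  Accordingly an operator acts on functions, respects equality almost everywhere, and is linear and
  extends its argument up to null sets.
\<close>

definition W1p_extension_operator ::
  "'a::euclidean_space set \<Rightarrow> real \<Rightarrow> real \<Rightarrow> (('a \<Rightarrow> real) \<Rightarrow> ('a \<Rightarrow> real)) \<Rightarrow> bool" where
  "W1p_extension_operator \<Omega> p \<gamma> \<Lambda> \<longleftrightarrow>
     (\<forall>f\<in>W1p_dist \<Omega> p \<gamma>. \<Lambda> f \<in> weighted_W1p UNIV p (dist_weight \<Omega> \<gamma>)) \<and>
     (\<forall>f\<in>W1p_dist \<Omega> p \<gamma>. \<forall>g\<in>W1p_dist \<Omega> p \<gamma>.
        (AE x in lebesgue. x \<in> \<Omega> \<longrightarrow> f x = g x) \<longrightarrow> (AE x in lebesgue. \<Lambda> f x = \<Lambda> g x)) \<and>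
     (\<forall>f\<in>W1p_dist \<Omega> p \<gamma>. \<forall>g\<in>W1p_dist \<Omega> p \<gamma>.
        AE x in lebesgue. \<Lambda> (\<lambda>y. f y + g y) x = \<Lambda> f x + \<Lambda> g x) \<and>
     (\<forall>f\<in>W1p_dist \<Omega> p \<gamma>. \<forall>c. AE x in lebesgue. \<Lambda> (\<lambda>y. c * f y) x = c * \<Lambda> f x) \<and>
     (\<exists>C::real. \<forall>f\<in>W1p_dist \<Omega> p \<gamma>.
        W1p_norm UNIV p (dist_weight \<Omega> \<gamma>) (\<Lambda> f)
          \<le> ennreal C * W1p_norm \<Omega> p (dist_weight \<Omega> \<gamma>) f) \<and>
     (\<forall>f\<in>W1p_dist \<Omega> p \<gamma>. AE x in lebesgue. x \<in> \<Omega> \<longrightarrow> \<Lambda> f x = f x)"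

definition W1p_extension_domain :: "'a::euclidean_space set \<Rightarrow> real \<Rightarrow> real \<Rightarrow> bool" where
  "W1p_extension_domain \<Omega> p \<gamma> \<longleftrightarrow> (\<exists>\<Lambda>. W1p_extension_operator \<Omega> p \<gamma> \<Lambda>)"

definition cubes :: "'a::euclidean_space set set" where
  "cubes = {cbox a (a + l *\<^sub>R One) | a l. l > 0}"

definition is_weight :: "('a::euclidean_space \<Rightarrow> ennreal) \<Rightarrow> bool" where
  "is_weight w \<longleftrightarrow> w \<in> borel_measurable lebesgue \<and> (AE x in lebesgue. w x < \<infinity>)"

text \<open>The following is meant for \<open>p > 1\<close> only; the case \<open>p = 1\<close> is \<open>muckenhoupt_A1\<close>.\<close>

definition muckenhoupt_Ap :: "real \<Rightarrow> ('a::euclidean_space \<Rightarrow> ennreal) \<Rightarrow> bool" where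
  "muckenhoupt_Ap p w \<longleftrightarrow> is_weight w \<and>
     (SUP Q\<in>cubes.
        epowr (\<integral>\<^sup>+x\<in>Q. w x \<partial>lebesgue) (1 / p)
          * epowr (\<integral>\<^sup>+x\<in>Q. epowr (w x) (- 1 / (p - 1)) \<partial>lebesgue) ((p - 1) / p)
          / emeasure lebesgue Q) < \<infinity>"

definition muckenhoupt_A1 :: "('a::euclidean_space \<Rightarrow> ennreal) \<Rightarrow> bool" where
  "muckenhoupt_A1 w \<longleftrightarrow> is_weight w \<and>
     (\<exists>C::real. \<forall>Q\<in>cubes. AE y in lebesgue. y \<in> Q \<longrightarrow>
        (\<integral>\<^sup>+x\<in>Q. w x \<partial>lebesgue) / emeasure lebesgue Q \<le> ennreal C * w y)"

definition weight_condition :: "'a::euclidean_space set \<Rightarrow> real \<Rightarrow> real \<Rightarrow> bool" where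
  "weight_condition \<Omega> \<alpha> \<beta> \<longleftrightarrow>
     (muckenhoupt_A1 (dist_weight \<Omega> \<alpha>) \<and> muckenhoupt_A1 (dist_weight \<Omega> \<beta>)) \<or>
     (\<alpha> * \<beta> \<ge> 0 \<and> muckenhoupt_A1 (dist_weight \<Omega> (\<alpha> + \<beta>)))"

end

theory Submission
  imports Defs
begin

text \<open>
  Write $y = x + h$. For $|h| < \theta d_\Omega(x)$ both weights are nearly powers of $d_\Omega(x)$, and Jensen's
  inequality on the segment from $x$ to $y$ bounds this part of the energy by integrals of
  $|v \cdot h|^p |h|^{-d-sp}$ over the unit ball, which equal $K_{d,p} |v|^p / (1 - s)$; the constant comes from Gaussian
  integrals. The rest of the energy is $o(1/(1-s))$: in (a), since $U$ is open, $s$ can be traded for a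
  small change of $\alpha$; in (b) and (c), $\alpha, \beta \ge 0$ and the weight of exponent $\alpha + \beta$ satisfies an
  $A_1$ bound at every point off the boundary, by which the weights at $x$ and $y$ can be replaced by the weight at
  the point of the segment where the gradient of an extension is evaluated, so that dominated convergence
  applies.

  The lower bound is Fatou's lemma for differentiable functions. It passes to Sobolev functions because
  mollification does not increase the part of the energy away from the boundary. For $p > 1$ the same
  estimate bounds the gradients of the mollified functions whenever the energies are bounded along a sequence;
  uniform convexity then yields a weak gradient.
\<close>

text \<open>The segment from x to y may leave \<Omega> once |h| >= \<theta> d(x); this is why an
  extension is needed and why its gradient is integrated over the whole space. With the point z of
  evaluation fixed and h integrated, |h| is at least a fixed multiple of d(z) in this region. But 1
  - s times |h|^p |h|^(-d-sp), although of bounded mass on the unit ball, concentrates at h = 0, so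
  nothing is left in the limit for z off the boundary. The A_1 condition is given almost everywhere
  only; it holds at a prescribed z because the weight is continuous there. The same continuity
  excludes negative exponents: such a weight vanishes at a boundary point, and the bound at that
  point would make it vanish on a whole cube.

  A function homogeneous of degree p has the same integral over a ball and against exp(-|h|^2), up
  to an explicit Gamma factor. The Gaussian is a product and invariant under rotations, so |v . h|^p
  reduces to one variable and polar coordinates never enter.\<close>

abbreviation nn_integral_lborel :: "('a::euclidean_space \<Rightarrow> ennreal) \<Rightarrow> ennreal" (binder "NN " 10)
  where "nn_integral_lborel f \<equiv> \<integral>\<^sup>+x. f x \<partial>lborel"

abbreviation integral_lborel :: "('a::euclidean_space \<Rightarrow> 'b::{banach, second_countable_topology}) \<Rightarrow> 'b" (binder "LL " 10)
  where "integral_lborel f \<equiv> \<integral>x. f x \<partial>lborel"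

abbreviation Borel :: "('a::topological_space \<Rightarrow> 'b::topological_space) set"
  where "Borel \<equiv> borel_measurable borel"

abbreviation sker :: "real \<Rightarrow> real \<Rightarrow> 'a::euclidean_space \<Rightarrow> ennreal"
  where "sker s p h \<equiv> ennreal (norm h powr (- (real DIM('a) + s * p)))"

section \<open>The constant\<close>

lemma pred_ball [measurable]: "Measurable.pred borel (\<lambda>x::'a::euclidean_space. x \<in> ball c r)"
  by (simp add: pred_def)

text \<open>Tonelli, with the condition |h| < r read either as a half-line in r or as a ball in h.
  With \<open>k\<close> the density of a power, this expresses integrals against radial kernels
  through the masses of balls and takes the place of polar coordinates.\<close>

lemma layer_cake:
  fixes W :: "'a::euclidean_space \<Rightarrow> ennreal" and k :: "real \<Rightarrow> ennreal"
  assumes [measurable]: "W \<in> Borel" "k \<in> Borel"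
  shows "(NN h. W h * (NN r. k r * indicator {norm h<..} r))
       = (NN r. k r * (NN h. W h * indicator (ball 0 r) h))"
proof -
  have eq: "indicator {norm h<..} r = (indicator (ball 0 r) h :: ennreal)" for h :: 'a and r
    by (auto split: split_indicator)
  \<comment> \<open>Measurability in both variables jointly is clear from the half-line form of the
    indicator.\<close>
  have [measurable]: "(\<lambda>(h::'a, r). indicator (ball 0 r) h :: ennreal) \<in> borel_measurable (lborel \<Otimes>\<^sub>M lborel)"
    unfolding eq[symmetric] by (simp add: indicator_def case_prod_beta')
  have "(NN h. W h * (NN r. k r * indicator {norm h<..} r))
      = (NN h. NN r. W h * (k r * indicator (ball 0 r) h))"
    unfolding eq by (intro nn_integral_cong nn_integral_cmult[symmetric]) measurable
  also have "\<dots> = (NN r. NN h. W h * (k r * indicator (ball 0 r) h))"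
    by (intro lborel_pair.Fubini') measurable
  also have "\<dots> = (NN r. k r * (NN h. W h * indicator (ball 0 r) h))"
    by (intro nn_integral_cong, subst nn_integral_cmult[symmetric]) (auto simp: mult_ac)
  finally show ?thesis .
qed

lemma nn_integral_powr_tail:
  assumes "(q::real) > 0" "\<rho> > 0"
  shows "(NN r. ennreal (q * r powr (-q - 1)) * indicator {\<rho><..} r) = ennreal (\<rho> powr (-q))"
proof -
  have "((\<lambda>x. q * x powr (-q-1)) has_integral q * (-(\<rho> powr (-q-1+1)) / (-q-1+1))) {\<rho>..}"
    using assms by (intro has_integral_mult_right has_integral_powr_to_inf) auto
  from nn_integral_has_integral_lebesgue'[OF _ this]
  have "(NN r. ennreal (q * r powr (-q - 1)) * indicator {\<rho>..} r) = ennreal (\<rho> powr (-q))"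
    using assms by simp
  moreover have "(NN r. ennreal (q * r powr (-q - 1)) * indicator {\<rho><..} r)
     = (NN r. ennreal (q * r powr (-q - 1)) * indicator {\<rho>..} r)"
    by (intro nn_integral_cong_AE eventually_mono[OF AE_lborel_singleton[of \<rho>]])
       (auto split: split_indicator)
  ultimately show ?thesis by simp
qed

lemma nn_integral_powr_head:
  assumes "(a::real) > 0" "R \<ge> 0"
  shows "(NN r. ennreal (r powr (a - 1)) * indicator {0<..<R} r) = ennreal (R powr a / a)"
proof -
  have "((\<lambda>x. x powr (a-1)) has_integral (R powr (a-1+1) / (a-1+1))) {0..R}"
    using assms by (intro has_integral_powr_from_0) auto
  from nn_integral_has_integral_lebesgue'[OF _ this]
  have "(NN r. ennreal (r powr (a - 1)) * indicator {0..R} r) = ennreal (R powr a / a)"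
    using assms by simp
  moreover have "(NN r. ennreal (r powr (a - 1)) * indicator {0<..<R} r)
     = (NN r. ennreal (r powr (a - 1)) * indicator {0..R} r)"
    by (intro nn_integral_cong_AE eventually_mono[OF AE_lborel_singleton[of R]])
       (auto split: split_indicator)
  ultimately show ?thesis by simp
qed

lemma layer_cake_powr:
  fixes W :: "'a::euclidean_space \<Rightarrow> ennreal"
  assumes [measurable]: "W \<in> Borel" and "q > 0"
  shows "(NN h. W h * ennreal (norm h powr (-q)))
       = (NN r. ennreal (q * r powr (-q - 1)) * indicator {0<..} r * (NN h. W h * indicator (ball 0 r) h))"
proof -
  have "(NN h. W h * ennreal (norm h powr (-q)))
     = (NN h. W h * (NN r. ennreal (q * r powr (-q - 1)) * indicator {0<..} r * indicator {norm h<..} r))"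
  \<comment> \<open>At h = 0 the integrands can differ, since \<open>0 powr (-q)\<close> is 0 while
    the tail integral over all r > 0 is infinite; the origin is dropped as a null set.\<close>
  proof (intro nn_integral_cong_AE eventually_mono[OF AE_lborel_singleton[of 0]])
    fix h :: 'a assume "h \<noteq> 0"
    have "(NN r. ennreal (q * r powr (-q - 1)) * indicator {0<..} r * indicator {norm h<..} r)
       = (NN r. ennreal (q * r powr (-q - 1)) * indicator {norm h<..} r)"
      by (intro nn_integral_cong) (auto split: split_indicator dest: le_less_trans[OF norm_ge_zero])
    also have "\<dots> = ennreal (norm h powr (-q))" using \<open>h \<noteq> 0\<close> \<open>q > 0\<close> by (simp add: nn_integral_powr_tail)
    finally show "W h * ennreal (norm h powr (-q)) = W h * (NN r. ennreal (q * r powr (-q - 1)) * indicator {0<..} r * indicator {norm h<..} r)"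
      by simp
  qed
  also have "\<dots> = (NN r. (ennreal (q * r powr (-q - 1)) * indicator {0<..} r) * (NN h. W h * indicator (ball 0 r) h))"
    by (rule layer_cake) measurable
  finally show ?thesis .
qed

text \<open>This is the case of ball masses that grow like r^\<delta> up to radius R and are
  constant from there on. Below R the power is integrable at 0 because q < \<delta>; above R the
  tail is finite because q > 0.\<close>

lemma nn_integral_powr_capped:
  fixes \<delta> q R :: real
  assumes "0 < q" "q < \<delta>" "R \<ge> 0"
  shows "(NN r. ennreal (q * r powr (-q - 1)) * indicator {0<..} r * ennreal (min r R powr \<delta>))
     = ennreal (\<delta> / (\<delta> - q) * R powr (\<delta> - q))"
proof -
  have "(NN r. ennreal (q * r powr (-q - 1)) * indicator {0<..} r * ennreal (min r R powr \<delta>))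
     = (NN r. ennreal q * (ennreal (r powr ((\<delta> - q) - 1)) * indicator {0<..<R} r)
      + ennreal (R powr \<delta>) * (ennreal (q * r powr (-q - 1)) * indicator {R<..} r))"
  proof (intro nn_integral_cong_AE eventually_mono[OF AE_lborel_singleton[of R]])
    fix r :: real assume "r \<noteq> R"
    show "ennreal (q * r powr (-q - 1)) * indicator {0<..} r * ennreal (min r R powr \<delta>) = ennreal q * (ennreal (r powr ((\<delta> - q) - 1)) * indicator {0<..<R} r)
      + ennreal (R powr \<delta>) * (ennreal (q * r powr (-q - 1)) * indicator {R<..} r)"
    proof (cases "0 < r \<and> r < R")
      case True
      have "q * r powr (-q - 1) * r powr \<delta> = q * r powr ((\<delta> - q) - 1)"
        by (auto simp: mult_ac powr_add[symmetric] algebra_simps)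
      then show ?thesis using True assms by (auto simp: ennreal_mult[symmetric])
    next
      case False
      then show ?thesis using \<open>r \<noteq> R\<close> \<open>R \<ge> 0\<close> by (auto simp: mult.commute)
    qed
  qed
  \<comment> \<open>The tail formula is for positive radii; if R = 0, the tail is multiplied by
    \<open>R powr \<delta>\<close>, which is 0.\<close>
  also have "\<dots> = ennreal q * ennreal (R powr (\<delta> - q) / (\<delta> - q)) + ennreal (R powr \<delta>) * (if R = 0 then 0 else ennreal (R powr (-q)))"
    using assms
    by (subst nn_integral_add) (auto simp: nn_integral_cmult nn_integral_powr_head nn_integral_powr_tail)
  also have "\<dots> = ennreal (\<delta> / (\<delta> - q) * R powr (\<delta> - q))"
  proof (cases "R = 0")
    case False
    have "q * (R powr (\<delta> - q) / (\<delta> - q)) + R powr \<delta> * R powr (-q) = \<delta> / (\<delta> - q) * R powr (\<delta> - q)"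
      using assms False by (simp add: powr_diff powr_minus field_simps)
    then show ?thesis using assms False by (simp add: ennreal_mult[symmetric] ennreal_plus[symmetric] del: ennreal_plus)
  qed (use assms in auto)
  finally show ?thesis .
qed

text \<open>The layer-cake formula sees only the masses of balls, so a growth bound for them
  suffices. For a weight the A_1 bound supplies it, with \<delta> the dimension.\<close>

lemma nn_integral_powr_ball_le:
  fixes W :: "'a::euclidean_space \<Rightarrow> ennreal"
  assumes [measurable]: "W \<in> Borel" and q: "0 < q" "q < \<delta>" "R \<ge> 0"
    and W: "\<And>r. r > 0 \<Longrightarrow> (NN h. W h * indicator (ball 0 r) h) \<le> A * ennreal (r powr \<delta>)"
  shows "(NN h. W h * indicator (ball 0 R) h * ennreal (norm h powr (-q)))
     \<le> A * ennreal (\<delta> / (\<delta> - q) * R powr (\<delta> - q))"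
proof -
  let ?m = "\<lambda>r. NN h. W h * indicator (ball 0 R) h * indicator (ball 0 r) h"
  have m: "?m r \<le> A * ennreal (min r R powr \<delta>)" if "r > 0" for r
  proof (cases "R = 0")
    case False
    then have "?m r \<le> (NN h. W h * indicator (ball 0 (min r R)) h)"
      by (intro nn_integral_mono) (auto split: split_indicator)
    also have "\<dots> \<le> A * ennreal (min r R powr \<delta>)" using False q that by (intro W) auto
    finally show ?thesis .
  qed auto
  have "(NN h. W h * indicator (ball 0 R) h * ennreal (norm h powr (-q)))
      = (NN r. ennreal (q * r powr (-q - 1)) * indicator {0<..} r * ?m r)"
    by (rule layer_cake_powr) (use q in simp_all)
  also have "\<dots> \<le> (NN r. ennreal (q * r powr (-q - 1)) * indicator {0<..} r * (A * ennreal (min r R powr \<delta>)))"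
    by (intro nn_integral_mono) (auto split: split_indicator intro!: mult_left_mono m)
  also have "\<dots> = (NN r. A * (ennreal (q * r powr (-q - 1)) * indicator {0<..} r * ennreal (min r R powr \<delta>)))"
    by (simp add: mult_ac)
  also have "\<dots> = A * ennreal (\<delta> / (\<delta> - q) * R powr (\<delta> - q))"
    by (subst nn_integral_cmult) (use q in \<open>simp_all add: nn_integral_powr_capped\<close>)
  finally show ?thesis .
qed

lemma nn_integral_lborel_affine:
  fixes f :: "'a::euclidean_space \<Rightarrow> ennreal"
  assumes [measurable]: "f \<in> Borel" and "c \<noteq> 0"
  shows "(NN x. f x) = ennreal (\<bar>c\<bar> ^ DIM('a)) * (NN x. f (t + c *\<^sub>R x))"
  by (subst lborel_affine[OF \<open>c \<noteq> 0\<close>, of t])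
     (simp add: nn_integral_density nn_integral_distr nn_integral_cmult)

lemma nn_integral_homogeneous_ball:
  fixes g :: "'a::euclidean_space \<Rightarrow> ennreal"
  assumes [measurable]: "g \<in> Borel"
    and hom: "\<And>c h. c > 0 \<Longrightarrow> g (c *\<^sub>R h) = ennreal (c powr p) * g h" and "r > 0"
  shows "(NN h. g h * indicator (ball 0 r) h)
     = (NN h. g h * indicator (ball 0 1) h) * ennreal (r powr (real DIM('a) + p))"
proof -
  have ind: "indicator (ball 0 r) (r *\<^sub>R h) = (indicator (ball 0 1) h :: ennreal)" for h :: 'a
    using \<open>r > 0\<close> by (auto split: split_indicator)
  have "(NN h. g h * indicator (ball 0 r) h)
     = ennreal (\<bar>r\<bar> ^ DIM('a)) * (NN h. g (0 + r *\<^sub>R h) * indicator (ball 0 r) (0 + r *\<^sub>R h))"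
    by (rule nn_integral_lborel_affine) (use \<open>r > 0\<close> in simp_all)
  also have "\<dots> = ennreal (\<bar>r\<bar> ^ DIM('a)) * (NN h. ennreal (r powr p) * (g h * indicator (ball 0 1) h))"
    using \<open>r > 0\<close> by (simp add: hom ind mult_ac)
  also have "\<dots> = (NN h. g h * indicator (ball 0 1) h) * ennreal (r powr (real DIM('a) + p))"
    using \<open>r > 0\<close> by (subst nn_integral_cmult)
      (auto simp: powr_add powr_realpow ennreal_mult mult_ac)
  finally show ?thesis .
qed

text \<open>For homogeneous \<open>g\<close> the mass of a ball of radius r is an exact multiple of
  r^(d+p), so the bound by layers becomes an identity.\<close>

lemma nn_integral_homogeneous_kernel:
  fixes g :: "'a::euclidean_space \<Rightarrow> ennreal"
  assumes [measurable]: "g \<in> Borel"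
    and hom: "\<And>c h. c > 0 \<Longrightarrow> g (c *\<^sub>R h) = ennreal (c powr p) * g h"
    and q: "0 < q" "q < real DIM('a) + p" "R \<ge> 0"
  shows "(NN h. g h * indicator (ball 0 R) h * ennreal (norm h powr (-q)))
     = (NN h. g h * indicator (ball 0 1) h)
       * ennreal ((real DIM('a) + p) / (real DIM('a) + p - q) * R powr (real DIM('a) + p - q))"
proof -
  let ?\<delta> = "real DIM('a) + p"
  let ?A = "NN h. g h * indicator (ball 0 1) h"
  let ?m = "\<lambda>r. NN h. g h * indicator (ball 0 R) h * indicator (ball 0 r) h"
  have m: "?m r = ?A * ennreal (min r R powr ?\<delta>)" if "r > 0" for r
  proof (cases "R = 0")
    case False
    have "?m r = (NN h. g h * indicator (ball 0 (min r R)) h)"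
      by (intro nn_integral_cong) (auto split: split_indicator)
    also have "\<dots> = ?A * ennreal (min r R powr ?\<delta>)" using False q that
      by (intro nn_integral_homogeneous_ball hom) auto
    finally show ?thesis .
  qed (use q that in auto)
  have "(NN h. g h * indicator (ball 0 R) h * ennreal (norm h powr (-q)))
      = (NN r. ennreal (q * r powr (-q - 1)) * indicator {0<..} r * ?m r)"
    by (rule layer_cake_powr) (use q in simp_all)
  also have "\<dots> = (NN r. ?A * (ennreal (q * r powr (-q - 1)) * indicator {0<..} r * ennreal (min r R powr ?\<delta>)))"
  proof (intro nn_integral_cong)
    fix r :: real
    show "ennreal (q * r powr (-q - 1)) * indicator {0<..} r * ?m r
      = ?A * (ennreal (q * r powr (-q - 1)) * indicator {0<..} r * ennreal (min r R powr ?\<delta>))"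
    proof (cases "r > 0")
      case True
      show ?thesis unfolding m[OF True] by (simp only: mult_ac)
    qed simp
  qed
  also have "\<dots> = ?A * ennreal (?\<delta> / (?\<delta> - q) * R powr (?\<delta> - q))"
    by (subst nn_integral_cmult) (use q in \<open>simp_all add: nn_integral_powr_capped\<close>)
  finally show ?thesis .
qed

section \<open>Gaussian integrals and the value of K\<close>

lemma nn_integral_homogeneous_gauss:
  fixes g :: "'a::euclidean_space \<Rightarrow> ennreal"
  assumes [measurable]: "g \<in> Borel"
    and hom: "\<And>c h. c > 0 \<Longrightarrow> g (c *\<^sub>R h) = ennreal (c powr p) * g h" and "p \<ge> 0"
  shows "(NN h. g h * ennreal (exp (- (norm h)\<^sup>2)))
     = (NN h. g h * indicator (ball 0 1) h) * ennreal (Gamma ((real DIM('a) + p) / 2 + 1))"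
proof -
  let ?\<delta> = "real DIM('a) + p"
  let ?A = "NN h. g h * indicator (ball 0 1) h"
  have d: "?\<delta> > 0" using \<open>p \<ge> 0\<close> by (simp add: add_pos_nonneg)
  \<comment> \<open>The Gaussian exp(-|h|^2) is the integral of exp(-t) over t > |h|^2. Its layers
    are balls of radius sqrt t, with mass proportional to t^((d+p)/2), and the integral of
    t^((d+p)/2) exp(-t) over t > 0 is the Gamma factor.\<close>
  have expo: "ennreal (exp (- \<rho>)) = (NN t. ennreal (exp (-t)) * indicator {\<rho><..} t)" for \<rho> :: real
  proof -
    have "(NN t. ennreal (exp (-t)) * indicator {\<rho>..} t) = ennreal (0 - (- exp (-\<rho>)))"
    proof (rule nn_integral_FTC_atLeast)
      show "((\<lambda>x::real. - exp (- x)) \<longlongrightarrow> 0) at_top"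
        using tendsto_minus[OF filterlim_compose[OF exp_at_bot filterlim_uminus_at_bot_at_top]] by simp
    qed (auto intro!: derivative_eq_intros)
    moreover have "(NN t. ennreal (exp (-t)) * indicator {\<rho>..} t) = (NN t. ennreal (exp (-t)) * indicator {\<rho><..} t)"
      by (intro nn_integral_cong_AE eventually_mono[OF AE_lborel_singleton[of \<rho>]])
         (auto split: split_indicator)
    ultimately show ?thesis by simp
  qed
  have "(NN h. g h * ennreal (exp (- (norm h)\<^sup>2)))
      = (NN h. NN t. g h * (ennreal (exp (-t)) * indicator {(norm h)\<^sup>2<..} t))"
    by (intro nn_integral_cong, subst nn_integral_cmult) (auto simp flip: expo)
  also have "\<dots> = (NN t. NN h. g h * (ennreal (exp (-t)) * indicator {(norm h)\<^sup>2<..} t))"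
    unfolding indicator_def greaterThan_iff by (intro lborel_pair.Fubini') measurable
  also have "\<dots> = (NN t. ?A * ennreal (indicator {0..} t * t powr ((?\<delta>/2 + 1) - 1) / exp t))"
  proof (intro nn_integral_cong_AE eventually_mono[OF AE_lborel_singleton[of 0]])
    fix t :: real assume "t \<noteq> 0"
    show "(NN h. g h * (ennreal (exp (-t)) * indicator {(norm h)\<^sup>2<..} t))
       = ?A * ennreal (indicator {0..} t * t powr ((?\<delta>/2 + 1) - 1) / exp t)"
    proof (cases "t > 0")
      case True
      have "indicator {(norm h)\<^sup>2<..} t = (indicator (ball 0 (sqrt t)) h :: ennreal)" for h :: 'a
        using real_sqrt_less_iff[of "(norm h)\<^sup>2" t] by (auto split: split_indicator)
      then have "(NN h. g h * (ennreal (exp (-t)) * indicator {(norm h)\<^sup>2<..} t))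
         = (NN h. ennreal (exp (-t)) * (g h * indicator (ball 0 (sqrt t)) h))"
        by (simp add: mult_ac)
      also have "\<dots> = ennreal (exp (-t)) * (?A * ennreal (sqrt t powr ?\<delta>))"
        using True by (subst nn_integral_cmult) (auto simp: nn_integral_homogeneous_ball[OF _ hom, of "sqrt t"])
      also have "sqrt t powr ?\<delta> = t powr (?\<delta> / 2)"
        using True by (simp add: powr_half_sqrt[symmetric] powr_powr)
      finally have "(NN h. g h * (ennreal (exp (-t)) * indicator {(norm h)\<^sup>2<..} t))
        = ?A * (ennreal (t powr (?\<delta> / 2)) * ennreal (exp (-t)))" by (simp only: mult_ac)
      also have "ennreal (t powr (?\<delta> / 2)) * ennreal (exp (-t)) = ennreal (t powr (?\<delta> / 2) / exp t)"
        by (simp add: ennreal_mult[symmetric] exp_minus field_simps)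
      finally show ?thesis using True by simp
    next
      case False
      have "\<not> (norm h)\<^sup>2 < t" for h :: 'a
        using False zero_le_power2[of "norm h"] by linarith
      then show ?thesis using False \<open>t \<noteq> 0\<close> by simp
    qed
  qed
  also have "\<dots> = ?A * ennreal (Gamma (?\<delta> / 2 + 1))"
  proof -
    have "0 < ?\<delta> / 2 + 1" by (rule add_pos_pos) (use d in auto)
    from Gamma_conv_nn_integral_real[OF this] show ?thesis
      by (subst nn_integral_cmult) simp_all
  qed
  finally show ?thesis .
qed

text \<open>The previous identity for the constant 1 in dimension one: the length 2 of the ball
  times Gamma(3/2) = sqrt pi / 2.\<close>

lemma nn_integral_gauss: "(NN x. ennreal (exp (-x\<^sup>2))) = ennreal (sqrt pi)"
proof -
  have "(NN (x::real). 1 * ennreal (exp (- (norm x)\<^sup>2)))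
    = (NN (h::real). 1 * indicator (ball 0 1) h) * ennreal (Gamma ((real DIM(real) + 0) / 2 + 1))"
    by (rule nn_integral_homogeneous_gauss) auto
  also have "(NN (h::real). 1 * indicator (ball 0 1) h) = ennreal 2"
    by (simp add: ball_eq_greaterThanLessThan)
  also have "Gamma ((real DIM(real) + 0) / 2 + 1) = sqrt pi / 2"
    using Gamma_plus1[of "1/2::real"] nonpos_Ints_nonpos[of "1/2::real"] by (auto simp: Gamma_one_half_real)
  also have "ennreal 2 * ennreal (sqrt pi / 2) = ennreal (sqrt pi)"
    by (subst ennreal_mult[symmetric]) auto
  finally show ?thesis by simp
qed

text \<open>Rotation invariance of the plane Gaussian, by substitution in one variable at a time: x
  is replaced by u with a x + b y = c u, where c^2 = a^2 + b^2, and then y is integrated out against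
  a shifted and scaled Gaussian.\<close>

lemma nn_integral_gauss_rotate2:
  fixes \<phi> :: "real \<Rightarrow> ennreal" and a b :: real
  assumes [measurable]: "\<phi> \<in> Borel"
  shows "(NN y. (NN x. \<phi> (a * x + b * y) * ennreal (exp (-x\<^sup>2))) * ennreal (exp (-y\<^sup>2)))
    = ennreal (sqrt pi) * (NN x. \<phi> (sqrt (a\<^sup>2 + b\<^sup>2) * x) * ennreal (exp (-x\<^sup>2)))"
proof -
  show ?thesis
  proof (cases "a = 0")
    case True
    \<comment> \<open>With a = 0 only the sign of b is at stake, and the Gaussian is even.\<close>
    have "(NN y. \<phi> (b * y) * ennreal (exp (-y\<^sup>2))) = (NN y. \<phi> (\<bar>b\<bar> * y) * ennreal (exp (-y\<^sup>2)))"
    proof (cases "b \<ge> 0")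
      case False
      then show ?thesis
        by (subst nn_integral_real_affine[where c="-1" and t=0]) auto
    qed auto
    then show ?thesis using True
      by (simp add: nn_integral_cmult nn_integral_gauss mult_ac nn_integral_multc)
  next
    case False
    define c where "c = sqrt (a\<^sup>2 + b\<^sup>2)"
    have c: "c > 0" "c\<^sup>2 = a\<^sup>2 + b\<^sup>2" using False by (auto simp: c_def add_pos_nonneg)
    have "(NN y. (NN x. \<phi> (a * x + b * y) * ennreal (exp (-x\<^sup>2))) * ennreal (exp (-y\<^sup>2)))
       = (NN y. ennreal (c / \<bar>a\<bar>) * (NN u. \<phi> (c * u) * ennreal (exp (- (((c/a) * y + (- (b / a) * u))\<^sup>2)) * exp (-u\<^sup>2))))"
    proof (intro nn_integral_cong)
      fix y :: real
      have arg: "a * (- b * y / a + (c / a) * u) + b * y = c * u" for u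
        using False by (simp add: right_diff_distrib)
      have sub: "(NN x. \<phi> (a * x + b * y) * ennreal (exp (-x\<^sup>2)))
         = ennreal \<bar>c / a\<bar> * (NN u. \<phi> (a * (- b * y / a + (c / a) * u) + b * y) * ennreal (exp (-(- b * y / a + (c / a) * u)\<^sup>2)))"
        using False c by (intro nn_integral_real_affine) auto
      have "(NN x. \<phi> (a * x + b * y) * ennreal (exp (-x\<^sup>2))) * ennreal (exp (-y\<^sup>2))
         = ennreal (c / \<bar>a\<bar>) * (NN u. \<phi> (c * u) * ennreal (exp (-(- b * y / a + (c / a) * u)\<^sup>2)) * ennreal (exp (-y\<^sup>2)))"
        unfolding sub arg
        by (subst nn_integral_multc, measurable) (simp only: mult.assoc abs_divide abs_of_pos[OF c(1)])
      also have "\<dots> = ennreal (c / \<bar>a\<bar>) * (NN u. \<phi> (c * u) * ennreal (exp (- (((c/a) * y + (- (b / a) * u))\<^sup>2)) * exp (-u\<^sup>2)))"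
      proof -
        have "exp (-(- b * y / a + (c / a) * u)\<^sup>2) * exp (-y\<^sup>2) = exp (- (((c/a) * y + (- (b / a) * u))\<^sup>2)) * exp (-u\<^sup>2)" for u
        proof -
          \<comment> \<open>x^2 + y^2 in the variables u and y, with the square completed in y; this
            is where c^2 = a^2 + b^2 enters.\<close>
          have "(- b * y / a + (c / a) * u)\<^sup>2 + y\<^sup>2 = ((c/a) * y + (- (b / a) * u))\<^sup>2 + u\<^sup>2"
          proof -
            have "(- b * y + c * u)\<^sup>2 + a\<^sup>2 * y\<^sup>2 = (c * y - b * u)\<^sup>2 + a\<^sup>2 * u\<^sup>2"
              using c(2) by algebra
            then show ?thesis using False by (simp add: field_simps power2_eq_square)
          qed
          then show ?thesis by (simp only: exp_add[symmetric] minus_add_distrib[symmetric])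
        qed
        then show ?thesis by (simp add: mult.assoc ennreal_mult[symmetric])
      qed
      finally show "(NN x. \<phi> (a * x + b * y) * ennreal (exp (-x\<^sup>2))) * ennreal (exp (-y\<^sup>2)) = \<dots>" .
    qed
    also have "\<dots> = ennreal (c / \<bar>a\<bar>) * (NN u. (NN y. \<phi> (c * u) * ennreal (exp (- (((c/a) * y + (- (b / a) * u))\<^sup>2)) * exp (-u\<^sup>2))))"
      by (subst nn_integral_cmult) (measurable, subst lborel_pair.Fubini', measurable)
    also have "\<dots> = ennreal (c / \<bar>a\<bar>) * (NN u. ennreal (sqrt pi * \<bar>a\<bar> / c) * (\<phi> (c * u) * ennreal (exp (-u\<^sup>2))))"
    proof (intro arg_cong2[where f="(*)"] refl nn_integral_cong)
      fix u :: real
      have "ennreal (sqrt pi) = ennreal \<bar>c/a\<bar> * (NN y. ennreal (exp (-(- (b / a) * u + (c / a) * y)\<^sup>2)))"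
        unfolding nn_integral_gauss[symmetric] using False c by (intro nn_integral_real_affine) auto
      then have "ennreal \<bar>a/c\<bar> * ennreal (sqrt pi) = ennreal \<bar>a/c\<bar> * ennreal \<bar>c/a\<bar> * (NN y. ennreal (exp (-(- (b / a) * u + (c / a) * y)\<^sup>2)))"
        by (simp only: mult.assoc)
      also have "ennreal \<bar>a/c\<bar> * ennreal \<bar>c/a\<bar> = 1"
        using False c by (simp add: ennreal_mult[symmetric] abs_mult[symmetric])
      finally have *: "(NN y. ennreal (exp (-((c / a) * y + - (b / a) * u)\<^sup>2))) = ennreal (sqrt pi * \<bar>a\<bar> / c)"
        using c by (simp add: ennreal_mult[symmetric] abs_divide add.commute mult.commute)
      have "(NN y. \<phi> (c * u) * ennreal (exp (- (((c/a) * y + (- (b / a) * u))\<^sup>2)) * exp (-u\<^sup>2)))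
        = (NN y. (\<phi> (c * u) * ennreal (exp (-u\<^sup>2))) * ennreal (exp (- (((c/a) * y + (- (b / a) * u))\<^sup>2))))"
        by (simp add: ennreal_mult mult_ac)
      also have "\<dots> = (\<phi> (c * u) * ennreal (exp (-u\<^sup>2))) * ennreal (sqrt pi * \<bar>a\<bar> / c)"
        by (subst nn_integral_cmult) (simp_all only: *, measurable)
      finally show "(NN y. \<phi> (c * u) * ennreal (exp (- (((c/a) * y + (- (b / a) * u))\<^sup>2)) * exp (-u\<^sup>2)))
        = ennreal (sqrt pi * \<bar>a\<bar> / c) * (\<phi> (c * u) * ennreal (exp (-u\<^sup>2)))"
        by (simp only: mult_ac)
    qed
    also have "\<dots> = (ennreal (c / \<bar>a\<bar>) * ennreal (sqrt pi * \<bar>a\<bar> / c)) * (NN u. \<phi> (c * u) * ennreal (exp (-u\<^sup>2)))"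
      by (subst nn_integral_cmult) (measurable, simp only: mult.assoc)
    also have "ennreal (c / \<bar>a\<bar>) * ennreal (sqrt pi * \<bar>a\<bar> / c) = ennreal (sqrt pi)"
      using False c by (subst ennreal_mult[symmetric]) auto
    finally show ?thesis unfolding c_def .
  qed
qed

text \<open>Induction on the coordinates; each step is a rotation in the plane spanned by the new
  coordinate and the direction collected so far. The factor sqrt pi on the left makes the empty
  product a valid base case.\<close>

lemma nn_integral_gauss_PiM:
  fixes \<phi> :: "real \<Rightarrow> ennreal" and v :: "'i \<Rightarrow> real"
  assumes "finite A" and [measurable]: "\<phi> \<in> Borel"
  shows "ennreal (sqrt pi) * (\<integral>\<^sup>+f. \<phi> (\<Sum>i\<in>A. v i * f i) * ennreal (exp (- (\<Sum>i\<in>A. (f i)\<^sup>2))) \<partial>(Pi\<^sub>M A (\<lambda>_. lborel)))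
    = ennreal (sqrt pi ^ card A) * (NN x. \<phi> (sqrt (\<Sum>i\<in>A. (v i)\<^sup>2) * x) * ennreal (exp (-x\<^sup>2)))"
  using assms
proof (induction arbitrary: \<phi> rule: finite_induct)
  case (empty \<phi>)
  note [measurable] = \<open>\<phi> \<in> Borel\<close>
  show ?case
    by (simp add: PiM_empty nn_integral_count_space_finite nn_integral_cmult nn_integral_gauss mult.commute)
next
  case (insert i A \<phi>)
  note [measurable] = \<open>\<phi> \<in> Borel\<close>
  interpret product_sigma_finite "\<lambda>_. lborel" by standard
  interpret A: sigma_finite_measure "Pi\<^sub>M A (\<lambda>_. lborel :: real measure)"
    by (rule sigma_finite) (rule insert.hyps)
  let ?V = "sqrt (\<Sum>i\<in>A. (v i)\<^sup>2)"
  have sq: "sqrt (\<Sum>i\<in>insert i A. (v i)\<^sup>2) = sqrt (?V\<^sup>2 + (v i)\<^sup>2)"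
    using insert.hyps by (simp add: sum_nonneg add.commute)
  have "(\<integral>\<^sup>+f. \<phi> (\<Sum>i\<in>insert i A. v i * f i) * ennreal (exp (- (\<Sum>i\<in>insert i A. (f i)\<^sup>2))) \<partial>(Pi\<^sub>M (insert i A) (\<lambda>_. lborel)))
     = (NN y. \<integral>\<^sup>+f. \<phi> (\<Sum>j\<in>insert i A. v j * (f(i := y)) j) * ennreal (exp (- (\<Sum>j\<in>insert i A. ((f(i := y)) j)\<^sup>2))) \<partial>Pi\<^sub>M A (\<lambda>_. lborel))"
    using insert.hyps by (subst product_nn_integral_insert_rev) auto
  also have "\<dots> = (NN y. \<integral>\<^sup>+f. (\<phi> ((\<Sum>j\<in>A. v j * f j) + v i * y) * ennreal (exp (- (\<Sum>j\<in>A. (f j)\<^sup>2)))) * ennreal (exp (-y\<^sup>2)) \<partial>Pi\<^sub>M A (\<lambda>_. lborel))"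
  proof (intro nn_integral_cong)
    fix y f
    have "(\<Sum>j\<in>A. v j * (f(i := y)) j) = (\<Sum>j\<in>A. v j * f j)" "(\<Sum>j\<in>A. ((f(i := y)) j)\<^sup>2) = (\<Sum>j\<in>A. (f j)\<^sup>2)"
      using insert.hyps by (auto intro!: sum.cong)
    then show "\<phi> (\<Sum>j\<in>insert i A. v j * (f(i := y)) j) * ennreal (exp (- (\<Sum>j\<in>insert i A. ((f(i := y)) j)\<^sup>2)))
       = (\<phi> ((\<Sum>j\<in>A. v j * f j) + v i * y) * ennreal (exp (- (\<Sum>j\<in>A. (f j)\<^sup>2)))) * ennreal (exp (-y\<^sup>2))"
      using insert.hyps by (simp add: mult.assoc ennreal_mult[symmetric] exp_add[symmetric] add.commute)
  qed
  also have "\<dots> = (NN y. (\<integral>\<^sup>+f. \<phi> ((\<Sum>j\<in>A. v j * f j) + v i * y) * ennreal (exp (- (\<Sum>j\<in>A. (f j)\<^sup>2))) \<partial>Pi\<^sub>M A (\<lambda>_. lborel)) * ennreal (exp (-y\<^sup>2)))"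
    by (intro nn_integral_cong nn_integral_multc) measurable
  finally have "ennreal (sqrt pi) * (\<integral>\<^sup>+f. \<phi> (\<Sum>i\<in>insert i A. v i * f i) * ennreal (exp (- (\<Sum>i\<in>insert i A. (f i)\<^sup>2))) \<partial>(Pi\<^sub>M (insert i A) (\<lambda>_. lborel)))
    = ennreal (sqrt pi) * \<dots>" by simp
  also have "\<dots> = (NN y. (ennreal (sqrt pi) * (\<integral>\<^sup>+f. \<phi> ((\<Sum>j\<in>A. v j * f j) + v i * y) * ennreal (exp (- (\<Sum>j\<in>A. (f j)\<^sup>2))) \<partial>Pi\<^sub>M A (\<lambda>_. lborel))) * ennreal (exp (-y\<^sup>2)))"
    by (subst nn_integral_cmult[symmetric]) (simp_all add: mult.assoc)
  also have "\<dots> = (NN y. ennreal (sqrt pi ^ card A) * ((NN x. \<phi> (?V * x + v i * y) * ennreal (exp (-x\<^sup>2))) * ennreal (exp (-y\<^sup>2))))"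
    by (intro nn_integral_cong, subst insert.IH) (simp_all add: mult.assoc)
  also have "\<dots> = ennreal (sqrt pi ^ card A) * (NN y. (NN x. \<phi> (?V * x + v i * y) * ennreal (exp (-x\<^sup>2))) * ennreal (exp (-y\<^sup>2)))"
    by (intro nn_integral_cmult) measurable
  also have "(NN y. (NN x. \<phi> (?V * x + v i * y) * ennreal (exp (-x\<^sup>2))) * ennreal (exp (-y\<^sup>2)))
     = ennreal (sqrt pi) * (NN x. \<phi> (sqrt (?V\<^sup>2 + (v i)\<^sup>2) * x) * ennreal (exp (-x\<^sup>2)))"
    by (rule nn_integral_gauss_rotate2) measurable
  finally show ?case unfolding sq using insert.hyps by (simp add: ennreal_mult mult_ac)
qed

lemma nn_integral_gauss_inner:
  fixes v :: "'a::euclidean_space" and \<phi> :: "real \<Rightarrow> ennreal"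
  assumes [measurable]: "\<phi> \<in> Borel"
  shows "ennreal (sqrt pi) * (NN h. \<phi> (v \<bullet> h) * ennreal (exp (- (norm h)\<^sup>2)))
    = ennreal (sqrt pi ^ DIM('a)) * (NN x. \<phi> (norm v * x) * ennreal (exp (-x\<^sup>2)))"
proof -
  have "(NN h. \<phi> (v \<bullet> h) * ennreal (exp (- (norm h)\<^sup>2)))
     = (\<integral>\<^sup>+h. \<phi> (v \<bullet> h) * ennreal (exp (- (norm h)\<^sup>2)) \<partial>distr (\<Pi>\<^sub>M b\<in>Basis. lborel) borel (\<lambda>f. \<Sum>b\<in>(Basis::'a set). f b *\<^sub>R b))"
    by (simp flip: lborel_eq)
  also have "\<dots> = (\<integral>\<^sup>+f. \<phi> (v \<bullet> (\<Sum>b\<in>(Basis::'a set). f b *\<^sub>R b)) * ennreal (exp (- (norm (\<Sum>b\<in>(Basis::'a set). f b *\<^sub>R b))\<^sup>2)) \<partial>(\<Pi>\<^sub>M b\<in>Basis. lborel))"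
    by (rule nn_integral_distr) measurable
  also have "\<dots> = (\<integral>\<^sup>+f. \<phi> (\<Sum>b\<in>Basis. (v \<bullet> b) * f b) * ennreal (exp (- (\<Sum>b\<in>(Basis::'a set). (f b)\<^sup>2))) \<partial>(\<Pi>\<^sub>M b\<in>Basis. lborel))"
    by (intro nn_integral_cong, subst euclidean_inner, subst power2_norm_eq_inner, subst euclidean_inner)
      (simp add: power2_eq_square)
  finally show ?thesis
    using nn_integral_gauss_PiM[of Basis \<phi> "\<lambda>b. v \<bullet> b"]
    by (simp add: norm_eq_sqrt_inner euclidean_inner[of v v] power2_eq_square)
qed

text \<open>Both the d-dimensional integral and the integral of |x|^p over (-1, 1) are exchanged for
  Gaussian integrals, which \<open>nn_integral_gauss_inner\<close> relates to each other. The Gamma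
  factors picked up on the way form the constant.\<close>

lemma nn_integral_inner_powr_ball:
  fixes v :: "'a::euclidean_space"
  assumes "p \<ge> 1"
  shows "(NN h. ennreal (\<bar>v \<bullet> h\<bar> powr p) * indicator (ball 0 1) h)
    = ennreal (p * K_const DIM('a) p / (real DIM('a) + p) * norm v powr p)"
proof -
  let ?d = "real DIM('a)"
  let ?A = "NN h. ennreal (\<bar>v \<bullet> h\<bar> powr p) * indicator (ball 0 1) h"
  let ?B = "NN (h::real). ennreal (\<bar>h\<bar> powr p) * indicator (ball 0 1) h"
  have hom: "ennreal (\<bar>v \<bullet> (c *\<^sub>R h)\<bar> powr p) = ennreal (c powr p) * ennreal (\<bar>v \<bullet> h\<bar> powr p)" if "c > 0" for c h
    using that by (simp add: ennreal_mult[symmetric] abs_mult powr_mult)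
  have hom1: "ennreal (\<bar>c *\<^sub>R h\<bar> powr p) = ennreal (c powr p) * ennreal (\<bar>h\<bar> powr p)" if "c > 0" for c h :: real
    using that by (simp add: ennreal_mult[symmetric] abs_mult powr_mult)
  have "?A * ennreal (Gamma ((?d + p) / 2 + 1)) = (NN h. ennreal (\<bar>v \<bullet> h\<bar> powr p) * ennreal (exp (- (norm h)\<^sup>2)))"
    by (rule nn_integral_homogeneous_gauss[symmetric, OF _ hom]) (use assms in auto)
  then have "ennreal (sqrt pi) * (?A * ennreal (Gamma ((?d + p) / 2 + 1)))
     = ennreal (sqrt pi ^ DIM('a)) * (NN x. ennreal (\<bar>norm v * x\<bar> powr p) * ennreal (exp (-x\<^sup>2)))"
    using nn_integral_gauss_inner[of "\<lambda>x. ennreal (\<bar>x\<bar> powr p)" v] by simp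
  also have "(NN x. ennreal (\<bar>norm v * x\<bar> powr p) * ennreal (exp (-x\<^sup>2)))
      = ennreal (norm v powr p) * (NN (x::real). ennreal (\<bar>x\<bar> powr p) * ennreal (exp (-(norm x)\<^sup>2)))"
    by (subst nn_integral_cmult[symmetric]) (auto simp: abs_mult powr_mult ennreal_mult mult.assoc)
  also have "(NN (x::real). ennreal (\<bar>x\<bar> powr p) * ennreal (exp (-(norm x)\<^sup>2)))
      = ?B * ennreal (Gamma ((real DIM(real) + p) / 2 + 1))"
    by (rule nn_integral_homogeneous_gauss[OF _ hom1]) (use assms in auto)
  also have "?B = ennreal (2 / (p + 1))"
  proof -
    have "?B = (NN x. ennreal (x powr (p + 1 - 1)) * indicator {0<..<1} x
        + ennreal (\<bar>x\<bar> powr p) * indicator {-1<..<0} x)"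
      by (intro nn_integral_cong_AE eventually_mono[OF AE_lborel_singleton[of 0]])
         (auto split: split_indicator)
    also have "\<dots> = ennreal (1 / (p + 1)) + (NN x. ennreal (\<bar>x\<bar> powr p) * indicator {-1<..<0} x)"
      using assms by (subst nn_integral_add, simp, simp) (subst nn_integral_powr_head, auto)
    also have "(NN x. ennreal (\<bar>x\<bar> powr p) * indicator {-1<..<0} x)
        = (NN x. ennreal (x powr (p + 1 - 1)) * indicator {0<..<1} x)"
      by (subst nn_integral_real_affine[where c="-1" and t=0])
         (auto intro!: nn_integral_cong split: split_indicator)
    also have "\<dots> = ennreal (1 / (p + 1))"
      using assms by (subst nn_integral_powr_head) auto
    finally show ?thesis using assms by (simp add: ennreal_plus[symmetric] del: ennreal_plus)
  qed
  also have "ennreal (2 / (p + 1)) * ennreal (Gamma ((real DIM(real) + p) / 2 + 1)) = ennreal (Gamma ((p + 1) / 2))"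
  proof -
    have "Gamma ((p + 1) / 2 + 1) = (p + 1) / 2 * Gamma ((p + 1) / 2)"
      using assms by (intro Gamma_plus1) (auto dest: nonpos_Ints_nonpos)
    then have "2 / (p + 1) * Gamma ((p + 1) / 2 + 1) = Gamma ((p + 1) / 2)"
      using assms by (simp add: field_simps)
    moreover have "Gamma ((p + 1) / 2 + 1) \<ge> 0"
      using assms by (intro less_imp_le[OF Gamma_real_pos] add_pos_pos) auto
    ultimately show ?thesis using assms by (simp add: ennreal_mult[symmetric] add.commute)
  qed
  finally have eq: "ennreal (sqrt pi) * (?A * ennreal (Gamma ((?d + p) / 2 + 1)))
      = ennreal (sqrt pi ^ DIM('a) * (norm v powr p * Gamma ((p + 1) / 2)))"
    using assms by (simp add: ennreal_mult)
  have G: "Gamma ((?d + p) / 2 + 1) = (?d + p) / 2 * Gamma ((?d + p) / 2)"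
    using assms by (intro Gamma_plus1) (auto dest: nonpos_Ints_nonpos)
  have Gpos: "Gamma ((?d + p) / 2) > 0" using assms by (intro Gamma_real_pos) (simp add: add_pos_nonneg)
  then have Gpos': "Gamma ((?d + p) / 2 + 1) > 0" unfolding G using assms by (simp add: add_pos_nonneg)
  \<comment> \<open>The Gamma factor is positive and finite, so the identity \<open>eq\<close> can
    be solved for \<open>?A\<close> inside ennreal.\<close>
  have "?A = ennreal (1 / (sqrt pi * Gamma ((?d + p) / 2 + 1))) * ennreal (sqrt pi * Gamma ((?d + p) / 2 + 1)) * ?A"
    using Gpos' by (subst ennreal_mult[symmetric]) auto
  also have "\<dots> = ennreal (1 / (sqrt pi * Gamma ((?d + p) / 2 + 1))) * ennreal (sqrt pi ^ DIM('a) * (norm v powr p * Gamma ((p + 1) / 2)))"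
    unfolding eq[symmetric] using Gpos' by (simp add: ennreal_mult mult_ac)
  also have "\<dots> = ennreal (1 / (sqrt pi * Gamma ((?d + p) / 2 + 1)) * (sqrt pi ^ DIM('a) * (norm v powr p * Gamma ((p + 1) / 2))))"
    using Gpos' assms by (subst ennreal_mult) auto
  also have "1 / (sqrt pi * Gamma ((?d + p) / 2 + 1)) * (sqrt pi ^ DIM('a) * (norm v powr p * Gamma ((p + 1) / 2)))
     = p * K_const DIM('a) p / (?d + p) * norm v powr p"
  proof -
    have "sqrt pi ^ DIM('a) = pi powr ((?d - 1) / 2) * sqrt pi"
    proof -
      have "sqrt pi ^ DIM('a) = sqrt pi powr ?d" by (simp add: powr_realpow)
      also have "\<dots> = pi powr (?d / 2)" by (simp add: powr_half_sqrt[symmetric] powr_powr)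
      also have "?d / 2 = (?d - 1) / 2 + 1 / 2" by (simp add: field_simps)
      also have "pi powr \<dots> = pi powr ((?d - 1) / 2) * sqrt pi"
        by (simp only: powr_add powr_half_sqrt pi_ge_zero)
      finally show ?thesis .
    qed
    moreover have "?d + p > 0" using assms by (simp add: add_pos_nonneg)
    ultimately show ?thesis using Gpos assms unfolding G K_const_def by (simp add: add.commute[of p] mult_ac)
  qed
  finally show ?thesis .
qed

section \<open>Kernel integrals over balls\<close>

lemma K_const_nonneg: "p \<ge> 1 \<Longrightarrow> K_const d p \<ge> 0"
  unfolding K_const_def by (intro mult_nonneg_nonneg divide_nonneg_nonneg less_imp_le[OF Gamma_real_pos]) (auto intro: add_pos_nonneg)

text \<open>The homogeneity d + p exceeds the order d + sp of the singularity by p (1 - s), which is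
  the source of 1 / (1 - s). The factor (d + p) / (p (1 - s)) turns the constant p K / (d + p) of
  the unit ball into K / (1 - s).\<close>

lemma kernel_integral_inner:
  fixes v :: "'a::euclidean_space"
  assumes "p \<ge> 1" "0 < s" "s < 1" "R \<ge> 0"
  shows "(NN h. ennreal (\<bar>v \<bullet> h\<bar> powr p) * indicator (ball 0 R) h * sker s p h)
    = ennreal (K_const DIM('a) p / (1 - s) * norm v powr p * R powr (p * (1 - s)))"
proof -
  have e: "real DIM('a) + p - (real DIM('a) + s * p) = p * (1 - s)" by (simp add: algebra_simps)
  have pos: "real DIM('a) + p > 0" "real DIM('a) + s * p > 0" "p * (1 - s) > 0" using assms by (auto intro: add_pos_nonneg)
  have "(NN h. ennreal (\<bar>v \<bullet> h\<bar> powr p) * indicator (ball 0 R) h * sker s p h)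
     = (NN h. ennreal (\<bar>v \<bullet> h\<bar> powr p) * indicator (ball 0 1) h)
       * ennreal ((real DIM('a) + p) / (real DIM('a) + p - (real DIM('a) + s * p)) * R powr (real DIM('a) + p - (real DIM('a) + s * p)))"
    by (rule nn_integral_homogeneous_kernel)
       (use assms pos e in \<open>auto simp: ennreal_mult[symmetric] abs_mult powr_mult\<close>)
  also have "\<dots> = ennreal (p * K_const DIM('a) p / (real DIM('a) + p) * norm v powr p) * ennreal ((real DIM('a) + p) / (p * (1 - s)) * R powr (p * (1 - s)))"
    unfolding e by (subst nn_integral_inner_powr_ball) (use assms in simp_all)
  also have "\<dots> = ennreal (K_const DIM('a) p / (1 - s) * norm v powr p * R powr (p * (1 - s)))"
    using assms pos K_const_nonneg[of p "DIM('a)"]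
    by (subst ennreal_mult[symmetric]) (auto intro!: mult_nonneg_nonneg)
  finally show ?thesis .
qed

text \<open>Only the order 1 / (1 - s) matters where this is used, so the integral of |h|^p over the
  unit ball is bounded by the volume.\<close>

lemma kernel_integral_norm:
  assumes "p \<ge> 1" "0 < s" "s < 1" "R \<ge> 0"
  shows "(NN (h::'a::euclidean_space). ennreal (norm h powr p) * indicator (ball 0 R) h * sker s p h)
    \<le> ennreal (unit_ball_vol DIM('a) * (real DIM('a) + p) / (p * (1 - s)) * R powr (p * (1 - s)))"
proof -
  have e: "real DIM('a) + p - (real DIM('a) + s * p) = p * (1 - s)" by (simp add: algebra_simps)
  have pos: "real DIM('a) + p > 0" "real DIM('a) + s * p > 0" "p * (1 - s) > 0" using assms by (auto intro: add_pos_nonneg)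
  have "(NN (h::'a). ennreal (norm h powr p) * indicator (ball 0 R) h * sker s p h)
     = (NN (h::'a). ennreal (norm h powr p) * indicator (ball 0 1) h)
       * ennreal ((real DIM('a) + p) / (real DIM('a) + p - (real DIM('a) + s * p)) * R powr (real DIM('a) + p - (real DIM('a) + s * p)))"
    by (rule nn_integral_homogeneous_kernel)
       (use assms pos e in \<open>auto simp: ennreal_mult[symmetric] abs_mult powr_mult\<close>)
  also have "\<dots> \<le> ennreal (unit_ball_vol DIM('a)) * ennreal ((real DIM('a) + p) / (p * (1 - s)) * R powr (p * (1 - s)))"
  proof -
    have "(NN (h::'a). ennreal (norm h powr p) * indicator (ball 0 1) h) \<le> (NN (h::'a). indicator (ball 0 1) h)"
      using assms by (intro nn_integral_mono) (auto split: split_indicator intro!: powr_le1)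
    also have "\<dots> = ennreal (unit_ball_vol DIM('a))" by (simp add: emeasure_ball)
    finally show ?thesis unfolding e by (intro mult_mono) auto
  qed
  also have "\<dots> = ennreal (unit_ball_vol DIM('a) * (real DIM('a) + p) / (p * (1 - s)) * R powr (p * (1 - s)))"
    using assms pos by (subst ennreal_mult[symmetric]) (auto intro!: mult_nonneg_nonneg simp: unit_ball_vol_nonneg)
  finally show ?thesis .
qed

section \<open>Boundary distance and energy\<close>

lemma frontier_nonempty:
  fixes \<Omega> :: "'a::euclidean_space set"
  shows "\<Omega> \<noteq> {} \<Longrightarrow> \<Omega> \<noteq> UNIV \<Longrightarrow> frontier \<Omega> \<noteq> {}"
  using frontier_eq_empty by blast

lemma bdist_nonneg: "0 \<le> bdist \<Omega> x"
  by (simp add: bdist_def infdist_nonneg)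

lemma bdist_le_add: "bdist \<Omega> x \<le> bdist \<Omega> y + dist x y"
  unfolding bdist_def by (rule infdist_triangle)

lemma bdist_pos_iff:
  fixes \<Omega> :: "'a::euclidean_space set"
  assumes "\<Omega> \<noteq> {}" "\<Omega> \<noteq> UNIV"
  shows "0 < bdist \<Omega> x \<longleftrightarrow> x \<notin> frontier \<Omega>"
  using in_closed_iff_infdist_zero[OF frontier_closed frontier_nonempty[OF assms], of x] bdist_nonneg[of \<Omega> x]
  unfolding bdist_def by auto

lemma bdist_pos:
  fixes \<Omega> :: "'a::euclidean_space set"
  assumes "open \<Omega>" "\<Omega> \<noteq> UNIV" "x \<in> \<Omega>"
  shows "0 < bdist \<Omega> x"
  using assms frontier_disjoint_eq[of \<Omega>] by (subst bdist_pos_iff) auto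

text \<open>Otherwise the ball about x of radius d(x), being connected, would meet the boundary of
  \<Omega>, at a distance less than d(x) from x.\<close>

lemma in_domain_if_near:
  fixes \<Omega> :: "'a::euclidean_space set"
  assumes "x \<in> \<Omega>" "dist x y < bdist \<Omega> x"
  shows "y \<in> \<Omega>"
proof (rule ccontr)
  assume "y \<notin> \<Omega>"
  have "0 < bdist \<Omega> x" using le_less_trans[OF zero_le_dist assms(2)] .
  then have "x \<in> ball x (bdist \<Omega> x) \<inter> \<Omega>" "y \<in> ball x (bdist \<Omega> x) - \<Omega>" using assms \<open>y \<notin> \<Omega>\<close> by auto
  then have "ball x (bdist \<Omega> x) \<inter> frontier \<Omega> \<noteq> {}"
    by (intro connected_Int_frontier) blast+
  then obtain z where "z \<in> frontier \<Omega>" "dist x z < bdist \<Omega> x" by auto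
  then show False using infdist_le[of z "frontier \<Omega>" x] unfolding bdist_def by auto
qed

lemma continuous_bdist [continuous_intros]: "continuous_on A (bdist \<Omega>)"
  unfolding bdist_def by (intro continuous_intros)

lemma borel_measurable_bdist [measurable]: "bdist \<Omega> \<in> Borel"
  by (intro borel_measurable_continuous_onI continuous_bdist)

lemma dist_weight_pos: "0 < bdist \<Omega> x \<Longrightarrow> dist_weight \<Omega> \<gamma> x = ennreal (bdist \<Omega> x powr (-\<gamma>))"
  by (auto simp: dist_weight_def epowr_def)

lemma dist_weight_zero: "bdist \<Omega> x = 0 \<Longrightarrow> dist_weight \<Omega> \<gamma> x = (if \<gamma> = 0 then 1 else if \<gamma> > 0 then \<infinity> else 0)"
  by (auto simp: dist_weight_def epowr_def)

lemma dist_weight_0 [simp]: "dist_weight \<Omega> 0 x = 1"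
  by (auto simp: dist_weight_def epowr_def)

lemma borel_measurable_dist_weight [measurable]: "dist_weight \<Omega> \<gamma> \<in> Borel"
proof -
  have "dist_weight \<Omega> \<gamma> = (\<lambda>x. if 0 < bdist \<Omega> x then ennreal (bdist \<Omega> x powr (-\<gamma>)) else (if \<gamma> = 0 then 1 else if \<gamma> > 0 then \<infinity> else 0))"
  proof
    fix x
    show "dist_weight \<Omega> \<gamma> x = (if 0 < bdist \<Omega> x then ennreal (bdist \<Omega> x powr (-\<gamma>)) else (if \<gamma> = 0 then 1 else if \<gamma> > 0 then \<infinity> else 0))"
      using bdist_nonneg[of \<Omega> x] by (cases "bdist \<Omega> x = 0") (auto simp: dist_weight_pos dist_weight_zero)
  qed
  also have "\<dots> \<in> Borel" by measurable
  finally show ?thesis .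
qed

section \<open>Borel representatives and difference variables\<close>

lemma completion_ex_borel_measurable_euclidean:
  fixes f :: "'b \<Rightarrow> 'a::euclidean_space"
  assumes f: "f \<in> borel_measurable (completion M)"
  obtains g where "g \<in> borel_measurable M" "AE x in M. f x = g x"
proof -
  have "\<exists>g'\<in>borel_measurable M. (AE x in M. f x \<bullet> b = g' x)" for b
    using f by (intro completion_ex_borel_measurable_real borel_measurable_inner) auto
  then obtain g where g: "\<And>b. g b \<in> borel_measurable M" "\<And>b. AE x in M. f x \<bullet> b = g b x" by metis
  have "AE x in M. \<forall>b\<in>Basis. f x \<bullet> b = g b x"
    using g(2) by (intro AE_finite_allI) auto
  then have "AE x in M. f x = (\<Sum>b\<in>Basis. g b x *\<^sub>R b)"
    by eventually_elim (subst euclidean_representation[symmetric], simp)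
  then show ?thesis using g(1) by (intro that[of "\<lambda>x. \<Sum>b\<in>Basis. g b x *\<^sub>R b"]) auto
qed

text \<open>Tonelli is applied on products of Borel spaces throughout, whereas the functions of the
  theorem are Lebesgue measurable. The representative is 0 off \<Omega>, which later serves as
  extension by zero.\<close>

lemma borel_measurable_imp_ae_borel:
  fixes f :: "'a::euclidean_space \<Rightarrow> 'b::euclidean_space"
  assumes "f \<in> borel_measurable (lebesgue_on \<Omega>)" "open \<Omega>"
  obtains g where "g \<in> Borel" "AE x in lborel. x \<in> \<Omega> \<longrightarrow> f x = g x"
    "\<And>x. x \<notin> \<Omega> \<Longrightarrow> g x = 0"
proof -
  have "(\<lambda>x. indicator \<Omega> x *\<^sub>R f x) \<in> borel_measurable lebesgue"
    using assms by (subst (asm) borel_measurable_restrict_space_iff) auto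
  then obtain g where g: "g \<in> borel_measurable lborel" "AE x in lborel. indicator \<Omega> x *\<^sub>R f x = g x"
    by (rule completion_ex_borel_measurable_euclidean)
  have [measurable]: "\<Omega> \<in> sets borel" using assms by auto
  show ?thesis
  proof (rule that[of "\<lambda>x. indicator \<Omega> x *\<^sub>R g x"])
    show "(\<lambda>x. indicator \<Omega> x *\<^sub>R g x) \<in> Borel" using g(1) by simp
    show "AE x in lborel. x \<in> \<Omega> \<longrightarrow> f x = indicator \<Omega> x *\<^sub>R g x"
      using g(2) by eventually_elim (auto split: split_indicator_asm)
  qed auto
qed

text \<open>The integrand of the energy in the variables $x$ and $h = y - x$.\<close>

definition energy_integrand ::
  "'a::euclidean_space set \<Rightarrow> real \<Rightarrow> real \<Rightarrow> real \<Rightarrow> real \<Rightarrow> ('a \<Rightarrow> real) \<Rightarrow> 'a \<Rightarrow> 'a \<Rightarrow> ennreal" where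
  "energy_integrand \<Omega> s p \<alpha> \<beta> f x h =
     ennreal (\<bar>f (x + h) - f x\<bar> powr p) * sker s p h
     * (dist_weight \<Omega> \<alpha> x * indicator \<Omega> x * (dist_weight \<Omega> \<beta> (x + h) * indicator \<Omega> (x + h)))"

lemma nn_integral_lborel_translate:
  fixes f :: "'a::euclidean_space \<Rightarrow> ennreal"
  assumes "f \<in> Borel"
  shows "(NN x. f (a + x)) = (NN x. f x)"
  using nn_integral_lborel_affine[OF assms, of 1 a] by simp

lemma gagliardo_energy_eq:
  fixes f :: "'a::euclidean_space \<Rightarrow> real"
  assumes [measurable]: "f \<in> Borel" and "open \<Omega>"
  shows "gagliardo_energy \<Omega> s p \<alpha> \<beta> f = (NN x. NN h. energy_integrand \<Omega> s p \<alpha> \<beta> f x h)"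
proof -
  have [measurable]: "\<Omega> \<in> sets borel" using assms by auto
  have "(\<integral>\<^sup>+y\<in>\<Omega>. ennreal (\<bar>f x - f y\<bar> powr p / norm (x - y) powr (real DIM('a) + s * p))
           * dist_weight \<Omega> \<alpha> x * dist_weight \<Omega> \<beta> y \<partial>lborel) * indicator \<Omega> x
      = (NN h. energy_integrand \<Omega> s p \<alpha> \<beta> f x h)" for x
  proof -
    have eq: "energy_integrand \<Omega> s p \<alpha> \<beta> f x h = ennreal (\<bar>f x - f (x + h)\<bar> powr p / norm (x - (x + h)) powr (real DIM('a) + s * p))
           * dist_weight \<Omega> \<alpha> x * dist_weight \<Omega> \<beta> (x + h) * indicator \<Omega> (x + h) * indicator \<Omega> x" for h
      unfolding energy_integrand_def powr_minus by (simp add: ennreal_mult[symmetric] divide_inverse abs_minus_commute mult_ac)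
    show ?thesis unfolding eq
      by (subst nn_integral_lborel_translate[where f="\<lambda>y. ennreal (\<bar>f x - f y\<bar> powr p / norm (x - y) powr (real DIM('a) + s * p))
           * dist_weight \<Omega> \<alpha> x * dist_weight \<Omega> \<beta> y * indicator \<Omega> y * indicator \<Omega> x"], measurable)
         (subst nn_integral_multc, measurable)
  qed
  then show ?thesis by (simp add: gagliardo_energy_def nn_integral_completion)
qed

lemma gagliardo_energy_cong_AE:
  assumes "AE x in lborel. x \<in> \<Omega> \<longrightarrow> f x = g x"
  shows "gagliardo_energy \<Omega> s p \<alpha> \<beta> f = gagliardo_energy \<Omega> s p \<alpha> \<beta> g"
  unfolding gagliardo_energy_def nn_integral_completion
proof (intro nn_integral_cong_AE)
  show "AE x in lborel. (\<integral>\<^sup>+y\<in>\<Omega>. ennreal (\<bar>f x - f y\<bar> powr p / norm (x - y) powr (real DIM('a) + s * p))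
           * dist_weight \<Omega> \<alpha> x * dist_weight \<Omega> \<beta> y \<partial>lborel) * indicator \<Omega> x
     = (\<integral>\<^sup>+y\<in>\<Omega>. ennreal (\<bar>g x - g y\<bar> powr p / norm (x - y) powr (real DIM('a) + s * p))
           * dist_weight \<Omega> \<alpha> x * dist_weight \<Omega> \<beta> y \<partial>lborel) * indicator \<Omega> x"
    using assms
  proof eventually_elim
    case (elim x)
    show ?case
    proof (cases "x \<in> \<Omega>")
      case True
      then have "f x = g x" using elim by simp
      show ?thesis unfolding \<open>f x = g x\<close>
        using assms by (intro arg_cong2[where f="(*)"] refl nn_integral_cong_AE, elim eventually_mono)
           (auto split: split_indicator)
    qed simp
  qed
qed

section \<open>Jensen's inequality along segments\<close>

lemma powr_tangent:
  fixes A u :: real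
  assumes "p \<ge> 1" "A > 0" "u \<ge> 0"
  shows "p * A powr (p - 1) * u \<le> u powr p + (p - 1) * A powr p"
proof (cases "u = 0")
  case False
  have conv: "convex_on {0<..} (\<lambda>x. x powr p)" using assms by (intro powr_convex)
  have *: "u powr p - A powr p \<ge> (p * A powr (p - 1)) * (u - A)"
    by (rule convex_on_imp_above_tangent[OF conv])
       (use assms False in \<open>auto intro!: derivative_eq_intros simp: interior_open\<close>)
  have "A powr (p - 1) * A = A powr p" using assms by (simp add: powr_diff)
  then have "p * A powr (p - 1) * (u - A) = p * A powr (p - 1) * u - (p - 1) * A powr p - A powr p"
    by (simp add: algebra_simps)
  with * show ?thesis by linarith
qed (use assms in auto)

text \<open>Jensen's inequality, free of integrability conditions.\<close>

lemma powr_le_nn_integral: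
  assumes M: "emeasure M (space M) = 1" and [measurable]: "g \<in> borel_measurable M"
    and g: "\<And>x. g x \<ge> 0" and p: "p \<ge> 1" and "A \<ge> 0" and A: "ennreal A \<le> (\<integral>\<^sup>+x. ennreal (g x) \<partial>M)"
  shows "ennreal (A powr p) \<le> (\<integral>\<^sup>+x. ennreal (g x powr p) \<partial>M)"
proof (cases "A = 0")
  case False
  then have "A > 0" using \<open>A \<ge> 0\<close> by simp
  \<comment> \<open>The tangent inequality at A is integrated over a space of mass 1; the finite
    term (p - 1) A^p is cancelled at the end.\<close>
  have "ennreal ((p - 1) * A powr p) + ennreal (A powr p) = ennreal (p * A powr (p - 1)) * ennreal A"
    using p \<open>A > 0\<close> by (simp add: ennreal_mult[symmetric] ennreal_plus[symmetric] powr_diff algebra_simps del: ennreal_plus)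
  also have "\<dots> \<le> ennreal (p * A powr (p - 1)) * (\<integral>\<^sup>+x. ennreal (g x) \<partial>M)"
    using A by (intro mult_left_mono) auto
  also have "\<dots> = (\<integral>\<^sup>+x. ennreal (p * A powr (p - 1)) * ennreal (g x) \<partial>M)"
    by (rule nn_integral_cmult[symmetric]) measurable
  also have "\<dots> \<le> (\<integral>\<^sup>+x. ennreal ((p - 1) * A powr p) + ennreal (g x powr p) \<partial>M)"
    using powr_tangent[OF p \<open>A > 0\<close> g] p g
    by (intro nn_integral_mono) (simp add: ennreal_mult[symmetric] ennreal_plus[symmetric] add.commute del: ennreal_plus)
  also have "\<dots> = ennreal ((p - 1) * A powr p) + (\<integral>\<^sup>+x. ennreal (g x powr p) \<partial>M)"
    using M by (subst nn_integral_add) auto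
  finally show ?thesis by (subst (asm) ennreal_add_left_cancel_le) auto
qed auto

text \<open>The fundamental theorem of calculus as an inequality, for each h and almost every x. It
  is all that the upper bounds use of a function and its gradient, and it holds for C^1 functions
  and for weak gradients on the whole space alike.\<close>

definition ftc_bound :: "('a::euclidean_space \<Rightarrow> real) \<Rightarrow> ('a \<Rightarrow> 'a) \<Rightarrow> bool" where
  "ftc_bound F G \<longleftrightarrow> F \<in> Borel \<and> G \<in> Borel \<and>
     (\<forall>h. AE x in lborel. ennreal \<bar>F (x + h) - F x\<bar> \<le> (\<integral>\<^sup>+t\<in>{0..1}. ennreal \<bar>G (x + t *\<^sub>R h) \<bullet> h\<bar> \<partial>lborel))"

text \<open>Jensen on the segment, then Tonelli and the substitution x = z - t h. This freezes the
  point z at which the gradient is taken and lets the weights, hidden in \<open>k\<close>, move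
  instead.\<close>

lemma ftc_bound_energy:
  fixes F :: "'a::euclidean_space \<Rightarrow> real" and k :: "'a \<Rightarrow> 'a \<Rightarrow> ennreal"
  assumes FG: "ftc_bound F G" and p: "p \<ge> 1"
    and [measurable]: "case_prod k \<in> borel_measurable (borel \<Otimes>\<^sub>M borel)"
  shows "(NN x. NN h. ennreal (\<bar>F (x + h) - F x\<bar> powr p) * k x h)
     \<le> (\<integral>\<^sup>+t\<in>{0..1}. (NN z. NN h. ennreal (\<bar>G z \<bullet> h\<bar> powr p) * k (z - t *\<^sub>R h) h) \<partial>lborel)"
proof -
  have [measurable]: "F \<in> Borel" "G \<in> Borel"
    using FG by (auto simp: ftc_bound_def)
  have "(NN x. NN h. ennreal (\<bar>F (x + h) - F x\<bar> powr p) * k x h)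
     = (NN h. NN x. ennreal (\<bar>F (x + h) - F x\<bar> powr p) * k x h)"
    by (rule lborel_pair.Fubini') measurable
  also have "\<dots> \<le> (NN h. NN x. NN t. ennreal (\<bar>G (x + t *\<^sub>R h) \<bullet> h\<bar> powr p) * k x h * indicator {0..1} t)"
  proof (rule nn_integral_mono, rule nn_integral_mono_AE)
    fix h :: 'a
    have "AE x in lborel. ennreal \<bar>F (x + h) - F x\<bar> \<le> (\<integral>\<^sup>+t\<in>{0..1}. ennreal \<bar>G (x + t *\<^sub>R h) \<bullet> h\<bar> \<partial>lborel)"
      using FG by (auto simp: ftc_bound_def)
    then show "AE x in lborel. ennreal (\<bar>F (x + h) - F x\<bar> powr p) * k x h
       \<le> (NN t. ennreal (\<bar>G (x + t *\<^sub>R h) \<bullet> h\<bar> powr p) * k x h * indicator {0..1} t)"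
    proof eventually_elim
      case (elim x)
      have "ennreal (\<bar>F (x + h) - F x\<bar> powr p) \<le> (\<integral>\<^sup>+t. ennreal (\<bar>G (x + t *\<^sub>R h) \<bullet> h\<bar> powr p) \<partial>restrict_space lborel {0..1})"
        using elim p by (intro powr_le_nn_integral) (auto simp: nn_integral_restrict_space emeasure_restrict_space measurable_restrict_space1)
      also have "\<dots> = (\<integral>\<^sup>+t\<in>{0..1}. ennreal (\<bar>G (x + t *\<^sub>R h) \<bullet> h\<bar> powr p) \<partial>lborel)"
        by (simp add: nn_integral_restrict_space)
      finally have "ennreal (\<bar>F (x + h) - F x\<bar> powr p) * k x h
         \<le> (\<integral>\<^sup>+t\<in>{0..1}. ennreal (\<bar>G (x + t *\<^sub>R h) \<bullet> h\<bar> powr p) \<partial>lborel) * k x h"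
        by (intro mult_right_mono) auto
      also have "\<dots> = (NN t. ennreal (\<bar>G (x + t *\<^sub>R h) \<bullet> h\<bar> powr p) * indicator {0..1} t * k x h)"
        by (rule nn_integral_multc[symmetric]) measurable
      finally show ?case by (simp only: mult_ac)
    qed
  qed
  also have "\<dots> = (NN h. NN t. NN x. ennreal (\<bar>G (x + t *\<^sub>R h) \<bullet> h\<bar> powr p) * k x h * indicator {0..1} t)"
    by (intro nn_integral_cong lborel_pair.Fubini') measurable
  also have "\<dots> = (NN h. NN t. NN z. ennreal (\<bar>G z \<bullet> h\<bar> powr p) * k (z - t *\<^sub>R h) h * indicator {0..1} t)"
  proof (rule nn_integral_cong, rule nn_integral_cong)
    fix h :: 'a and t :: real
    have [measurable]: "(\<lambda>z. k (z - t *\<^sub>R h) h) \<in> Borel"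
      using measurable_compose[of "\<lambda>z. (z - t *\<^sub>R h, h)" borel "borel \<Otimes>\<^sub>M borel" "case_prod k" borel] by simp
    show "(NN x. ennreal (\<bar>G (x + t *\<^sub>R h) \<bullet> h\<bar> powr p) * k x h * indicator {0..1} t)
      = (NN z. ennreal (\<bar>G z \<bullet> h\<bar> powr p) * k (z - t *\<^sub>R h) h * indicator {0..1} t)"
      using nn_integral_lborel_translate[of "\<lambda>z. ennreal (\<bar>G z \<bullet> h\<bar> powr p) * k (z - t *\<^sub>R h) h * indicator {0..1} t" "t *\<^sub>R h"]
      by (simp add: add.commute)
  qed
  also have "\<dots> = (NN t. NN h. NN z. ennreal (\<bar>G z \<bullet> h\<bar> powr p) * k (z - t *\<^sub>R h) h * indicator {0..1} t)"
    by (intro lborel_pair.Fubini') measurable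
  also have "\<dots> = (NN t. NN z. NN h. ennreal (\<bar>G z \<bullet> h\<bar> powr p) * k (z - t *\<^sub>R h) h * indicator {0..1} t)"
    by (intro nn_integral_cong lborel_pair.Fubini') measurable
  also have "\<dots> = (\<integral>\<^sup>+t\<in>{0..1}. (NN z. NN h. ennreal (\<bar>G z \<bullet> h\<bar> powr p) * k (z - t *\<^sub>R h) h) \<partial>lborel)"
  proof (intro nn_integral_cong)
    fix t :: real
    show "(NN z. NN h. ennreal (\<bar>G z \<bullet> h\<bar> powr p) * k (z - t *\<^sub>R h) h * indicator {0..1} t)
      = (NN z. NN h. ennreal (\<bar>G z \<bullet> h\<bar> powr p) * k (z - t *\<^sub>R h) h) * indicator {0..1} t"
      by (cases "t \<in> {0..1}") auto
  qed
  finally show ?thesis .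
qed

section \<open>The limit for smooth functions\<close>

lemma powr_between_le:
  fixes u q \<alpha> :: real
  assumes "0 < u" "1 \<le> q" "u \<le> q" "1 \<le> u * q"
  shows "u powr \<alpha> \<le> q powr \<bar>\<alpha>\<bar>"
proof (cases "\<alpha> \<ge> 0")
  case True
  then show ?thesis using assms by (auto intro!: powr_mono2)
next
  case False
  have "u powr \<alpha> = (inverse u) powr (-\<alpha>)" using assms by (simp add: powr_minus inverse_powr)
  also have "\<dots> \<le> q powr (-\<alpha>)" using assms False by (intro powr_mono2) (auto simp: field_simps)
  finally show ?thesis using False by simp
qed

lemma ratio_powr_le:
  fixes u v q :: real
  assumes "0 < u" "0 < v" "1 \<le> q" "u \<le> q * v" "v \<le> q * u"
  shows "(u / v) powr \<alpha> \<le> q powr \<bar>\<alpha>\<bar>"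
  using assms by (intro powr_between_le) (auto simp: field_simps)

text \<open>Here a, b, c stand for the boundary distances of x, of y and of a point z of the
  segment. They lie in one interval whose endpoints have ratio (1 + \<theta>) / (1 - \<theta>), so
  any two of them are comparable up to this ratio.\<close>

lemma near_weight_le:
  fixes a b c \<theta> :: real
  assumes \<theta>: "0 < \<theta>" "\<theta> < 1" and a: "0 < a" and b: "(1 - \<theta>) * a \<le> b" "b \<le> (1 + \<theta>) * a"
    and c: "(1 - \<theta>) * a \<le> c" "c \<le> (1 + \<theta>) * a"
  shows "a powr (-\<alpha>) * b powr (-\<beta>) \<le> ((1 + \<theta>) / (1 - \<theta>)) powr (\<bar>\<alpha>\<bar> + \<bar>\<beta>\<bar>) * c powr (-(\<alpha> + \<beta>))"
proof -
  let ?q = "(1 + \<theta>) / (1 - \<theta>)"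
  have q: "1 \<le> ?q" using \<theta> by (simp add: field_simps)
  have pos: "0 < (1 - \<theta>) * a" using \<theta> a by simp
  then have "0 < b" "0 < c" using b c by linarith+
  have le: "x \<le> ?q * y" if "(1 - \<theta>) * a \<le> y" "x \<le> (1 + \<theta>) * a" for x y
  proof -
    have "x \<le> (1 + \<theta>) * a" by fact
    also have "\<dots> = ?q * ((1 - \<theta>) * a)" using \<theta> by simp
    also have "\<dots> \<le> ?q * y" using that q by (intro mult_left_mono) auto
    finally show ?thesis .
  qed
  have aa: "(1 - \<theta>) * a \<le> a" "a \<le> (1 + \<theta>) * a" using \<theta> a by (auto simp: algebra_simps)
  have 1: "(c / a) powr \<alpha> \<le> ?q powr \<bar>\<alpha>\<bar>"
    using le[OF aa(1) c(2)] le[OF c(1) aa(2)] q a \<open>0 < c\<close> by (intro ratio_powr_le)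
  have 2: "(c / b) powr \<beta> \<le> ?q powr \<bar>\<beta>\<bar>"
    using le[OF b(1) c(2)] le[OF c(1) b(2)] q \<open>0 < b\<close> \<open>0 < c\<close> by (intro ratio_powr_le)
  have "a powr (-\<alpha>) * b powr (-\<beta>) = ((c / a) powr \<alpha> * (c / b) powr \<beta>) * c powr (-(\<alpha> + \<beta>))"
  proof -
    have "c powr (-(\<alpha> + \<beta>)) = inverse (c powr \<alpha> * c powr \<beta>)" by (simp only: powr_minus powr_add)
    then show ?thesis
      using a \<open>0 < b\<close> \<open>0 < c\<close> by (simp add: powr_divide powr_minus field_simps del: minus_add_distrib)
  qed
  also have "\<dots> \<le> (?q powr \<bar>\<alpha>\<bar> * ?q powr \<bar>\<beta>\<bar>) * c powr (-(\<alpha> + \<beta>))"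
    using 1 2 by (intro mult_right_mono mult_mono) auto
  finally show ?thesis by (simp add: powr_add)
qed

text \<open>For |h| < \<theta> d(x) the whole segment stays in \<Omega>, and both weights move to z
  at the cost of a factor that tends to 1 with \<theta>. The restriction |h| < 1 leaves the kernel
  integral of radius 1, in which the power of the radius is exactly 1.\<close>

lemma near_energy_le:
  fixes \<Omega> :: "'a::euclidean_space set"
  assumes "open \<Omega>" "\<Omega> \<noteq> UNIV" and FG: "ftc_bound F G" and p: "p \<ge> 1" and \<theta>: "0 < \<theta>" "\<theta> < 1"
    and s: "0 < s" "s < 1"
  shows "(NN x. NN h. energy_integrand \<Omega> s p \<alpha> \<beta> F x h
            * (if norm h < 1 \<and> norm h < \<theta> * bdist \<Omega> x then 1 else 0))
    \<le> ennreal (((1 + \<theta>) / (1 - \<theta>)) powr (\<bar>\<alpha>\<bar> + \<bar>\<beta>\<bar>)) * ennreal (K_const DIM('a) p / (1 - s))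
       * (NN z. ennreal (norm (G z) powr p) * dist_weight \<Omega> (\<alpha> + \<beta>) z * indicator \<Omega> z)"
proof -
  have [measurable]: "\<Omega> \<in> sets borel" using assms by auto
  have [measurable]: "F \<in> Borel" "G \<in> Borel"
    using FG by (auto simp: ftc_bound_def)
  define C where "C = ((1 + \<theta>) / (1 - \<theta>)) powr (\<bar>\<alpha>\<bar> + \<bar>\<beta>\<bar>)"
  define k where "k x h = sker s p h
     * (dist_weight \<Omega> \<alpha> x * indicator \<Omega> x * (dist_weight \<Omega> \<beta> (x + h) * indicator \<Omega> (x + h)))
     * (if norm h < 1 \<and> norm h < \<theta> * bdist \<Omega> x then 1 else 0)" for x h
  have [measurable]: "case_prod k \<in> borel_measurable (borel \<Otimes>\<^sub>M borel)"
    unfolding k_def by measurable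
  have k_le: "k (z - t *\<^sub>R h) h \<le> ennreal C * (dist_weight \<Omega> (\<alpha> + \<beta>) z * indicator \<Omega> z)
      * (sker s p h * indicator (ball 0 1) h)" if t: "t \<in> {0..1}" for z t h
  proof (cases "norm h < 1 \<and> norm h < \<theta> * bdist \<Omega> (z - t *\<^sub>R h) \<and> z - t *\<^sub>R h \<in> \<Omega>")
    case True
    define x where "x = z - t *\<^sub>R h"
    define y where "y = x + h"
    have z: "z = x + t *\<^sub>R h" by (simp add: x_def)
    have x: "x \<in> \<Omega>" "norm h < \<theta> * bdist \<Omega> x" using True by (auto simp: x_def)
    have dx: "0 < bdist \<Omega> x" using bdist_pos assms x by blast
    have "t * norm h \<le> 1 * norm h" using t by (intro mult_right_mono) auto
    then have d: "dist x z < \<theta> * bdist \<Omega> x" "dist x y < \<theta> * bdist \<Omega> x"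
      using x t by (auto simp: z y_def dist_norm)
    have "\<theta> * bdist \<Omega> x \<le> 1 * bdist \<Omega> x" using \<theta> dx by (intro mult_right_mono) auto
    then have "dist x z < bdist \<Omega> x" "dist x y < bdist \<Omega> x" using d by auto
    then have zy: "z \<in> \<Omega>" "y \<in> \<Omega>" using x(1) in_domain_if_near by blast+
    have dd: "0 < bdist \<Omega> y" "0 < bdist \<Omega> z" using bdist_pos assms zy by blast+
    have "(1 - \<theta>) * bdist \<Omega> x \<le> bdist \<Omega> w \<and> bdist \<Omega> w \<le> (1 + \<theta>) * bdist \<Omega> x" if "dist x w < \<theta> * bdist \<Omega> x" for w
      using bdist_le_add[of \<Omega> x w] bdist_le_add[of \<Omega> w x] that by (auto simp: dist_commute algebra_simps)
    then have "bdist \<Omega> x powr (-\<alpha>) * bdist \<Omega> y powr (-\<beta>) \<le> C * bdist \<Omega> z powr (-(\<alpha> + \<beta>))"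
      unfolding C_def using \<theta> dx d by (intro near_weight_le) auto
    then have "dist_weight \<Omega> \<alpha> x * dist_weight \<Omega> \<beta> y \<le> ennreal C * dist_weight \<Omega> (\<alpha> + \<beta>) z"
      using dx dd by (simp add: dist_weight_pos ennreal_mult[symmetric] C_def del: minus_add_distrib)
    then have "sker s p h * (dist_weight \<Omega> \<alpha> x * dist_weight \<Omega> \<beta> y)
       \<le> sker s p h * (ennreal C * dist_weight \<Omega> (\<alpha> + \<beta>) z)"
      by (intro mult_left_mono) auto
    then show ?thesis using True x zy by (simp add: k_def x_def[symmetric] y_def[symmetric] mult_ac)
  qed (auto simp: k_def)
  have "(NN x. NN h. energy_integrand \<Omega> s p \<alpha> \<beta> F x h
            * (if norm h < 1 \<and> norm h < \<theta> * bdist \<Omega> x then 1 else 0))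
      = (NN x. NN h. ennreal (\<bar>F (x + h) - F x\<bar> powr p) * k x h)"
    unfolding k_def energy_integrand_def by (simp only: mult_ac)
  also have "\<dots> \<le> (\<integral>\<^sup>+t\<in>{0..1}. (NN z. NN h. ennreal (\<bar>G z \<bullet> h\<bar> powr p) * k (z - t *\<^sub>R h) h) \<partial>lborel)"
    by (rule ftc_bound_energy[OF FG p]) measurable
  also have "\<dots> \<le> (\<integral>\<^sup>+t\<in>{0..1}. (NN z. NN h. ennreal C * (dist_weight \<Omega> (\<alpha> + \<beta>) z * indicator \<Omega> z) *
      (ennreal (\<bar>G z \<bullet> h\<bar> powr p) * indicator (ball 0 1) h * sker s p h)) \<partial>(lborel::real measure))"
  proof (rule nn_integral_mono)
    fix t :: real
    show "(NN z. NN h. ennreal (\<bar>G z \<bullet> h\<bar> powr p) * k (z - t *\<^sub>R h) h) * indicator {0..1} t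
      \<le> (NN z. NN h. ennreal C * (dist_weight \<Omega> (\<alpha> + \<beta>) z * indicator \<Omega> z) *
      (ennreal (\<bar>G z \<bullet> h\<bar> powr p) * indicator (ball 0 1) h * sker s p h)) * indicator {0..1} t"
    proof (cases "t \<in> {0..1}")
      case True
      show ?thesis
      proof (intro mult_right_mono nn_integral_mono)
        fix z h
        show "ennreal (\<bar>G z \<bullet> h\<bar> powr p) * k (z - t *\<^sub>R h) h \<le> ennreal C * (dist_weight \<Omega> (\<alpha> + \<beta>) z * indicator \<Omega> z) *
            (ennreal (\<bar>G z \<bullet> h\<bar> powr p) * indicator (ball 0 1) h * sker s p h)"
          using mult_left_mono[OF k_le[OF True, of z h], of "ennreal (\<bar>G z \<bullet> h\<bar> powr p)"] by (simp add: mult_ac)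
      qed auto
    qed auto
  qed
  also have "\<dots> = (NN z. NN h. ennreal C * (dist_weight \<Omega> (\<alpha> + \<beta>) z * indicator \<Omega> z) *
      (ennreal (\<bar>G z \<bullet> h\<bar> powr p) * indicator (ball 0 1) h * sker s p h))"
    by (subst nn_integral_cmult_indicator) auto
  also have "\<dots> = (NN z. (ennreal C * ennreal (K_const DIM('a) p / (1 - s)))
        * (ennreal (norm (G z) powr p) * dist_weight \<Omega> (\<alpha> + \<beta>) z * indicator \<Omega> z))"
  proof (intro nn_integral_cong)
    fix z
    have "(NN h. ennreal C * (dist_weight \<Omega> (\<alpha> + \<beta>) z * indicator \<Omega> z) *
      (ennreal (\<bar>G z \<bullet> h\<bar> powr p) * indicator (ball 0 1) h * sker s p h))
     = ennreal C * (dist_weight \<Omega> (\<alpha> + \<beta>) z * indicator \<Omega> z) * ennreal (K_const DIM('a) p / (1 - s) * norm (G z) powr p * 1 powr (p * (1 - s)))"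
      by (subst nn_integral_cmult, measurable, subst kernel_integral_inner) (use p s in simp_all)
    also have "\<dots> = (ennreal C * ennreal (K_const DIM('a) p / (1 - s)))
        * (ennreal (norm (G z) powr p) * dist_weight \<Omega> (\<alpha> + \<beta>) z * indicator \<Omega> z)"
    proof -
      have "ennreal (K_const DIM('a) p / (1 - s) * norm (G z) powr p * 1 powr (p * (1 - s)))
        = ennreal (K_const DIM('a) p / (1 - s)) * ennreal (norm (G z) powr p)"
        using s K_const_nonneg[OF p, of "DIM('a)"] by (subst ennreal_mult[symmetric]) auto
      then show ?thesis by (simp only: mult_ac)
    qed
    finally show "(NN h. ennreal C * (dist_weight \<Omega> (\<alpha> + \<beta>) z * indicator \<Omega> z) *
      (ennreal (\<bar>G z \<bullet> h\<bar> powr p) * indicator (ball 0 1) h * sker s p h)) = \<dots>" .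
  qed
  also have "\<dots> = (ennreal C * ennreal (K_const DIM('a) p / (1 - s))) * (NN z. ennreal (norm (G z) powr p) * dist_weight \<Omega> (\<alpha> + \<beta>) z * indicator \<Omega> z)"
    by (rule nn_integral_cmult) measurable
  finally show ?thesis unfolding C_def .
qed

text \<open>Lowering s to s' costs the factor |h|^(-(s-s')p). Where |h| is bounded below by 1 or by
  \<theta> d(x), this is at most a power of d(x) that no longer depends on s. Hence two energies at
  s', one with \<alpha> raised by (1 - s') p, dominate all s in [s', 1).\<close>

lemma far_integrand_le:
  fixes \<Omega> :: "'a::euclidean_space set"
  assumes "open \<Omega>" "\<Omega> \<noteq> UNIV" and p: "p \<ge> 1" and \<theta>: "0 < \<theta>" "\<theta> < 1"
    and s: "0 < s'" "s' \<le> s" "s < 1" and far: "\<not> (norm h < 1 \<and> norm h < \<theta> * bdist \<Omega> x)"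
  shows "energy_integrand \<Omega> s p \<alpha> \<beta> f x h
    \<le> ennreal (\<theta> powr (-p)) * (energy_integrand \<Omega> s' p \<alpha> \<beta> f x h + energy_integrand \<Omega> s' p (\<alpha> + (1 - s') * p) \<beta> f x h)"
proof (cases "x \<in> \<Omega>")
  case True
  define d where "d = bdist \<Omega> x"
  define \<tau> where "\<tau> = (s - s') * p"
  have d: "d > 0" using assms True bdist_pos unfolding d_def by blast
  have \<tau>: "0 \<le> \<tau>" "\<tau> \<le> (1 - s') * p" "\<tau> \<le> p" using s p by (auto simp: \<tau>_def mult_le_cancel_right1)
  have h: "norm h > 0" using far d \<theta> unfolding d_def[symmetric] by (cases "h = 0") auto
  have "norm h powr (-\<tau>) \<le> \<theta> powr (-p) * (1 + d powr (-((1 - s') * p)))"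
  proof (cases "norm h < 1")
    case False
    then have "norm h powr (-\<tau>) \<le> 1 powr (-\<tau>)" using \<tau> by (intro powr_mono2') auto
    also have "\<dots> \<le> \<theta> powr (-p) * 1" using \<theta> p by (simp add: powr_minus one_le_inverse_iff powr_le1)
    also have "\<dots> \<le> \<theta> powr (-p) * (1 + d powr (-((1 - s') * p)))" by (intro mult_left_mono) auto
    finally show ?thesis .
  next
    case True
    then have "\<theta> * d \<le> norm h" using far by (auto simp: d_def)
    then have "norm h powr (-\<tau>) \<le> (\<theta> * d) powr (-\<tau>)" using \<tau> \<theta> d by (intro powr_mono2') auto
    also have "\<dots> = \<theta> powr (-\<tau>) * d powr (-\<tau>)" using \<theta> d by (simp add: powr_mult)
    also have "\<dots> \<le> \<theta> powr (-p) * (1 + d powr (-((1 - s') * p)))"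
    proof (intro mult_mono)
      show "\<theta> powr (-\<tau>) \<le> \<theta> powr (-p)" using \<tau> \<theta> by (intro powr_mono') auto
      \<comment> \<open>For d >= 1 the power is at most 1, for d < 1 it is at most the one with the
        largest possible \<tau>; the sum covers both cases and is free of s.\<close>
      show "d powr (-\<tau>) \<le> 1 + d powr (-((1 - s') * p))"
      proof (cases "d \<ge> 1")
        case True
        then have "d powr (-\<tau>) \<le> 1 powr (-\<tau>)" using \<tau> by (intro powr_mono2') auto
        then show ?thesis by (simp add: add_increasing2)
      next
        case False
        then have "d powr (-\<tau>) \<le> d powr (-((1 - s') * p))" using \<tau> d by (intro powr_mono') auto
        then show ?thesis by simp
      qed
    qed auto
    finally show ?thesis .
  qed
  then have "norm h powr (-(real DIM('a) + s' * p)) * norm h powr (-\<tau>)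
     \<le> norm h powr (-(real DIM('a) + s' * p)) * (\<theta> powr (-p) * (1 + d powr (-((1 - s') * p))))"
    by (intro mult_left_mono) auto
  moreover have "norm h powr (-(real DIM('a) + s' * p)) * norm h powr (-\<tau>) = norm h powr (-(real DIM('a) + s * p))"
    by (simp add: powr_add[symmetric] \<tau>_def algebra_simps)
  ultimately have "norm h powr (-(real DIM('a) + s * p)) * d powr (-\<alpha>)
      \<le> norm h powr (-(real DIM('a) + s' * p)) * (\<theta> powr (-p) * (1 + d powr (-((1 - s') * p)))) * d powr (-\<alpha>)"
    by (intro mult_right_mono) auto
  also have "\<dots> = \<theta> powr (-p) * (norm h powr (-(real DIM('a) + s' * p)) * d powr (-\<alpha>) + norm h powr (-(real DIM('a) + s' * p)) * d powr (-(\<alpha> + (1 - s') * p)))"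
    using d by (simp add: algebra_simps powr_add powr_diff powr_minus divide_inverse)
  finally have *: "sker s p h * dist_weight \<Omega> \<alpha> x
      \<le> ennreal (\<theta> powr (-p)) * (sker s' p h * dist_weight \<Omega> \<alpha> x
          + sker s' p h * dist_weight \<Omega> (\<alpha> + (1 - s') * p) x)"
    using d by (simp add: dist_weight_pos d_def ennreal_mult[symmetric] ennreal_plus[symmetric] ennreal_leI del: ennreal_plus minus_add_distrib)
  let ?r = "ennreal (\<bar>f (x + h) - f x\<bar> powr p) * (dist_weight \<Omega> \<beta> (x + h) * indicator \<Omega> (x + h))"
  show ?thesis
    using mult_left_mono[OF *, of ?r] True by (simp add: energy_integrand_def distrib_left mult_ac)
qed (simp add: energy_integrand_def)

section \<open>The lower bound at a point of differentiability\<close>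

lemma powr_add_le_convex:
  fixes A B \<mu> :: real
  assumes "p \<ge> 1" "A \<ge> 0" "B \<ge> 0" "0 < \<mu>" "\<mu> < 1"
  shows "(A + B) powr p \<le> (1 - \<mu>) powr (1 - p) * A powr p + \<mu> powr (1 - p) * B powr p"
proof -
  have ge1: "1 \<le> t powr (1 - p)" if "0 < t" "t < 1" for t
    using powr_mono2'[of "1 - p" t 1] that assms by simp
  show ?thesis
  proof (cases "A = 0 \<or> B = 0")
    case True
    have "A powr p \<le> (1 - \<mu>) powr (1 - p) * A powr p" "B powr p \<le> \<mu> powr (1 - p) * B powr p"
      using mult_right_mono[OF ge1[of "1 - \<mu>"], of "A powr p"] mult_right_mono[OF ge1[of \<mu>], of "B powr p"] assms by auto
    then show ?thesis using True by auto
  next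
    case False
    then have AB: "A > 0" "B > 0" using assms by auto
    \<comment> \<open>Convexity at the points A / (1 - \<mu>) and B / \<mu>. As \<mu> tends to 0 the
      coefficient of A^p tends to 1, so a perturbation B that is small compared with A costs
      little.\<close>
    have "((1 - \<mu>) * (A / (1 - \<mu>)) + \<mu> * (B / \<mu>)) powr p \<le> (1 - \<mu>) * (A / (1 - \<mu>)) powr p + \<mu> * (B / \<mu>) powr p"
      using convex_onD[OF powr_convex[OF assms(1)], of \<mu> "A / (1 - \<mu>)" "B / \<mu>"] assms AB by simp
    moreover have "(1 - \<mu>) * (A / (1 - \<mu>)) powr p = (1 - \<mu>) powr (1 - p) * A powr p"
      "\<mu> * (B / \<mu>) powr p = \<mu> powr (1 - p) * B powr p"
      using assms AB by (auto simp: powr_divide powr_diff field_simps)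
    ultimately show ?thesis using assms by simp
  qed
qed

text \<open>Near x the increment differs from v . h by at most \<eta> |h|. Solving the convexity
  estimate for the increment leaves (1 - \<mu>)^(p-1) K |v|^p minus a term with \<eta>^p, times
  \<delta>^(p(1-s)), where \<delta> is the radius of the neighbourhood; this last factor tends to
  1.\<close>

lemma kernel_liminf:
  fixes f :: "'a::euclidean_space \<Rightarrow> real"
  assumes der: "(f has_derivative (\<lambda>h. v \<bullet> h)) (at x)" and [measurable]: "f \<in> Borel"
    and p: "p \<ge> 1" and r: "r > 0" and S: "S \<longlonglongrightarrow> 1" "\<And>n. 0 < S n" "\<And>n. S n < 1"
  shows "ennreal (K_const DIM('a) p * norm v powr p)
    \<le> liminf (\<lambda>n. ennreal (1 - S n) * (NN h. ennreal (\<bar>f (x + h) - f x\<bar> powr p) * indicator (ball 0 r) h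
         * sker (S n) p h))"
proof -
  define J where "J n = ennreal (1 - S n) * (NN h. ennreal (\<bar>f (x + h) - f x\<bar> powr p) * indicator (ball 0 r) h
         * sker (S n) p h)" for n
  define k where "k = K_const DIM('a) p * norm v powr p"
  \<comment> \<open>The constant in the bound for 1 - s times the integral of |h|^p against the
    kernel; it multiplies the error term.\<close>
  define V where "V = unit_ball_vol DIM('a) * (real DIM('a) + p) / p"
  have V: "V \<ge> 0" using p by (simp add: V_def)
  have k: "k \<ge> 0" using p by (simp add: k_def K_const_nonneg)
  have "\<forall>\<^sub>F n in sequentially. y < J n" if y: "y < ennreal k" for y
  proof -
    obtain c where c: "y = ennreal c" "0 \<le> c" "c < k"
      using y k by (cases y) (auto simp: ennreal_less_iff)
    \<comment> \<open>\<mu> is fixed before \<eta>, because the coefficient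
      \<open>\<mu> powr (1 - p)\<close> of the error can be large for small \<mu>.\<close>
    have "((\<lambda>\<mu>. (1 - \<mu>) powr (p - 1) * k) \<longlongrightarrow> (1 - 0) powr (p - 1) * k) (at_right 0)"
      by (intro tendsto_intros) auto
    then have "\<forall>\<^sub>F \<mu> in at_right 0. c < (1 - \<mu>) powr (p - 1) * k"
      using c by (intro order_tendstoD(1)) auto
    moreover have "\<forall>\<^sub>F \<mu>::real in at_right 0. 0 < \<mu> \<and> \<mu> < 1"
      by (rule eventually_at_rightI[of 0 1]) auto
    ultimately have "\<forall>\<^sub>F \<mu> in at_right 0. (0 < \<mu> \<and> \<mu> < 1) \<and> c < (1 - \<mu>) powr (p - 1) * k"
      by eventually_elim auto
    then obtain \<mu> where \<mu>: "0 < \<mu>" "\<mu> < 1" "c < (1 - \<mu>) powr (p - 1) * k"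
      using eventually_happens'[OF trivial_limit_at_right_real] by blast
    have "((\<lambda>\<eta>. (1 - \<mu>) powr (p - 1) * (k - \<mu> powr (1 - p) * \<eta> powr p * V)) \<longlongrightarrow> (1 - \<mu>) powr (p - 1) * (k - \<mu> powr (1 - p) * 0 powr p * V)) (at_right 0)"
      using p by (intro tendsto_intros tendsto_powr') (auto intro!: eventually_at_rightI[of 0 1])
    then have "\<forall>\<^sub>F \<eta> in at_right 0. c < (1 - \<mu>) powr (p - 1) * (k - \<mu> powr (1 - p) * \<eta> powr p * V)"
      using \<mu> by (intro order_tendstoD(1)) auto
    moreover have "\<forall>\<^sub>F \<eta>::real in at_right 0. 0 < \<eta>" by (rule eventually_at_right_less)
    ultimately have "\<forall>\<^sub>F \<eta> in at_right 0. 0 < \<eta> \<and> c < (1 - \<mu>) powr (p - 1) * (k - \<mu> powr (1 - p) * \<eta> powr p * V)"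
      by eventually_elim auto
    then obtain \<eta> where \<eta>: "0 < \<eta>" "c < (1 - \<mu>) powr (p - 1) * (k - \<mu> powr (1 - p) * \<eta> powr p * V)"
      using eventually_happens'[OF trivial_limit_at_right_real] by blast
    define \<Psi> where "\<Psi> = (1 - \<mu>) powr (p - 1) * (k - \<mu> powr (1 - p) * \<eta> powr p * V)"
    obtain \<delta>0 where \<delta>0: "\<delta>0 > 0" "\<And>y. norm (y - x) < \<delta>0 \<Longrightarrow> norm (f y - f x - v \<bullet> (y - x)) \<le> \<eta> * norm (y - x)"
      using der \<eta>(1) unfolding has_derivative_at_alt by blast
    define \<delta> where "\<delta> = min \<delta>0 r"
    have \<delta>: "\<delta> > 0" "\<delta> \<le> r" using \<delta>0 r by (auto simp: \<delta>_def)
    have pt: "\<bar>v \<bullet> h\<bar> powr p \<le> (1 - \<mu>) powr (1 - p) * \<bar>f (x + h) - f x\<bar> powr p + \<mu> powr (1 - p) * \<eta> powr p * norm h powr p"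
      if "norm h < \<delta>" for h
    proof -
      have "\<bar>f (x + h) - f x - v \<bullet> h\<bar> \<le> \<eta> * norm h" using \<delta>0(2)[of "x + h"] that by (simp add: \<delta>_def)
      then have "\<bar>v \<bullet> h\<bar> \<le> \<bar>f (x + h) - f x\<bar> + \<eta> * norm h" by linarith
      then have "\<bar>v \<bullet> h\<bar> powr p \<le> (\<bar>f (x + h) - f x\<bar> + \<eta> * norm h) powr p"
        using p by (intro powr_mono2) auto
      also have "\<dots> \<le> (1 - \<mu>) powr (1 - p) * \<bar>f (x + h) - f x\<bar> powr p + \<mu> powr (1 - p) * (\<eta> * norm h) powr p"
        using p \<mu> \<eta> by (intro powr_add_le_convex) auto
      finally show ?thesis using \<eta> by (simp add: powr_mult)
    qed
    have J_ge: "ennreal (\<Psi> * \<delta> powr (p * (1 - S n))) \<le> J n" for n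
    proof -
      note Sn = S(2,3)[of n]
      define \<kappa> where "\<kappa> h = sker (S n) p h" for h :: 'a
      have [measurable]: "\<kappa> \<in> Borel" unfolding \<kappa>_def by measurable
      let ?A = "(1 - \<mu>) powr (1 - p)" and ?B = "\<mu> powr (1 - p) * \<eta> powr p"
      let ?D = "\<delta> powr (p * (1 - S n))"
      have "ennreal (K_const DIM('a) p / (1 - S n) * norm v powr p * ?D)
         = (NN h. ennreal (\<bar>v \<bullet> h\<bar> powr p) * indicator (ball 0 \<delta>) h * \<kappa> h)"
        unfolding \<kappa>_def by (rule kernel_integral_inner[symmetric]) (use p Sn \<delta> in auto)
      also have "\<dots> \<le> (NN h. ennreal ?A * (ennreal (\<bar>f (x + h) - f x\<bar> powr p) * indicator (ball 0 r) h * \<kappa> h)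
          + ennreal ?B * (ennreal (norm h powr p) * indicator (ball 0 \<delta>) h * \<kappa> h))"
      proof (rule nn_integral_mono)
        fix h :: 'a
        show "ennreal (\<bar>v \<bullet> h\<bar> powr p) * indicator (ball 0 \<delta>) h * \<kappa> h
          \<le> ennreal ?A * (ennreal (\<bar>f (x + h) - f x\<bar> powr p) * indicator (ball 0 r) h * \<kappa> h)
          + ennreal ?B * (ennreal (norm h powr p) * indicator (ball 0 \<delta>) h * \<kappa> h)"
        proof (cases "norm h < \<delta>")
          case True
          have "ennreal (\<bar>v \<bullet> h\<bar> powr p) \<le> ennreal ?A * ennreal (\<bar>f (x + h) - f x\<bar> powr p) + ennreal ?B * ennreal (norm h powr p)"
            using pt[OF True] by (simp add: ennreal_mult[symmetric] ennreal_plus[symmetric] ennreal_leI del: ennreal_plus)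
          from mult_right_mono[OF this, of "\<kappa> h"] show ?thesis
            using True \<delta> by (simp only: distrib_right mult_ac) (simp add: distrib_left)
        qed auto
      qed
      also have "\<dots> = ennreal ?A * (NN h. ennreal (\<bar>f (x + h) - f x\<bar> powr p) * indicator (ball 0 r) h * \<kappa> h)
          + ennreal ?B * (NN h. ennreal (norm h powr p) * indicator (ball 0 \<delta>) h * \<kappa> h)"
        by (subst nn_integral_add) (auto simp: nn_integral_cmult)
      also have "\<dots> \<le> ennreal ?A * (NN h. ennreal (\<bar>f (x + h) - f x\<bar> powr p) * indicator (ball 0 r) h * \<kappa> h)
          + ennreal ?B * ennreal (unit_ball_vol DIM('a) * (real DIM('a) + p) / (p * (1 - S n)) * ?D)"
        unfolding \<kappa>_def by (intro add_left_mono mult_left_mono kernel_integral_norm) (use p Sn \<delta> in auto)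
      finally have "ennreal (1 - S n) * ennreal (K_const DIM('a) p / (1 - S n) * norm v powr p * ?D)
        \<le> ennreal (1 - S n) * (ennreal ?A * (NN h. ennreal (\<bar>f (x + h) - f x\<bar> powr p) * indicator (ball 0 r) h * \<kappa> h)
          + ennreal ?B * ennreal (unit_ball_vol DIM('a) * (real DIM('a) + p) / (p * (1 - S n)) * ?D))"
        by (intro mult_left_mono) auto
      also have "\<dots> = ennreal ?A * J n + ennreal (1 - S n) * (ennreal ?B * ennreal (unit_ball_vol DIM('a) * (real DIM('a) + p) / (p * (1 - S n)) * ?D))"
        by (simp add: distrib_left J_def \<kappa>_def mult_ac)
      also have "ennreal (1 - S n) * (ennreal ?B * ennreal (unit_ball_vol DIM('a) * (real DIM('a) + p) / (p * (1 - S n)) * ?D)) = ennreal (?B * V * ?D)"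
        using Sn p by (simp add: ennreal_mult[symmetric] V_def)
      also have "ennreal (1 - S n) * ennreal (K_const DIM('a) p / (1 - S n) * norm v powr p * ?D) = ennreal (k * ?D)"
        using Sn p K_const_nonneg[OF p, of "DIM('a)"] by (simp add: ennreal_mult[symmetric] k_def)
      finally have "ennreal (k * ?D) - ennreal (?B * V * ?D) \<le> ennreal ?A * J n"
        by (simp add: ennreal_minus_le_iff add.commute)
      then have "ennreal (k * ?D - ?B * V * ?D) \<le> ennreal ?A * J n"
        using V \<eta> by (simp add: ennreal_minus)
      then have "ennreal ((1 - \<mu>) powr (p - 1)) * ennreal (k * ?D - ?B * V * ?D) \<le> ennreal ((1 - \<mu>) powr (p - 1)) * (ennreal ?A * J n)"
        by (intro mult_left_mono) auto
      also have "\<dots> = (ennreal ((1 - \<mu>) powr (p - 1)) * ennreal ?A) * J n" by (simp only: mult.assoc)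
      also have "ennreal ((1 - \<mu>) powr (p - 1)) * ennreal ?A = 1"
        using \<mu> by (simp add: ennreal_mult[symmetric] powr_add[symmetric])
      also have "ennreal ((1 - \<mu>) powr (p - 1)) * ennreal (k * ?D - ?B * V * ?D) = ennreal (\<Psi> * ?D)"
        by (subst ennreal_mult'[symmetric]) (auto simp: \<Psi>_def algebra_simps)
      finally show ?thesis by simp
    qed
    have "(\<lambda>n. \<Psi> * \<delta> powr (p * (1 - S n))) \<longlonglongrightarrow> \<Psi> * \<delta> powr (p * (1 - 1))"
      using \<delta> S(1) by (intro tendsto_intros) auto
    then have "\<forall>\<^sub>F n in sequentially. c < \<Psi> * \<delta> powr (p * (1 - S n))"
      using \<delta> \<eta>(2) by (intro order_tendstoD(1)) (auto simp: \<Psi>_def)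
    then show ?thesis
    proof eventually_elim
      case (elim n)
      then have "y < ennreal (\<Psi> * \<delta> powr (p * (1 - S n)))" using c by (simp add: ennreal_lessI)
      then show ?case using J_ge[of n] by (rule less_le_trans)
    qed
  qed
  then show ?thesis unfolding J_def[symmetric] k_def[symmetric] by (subst le_Liminf_iff) auto
qed

text \<open>Lower semicontinuity of W at h = 0 is enough: every c < \<open>c0\<close> is a lower
  bound near 0, it factors out of the integral over a small ball, and then c tends to
  \<open>c0\<close>.\<close>

lemma kernel_liminf_weight:
  fixes f :: "'a::euclidean_space \<Rightarrow> real" and W :: "'a \<Rightarrow> ennreal"
  assumes der: "(f has_derivative (\<lambda>h. v \<bullet> h)) (at x)" and [measurable]: "f \<in> Borel"
    and p: "p \<ge> 1" and S: "S \<longlonglongrightarrow> 1" "\<And>n. 0 < S n" "\<And>n. S n < 1"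
    and [measurable]: "W \<in> Borel" and c0: "c0 > 0"
    and W: "\<And>c. 0 \<le> c \<Longrightarrow> c < c0 \<Longrightarrow> \<exists>r>0. \<forall>h. norm h < r \<longrightarrow> ennreal c \<le> W h"
  shows "ennreal (c0 * (K_const DIM('a) p * norm v powr p))
    \<le> liminf (\<lambda>n. ennreal (1 - S n) * (NN h. ennreal (\<bar>f (x + h) - f x\<bar> powr p)
         * sker (S n) p h * W h))" (is "_ \<le> ?R")
proof -
  let ?k = "K_const DIM('a) p * norm v powr p"
  have "\<forall>\<^sub>F c in at_left c0. ennreal (c * ?k) \<le> ?R"
  proof (rule eventually_at_leftI[of 0])
    fix c assume c: "c \<in> {0<..<c0}"
    then obtain r where r: "r > 0" "\<And>h. norm h < r \<Longrightarrow> ennreal c \<le> W h" using W[of c] by auto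
    let ?J = "\<lambda>n. ennreal (1 - S n) * (NN h. ennreal (\<bar>f (x + h) - f x\<bar> powr p) * indicator (ball 0 r) h
         * sker (S n) p h)"
    have "ennreal (c * ?k) = ennreal c * ennreal ?k" using c by (simp add: ennreal_mult')
    also have "\<dots> \<le> ennreal c * liminf ?J"
      by (intro mult_left_mono kernel_liminf[OF der _ p r(1) S]) auto
    also have "\<dots> = liminf (\<lambda>n. ennreal c * ?J n)"
      by (intro Liminf_compose_continuous_mono[symmetric, where f="\<lambda>x. ennreal c * x"])
         (auto intro!: ennreal_continuous_on_cmult continuous_intros monoI mult_left_mono)
    also have "\<dots> \<le> ?R"
    proof (intro Liminf_mono always_eventually allI)
      fix n
      have "ennreal c * ?J n = ennreal (1 - S n) * (NN h. ennreal c * (ennreal (\<bar>f (x + h) - f x\<bar> powr p) * indicator (ball 0 r) h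
         * sker (S n) p h))"
        by (subst nn_integral_cmult) (auto simp: mult_ac)
      also have "\<dots> \<le> ennreal (1 - S n) * (NN h. ennreal (\<bar>f (x + h) - f x\<bar> powr p)
         * sker (S n) p h * W h)"
      proof (intro mult_left_mono nn_integral_mono)
        fix h :: 'a
        show "ennreal c * (ennreal (\<bar>f (x + h) - f x\<bar> powr p) * indicator (ball 0 r) h
         * sker (S n) p h) \<le> ennreal (\<bar>f (x + h) - f x\<bar> powr p)
         * sker (S n) p h * W h"
        proof (cases "norm h < r")
          case True
          show ?thesis using mult_left_mono[OF r(2)[OF True], of "ennreal (\<bar>f (x + h) - f x\<bar> powr p)
              * sker (S n) p h"] True
            by (simp add: mult_ac)
        qed auto
      qed auto
      finally show "ennreal c * ?J n \<le> \<dots>" .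
    qed
    finally show "ennreal (c * ?k) \<le> ?R" .
  qed (use c0 in auto)
  moreover have "((\<lambda>c. ennreal (c * ?k)) \<longlongrightarrow> ennreal (c0 * ?k)) (at_left c0)"
    by (intro tendsto_intros)
  ultimately show ?thesis by (intro tendsto_upperbound) (auto simp: trivial_limit_at_left_real)
qed

section \<open>Limits at s = 1\<close>

lemma tendsto_at_left_1I:
  fixes X :: "real \<Rightarrow> ennreal"
  assumes upper: "\<And>l. L < l \<Longrightarrow> \<forall>\<^sub>F s in at_left 1. X s < l"
    and lower: "\<And>S l. S \<longlonglongrightarrow> 1 \<Longrightarrow> (\<And>n. 0 < S n) \<Longrightarrow> (\<And>n. S n < 1) \<Longrightarrow> l < \<infinity> \<Longrightarrow> (\<And>n. X (S n) \<le> l) \<Longrightarrow> L \<le> l"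
  shows "(X \<longlongrightarrow> L) (at_left 1)"
proof (rule order_tendstoI)
  fix l assume l: "l < L"
  show "\<forall>\<^sub>F s in at_left 1. l < X s"
  proof (rule ccontr)
    \<comment> \<open>If the lower half failed, X would stay below some l < L along a sequence
      tending to 1. So lower bounds are needed only along sequences with bounded energies, and this
      covers an infinite limit L as well.\<close>
    assume "\<not> ?thesis"
    then have *: "\<exists>y>b. y < 1 \<and> X y \<le> l" if "b < 1" for b
      unfolding eventually_at_left_field using that by (meson not_le not_less)
    have "\<exists>y>1 - inverse (real (Suc n)). y < 1 \<and> X y \<le> l" for n
      by (rule *) auto
    then obtain S where S: "\<And>n. 1 - inverse (real (Suc n)) < S n" "\<And>n. S n < 1" "\<And>n. X (S n) \<le> l" by metis
    have "0 < S n" for n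
      by (rule le_less_trans[OF _ S(1)]) (simp add: field_simps)
    moreover have "S \<longlonglongrightarrow> 1"
    proof (rule tendsto_sandwich[where f="\<lambda>n. 1 - inverse (real (Suc n))" and h="\<lambda>_. 1"])
      show "(\<lambda>n. 1 - inverse (real (Suc n))) \<longlonglongrightarrow> 1"
        using LIMSEQ_inverse_real_of_nat_add_minus[of 1] by simp
    qed (use S in \<open>auto intro!: always_eventually less_imp_le\<close>)
    moreover have "l < \<infinity>" using l by (metis infinity_ennreal_def less_le_trans top_greatest)
    ultimately have "L \<le> l" using S by (intro lower[of S]) auto
    then show False using l by auto
  qed
qed (rule upper)

text \<open>The order of the limits matters: s tends to 1 for fixed \<theta>, which removes the
  remainder however badly it depends on \<theta>, and then \<theta> tends to 0.\<close>

lemma upper_limitI: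
  fixes X :: "real \<Rightarrow> ennreal" and C :: "real \<Rightarrow> real"
  assumes C: "(C \<longlongrightarrow> 1) (at_right 0)"
    and R: "\<And>\<theta>. 0 < \<theta> \<Longrightarrow> \<theta> < 1 \<Longrightarrow> \<exists>R. (R \<longlongrightarrow> 0) (at_left 1) \<and> (\<forall>\<^sub>F s in at_left 1. X s \<le> ennreal (C \<theta>) * L + R s)"
    and l: "L < l"
  shows "\<forall>\<^sub>F s in at_left 1. X s < l"
proof -
  have L: "L < \<infinity>" using l by (metis infinity_ennreal_def less_le_trans top_greatest)
  have "((\<lambda>\<theta>. L * ennreal (C \<theta>)) \<longlongrightarrow> L * ennreal 1) (at_right 0)"
    using L by (intro ennreal_tendsto_cmult tendsto_intros C) auto
  then have "\<forall>\<^sub>F \<theta> in at_right 0. L * ennreal (C \<theta>) < l"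
    using l by (intro order_tendstoD(2)) auto
  moreover have "\<forall>\<^sub>F \<theta>::real in at_right 0. 0 < \<theta> \<and> \<theta> < 1" by (rule eventually_at_rightI[of 0 1]) auto
  ultimately have "\<forall>\<^sub>F \<theta> in at_right 0. (0 < \<theta> \<and> \<theta> < 1) \<and> L * ennreal (C \<theta>) < l" by eventually_elim auto
  then obtain \<theta> where \<theta>: "0 < \<theta>" "\<theta> < 1" "L * ennreal (C \<theta>) < l"
    using eventually_happens'[OF trivial_limit_at_right_real] by blast
  obtain R where R: "(R \<longlongrightarrow> 0) (at_left 1)" "\<forall>\<^sub>F s in at_left 1. X s \<le> ennreal (C \<theta>) * L + R s"
    using R \<theta> by blast
  have "((\<lambda>s. ennreal (C \<theta>) * L + R s) \<longlongrightarrow> ennreal (C \<theta>) * L + 0) (at_left 1)"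
    by (intro tendsto_add tendsto_const R)
  then have "\<forall>\<^sub>F s in at_left 1. ennreal (C \<theta>) * L + R s < l"
    using \<theta> by (intro order_tendstoD(2)) (auto simp: mult.commute)
  with R(2) show ?thesis by eventually_elim auto
qed

lemma near_constant_tendsto: "((\<lambda>\<theta>::real. ((1 + \<theta>) / (1 - \<theta>)) powr c) \<longlongrightarrow> 1) (at_right 0)"
proof -
  have "((\<lambda>\<theta>::real. ((1 + \<theta>) / (1 - \<theta>)) powr c) \<longlongrightarrow> ((1 + 0) / (1 - 0)) powr c) (at_right 0)"
    by (intro tendsto_intros) auto
  then show ?thesis by simp
qed

section \<open>Upper and lower bounds for C^1 functions\<close>

lemma ftc_bound_C1:
  fixes F :: "'a::euclidean_space \<Rightarrow> real"
  assumes der: "\<And>x. (F has_derivative (\<lambda>h. G x \<bullet> h)) (at x)" and cont: "continuous_on UNIV G"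
  shows "ftc_bound F G"
  unfolding ftc_bound_def
proof (intro conjI allI AE_I2)
  have "continuous_on UNIV F"
    using der by (intro continuous_at_imp_continuous_on ballI has_derivative_continuous)
  then show "F \<in> Borel" by (rule borel_measurable_continuous_onI)
  show "G \<in> Borel" using cont by (rule borel_measurable_continuous_onI)
  fix h x :: 'a
  have d: "((\<lambda>t. F (x + t *\<^sub>R h)) has_vector_derivative G (x + t *\<^sub>R h) \<bullet> h) (at t within {0..1})" for t :: real
  proof -
    have "((\<lambda>t. x + t *\<^sub>R h) has_derivative (\<lambda>u. u *\<^sub>R h)) (at t within {0..1})"
      by (auto intro!: derivative_eq_intros)
    from has_derivative_compose[OF this der] show ?thesis
      by (simp add: has_vector_derivative_def)
  qed
  have "continuous_on {0..1} (\<lambda>t. G (x + t *\<^sub>R h) \<bullet> h)"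
    by (intro continuous_intros continuous_on_compose2[OF cont]) auto
  from integral_FTC_Icc[OF _ d this] has_bochner_integral_FTC_Icc[OF _ d this]
  have "F (x + h) - F x = (LL t. indicator {0..1} t *\<^sub>R (G (x + t *\<^sub>R h) \<bullet> h))"
    and int: "integrable lborel (\<lambda>t. indicator {0..1} t *\<^sub>R (G (x + t *\<^sub>R h) \<bullet> h))"
    by (auto simp: has_bochner_integral_iff)
  then have "ennreal \<bar>F (x + h) - F x\<bar> \<le> (NN t. ennreal (norm (indicator {0..1} t *\<^sub>R (G (x + t *\<^sub>R h) \<bullet> h))))"
    using integral_norm_bound_ennreal[OF int] by simp
  also have "\<dots> = (\<integral>\<^sup>+t\<in>{0..1}. ennreal \<bar>G (x + t *\<^sub>R h) \<bullet> h\<bar> \<partial>lborel)"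
    by (intro nn_integral_cong) (auto split: split_indicator)
  finally show "ennreal \<bar>F (x + h) - F x\<bar> \<le> \<dots>" .
qed

lemma grad_has_derivative:
  fixes F :: "'a::euclidean_space \<Rightarrow> real"
  assumes "F differentiable (at x)"
  shows "(F has_derivative (\<lambda>h. grad F x \<bullet> h)) (at x)"
proof -
  let ?D = "frechet_derivative F (at x)"
  have D: "(F has_derivative ?D) (at x)" using assms frechet_derivative_works by blast
  then interpret D: linear ?D by (rule has_derivative_linear)
  have "?D = (\<lambda>h. grad F x \<bullet> h)"
  proof
    fix h
    have "?D h = ?D (\<Sum>b\<in>Basis. (h \<bullet> b) *\<^sub>R b)" by (simp only: euclidean_representation)
    also have "\<dots> = (\<Sum>b\<in>Basis. (h \<bullet> b) * ?D b)" by (simp add: D.sum D.scaleR)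
    also have "\<dots> = grad F x \<bullet> h"
      by (simp add: grad_def partial_deriv_def inner_sum_left inner_commute[of h] mult.commute)
    finally show "?D h = grad F x \<bullet> h" .
  qed
  then show ?thesis using D by simp
qed

lemma C_k_Suc_has_derivative:
  "C_k (Suc k) F \<Longrightarrow> (F has_derivative (\<lambda>h. grad F x \<bullet> h)) (at x)"
  by (auto intro: grad_has_derivative)

lemma C_k_imp_continuous: "C_k k F \<Longrightarrow> continuous_on UNIV F"
  by (cases k) (auto intro!: differentiable_imp_continuous_on simp: differentiable_on_def intro: differentiable_at_withinI)

lemma C_k_Suc_continuous_grad: "C_k (Suc k) F \<Longrightarrow> continuous_on UNIV (grad F)"
  unfolding grad_def[abs_def] by (auto intro!: continuous_intros C_k_imp_continuous)

lemma grad_cong_open: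
  assumes "open \<Omega>" "x \<in> \<Omega>" "\<And>y. y \<in> \<Omega> \<Longrightarrow> f y = F y"
  shows "grad f x = grad F x"
proof -
  have "(f has_derivative D) (at x) \<longleftrightarrow> (F has_derivative D) (at x)" for D
    using assms by (auto intro: has_derivative_transform_within_open[of _ _ x UNIV \<Omega>])
  then show ?thesis unfolding grad_def partial_deriv_def frechet_derivative_def by simp
qed

text \<open>Continuity of the boundary distance; this is the hypothesis on W in
  \<open>kernel_liminf_weight\<close>, for the product of the two weights.\<close>

lemma dist_weight_lower_near:
  fixes \<Omega> :: "'a::euclidean_space set"
  assumes "open \<Omega>" "\<Omega> \<noteq> UNIV" and x: "x \<in> \<Omega>" and c: "0 \<le> c" "c < bdist \<Omega> x powr (-(\<alpha> + \<beta>))"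
  shows "\<exists>r>0. \<forall>h::'a. norm h < r \<longrightarrow> ennreal c \<le> dist_weight \<Omega> \<alpha> x * indicator \<Omega> x * (dist_weight \<Omega> \<beta> (x + h) * indicator \<Omega> (x + h))"
proof -
  have dx: "0 < bdist \<Omega> x" using bdist_pos assms by blast
  have "isCont (bdist \<Omega>) x" using continuous_bdist[of UNIV \<Omega>] by (simp add: continuous_on_eq_continuous_at)
  then have "((\<lambda>h. bdist \<Omega> (x + h)) \<longlongrightarrow> bdist \<Omega> x) (at 0)" by (simp add: isCont_def LIM_offset_zero_iff)
  then have "((\<lambda>h. bdist \<Omega> x powr (-\<alpha>) * bdist \<Omega> (x + h) powr (-\<beta>)) \<longlongrightarrow> bdist \<Omega> x powr (-\<alpha>) * bdist \<Omega> x powr (-\<beta>)) (at 0)"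
    using dx by (intro tendsto_intros) auto
  moreover have "c < bdist \<Omega> x powr (-\<alpha>) * bdist \<Omega> x powr (-\<beta>)" using c by (simp add: powr_add[symmetric])
  ultimately have "\<forall>\<^sub>F h in at 0. c < bdist \<Omega> x powr (-\<alpha>) * bdist \<Omega> (x + h) powr (-\<beta>)" by (rule order_tendstoD(1))
  then obtain r0 where r0: "r0 > 0" "\<And>h. h \<noteq> 0 \<Longrightarrow> norm h < r0 \<Longrightarrow> c < bdist \<Omega> x powr (-\<alpha>) * bdist \<Omega> (x + h) powr (-\<beta>)"
    unfolding eventually_at by (auto simp: dist_norm)
  show ?thesis
  proof (intro exI[of _ "min r0 (bdist \<Omega> x)"] conjI allI impI)
    fix h :: 'a assume h: "norm h < min r0 (bdist \<Omega> x)"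
    have xh: "x + h \<in> \<Omega>" using in_domain_if_near[OF x, of "x + h"] h by (simp add: dist_norm)
    then have dxh: "0 < bdist \<Omega> (x + h)" by (rule bdist_pos[OF assms(1,2)])
    have "c \<le> bdist \<Omega> x powr (-\<alpha>) * bdist \<Omega> (x + h) powr (-\<beta>)"
      using r0(2)[of h] h c by (cases "h = 0") (auto simp: powr_add[symmetric] less_imp_le)
    then show "ennreal c \<le> dist_weight \<Omega> \<alpha> x * indicator \<Omega> x * (dist_weight \<Omega> \<beta> (x + h) * indicator \<Omega> (x + h))"
      using x xh dx dxh by (simp add: dist_weight_pos ennreal_mult[symmetric] ennreal_leI)
  qed (use r0 dx in auto)
qed

lemma C1_energy_lower:
  fixes F :: "'a::euclidean_space \<Rightarrow> real"
  assumes "open \<Omega>" "\<Omega> \<noteq> UNIV" and p: "p \<ge> 1"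
    and der: "\<And>x. (F has_derivative (\<lambda>h. G x \<bullet> h)) (at x)" and cont: "continuous_on UNIV G"
    and S: "S \<longlonglongrightarrow> 1" "\<And>n. 0 < S n" "\<And>n. S n < 1"
    and le: "\<And>n. ennreal (1 - S n) * gagliardo_energy \<Omega> (S n) p \<alpha> \<beta> F \<le> l"
  shows "ennreal (K_const DIM('a) p) * (NN z. ennreal (norm (G z) powr p) * dist_weight \<Omega> (\<alpha> + \<beta>) z * indicator \<Omega> z) \<le> l"
proof -
  have [measurable]: "\<Omega> \<in> sets borel" using \<open>open \<Omega>\<close> by (rule borel_open)
  have [measurable]: "F \<in> Borel" "G \<in> Borel"
    using ftc_bound_C1[OF der cont] by (auto simp: ftc_bound_def)
  let ?I = "\<lambda>n x. ennreal (1 - S n) * (NN h. energy_integrand \<Omega> (S n) p \<alpha> \<beta> F x h)"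
  have "ennreal (K_const DIM('a) p) * (NN z. ennreal (norm (G z) powr p) * dist_weight \<Omega> (\<alpha> + \<beta>) z * indicator \<Omega> z)
     = (NN z. ennreal (K_const DIM('a) p) * (ennreal (norm (G z) powr p) * dist_weight \<Omega> (\<alpha> + \<beta>) z * indicator \<Omega> z))"
    by (rule nn_integral_cmult[symmetric]) measurable
  also have "\<dots> \<le> (NN x. liminf (\<lambda>n. ?I n x))"
  proof (rule nn_integral_mono)
    fix x
    show "ennreal (K_const DIM('a) p) * (ennreal (norm (G x) powr p) * dist_weight \<Omega> (\<alpha> + \<beta>) x * indicator \<Omega> x) \<le> liminf (\<lambda>n. ?I n x)"
    proof (cases "x \<in> \<Omega>")
      case True
      let ?W = "\<lambda>h. dist_weight \<Omega> \<alpha> x * indicator \<Omega> x * (dist_weight \<Omega> \<beta> (x + h) * indicator \<Omega> (x + h))"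
      have dx: "0 < bdist \<Omega> x" using bdist_pos assms True by blast
      have "ennreal (K_const DIM('a) p) * (ennreal (norm (G x) powr p) * dist_weight \<Omega> (\<alpha> + \<beta>) x * indicator \<Omega> x)
        = ennreal (bdist \<Omega> x powr (-(\<alpha> + \<beta>)) * (K_const DIM('a) p * norm (G x) powr p))"
        using True dx K_const_nonneg[OF p, of "DIM('a)"] by (simp add: dist_weight_pos ennreal_mult mult_ac)
      also have "\<dots> \<le> liminf (\<lambda>n. ennreal (1 - S n) * (NN h. ennreal (\<bar>F (x + h) - F x\<bar> powr p)
         * sker (S n) p h * ?W h))"
        by (rule kernel_liminf_weight[OF der _ p S])
           (use dx dist_weight_lower_near[OF assms(1,2) True] in \<open>auto simp del: minus_add_distrib\<close>)
      finally show ?thesis unfolding energy_integrand_def .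
    qed simp
  qed
  also have "\<dots> \<le> liminf (\<lambda>n. NN x. ?I n x)"
    unfolding energy_integrand_def by (rule nn_integral_liminf) measurable
  also have "\<dots> = liminf (\<lambda>n. ennreal (1 - S n) * gagliardo_energy \<Omega> (S n) p \<alpha> \<beta> F)"
    unfolding energy_integrand_def
    by (subst nn_integral_cmult, measurable) (simp add: gagliardo_energy_eq assms energy_integrand_def)
  also have "\<dots> \<le> liminf (\<lambda>n. l)"
    by (intro Liminf_mono always_eventually allI le)
  finally show ?thesis by (simp add: Liminf_const)
qed

text \<open>The near part gives the limit up to a factor close to 1. The far part is dominated by
  two energies at the fixed order s', so the factor 1 - s makes it vanish as soon as these are
  finite.\<close>

lemma C1_energy_upper:
  fixes F :: "'a::euclidean_space \<Rightarrow> real"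
  assumes "open \<Omega>" "\<Omega> \<noteq> UNIV" and p: "p \<ge> 1" and FG: "ftc_bound F G" and \<theta>: "0 < \<theta>" "\<theta> < 1"
    and s: "0 < s'" "s' \<le> s" "s < 1"
  shows "ennreal (1 - s) * gagliardo_energy \<Omega> s p \<alpha> \<beta> F
    \<le> ennreal (((1 + \<theta>) / (1 - \<theta>)) powr (\<bar>\<alpha>\<bar> + \<bar>\<beta>\<bar>)) * (ennreal (K_const DIM('a) p)
       * (NN z. ennreal (norm (G z) powr p) * dist_weight \<Omega> (\<alpha> + \<beta>) z * indicator \<Omega> z))
     + ennreal (1 - s) * (ennreal (\<theta> powr (-p)) * (gagliardo_energy \<Omega> s' p \<alpha> \<beta> F + gagliardo_energy \<Omega> s' p (\<alpha> + (1 - s') * p) \<beta> F))"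
proof -
  have [measurable]: "\<Omega> \<in> sets borel" using \<open>open \<Omega>\<close> by (rule borel_open)
  have [measurable]: "F \<in> Borel" "G \<in> Borel"
    using FG by (auto simp: ftc_bound_def)
  have [measurable]: "(\<lambda>(x, h). energy_integrand \<Omega> s p \<alpha> \<beta> F x h) \<in> borel_measurable (borel \<Otimes>\<^sub>M borel)" for s \<alpha>
    unfolding energy_integrand_def by measurable
  have sec [measurable]: "energy_integrand \<Omega> s p \<alpha> \<beta> F x \<in> Borel" for s \<alpha> x
    unfolding energy_integrand_def by measurable
  have outer [measurable]: "(\<lambda>x. NN h. energy_integrand \<Omega> s p \<alpha> \<beta> F x h) \<in> Borel" for s \<alpha>
    unfolding energy_integrand_def by measurable
  let ?near = "\<lambda>x h. if norm h < 1 \<and> norm h < \<theta> * bdist \<Omega> x then 1 else 0 :: ennreal"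
  let ?e = "\<lambda>s \<alpha>. energy_integrand \<Omega> s p \<alpha> \<beta> F"
  let ?W = "NN z. ennreal (norm (G z) powr p) * dist_weight \<Omega> (\<alpha> + \<beta>) z * indicator \<Omega> z"
  have "gagliardo_energy \<Omega> s p \<alpha> \<beta> F \<le> (NN x. NN h. ?e s \<alpha> x h * ?near x h + ennreal (\<theta> powr (-p)) * (?e s' \<alpha> x h + ?e s' (\<alpha> + (1 - s') * p) x h))"
    unfolding gagliardo_energy_eq[OF \<open>F \<in> Borel\<close> assms(1)]
  proof (intro nn_integral_mono)
    fix x h :: 'a
    show "?e s \<alpha> x h \<le> ?e s \<alpha> x h * ?near x h + ennreal (\<theta> powr (-p)) * (?e s' \<alpha> x h + ?e s' (\<alpha> + (1 - s') * p) x h)"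
    proof (cases "norm h < 1 \<and> norm h < \<theta> * bdist \<Omega> x")
      case False
      then show ?thesis using far_integrand_le[OF assms(1,2) p \<theta> s False] by auto
    qed auto
  qed
  also have "\<dots> = (NN x. NN h. ?e s \<alpha> x h * ?near x h)
      + ennreal (\<theta> powr (-p)) * (gagliardo_energy \<Omega> s' p \<alpha> \<beta> F + gagliardo_energy \<Omega> s' p (\<alpha> + (1 - s') * p) \<beta> F)"
  proof -
    have m: "(\<lambda>x. NN h. ?e s \<alpha> x h * ?near x h) \<in> Borel"
      unfolding energy_integrand_def by measurable
    have "(NN h. ?e s \<alpha> x h * ?near x h + ennreal (\<theta> powr (-p)) * (?e s' \<alpha> x h + ?e s' (\<alpha> + (1 - s') * p) x h))
       = (NN h. ?e s \<alpha> x h * ?near x h) + ennreal (\<theta> powr (-p)) * ((NN h. ?e s' \<alpha> x h) + (NN h. ?e s' (\<alpha> + (1 - s') * p) x h))" for x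
      by (subst nn_integral_add) (auto simp: nn_integral_cmult nn_integral_add)
    then show ?thesis using m outer
      by (simp add: gagliardo_energy_eq assms nn_integral_add nn_integral_cmult)
  qed
  also have "\<dots> \<le> ennreal (((1 + \<theta>) / (1 - \<theta>)) powr (\<bar>\<alpha>\<bar> + \<bar>\<beta>\<bar>)) * ennreal (K_const DIM('a) p / (1 - s)) * ?W
      + ennreal (\<theta> powr (-p)) * (gagliardo_energy \<Omega> s' p \<alpha> \<beta> F + gagliardo_energy \<Omega> s' p (\<alpha> + (1 - s') * p) \<beta> F)"
    by (intro add_right_mono near_energy_le[OF assms(1,2) FG p \<theta>]) (use s in auto)
  finally have "ennreal (1 - s) * gagliardo_energy \<Omega> s p \<alpha> \<beta> F \<le> ennreal (1 - s) * \<dots>"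
    by (intro mult_left_mono) auto
  also have "\<dots> = ennreal (((1 + \<theta>) / (1 - \<theta>)) powr (\<bar>\<alpha>\<bar> + \<bar>\<beta>\<bar>)) * ((ennreal (1 - s) * ennreal (K_const DIM('a) p / (1 - s))) * ?W)
      + ennreal (1 - s) * (ennreal (\<theta> powr (-p)) * (gagliardo_energy \<Omega> s' p \<alpha> \<beta> F + gagliardo_energy \<Omega> s' p (\<alpha> + (1 - s') * p) \<beta> F))"
    by (simp only: distrib_left mult_ac)
  also have "ennreal (1 - s) * ennreal (K_const DIM('a) p / (1 - s)) = ennreal (K_const DIM('a) p)"
    using s K_const_nonneg[OF p, of "DIM('a)"] by (simp add: ennreal_mult[symmetric])
  finally show ?thesis .
qed

lemma gagliardo_seminorm_finite_iff:
  "p \<ge> 1 \<Longrightarrow> gagliardo_seminorm \<Omega> s p \<alpha> \<beta> f < \<infinity> \<longleftrightarrow> gagliardo_energy \<Omega> s p \<alpha> \<beta> f < \<infinity>"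
  by (auto simp: gagliardo_seminorm_def epowr_def less_top)

lemma tendsto_one_minus_mult:
  "c < \<infinity> \<Longrightarrow> ((\<lambda>s. ennreal (1 - s) * c) \<longlongrightarrow> 0) (at_left (1::real))"
proof -
  assume c: "c < \<infinity>"
  have "((\<lambda>s. c * ennreal (1 - s)) \<longlongrightarrow> c * ennreal (1 - 1)) (at_left (1::real))"
    using c by (intro ennreal_tendsto_cmult tendsto_intros) auto
  then show ?thesis by (simp add: mult.commute)
qed

theorem smooth_case:
  fixes f :: "'a::euclidean_space \<Rightarrow> real"
  assumes "p \<ge> 1" "open \<Omega>" "\<Omega> \<noteq> UNIV" and f: "f \<in> C2c_closure \<Omega>" and U: "open U" "(\<alpha>, \<beta>) \<in> U"
    and s0: "s0 \<in> {0<..<1}" "\<forall>(\<alpha>, \<beta>)\<in>U. \<forall>s\<in>{s0<..<1}. gagliardo_seminorm \<Omega> s p \<alpha> \<beta> f < \<infinity>"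
  shows "((\<lambda>s. ennreal (1 - s) * gagliardo_energy \<Omega> s p \<alpha> \<beta> f)
    \<longlongrightarrow> ennreal (K_const DIM('a) p) * weighted_energy \<Omega> p (dist_weight \<Omega> (\<alpha> + \<beta>)) (grad f)) (at_left 1)"
proof -
  note p = \<open>p \<ge> 1\<close>
  obtain F where F: "C_k 2 F" "\<And>x. x \<in> closure \<Omega> \<Longrightarrow> f x = F x"
    using f by (auto simp: C2c_closure_def)
  have F1: "C_k (Suc 1) F" using F(1) by (simp add: numeral_2_eq_2)
  have der: "(F has_derivative (\<lambda>h. grad F x \<bullet> h)) (at x)" for x using F1 by (rule C_k_Suc_has_derivative)
  have cont: "continuous_on UNIV (grad F)" using F1 by (rule C_k_Suc_continuous_grad)
  have fF: "f x = F x" if "x \<in> \<Omega>" for x using F(2) closure_subset that by blast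
  have E: "gagliardo_energy \<Omega> s p \<alpha> \<beta> f = gagliardo_energy \<Omega> s p \<alpha> \<beta> F" for s \<alpha> \<beta>
    by (rule gagliardo_energy_cong_AE) (auto simp: fF)
  have W: "weighted_energy \<Omega> p (dist_weight \<Omega> (\<alpha> + \<beta>)) (grad f)
      = (NN z. ennreal (norm (grad F z) powr p) * dist_weight \<Omega> (\<alpha> + \<beta>) z * indicator \<Omega> z)"
    unfolding weighted_energy_def nn_integral_completion
    by (intro nn_integral_cong) (auto split: split_indicator simp: grad_cong_open[OF \<open>open \<Omega>\<close> _ fF])
  have fin: "gagliardo_energy \<Omega> s p \<alpha>' \<beta>' F < \<infinity>" if "(\<alpha>', \<beta>') \<in> U" "s0 < s" "s < 1" for s \<alpha>' \<beta>'
    using bspec[OF s0(2) that(1)] that(2,3) by (simp add: gagliardo_seminorm_finite_iff[OF p, simplified] E)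
  \<comment> \<open>Since U is open and (1 - s') p tends to 0, the raised exponent \<alpha> + (1 -
    s') p keeps the pair in U for s' close to 1; s' > s0 then makes both dominating energies
    finite.\<close>
  obtain s' where s': "s0 < s'" "s' < 1" "(\<alpha> + (1 - s') * p, \<beta>) \<in> U"
  proof -
    have "((\<lambda>s. (\<alpha> + (1 - s) * p, \<beta>)) \<longlongrightarrow> (\<alpha> + (1 - 1) * p, \<beta>)) (at_left (1::real))" by (intro tendsto_intros)
    then have "\<forall>\<^sub>F s in at_left 1. (\<alpha> + (1 - s) * p, \<beta>) \<in> U"
      using U by (intro topological_tendstoD) auto
    moreover have "\<forall>\<^sub>F s in at_left 1. s0 < s \<and> s < 1"
      using s0(1) by (intro eventually_at_leftI[of s0]) auto
    ultimately have "\<forall>\<^sub>F s in at_left 1. (s0 < s \<and> s < 1) \<and> (\<alpha> + (1 - s) * p, \<beta>) \<in> U" by eventually_elim auto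
    then show ?thesis using that eventually_happens'[OF trivial_limit_at_left_real] by blast
  qed
  let ?L = "ennreal (K_const DIM('a) p) * (NN z. ennreal (norm (grad F z) powr p) * dist_weight \<Omega> (\<alpha> + \<beta>) z * indicator \<Omega> z)"
  show ?thesis unfolding E W
  proof (rule tendsto_at_left_1I)
    fix l assume "?L < l"
    then show "\<forall>\<^sub>F s in at_left 1. ennreal (1 - s) * gagliardo_energy \<Omega> s p \<alpha> \<beta> F < l"
    proof (rule upper_limitI[rotated 2])
      show "((\<lambda>\<theta>. ((1 + \<theta>) / (1 - \<theta>)) powr (\<bar>\<alpha>\<bar> + \<bar>\<beta>\<bar>)) \<longlongrightarrow> 1) (at_right 0)" by (rule near_constant_tendsto)
      fix \<theta> :: real assume \<theta>: "0 < \<theta>" "\<theta> < 1"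
      let ?c = "ennreal (\<theta> powr (-p)) * (gagliardo_energy \<Omega> s' p \<alpha> \<beta> F + gagliardo_energy \<Omega> s' p (\<alpha> + (1 - s') * p) \<beta> F)"
      have "?c < \<infinity>" using fin[OF U(2) s'(1,2)] fin[OF s'(3,1,2)] by (simp add: ennreal_mult_less_top)
      moreover have "\<forall>\<^sub>F s in at_left 1. ennreal (1 - s) * gagliardo_energy \<Omega> s p \<alpha> \<beta> F
         \<le> ennreal (((1 + \<theta>) / (1 - \<theta>)) powr (\<bar>\<alpha>\<bar> + \<bar>\<beta>\<bar>)) * ?L + ennreal (1 - s) * ?c"
      proof (rule eventually_at_leftI[of s'])
        fix s assume "s \<in> {s'<..<1}"
        then show "ennreal (1 - s) * gagliardo_energy \<Omega> s p \<alpha> \<beta> F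
         \<le> ennreal (((1 + \<theta>) / (1 - \<theta>)) powr (\<bar>\<alpha>\<bar> + \<bar>\<beta>\<bar>)) * ?L + ennreal (1 - s) * ?c"
          using s' s0 by (intro C1_energy_upper[OF assms(2,3) p ftc_bound_C1[OF der cont] \<theta>]) auto
      qed (use s' in auto)
      ultimately show "\<exists>R. (R \<longlongrightarrow> 0) (at_left 1) \<and> (\<forall>\<^sub>F s in at_left 1. ennreal (1 - s) * gagliardo_energy \<Omega> s p \<alpha> \<beta> F
         \<le> ennreal (((1 + \<theta>) / (1 - \<theta>)) powr (\<bar>\<alpha>\<bar> + \<bar>\<beta>\<bar>)) * ?L + R s)"
        by (intro exI[of _ "\<lambda>s. ennreal (1 - s) * ?c"] conjI tendsto_one_minus_mult)
    qed
  next
    fix S :: "nat \<Rightarrow> real" and l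
    assume "S \<longlonglongrightarrow> 1" "\<And>n. 0 < S n" "\<And>n. S n < 1" "\<And>n. ennreal (1 - S n) * gagliardo_energy \<Omega> (S n) p \<alpha> \<beta> F \<le> l"
    then show "?L \<le> l" by (rule C1_energy_lower[OF assms(2,3) p der cont])
  qed
qed

section \<open>Mollification\<close>

definition flat_exp :: "nat \<Rightarrow> real \<Rightarrow> real" where
  "flat_exp m t = (if t > 0 then (1 / t) ^ m * exp (- (1 / t)) else 0)"

lemma flat_exp_tendsto_0: "(flat_exp m \<longlongrightarrow> 0) (at 0)"
proof -
  have "((\<lambda>t::real. (1 / t) ^ m / exp (1 / t)) \<longlongrightarrow> 0) (at_right 0)"
    using filterlim_compose[OF tendsto_power_div_exp_0 filterlim_inverse_at_top_right, of m] by (simp add: inverse_eq_divide)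
  then have "(flat_exp m \<longlongrightarrow> 0) (at_right 0)"
  proof (rule Lim_transform_eventually)
    show "\<forall>\<^sub>F t in at_right 0. (1 / t) ^ m / exp (1 / t) = flat_exp m t"
      by (rule eventually_at_rightI[of 0 1]) (auto simp: flat_exp_def exp_minus divide_inverse)
  qed
  moreover have "(flat_exp m \<longlongrightarrow> 0) (at_left 0)"
    by (rule tendsto_eventually) (rule eventually_at_leftI[of "-1"], auto simp: flat_exp_def)
  ultimately show ?thesis by (simp add: filterlim_at_split)
qed

text \<open>The factor (1/t)^m is there so that derivatives are combinations of members of the same
  family. At t = 0 the difference quotient of the m-th member is the next member, which tends to
  0.\<close>

lemma flat_exp_has_derivative:
  "(flat_exp m has_real_derivative (flat_exp (m + 2) t - real m * flat_exp (Suc m) t)) (at t)"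
proof -
  consider "t > 0" | "t < 0" | "t = 0" by linarith
  then show ?thesis
  proof cases
    case 1
    have "((\<lambda>t. (1 / t) ^ m * exp (- (1 / t))) has_real_derivative
       (real m * (1 / t) ^ (m - 1) * (- (1 / t\<^sup>2)) * exp (- (1 / t)) + exp (- (1 / t)) * (1 / t\<^sup>2) * (1 / t) ^ m)) (at t)"
      using 1 by (auto intro!: derivative_eq_intros simp: power2_eq_square)
    moreover have "real m * (1 / t) ^ (m - 1) * (- (1 / t\<^sup>2)) * exp (- (1 / t)) + exp (- (1 / t)) * (1 / t\<^sup>2) * (1 / t) ^ m
      = flat_exp (m + 2) t - real m * flat_exp (Suc m) t"
      using 1 by (cases m) (auto simp: flat_exp_def power2_eq_square field_simps)
    ultimately have "((\<lambda>t. (1 / t) ^ m * exp (- (1 / t))) has_real_derivative (flat_exp (m + 2) t - real m * flat_exp (Suc m) t)) (at t)"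
      by simp
    from has_field_derivative_transform_within_open[OF this, of "{0<..}" "flat_exp m"] 1 show ?thesis
      by (auto simp: flat_exp_def)
  next
    case 2
    have "((\<lambda>_. 0) has_real_derivative 0) (at t)" by simp
    from has_field_derivative_transform_within_open[OF this, of "{..<0}" "flat_exp m"] 2
    have "(flat_exp m has_real_derivative 0) (at t)"
      by (auto simp: flat_exp_def)
    then show ?thesis using 2 by (simp add: flat_exp_def)
  next
    case 3
    have "((\<lambda>h. (flat_exp m (0 + h) - flat_exp m 0) / h) \<longlongrightarrow> 0) (at 0)"
      by (rule Lim_transform_eventually[OF flat_exp_tendsto_0[of "Suc m"]])
         (auto simp: flat_exp_def eventually_at intro!: exI[of _ 1])
    then show ?thesis using 3 by (simp add: DERIV_def flat_exp_def)
  qed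
qed

text \<open>A class of functions that contains the standard bumps and is stable under partial derivatives.\<close>

inductive bump_algebra :: "'a::euclidean_space \<Rightarrow> real \<Rightarrow> ('a \<Rightarrow> real) \<Rightarrow> bool" for a r where
  flat: "bump_algebra a r (\<lambda>y. flat_exp m (r - (y - a) \<bullet> (y - a)))"
| coord: "bump_algebra a r (\<lambda>y. (y - a) \<bullet> b)"
| const: "bump_algebra a r (\<lambda>_. c)"
| add: "bump_algebra a r f \<Longrightarrow> bump_algebra a r g \<Longrightarrow> bump_algebra a r (\<lambda>y. f y + g y)"
| mult: "bump_algebra a r f \<Longrightarrow> bump_algebra a r g \<Longrightarrow> bump_algebra a r (\<lambda>y. f y * g y)"

text \<open>The induction carries a formula for the derivative in every direction, so that
  membership of the partial derivatives can be read off. The coordinate functions come from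
  differentiating (y - a) . (y - a).\<close>

lemma bump_algebra_deriv:
  assumes "bump_algebra a r g"
  shows "(\<forall>x. g differentiable (at x)) \<and> (\<forall>b. bump_algebra a r (partial_deriv b g))"
proof -
  have "\<exists>g'. (\<forall>b. bump_algebra a r (g' b)) \<and> (\<forall>x. (g has_derivative (\<lambda>h. g' h x)) (at x))"
    using assms
  proof induction
    case (flat m)
    let ?q = "\<lambda>y. r - (y - a) \<bullet> (y - a)"
    let ?c = "\<lambda>x. flat_exp (m + 2) (?q x) + (- real m) * flat_exp (Suc m) (?q x)"
    show ?case
    proof (intro exI conjI allI)
      show "bump_algebra a r (\<lambda>x. ?c x * (- 2 * ((x - a) \<bullet> b)))" for b
        by (intro bump_algebra.intros)
      fix x
      have q: "(?q has_derivative (\<lambda>h. - 2 * ((x - a) \<bullet> h))) (at x)"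
        by (auto intro!: derivative_eq_intros simp: inner_commute)
      have "(flat_exp m has_derivative (\<lambda>u. u * (flat_exp (m + 2) (?q x) - real m * flat_exp (Suc m) (?q x)))) (at (?q x))"
        using flat_exp_has_derivative unfolding has_field_derivative_def mult_commute_abs .
      from has_derivative_compose[OF q this]
      show "((\<lambda>y. flat_exp m (?q y)) has_derivative (\<lambda>h. ?c x * (- 2 * ((x - a) \<bullet> h)))) (at x)"
        by (simp add: mult.commute)
    qed
  next
    case (coord b)
    show ?case
      by (rule exI[of _ "\<lambda>h x. h \<bullet> b"]) (auto intro!: bump_algebra.intros derivative_eq_intros)
  next
    case (const c)
    show ?case by (rule exI[of _ "\<lambda>h x. 0"]) (auto intro!: bump_algebra.intros)
  next
    case (add f g)
    then obtain f' g' where "\<forall>b. bump_algebra a r (f' b)" "\<forall>x. (f has_derivative (\<lambda>h. f' h x)) (at x)"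
      "\<forall>b. bump_algebra a r (g' b)" "\<forall>x. (g has_derivative (\<lambda>h. g' h x)) (at x)" by blast
    then show ?case
      by (intro exI[of _ "\<lambda>h x. f' h x + g' h x"]) (auto intro!: bump_algebra.intros derivative_eq_intros)
  next
    case (mult f g)
    then obtain f' g' where "\<forall>b. bump_algebra a r (f' b)" "\<forall>x. (f has_derivative (\<lambda>h. f' h x)) (at x)"
      "\<forall>b. bump_algebra a r (g' b)" "\<forall>x. (g has_derivative (\<lambda>h. g' h x)) (at x)" by blast
    with mult.hyps show ?case
      by (intro exI[of _ "\<lambda>h x. f x * g' h x + f' h x * g x"]) (auto intro!: bump_algebra.intros derivative_eq_intros)
  qed
  then obtain g' where g': "\<And>b. bump_algebra a r (g' b)" "\<And>x. (g has_derivative (\<lambda>h. g' h x)) (at x)" by blast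
  have "partial_deriv b g = g' b" for b
    using frechet_derivative_at[OF g'(2)] by (auto simp: partial_deriv_def fun_eq_iff)
  then show ?thesis using g' by (auto simp: differentiable_def)
qed

lemma bump_algebra_C_k: "bump_algebra a r g \<Longrightarrow> C_k k g"
proof (induction k arbitrary: g)
  case 0
  then show ?case using bump_algebra_deriv[OF 0]
    by (auto intro!: differentiable_imp_continuous_on simp: differentiable_on_def intro: differentiable_at_withinI)
next
  case (Suc k)
  then show ?case using bump_algebra_deriv[OF Suc.prems] by auto
qed

text \<open>Inside the ball of radius \<epsilon> this is exp(-1 / (\<epsilon>^2 - |x|^2)), the
  standard bump; the inner product is used because the norm is not smooth at 0.\<close>

definition bump :: "real \<Rightarrow> 'a::euclidean_space \<Rightarrow> real" where
  "bump \<epsilon> x = flat_exp 0 (\<epsilon>\<^sup>2 - x \<bullet> x)"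

definition moll :: "real \<Rightarrow> 'a::euclidean_space \<Rightarrow> real" where
  "moll \<epsilon> x = bump \<epsilon> x / (LL x. bump \<epsilon> (x::'a))"

lemma bump_bounds: "0 \<le> bump \<epsilon> x" "bump \<epsilon> x \<le> 1"
  by (auto simp: bump_def flat_exp_def)

lemma bump_zero: "0 < \<epsilon> \<Longrightarrow> \<epsilon> \<le> norm x \<Longrightarrow> bump \<epsilon> x = 0"
  by (simp add: bump_def flat_exp_def dot_square_norm power_mono not_less)

lemma bump_pos: "norm x < \<epsilon> \<Longrightarrow> 0 < bump \<epsilon> x"
  using power_strict_mono[of "norm x" \<epsilon> 2] by (auto simp: bump_def flat_exp_def dot_square_norm)

lemma bump_C_k_shift: "C_k k (\<lambda>y. c * bump \<epsilon> (x - y))"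
proof -
  have "bump_algebra x (\<epsilon>\<^sup>2) (\<lambda>y. c * flat_exp 0 (\<epsilon>\<^sup>2 - (y - x) \<bullet> (y - x)))"
    by (intro bump_algebra.intros)
  moreover have "(\<lambda>y. c * flat_exp 0 (\<epsilon>\<^sup>2 - (y - x) \<bullet> (y - x))) = (\<lambda>y. c * bump \<epsilon> (x - y))"
    by (simp add: bump_def inner_diff_left inner_diff_right inner_commute fun_eq_iff algebra_simps)
  ultimately show ?thesis using bump_algebra_C_k by metis
qed

lemma bump_even: "bump \<epsilon> (- x) = bump \<epsilon> x"
  by (simp add: bump_def)

lemma bump_C_k: "C_k k (bump \<epsilon>)"
  using bump_C_k_shift[of k 1 \<epsilon> 0] by (simp add: bump_even)

lemma continuous_bump: "continuous_on A (bump \<epsilon>)"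
  using C_k_imp_continuous[OF bump_C_k[of 0]] continuous_on_subset by blast

lemma bump_measurable [measurable]: "bump \<epsilon> \<in> Borel"
  using continuous_bump by (rule borel_measurable_continuous_onI)

lemma bump_integrable:
  assumes "0 < \<epsilon>"
  shows "integrable lborel (bump \<epsilon> :: 'a::euclidean_space \<Rightarrow> real)"
proof -
  have "integrable lborel (\<lambda>x::'a. indicator (cball 0 \<epsilon>) x *\<^sub>R bump \<epsilon> x)"
    by (intro borel_integrable_compact continuous_bump) auto
  moreover have "(\<lambda>x::'a. indicator (cball 0 \<epsilon>) x *\<^sub>R bump \<epsilon> x) = bump \<epsilon>"
    using assms bump_zero[OF assms] by (force simp: fun_eq_iff indicator_def)
  ultimately show ?thesis by simp
qed

lemma bump_integral_pos:
  assumes "0 < \<epsilon>"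
  shows "0 < (LL x. bump \<epsilon> (x::'a::euclidean_space))"
proof -
  have "emeasure lborel {x::'a. bump \<epsilon> x \<noteq> 0} \<noteq> 0"
  proof
    assume 0: "emeasure lborel {x::'a. bump \<epsilon> x \<noteq> 0} = 0"
    have "ball 0 \<epsilon> \<subseteq> {x::'a. bump \<epsilon> x \<noteq> 0}" using bump_pos[where \<epsilon>=\<epsilon>] by (force simp: less_imp_neq)
    then have "emeasure lborel (ball (0::'a) \<epsilon>) \<le> 0"
      unfolding 0[symmetric] by (intro emeasure_mono) auto
    then show False using assms unit_ball_vol_pos[of "real DIM('a)"] by (simp add: emeasure_ball)
  qed
  then have "(LL x. bump \<epsilon> (x::'a)) \<noteq> 0"
    by (subst integral_nonneg_eq_0_iff_AE[OF bump_integrable[OF assms]])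
       (simp_all add: bump_bounds AE_iff_measurable[OF _ refl])
  moreover have "0 \<le> (LL x. bump \<epsilon> (x::'a))"
    by (intro integral_nonneg_AE) (auto simp: bump_bounds)
  ultimately show ?thesis by simp
qed

context
  fixes \<epsilon> :: real
  assumes \<epsilon>: "0 < \<epsilon>"
begin

lemma moll_nonneg: "0 \<le> moll \<epsilon> (x::'a::euclidean_space)"
  using bump_integral_pos[OF \<epsilon>, where 'a='a] by (simp add: moll_def bump_bounds)

lemma moll_zero: "\<epsilon> \<le> norm x \<Longrightarrow> moll \<epsilon> (x::'a::euclidean_space) = 0"
  by (simp add: moll_def bump_zero[OF \<epsilon>])

lemma moll_C_k_shift: "C_k k (\<lambda>y. moll \<epsilon> (x - y :: 'a::euclidean_space))"
  using bump_C_k_shift[of k "1 / (LL x. bump \<epsilon> (x::'a))" \<epsilon> x] by (simp add: moll_def)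

lemma moll_even: "moll \<epsilon> (- x) = moll \<epsilon> (x::'a::euclidean_space)"
  by (simp add: moll_def bump_even)

lemma moll_C_k: "C_k k (moll \<epsilon> :: 'a::euclidean_space \<Rightarrow> real)"
  using moll_C_k_shift[of k 0] by (simp add: moll_even)

lemma moll_continuous: "continuous_on A (moll \<epsilon> :: 'a::euclidean_space \<Rightarrow> real)"
  using C_k_imp_continuous[OF moll_C_k[of 0]] continuous_on_subset by blast

lemma moll_measurable [measurable]: "moll \<epsilon> \<in> borel_measurable (borel :: 'a::euclidean_space measure)"
  using moll_continuous by (rule borel_measurable_continuous_onI)

lemma moll_integrable: "integrable lborel (moll \<epsilon> :: 'a::euclidean_space \<Rightarrow> real)"
  unfolding moll_def[abs_def] by (intro integrable_divide bump_integrable \<epsilon>)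

lemma moll_integral: "(LL x. moll \<epsilon> (x::'a::euclidean_space)) = 1"
  using bump_integral_pos[OF \<epsilon>, where 'a='a] by (simp add: moll_def)

lemma moll_nn_integral: "(NN x. ennreal (moll \<epsilon> (x::'a::euclidean_space))) = 1"
  using moll_integrable moll_nonneg by (subst nn_integral_eq_integral) (auto simp: moll_integral)

lemma moll_supp: "supp (\<lambda>y. moll \<epsilon> (x - y :: 'a::euclidean_space)) \<subseteq> cball x \<epsilon>"
  unfolding supp_def
proof (rule closure_minimal)
  show "{y. moll \<epsilon> (x - y) \<noteq> 0} \<subseteq> cball x \<epsilon>"
    using moll_zero by (force simp: dist_norm)
qed simp

text \<open>This test function turns the definition of a weak gradient into a statement about
  convolutions.\<close>

lemma moll_test_function:
  "cball x \<epsilon> \<subseteq> G \<Longrightarrow> (\<lambda>y. moll \<epsilon> (x - y :: 'a::euclidean_space)) \<in> test_functions G"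
  using moll_supp[of x] moll_C_k_shift bounded_subset[OF bounded_cball moll_supp]
  unfolding test_functions_def by (auto simp: supp_def compact_eq_bounded_closed)

end

section \<open>Continuity of translations in L^1\<close>

lemma lborel_distr_reflect: "distr lborel borel (\<lambda>y. x - y) = (lborel :: 'a::euclidean_space measure)"
  using lborel_affine[of "-1" x] by (simp add: density_1)

lemma lborel_distr_shift: "distr lborel borel (\<lambda>y. y + x) = (lborel :: 'a::euclidean_space measure)"
proof -
  have "(\<lambda>y. y + x) = (+) x" by (auto simp: add.commute)
  then show ?thesis using lborel_distr_plus[of x] by simp
qed

lemma integral_lborel_reflect:
  fixes f :: "'a::euclidean_space \<Rightarrow> 'b::{banach, second_countable_topology}"
  assumes [measurable]: "f \<in> Borel"
  shows "(LL y. f (x - y)) = (LL y. f y)"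
  by (subst (2) lborel_distr_reflect[of x, symmetric]) (simp add: integral_distr)

lemma nn_integral_lborel_shift:
  fixes f :: "'a::euclidean_space \<Rightarrow> ennreal"
  assumes "f \<in> Borel"
  shows "(NN y. f (y + x)) = (NN y. f y)"
  using nn_integral_lborel_translate[OF assms, of x] by (simp add: add.commute)

definition shift_dist :: "('a::euclidean_space \<Rightarrow> 'b::euclidean_space) \<Rightarrow> 'a \<Rightarrow> ennreal" where
  "shift_dist f u = (NN x. ennreal (norm (f (x + u) - f x)))"

lemma shift_dist_approx:
  assumes [measurable]: "f \<in> Borel" "g \<in> Borel"
  shows "shift_dist f u \<le> shift_dist g u + 2 * (NN x. ennreal (norm (f x - g x)))"
proof -
  have "shift_dist f u \<le> (NN x. ennreal (norm (g (x + u) - g x)) + (ennreal (norm (f (x + u) - g (x + u))) + ennreal (norm (f x - g x))))"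
    unfolding shift_dist_def
  proof (rule nn_integral_mono)
    fix x
    have "f (x + u) - f x = (g (x + u) - g x) + (f (x + u) - g (x + u)) - (f x - g x)" by simp
    then have "norm (f (x + u) - f x) \<le> norm (g (x + u) - g x) + norm (f (x + u) - g (x + u)) + norm (f x - g x)"
      using norm_triangle_ineq4[of "(g (x + u) - g x) + (f (x + u) - g (x + u))" "f x - g x"]
        norm_triangle_ineq[of "g (x + u) - g x" "f (x + u) - g (x + u)"] by simp
    then show "ennreal (norm (f (x + u) - f x)) \<le> ennreal (norm (g (x + u) - g x)) + (ennreal (norm (f (x + u) - g (x + u))) + ennreal (norm (f x - g x)))"
      by (simp add: ennreal_plus[symmetric] ennreal_leI add.assoc del: ennreal_plus)
  qed
  also have "\<dots> = shift_dist g u + ((NN x. ennreal (norm (f (x + u) - g (x + u)))) + (NN x. ennreal (norm (f x - g x))))"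
    unfolding shift_dist_def by (simp add: nn_integral_add)
  also have "(NN x. ennreal (norm (f (x + u) - g (x + u)))) = (NN x. ennreal (norm (f x - g x)))"
    using nn_integral_lborel_shift[of "\<lambda>x. ennreal (norm (f x - g x))" u] by simp
  finally show ?thesis by (simp add: mult_2)
qed

lemma shift_dist_tendsto_approx:
  assumes [measurable]: "f \<in> Borel"
    and g: "\<And>e::real. e > 0 \<Longrightarrow> \<exists>g\<in>borel_measurable borel. (shift_dist g \<longlongrightarrow> 0) (at 0) \<and> (NN x. ennreal (norm (f x - g x))) \<le> ennreal e"
  shows "(shift_dist f \<longlongrightarrow> 0) (at 0)"
proof (rule order_tendstoI)
  fix y :: ennreal assume "0 < y"
  \<comment> \<open>One e bounds the translation of g; two more bound the distance from f to g,
    which enters at x and at x + u.\<close>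
  then obtain e where e: "0 < e" "ennreal (3 * e) \<le> y"
  proof (cases y)
    case (real r)
    then have "0 < r" using \<open>0 < y\<close> by simp
    then show ?thesis using real by (intro that[of "r / 3"]) auto
  qed (auto intro: that[of 1])
  obtain g where [measurable]: "g \<in> Borel" and g: "(shift_dist g \<longlongrightarrow> 0) (at 0)" "(NN x. ennreal (norm (f x - g x))) \<le> ennreal e"
    using g[OF e(1)] by auto
  have "\<forall>\<^sub>F u in at 0. shift_dist g u < ennreal e" using g(1) e(1) by (intro order_tendstoD(2)) auto
  then show "\<forall>\<^sub>F u in at 0. shift_dist f u < y"
  proof eventually_elim
    case (elim u)
    have "shift_dist f u \<le> shift_dist g u + 2 * (NN x. ennreal (norm (f x - g x)))"
      by (rule shift_dist_approx) measurable
    also have "\<dots> \<le> shift_dist g u + 2 * ennreal e"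
      by (intro add_left_mono mult_left_mono g) auto
    also have "\<dots> < ennreal e + 2 * ennreal e"
      using elim ennreal_add_left_cancel_less[of "2 * ennreal e" "shift_dist g u" "ennreal e"]
      by (simp add: add.commute ennreal_mult_eq_top_iff)
    also have "\<dots> = ennreal (3 * e)"
    proof -
      have "2 * ennreal e = ennreal (2 * e)" using e(1) by (simp add: ennreal_mult')
      then show ?thesis using e(1) ennreal_plus[of e "2 * e"] by simp
    qed
    finally show ?case using e(2) by simp
  qed
qed simp

text \<open>A point of an open set stays in it under small translations, so dominated convergence
  with majorant 1_U applies. \<open>T u\<close> measures the points that leave U under translation
  by u; those that enter are counted by \<open>T (- u)\<close>, by translation invariance.\<close>

lemma shift_dist_open:
  fixes U :: "'a::euclidean_space set" and c :: "'b::euclidean_space"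
  assumes U: "open U" "emeasure lborel U < \<infinity>"
  shows "(shift_dist (\<lambda>x. indicator U x *\<^sub>R c) \<longlongrightarrow> 0) (at 0)"
proof -
  have [measurable]: "U \<in> sets borel" using U by auto
  define T where "T u = (NN x. indicator U x * indicator (- U) (x + u))" for u :: 'a
  have eq: "shift_dist (\<lambda>x. indicator U x *\<^sub>R c) u = (T u + T (- u)) * ennreal (norm c)" for u
  proof -
    have "T (- u) = (NN x. indicator U (x + u) * indicator (- U) (x + u + (- u)))"
      unfolding T_def by (subst nn_integral_lborel_shift[symmetric, where x=u]) auto
    then have "T u + T (- u) = (NN x. indicator U x * indicator (- U) (x + u) + indicator U (x + u) * indicator (- U) x)"
      unfolding T_def by (subst nn_integral_add) (auto simp: add.assoc)
    moreover have "ennreal (norm (indicator U (x + u) *\<^sub>R c - indicator U x *\<^sub>R c))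
       = (indicator U x * indicator (- U) (x + u) + indicator U (x + u) * indicator (- U) x) * ennreal (norm c)" for x
      by (auto split: split_indicator)
    ultimately show ?thesis unfolding shift_dist_def by (simp add: nn_integral_multc)
  qed
  have T0: "(T \<longlongrightarrow> 0) (at 0)"
    unfolding tendsto_at_iff_sequentially comp_def
  proof (intro allI impI)
    fix X :: "nat \<Rightarrow> 'a" assume X: "X \<longlonglongrightarrow> 0"
    have "(\<lambda>n. NN x. indicator U x * indicator (- U) (x + X n)) \<longlonglongrightarrow> (\<integral>\<^sup>+x. 0 \<partial>(lborel::'a measure))"
    proof (rule nn_integral_dominated_convergence[where w="indicator U"])
      show "AE x in lborel. (\<lambda>n. indicator U x * indicator (- U) (x + X n)) \<longlonglongrightarrow> (0::ennreal)"
      proof (rule AE_I2)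
        fix x
        show "(\<lambda>n. indicator U x * indicator (- U) (x + X n)) \<longlonglongrightarrow> (0::ennreal)"
        proof (cases "x \<in> U")
          case True
          have "(\<lambda>n. x + X n) \<longlonglongrightarrow> x + 0" by (intro tendsto_intros X)
          then have "\<forall>\<^sub>F n in sequentially. x + X n \<in> U"
            using U True by (intro topological_tendstoD) auto
          then have "\<forall>\<^sub>F n in sequentially. indicator U x * indicator (- U) (x + X n) = (0::ennreal)"
            by eventually_elim auto
          then show ?thesis by (rule tendsto_eventually)
        qed simp
      qed
    qed (use U in \<open>auto intro!: AE_I2 split: split_indicator\<close>)
    then show "(\<lambda>n. T (X n)) \<longlonglongrightarrow> 0" by (simp add: T_def)
  qed
  have "((\<lambda>u::'a. - u) \<longlongrightarrow> - 0) (at 0)" by (intro tendsto_intros)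
  then have "filterlim (\<lambda>u::'a. - u) (at 0) (at 0)"
    by (simp add: filterlim_at eventually_at) (auto intro!: exI[of _ 1])
  then have T1: "((\<lambda>u. T (- u)) \<longlongrightarrow> 0) (at 0)" using T0 filterlim_compose by blast
  have "((\<lambda>u. ennreal (norm c) * (T u + T (- u))) \<longlongrightarrow> ennreal (norm c) * (0 + 0)) (at 0)"
    by (intro ennreal_tendsto_cmult tendsto_add T0 T1) auto
  then show ?thesis by (subst (asm) mult.commute) (simp add: eq[abs_def] fun_eq_iff[symmetric])
qed

text \<open>The induction follows the construction of the integral: indicators are approximated from
  outside by open sets, and sums and dominated limits preserve the claim.\<close>

lemma shift_dist_tendsto_0:
  fixes f :: "'a::euclidean_space \<Rightarrow> 'b::euclidean_space"
  assumes "integrable lborel f"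
  shows "(shift_dist f \<longlongrightarrow> 0) (at 0)"
  using assms
proof (induction rule: integrable_induct)
  case (base A c)
  then have [measurable]: "A \<in> sets borel" by simp
  show ?case
  proof (rule shift_dist_tendsto_approx)
    fix e :: real assume "e > 0"
    \<comment> \<open>Adding 1 to the denominator admits c = 0.\<close>
    then have e': "e / (norm c + 1) > 0" by (simp add: add_nonneg_pos)
    obtain T where T: "open T" "A \<subseteq> T" "T - A \<in> lmeasurable" "emeasure lebesgue (T - A) < ennreal (e / (norm c + 1))"
      using sets_lebesgue_outer_open[of A, OF _ e'] \<open>A \<in> sets borel\<close> by (auto simp: sets_completionI_sets)
    have [measurable]: "T \<in> sets borel" using T by auto
    have TA: "emeasure lborel (T - A) < ennreal (e / (norm c + 1))" using T(4) by simp
    have "emeasure lborel T \<le> emeasure lborel A + emeasure lborel (T - A)"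
    proof -
      have "T = A \<union> (T - A)" using T(2) by auto
      then show ?thesis using emeasure_subadditive[of A lborel "T - A"] by simp
    qed
    also have "\<dots> < \<infinity>" using base TA by (auto simp: less_top[symmetric] dest: less_trans[OF _ ennreal_less_top])
    finally have "(shift_dist (\<lambda>x. indicator T x *\<^sub>R c) \<longlongrightarrow> 0) (at 0)" by (intro shift_dist_open T)
    moreover have "(NN x. ennreal (norm (indicator A x *\<^sub>R c - indicator T x *\<^sub>R c))) \<le> ennreal e"
    proof -
      have "(NN x. ennreal (norm (indicator A x *\<^sub>R c - indicator T x *\<^sub>R c))) = (NN x. ennreal (norm c) * indicator (T - A) x)"
        using T(2) by (intro nn_integral_cong) (auto split: split_indicator)
      also have "\<dots> = ennreal (norm c) * emeasure lborel (T - A)" by (subst nn_integral_cmult_indicator) auto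
      also have "\<dots> \<le> ennreal (norm c) * ennreal (e / (norm c + 1))" by (intro mult_left_mono less_imp_le[OF TA]) auto
      also have "\<dots> \<le> ennreal e"
      proof -
        have "norm c + 1 > 0" using norm_ge_zero[of c] by linarith
        then have "norm c / (norm c + 1) \<le> 1" by (subst pos_divide_le_eq) auto
        from mult_left_mono[OF this, of e] have "norm c * (e / (norm c + 1)) \<le> e"
          using \<open>e > 0\<close> by (simp add: mult.commute)
        then show ?thesis using e' by (simp add: ennreal_mult[symmetric] ennreal_leI)
      qed
      finally show ?thesis .
    qed
    ultimately show "\<exists>g\<in>borel_measurable borel. (shift_dist g \<longlongrightarrow> 0) (at 0) \<and> (NN x. ennreal (norm (indicator A x *\<^sub>R c - g x))) \<le> ennreal e"
      by (intro bexI[of _ "\<lambda>x. indicator T x *\<^sub>R c"]) auto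
  qed simp
next
  case (add f g)
  then have [measurable]: "f \<in> Borel" "g \<in> Borel" by auto
  have le: "shift_dist (\<lambda>x. f x + g x) u \<le> shift_dist f u + shift_dist g u" for u
  proof -
    have "shift_dist (\<lambda>x. f x + g x) u \<le> (NN x. ennreal (norm (f (x + u) - f x)) + ennreal (norm (g (x + u) - g x)))"
      unfolding shift_dist_def
    proof (rule nn_integral_mono)
      fix x
      have "norm (f (x + u) + g (x + u) - (f x + g x)) \<le> norm (f (x + u) - f x) + norm (g (x + u) - g x)"
        by (metis add_diff_add norm_triangle_ineq)
      then show "ennreal (norm (f (x + u) + g (x + u) - (f x + g x))) \<le> ennreal (norm (f (x + u) - f x)) + ennreal (norm (g (x + u) - g x))"
        by (simp add: ennreal_plus[symmetric] ennreal_leI del: ennreal_plus)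
    qed
    also have "\<dots> = shift_dist f u + shift_dist g u" unfolding shift_dist_def by (subst nn_integral_add) auto
    finally show ?thesis .
  qed
  have "((\<lambda>u. shift_dist f u + shift_dist g u) \<longlongrightarrow> 0 + 0) (at 0)" by (intro tendsto_add add.IH)
  then have lim: "((\<lambda>u. shift_dist f u + shift_dist g u) \<longlongrightarrow> 0) (at 0)" by simp
  show ?case
    by (rule tendsto_sandwich[OF _ _ tendsto_const lim]) (simp_all add: le)
next
  case (lim f s)
  have [measurable]: "f \<in> Borel" "\<And>i. s i \<in> Borel"
    using lim.hyps by (auto dest: borel_measurable_integrable)
  show ?case
  proof (rule shift_dist_tendsto_approx)
    fix e :: real assume "e > 0"
    have "(\<lambda>i. NN x. ennreal (norm (f x - s i x))) \<longlonglongrightarrow> 0"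
    proof -
      have "(\<lambda>i. NN x. ennreal (norm (f x - s i x))) \<longlonglongrightarrow> (\<integral>\<^sup>+x. 0 \<partial>(lborel::'a measure))"
      proof (rule nn_integral_dominated_convergence[where w="\<lambda>x. ennreal (3 * norm (f x))"])
        show "AE x in lborel. ennreal (norm (f x - s j x)) \<le> ennreal (3 * norm (f x))" for j
        proof (rule AE_I2)
          fix x :: 'a
          have "norm (f x - s j x) \<le> norm (f x) + norm (s j x)" by (rule norm_triangle_ineq4)
          also have "norm (s j x) \<le> 2 * norm (f x)" using lim.hyps(3)[of x j] by simp
          finally show "ennreal (norm (f x - s j x)) \<le> ennreal (3 * norm (f x))" by (simp add: ennreal_leI)
        qed
        have "(NN x. ennreal (norm (f x))) < \<infinity>"
          using lim.hyps(4) by (simp add: integrable_iff_bounded)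
        then show "(NN x. ennreal (3 * norm (f x))) < \<infinity>"
          by (subst ennreal_mult') (simp_all add: nn_integral_cmult ennreal_mult_less_top)
        show "AE x in lborel. (\<lambda>i. ennreal (norm (f x - s i x))) \<longlonglongrightarrow> 0"
        proof (rule AE_I2)
          fix x :: 'a
          have "(\<lambda>i. ennreal (norm (f x - s i x))) \<longlonglongrightarrow> ennreal (norm (f x - f x))"
            using lim.hyps(2)[of x] by (intro tendsto_intros) auto
          then show "(\<lambda>i. ennreal (norm (f x - s i x))) \<longlonglongrightarrow> 0" by simp
        qed
      qed auto
      then show ?thesis by simp
    qed
    then have "\<forall>\<^sub>F i in sequentially. (NN x. ennreal (norm (f x - s i x))) < ennreal e"
      using \<open>e > 0\<close> by (intro order_tendstoD(2)) auto
    then obtain i where "(NN x. ennreal (norm (f x - s i x))) < ennreal e"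
      by (auto simp: eventually_sequentially)
    then show "\<exists>g\<in>borel_measurable borel. (shift_dist g \<longlongrightarrow> 0) (at 0) \<and> (NN x. ennreal (norm (f x - g x))) \<le> ennreal e"
      using lim.IH by (intro bexI[of _ "s i"]) auto
  qed simp
qed

section \<open>Convolution with kernels of bounded support\<close>

definition locint :: "('a::euclidean_space \<Rightarrow> 'b::euclidean_space) \<Rightarrow> bool" where
  "locint f \<longleftrightarrow> f \<in> Borel \<and> (\<forall>R. integrable lborel (\<lambda>x. indicator (ball 0 R) x *\<^sub>R f x))"

lemma locint_measurable: "locint f \<Longrightarrow> f \<in> Borel"
  by (simp add: locint_def)

lemma integrable_imp_locint:
  "integrable lborel f \<Longrightarrow> locint (f :: 'a::euclidean_space \<Rightarrow> 'b::euclidean_space)"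
  unfolding locint_def
  using borel_measurable_integrable[of lborel f] by (auto intro!: integrable_mult_indicator)

text \<open>The integrands below are bounded kernels of bounded support times a locally integrable
  f. The second conclusion makes remainders small: M is the size of the remainder kernel and the
  integral stays fixed.\<close>

lemma locint_dominated:
  fixes f :: "'a::euclidean_space \<Rightarrow> 'b::euclidean_space" and g :: "'a \<Rightarrow> 'c::euclidean_space"
  assumes f: "locint f" and g: "g \<in> Borel"
    and le: "\<And>y. norm (g y) \<le> M * (indicator (ball 0 R) y * norm (f y))"
  shows "integrable lborel g" "norm (LL y. g y) \<le> M * (LL y. indicator (ball 0 R) y * norm (f y))"
proof -
  have "integrable lborel (\<lambda>x. norm (indicator (ball 0 R) x *\<^sub>R f x))"
    using f by (intro integrable_norm) (auto simp: locint_def)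
  then have i: "integrable lborel (\<lambda>y. M * (indicator (ball 0 R) y * norm (f y)))"
    by (intro integrable_mult_right) (simp add: indicator_def)
  show "integrable lborel g"
    by (rule Bochner_Integration.integrable_bound[OF i]) (use g le in \<open>auto intro!: AE_I2 order_trans[OF le]\<close>)
  then have "norm (LL y. g y) \<le> (LL y. M * (indicator (ball 0 R) y * norm (f y)))"
    using i le by (intro order_trans[OF integral_norm_bound] integral_mono) auto
  then show "norm (LL y. g y) \<le> M * (LL y. indicator (ball 0 R) y * norm (f y))" by simp
qed

definition kern :: "real \<Rightarrow> ('a::euclidean_space \<Rightarrow> 'b::euclidean_space) \<Rightarrow> bool" where
  "kern R k \<longleftrightarrow> continuous_on UNIV k \<and> (\<forall>z. R \<le> norm z \<longrightarrow> k z = 0)"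

lemma kern_measurable: "kern R k \<Longrightarrow> k \<in> Borel"
  by (auto simp: kern_def intro: borel_measurable_continuous_onI)

lemma kern_bounded:
  assumes "kern R k"
  obtains M where "M \<ge> 0" "\<And>z. norm (k z) \<le> M"
proof -
  have "compact (k ` cball 0 R)"
    using assms by (intro compact_continuous_image) (auto simp: kern_def intro: continuous_on_subset)
  then obtain M where M: "\<And>z. z \<in> cball 0 R \<Longrightarrow> norm (k z) \<le> M"
    using compact_imp_bounded bounded_iff by (metis image_eqI)
  have "norm (k z) \<le> max 0 M" for z
    using M[of z] assms by (cases "norm z \<le> R") (auto simp: kern_def)
  then show ?thesis by (intro that[of "max 0 M"]) auto
qed

lemma kern_uniform:
  assumes "kern R k" "0 < \<eta>"
  obtains \<delta> where "0 < \<delta>" "\<delta> \<le> 1" "\<And>u v. norm (u - v) < \<delta> \<Longrightarrow> norm (k u - k v) \<le> \<eta>"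
proof -
  have "uniformly_continuous_on (cball 0 (R + 1)) k"
    using assms by (intro compact_uniformly_continuous) (auto simp: kern_def intro: continuous_on_subset)
  then obtain \<delta> where \<delta>: "0 < \<delta>" "\<And>u v. u \<in> cball 0 (R + 1) \<Longrightarrow> v \<in> cball 0 (R + 1) \<Longrightarrow> dist v u < \<delta> \<Longrightarrow> dist (k v) (k u) < \<eta>"
    using assms(2) unfolding uniformly_continuous_on_def by metis
  show ?thesis
  proof (rule that[of "min \<delta> 1"])
    fix u v :: 'a assume uv: "norm (u - v) < min \<delta> 1"
    show "norm (k u - k v) \<le> \<eta>"
    proof (cases "norm u \<le> R + 1 \<and> norm v \<le> R + 1")
      case True
      then show ?thesis using \<delta>(2)[of v u] uv by (auto simp: dist_norm)
    next
      \<comment> \<open>The points are less than 1 apart, so if one is outside the ball of radius R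
        + 1, both are outside the ball of radius R, where k vanishes.\<close>
      case False
      have "norm u \<le> norm v + norm (u - v)" "norm v \<le> norm u + norm (u - v)"
        using norm_triangle_ineq2[of u v] norm_triangle_ineq2[of v u] by (auto simp: norm_minus_commute)
      then have "R \<le> norm u" "R \<le> norm v" using False uv by auto
      then show ?thesis using assms by (simp add: kern_def)
    qed
  qed (use \<delta> in auto)
qed

definition conv :: "('a::euclidean_space \<Rightarrow> real) \<Rightarrow> ('a \<Rightarrow> 'b::euclidean_space) \<Rightarrow> 'a \<Rightarrow> 'b" where
  "conv k f x = (LL y. k (x - y) *\<^sub>R f y)"

lemma kern_dominated:
  assumes "\<And>z. norm (k z) \<le> M" "\<And>z. R \<le> norm z \<Longrightarrow> k z = 0" "norm x + R \<le> R'"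
  shows "norm (k (x - y)) * norm (f y) \<le> M * (indicator (ball 0 R') y * norm (f y))"
proof (cases "norm y < R'")
  case True
  then show ?thesis using mult_right_mono[OF assms(1)[of "x - y"], of "norm (f y)"] by simp
next
  case False
  have "norm y \<le> norm x + norm (x - y)" using norm_triangle_ineq2[of y x] by (simp add: norm_minus_commute)
  then have "R \<le> norm (x - y)" using False assms(3) by simp
  then show ?thesis using False assms(2) by simp
qed

lemma conv_integrable:
  assumes "kern R k" and f: "locint f"
  shows "integrable lborel (\<lambda>y. k (x - y) *\<^sub>R f y)"
proof -
  obtain M where "\<And>z. norm (k z) \<le> M" using kern_bounded[OF assms(1)] by blast
  then have "norm (k (x - y) *\<^sub>R f y) \<le> M * (indicator (ball 0 (norm x + R)) y * norm (f y))" for y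
    using assms(1) kern_dominated[of k M R x "norm x + R" y f] by (auto simp: kern_def)
  moreover have "(\<lambda>y. k (x - y) *\<^sub>R f y) \<in> Borel"
    using kern_measurable[OF assms(1)] locint_measurable[OF f] by measurable
  ultimately show ?thesis by (intro locint_dominated(1)[OF f])
qed

lemma vector_conv_integrable:
  fixes f :: "'a::euclidean_space \<Rightarrow> real"
  assumes "kern R k" and f: "locint f"
  shows "integrable lborel (\<lambda>y. f y *\<^sub>R k (x - y))"
proof -
  obtain M where "\<And>z. norm (k z) \<le> M" using kern_bounded[OF assms(1)] by blast
  then have "norm (f y *\<^sub>R k (x - y)) \<le> M * (indicator (ball 0 (norm x + R)) y * norm (f y))" for y
    using assms(1) kern_dominated[of k M R x "norm x + R" y f] by (auto simp: kern_def mult.commute)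
  moreover have "(\<lambda>y. f y *\<^sub>R k (x - y)) \<in> Borel"
    using kern_measurable[OF assms(1)] locint_measurable[OF f] by measurable
  ultimately show ?thesis by (intro locint_dominated(1)[OF f])
qed

text \<open>The difference of the two integrals is a convolution with the kernel k(. + x' - x) - k,
  which is uniformly small and vanishes outside radius R + 1.\<close>

lemma vector_conv_continuous:
  fixes f :: "'a::euclidean_space \<Rightarrow> real" and k :: "'a \<Rightarrow> 'b::euclidean_space"
  assumes k: "kern R k" and f: "locint f"
  shows "continuous_on UNIV (\<lambda>x. LL y. f y *\<^sub>R k (x - y))"
proof (unfold continuous_on_iff, intro ballI allI impI)
  fix x :: 'a and e :: real assume e: "0 < e"
  define A where "A = (LL y. indicator (ball 0 (norm x + (R + 1))) y * norm (f y))"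
  have "A \<ge> 0" unfolding A_def by (intro integral_nonneg_AE) auto
  then have \<eta>: "0 < e / (A + 1)" using e by (intro divide_pos_pos) auto
  obtain \<delta> where \<delta>: "0 < \<delta>" "\<delta> \<le> 1" "\<And>u v. norm (u - v) < \<delta> \<Longrightarrow> norm (k u - k v) \<le> e / (A + 1)"
    using kern_uniform[OF k \<eta>] by blast
  have [measurable]: "k \<in> Borel" "f \<in> Borel"
    using kern_measurable[OF k] locint_measurable[OF f] by auto
  have "dist (LL y. f y *\<^sub>R k (x' - y)) (LL y. f y *\<^sub>R k (x - y)) < e" if x': "dist x' x < \<delta>" for x'
  proof -
    let ?r = "\<lambda>z. k (z + (x' - x)) - k z"
    have "norm (f y *\<^sub>R ?r (x - y)) \<le> e / (A + 1) * (indicator (ball 0 (norm x + (R + 1))) y * norm (f y))" for y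
    proof -
      have "norm (?r z) \<le> e / (A + 1)" for z using \<delta>(3)[of "z + (x' - x)" z] x' by (simp add: dist_norm)
      moreover have "?r z = 0" if "R + 1 \<le> norm z" for z
      proof -
        have "norm z \<le> norm (z + (x' - x)) + norm (x' - x)"
          using norm_triangle_ineq4[of "z + (x' - x)" "x' - x"] by simp
        then have "R \<le> norm (z + (x' - x))" "R \<le> norm z" using that x' \<delta>(2) by (auto simp: dist_norm)
        then show ?thesis using k by (simp add: kern_def)
      qed
      ultimately show ?thesis
        using kern_dominated[of ?r "e / (A + 1)" "R + 1" x "norm x + (R + 1)" y f] by (simp add: mult.commute)
    qed
    then have "norm (LL y. f y *\<^sub>R ?r (x - y)) \<le> e / (A + 1) * A"
      unfolding A_def by (intro locint_dominated(2)[OF f]) auto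
    also have "\<dots> < e" using \<open>A \<ge> 0\<close> e by (simp add: field_simps)
    also have "(LL y. f y *\<^sub>R ?r (x - y)) = (LL y. f y *\<^sub>R k (x' - y)) - (LL y. f y *\<^sub>R k (x - y))"
      by (subst Bochner_Integration.integral_diff[symmetric])
         (auto intro!: vector_conv_integrable[OF k f] simp: scaleR_diff_right algebra_simps)
    finally show ?thesis by (simp add: dist_norm)
  qed
  then show "\<exists>d>0. \<forall>x'\<in>UNIV. dist x' x < d \<longrightarrow> dist (LL y. f y *\<^sub>R k (x' - y)) (LL y. f y *\<^sub>R k (x - y)) < e"
    using \<delta>(1) by blast
qed

lemma grad_zero_outside:
  assumes "open S" "x \<in> S" "\<And>y. y \<in> S \<Longrightarrow> g y = 0"
  shows "grad g x = 0" "partial_deriv b g x = 0"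
proof -
  have "((\<lambda>_. 0) has_derivative (\<lambda>_. 0)) (at x)" by simp
  then have "(g has_derivative (\<lambda>_. 0)) (at x)"
    by (rule has_derivative_transform_within_open[OF _ assms(1,2)]) (simp add: assms(3))
  then have "frechet_derivative g (at x) = (\<lambda>_. 0)" by (rule frechet_derivative_at[symmetric])
  then show "grad g x = 0" "partial_deriv b g x = 0" by (auto simp: grad_def partial_deriv_def)
qed

lemma kern_moll: "0 < \<epsilon> \<Longrightarrow> kern \<epsilon> (moll \<epsilon>)"
  by (simp add: kern_def moll_continuous moll_zero)

lemma moll_has_derivative: "0 < \<epsilon> \<Longrightarrow> (moll \<epsilon> has_derivative (\<lambda>h. grad (moll \<epsilon>) x \<bullet> h)) (at x)"
  by (rule C_k_Suc_has_derivative[OF moll_C_k])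

text \<open>The radius exceeds \<epsilon>, so that the claim is only about the open exterior of the
  closed \<epsilon>-ball, on which the mollifier is identically 0.\<close>

lemma kern_grad_moll:
  assumes "0 < \<epsilon>"
  shows "kern (\<epsilon> + 1) (grad (moll \<epsilon> :: 'a::euclidean_space \<Rightarrow> real))"
  unfolding kern_def
proof (intro conjI allI impI)
  show "continuous_on UNIV (grad (moll \<epsilon> :: 'a \<Rightarrow> real))" by (rule C_k_Suc_continuous_grad[OF moll_C_k[OF assms]])
  fix z :: 'a assume z: "\<epsilon> + 1 \<le> norm z"
  show "grad (moll \<epsilon>) z = 0"
    by (rule grad_zero_outside[of "- cball 0 \<epsilon>"]) (use z assms in \<open>auto intro!: moll_zero\<close>)
qed

text \<open>Mean value theorem on the segment and uniform continuity of D. The remainder is small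
  uniformly in the base point u, as differentiation under the integral sign requires.\<close>

lemma uniformly_differentiable:
  fixes g :: "'a::euclidean_space \<Rightarrow> real"
  assumes der: "\<And>x. (g has_derivative (\<lambda>h. D x \<bullet> h)) (at x)" and D: "kern R D" and "0 < \<eta>"
  obtains \<delta> where "0 < \<delta>" "\<delta> \<le> 1"
    "\<And>u h. norm h < \<delta> \<Longrightarrow> \<bar>g (u + h) - g u - D u \<bullet> h\<bar> \<le> \<eta> * norm h"
proof -
  obtain \<delta> where \<delta>: "0 < \<delta>" "\<delta> \<le> 1" "\<And>u v. norm (u - v) < \<delta> \<Longrightarrow> norm (D u - D v) \<le> \<eta>"
    using kern_uniform[OF D assms(3)] by blast
  show ?thesis
  proof (rule that[OF \<delta>(1,2)])
    fix u h :: 'a assume h: "norm h < \<delta>"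
    have d: "((\<lambda>t. g (u + t *\<^sub>R h)) has_derivative (\<lambda>s. D (u + t *\<^sub>R h) \<bullet> (s *\<^sub>R h))) (at t within {0..1})" for t :: real
    proof -
      have "((\<lambda>t. u + t *\<^sub>R h) has_derivative (\<lambda>s. s *\<^sub>R h)) (at t within {0..1})"
        by (auto intro!: derivative_eq_intros)
      from has_derivative_compose[OF this der] show ?thesis .
    qed
    obtain t where t: "t \<in> {0<..<1}" "g (u + 1 *\<^sub>R h) - g (u + 0 *\<^sub>R h) = D (u + t *\<^sub>R h) \<bullet> ((1 - 0) *\<^sub>R h)"
      using mvt_simple[of 0 1 "\<lambda>t. g (u + t *\<^sub>R h)" "\<lambda>t s. D (u + t *\<^sub>R h) \<bullet> (s *\<^sub>R h)"] d by auto
    then have "g (u + h) - g u - D u \<bullet> h = (D (u + t *\<^sub>R h) - D u) \<bullet> h"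
      by (simp add: inner_diff_left)
    also have "\<bar>\<dots>\<bar> \<le> norm (D (u + t *\<^sub>R h) - D u) * norm h" by (rule Cauchy_Schwarz_ineq2)
    also have "\<dots> \<le> \<eta> * norm h"
    proof (intro mult_right_mono \<delta>)
      have "t * norm h \<le> 1 * norm h" using t by (intro mult_right_mono) auto
      then show "norm (u + t *\<^sub>R h - u) < \<delta>" using h t by simp
    qed simp
    finally show "\<bar>g (u + h) - g u - D u \<bullet> h\<bar> \<le> \<eta> * norm h" .
  qed
qed

definition grad_conv :: "real \<Rightarrow> ('a::euclidean_space \<Rightarrow> real) \<Rightarrow> 'a \<Rightarrow> 'a" where
  "grad_conv \<epsilon> f x = (LL y. f y *\<^sub>R grad (moll \<epsilon>) (x - y))"

lemma grad_conv_continuous: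
  assumes "0 < \<epsilon>" "locint f"
  shows "continuous_on UNIV (grad_conv \<epsilon> f)"
proof -
  have "grad_conv \<epsilon> f = (\<lambda>x. LL y. f y *\<^sub>R grad (moll \<epsilon>) (x - y))"
    by (rule ext) (simp only: grad_conv_def)
  then show ?thesis using vector_conv_continuous[OF kern_grad_moll[OF assms(1)] assms(2)] by simp
qed

text \<open>The first-order remainder of the convolution is the integral of f against the remainder
  of the mollifier. That kernel is at most e |h| / (A + 1) and vanishes outside radius \<epsilon> +
  2, and A is the integral of |f| over the ball that matters.\<close>

lemma conv_has_derivative:
  fixes f :: "'a::euclidean_space \<Rightarrow> real"
  assumes \<epsilon>: "0 < \<epsilon>" and f: "locint f"
  shows "(conv (moll \<epsilon>) f has_derivative (\<lambda>h. grad_conv \<epsilon> f x \<bullet> h)) (at x)"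
  unfolding has_derivative_at_alt
proof (intro conjI allI impI)
  show "bounded_linear (\<lambda>h. grad_conv \<epsilon> f x \<bullet> h)" by (rule bounded_linear_inner_right)
  fix e :: real assume e: "0 < e"
  define A where "A = (LL y. indicator (ball 0 (norm x + (\<epsilon> + 2))) y * norm (f y))"
  have "A \<ge> 0" unfolding A_def by (intro integral_nonneg_AE) auto
  then have \<eta>: "0 < e / (A + 1)" using e by (intro divide_pos_pos) auto
  obtain \<delta> where \<delta>: "0 < \<delta>" "\<delta> \<le> 1"
    "\<And>u h::'a. norm h < \<delta> \<Longrightarrow> \<bar>moll \<epsilon> (u + h) - moll \<epsilon> u - grad (moll \<epsilon>) u \<bullet> h\<bar> \<le> e / (A + 1) * norm h"
    using uniformly_differentiable[OF moll_has_derivative[OF \<epsilon>] kern_grad_moll[OF \<epsilon>] \<eta>] by blast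
  have [measurable]: "f \<in> Borel" "moll \<epsilon> \<in> borel_measurable (borel :: 'a measure)" "grad (moll \<epsilon>) \<in> borel_measurable (borel :: 'a measure)"
    using locint_measurable[OF f] moll_measurable[OF \<epsilon>] kern_measurable[OF kern_grad_moll[OF \<epsilon>]] by auto
  have "norm (conv (moll \<epsilon>) f y - conv (moll \<epsilon>) f x - grad_conv \<epsilon> f x \<bullet> (y - x)) \<le> e * norm (y - x)" if y: "norm (y - x) < \<delta>" for y
  proof -
    define h where "h = y - x"
    let ?r = "\<lambda>z. moll \<epsilon> (z + h) - moll \<epsilon> z - grad (moll \<epsilon>) z \<bullet> h"
    have "norm (f w *\<^sub>R ?r (x - w)) \<le> (e / (A + 1) * norm h) * (indicator (ball 0 (norm x + (\<epsilon> + 2))) w * norm (f w))" for w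
    proof -
      have "norm (?r z) \<le> e / (A + 1) * norm h" for z using \<delta>(3)[of h z] y by (simp add: h_def)
      moreover have "?r z = 0" if "\<epsilon> + 2 \<le> norm z" for z
      proof -
        have "norm z \<le> norm (z + h) + norm h"
          using norm_triangle_ineq4[of "z + h" h] by simp
        then have "\<epsilon> \<le> norm (z + h)" "\<epsilon> \<le> norm z" "\<epsilon> + 1 \<le> norm z" using that y \<delta>(2) by (auto simp: h_def)
        then have "moll \<epsilon> (z + h) = 0" "moll \<epsilon> z = 0" "grad (moll \<epsilon>) z = 0"
          using kern_moll[OF \<epsilon>] kern_grad_moll[OF \<epsilon>] unfolding kern_def by blast+
        then show ?thesis by simp
      qed
      ultimately show ?thesis
        using kern_dominated[of ?r "e / (A + 1) * norm h" "\<epsilon> + 2" x "norm x + (\<epsilon> + 2)" w f] by (simp add: mult.commute abs_mult)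
    qed
    then have "norm (LL w. f w *\<^sub>R ?r (x - w)) \<le> (e / (A + 1) * norm h) * A"
      unfolding A_def by (intro locint_dominated(2)[OF f]) auto
    also have "\<dots> \<le> e * norm h"
    proof -
      have "e / (A + 1) * A \<le> e" using \<open>A \<ge> 0\<close> e by (simp add: field_simps)
      from mult_right_mono[OF this, of "norm h"] show ?thesis by (simp add: mult_ac)
    qed
    also have "(LL w. f w *\<^sub>R ?r (x - w)) = conv (moll \<epsilon>) f y - conv (moll \<epsilon>) f x - grad_conv \<epsilon> f x \<bullet> h"
    proof -
      have i1: "integrable lborel (\<lambda>w. moll \<epsilon> (y - w) *\<^sub>R f w)" "integrable lborel (\<lambda>w. moll \<epsilon> (x - w) *\<^sub>R f w)"
        by (intro conv_integrable[OF kern_moll[OF \<epsilon>] f])+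
      have i2: "integrable lborel (\<lambda>w. f w *\<^sub>R grad (moll \<epsilon>) (x - w))"
        by (rule vector_conv_integrable[OF kern_grad_moll[OF \<epsilon>] f])
      have "conv (moll \<epsilon>) f y - conv (moll \<epsilon>) f x - grad_conv \<epsilon> f x \<bullet> h
        = (LL w. moll \<epsilon> (y - w) *\<^sub>R f w - moll \<epsilon> (x - w) *\<^sub>R f w - (f w *\<^sub>R grad (moll \<epsilon>) (x - w)) \<bullet> h)"
      proof -
        have e3: "(LL w. f w *\<^sub>R grad (moll \<epsilon>) (x - w)) \<bullet> h = (LL w. (f w *\<^sub>R grad (moll \<epsilon>) (x - w)) \<bullet> h)"
          by (rule integral_inner_left[symmetric]) (rule i2)
        have i3: "integrable lborel (\<lambda>w. (f w *\<^sub>R grad (moll \<epsilon>) (x - w)) \<bullet> h)"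
          by (intro integrable_inner_left i2)
        show ?thesis unfolding conv_def grad_conv_def e3
          using i1 i3 by (simp only: Bochner_Integration.integral_diff Bochner_Integration.integrable_diff)
      qed
      also have "\<dots> = (LL w. f w *\<^sub>R ?r (x - w))"
        by (intro Bochner_Integration.integral_cong) (auto simp: h_def algebra_simps)
      finally show ?thesis by simp
    qed
    finally show ?thesis by (simp add: h_def)
  qed
  then show "\<exists>d>0. \<forall>y. norm (y - x) < d \<longrightarrow> norm (conv (moll \<epsilon>) f y - conv (moll \<epsilon>) f x - grad_conv \<epsilon> f x \<bullet> (y - x)) \<le> e * norm (y - x)"
    using \<delta>(1) by blast
qed

section \<open>Convergence of mollifications\<close>

lemma conv_moll_eq:
  fixes f :: "'a::euclidean_space \<Rightarrow> 'b::euclidean_space"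
  assumes \<epsilon>: "0 < \<epsilon>" and f: "locint f"
  shows "conv (moll \<epsilon>) f x = (LL y. moll \<epsilon> y *\<^sub>R f (x - y))"
    and "integrable lborel (\<lambda>y. moll \<epsilon> y *\<^sub>R f (x - y))"
proof -
  have [measurable]: "f \<in> Borel" "moll \<epsilon> \<in> borel_measurable (borel :: 'a measure)"
    using locint_measurable[OF f] moll_measurable[OF \<epsilon>] by auto
  show "conv (moll \<epsilon>) f x = (LL y. moll \<epsilon> y *\<^sub>R f (x - y))"
    using integral_lborel_reflect[of "\<lambda>y. moll \<epsilon> (x - y) *\<^sub>R f y" x] unfolding conv_def by simp
  have "integrable lborel (\<lambda>y. moll \<epsilon> (x - y) *\<^sub>R f y)" by (rule conv_integrable[OF kern_moll[OF \<epsilon>] f])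
  then have "integrable (distr lborel borel (\<lambda>y. x - y)) (\<lambda>y. moll \<epsilon> (x - y) *\<^sub>R f y)" by (simp add: lborel_distr_reflect)
  then show "integrable lborel (\<lambda>y. moll \<epsilon> y *\<^sub>R f (x - y))" by (subst (asm) integrable_distr_eq) auto
qed

lemma conv_moll_diff:
  fixes f :: "'a::euclidean_space \<Rightarrow> 'b::euclidean_space"
  assumes \<epsilon>: "0 < \<epsilon>" and f: "locint f"
  shows "conv (moll \<epsilon>) f x - f x = (LL y. moll \<epsilon> y *\<^sub>R (f (x - y) - f x))"
proof -
  have "f x = (\<integral>y. moll \<epsilon> y *\<^sub>R f x \<partial>(lborel::'a measure))"
    using moll_integrable[OF \<epsilon>, where 'a='a] moll_integral[OF \<epsilon>, where 'a='a]
    by (subst integral_scaleR_left) auto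
  moreover have "integrable lborel (\<lambda>y::'a. moll \<epsilon> y *\<^sub>R f x)"
    by (intro integrable_scaleR_left moll_integrable[OF \<epsilon>])
  ultimately show ?thesis
    unfolding conv_moll_eq(1)[OF assms] scaleR_diff_right
    by (subst Bochner_Integration.integral_diff[OF conv_moll_eq(2)[OF assms]]) simp_all
qed

text \<open>The error at x is an average of f(x - y) - f(x) against the mollifier, so its L^1 norm
  is at most the average of \<open>shift_dist f (- y)\<close> over |y| < \<epsilon>.\<close>

lemma conv_moll_L1:
  fixes f :: "'a::euclidean_space \<Rightarrow> 'b::euclidean_space"
  assumes f: "integrable lborel f"
  shows "((\<lambda>\<epsilon>. (NN x. ennreal (norm (conv (moll \<epsilon>) f x - f x)))) \<longlongrightarrow> 0) (at_right 0)"
proof (rule order_tendstoI)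
  have [measurable]: "f \<in> Borel" using f by auto
  note f' = integrable_imp_locint[OF f]
  fix c :: ennreal assume c: "0 < c"
  obtain c' where c': "0 < c'" "c' < c" using dense[OF c] by blast
  have "\<forall>\<^sub>F u in at 0. shift_dist f u < c'" by (rule order_tendstoD(2)[OF shift_dist_tendsto_0[OF f] c'(1)])
  then obtain \<delta> where \<delta>: "0 < \<delta>" "\<And>u. u \<noteq> 0 \<Longrightarrow> norm u < \<delta> \<Longrightarrow> shift_dist f u < c'"
    unfolding eventually_at by (auto simp: dist_norm)
  have "shift_dist f 0 = 0" by (simp add: shift_dist_def)
  then have sd: "shift_dist f u \<le> c'" if "norm u < \<delta>" for u
    using \<delta>(2)[of u] that by (cases "u = 0") (auto simp: less_imp_le)
  show "\<forall>\<^sub>F \<epsilon> in at_right 0. (NN x. ennreal (norm (conv (moll \<epsilon>) f x - f x))) < c"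
  proof (rule eventually_at_rightI[of 0 \<delta>])
    fix \<epsilon> assume "\<epsilon> \<in> {0<..<\<delta>}"
    then have \<epsilon>: "0 < \<epsilon>" "\<epsilon> < \<delta>" by auto
    have [measurable]: "moll \<epsilon> \<in> borel_measurable (borel :: 'a measure)" by (rule moll_measurable[OF \<epsilon>(1)])
    have "(NN x. ennreal (norm (conv (moll \<epsilon>) f x - f x)))
       \<le> (NN x. NN y. ennreal (moll \<epsilon> y) * ennreal (norm (f (x - y) - f x)))"
    proof (rule nn_integral_mono)
      fix x
      have i: "integrable lborel (\<lambda>y. moll \<epsilon> y *\<^sub>R (f (x - y) - f x))"
        unfolding scaleR_diff_right
        by (intro Bochner_Integration.integrable_diff conv_moll_eq(2)[OF \<epsilon>(1) f'] integrable_scaleR_left moll_integrable[OF \<epsilon>(1)])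
      have "ennreal (norm (conv (moll \<epsilon>) f x - f x)) \<le> (NN y. ennreal (norm (moll \<epsilon> y *\<^sub>R (f (x - y) - f x))))"
        unfolding conv_moll_diff[OF \<epsilon>(1) f'] using i by (rule integral_norm_bound_ennreal)
      also have "\<dots> = (NN y. ennreal (moll \<epsilon> y) * ennreal (norm (f (x - y) - f x)))"
        using moll_nonneg[OF \<epsilon>(1), where 'a='a] by (intro nn_integral_cong) (simp add: ennreal_mult[symmetric])
      finally show "ennreal (norm (conv (moll \<epsilon>) f x - f x)) \<le> \<dots>" .
    qed
    also have "\<dots> = (NN y. NN x. ennreal (moll \<epsilon> y) * ennreal (norm (f (x - y) - f x)))"
      by (rule lborel_pair.Fubini') measurable
    also have "\<dots> = (NN y. ennreal (moll \<epsilon> y) * shift_dist f (- y))"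
      by (intro nn_integral_cong, subst nn_integral_cmult) (auto simp: shift_dist_def)
    also have "\<dots> \<le> (\<integral>\<^sup>+y. ennreal (moll \<epsilon> y) * c' \<partial>(lborel :: 'a measure))"
    proof (rule nn_integral_mono)
      fix y :: 'a
      show "ennreal (moll \<epsilon> y) * shift_dist f (- y) \<le> ennreal (moll \<epsilon> y) * c'"
      proof (cases "norm y < \<epsilon>")
        case True
        then show ?thesis using \<epsilon> by (intro mult_left_mono sd) auto
      next
        case False
        then show ?thesis using moll_zero[OF \<epsilon>(1), of y] by simp
      qed
    qed
    also have "\<dots> = c'" using moll_nn_integral[OF \<epsilon>(1), where 'a='a] by (simp add: nn_integral_multc)
    finally show "(NN x. ennreal (norm (conv (moll \<epsilon>) f x - f x))) < c" using c'(2) by simp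
  qed (use \<delta> in auto)
qed simp

lemma conv_moll_cong_ball:
  assumes "0 < \<epsilon>" "\<And>y. norm (x - y) < \<epsilon> \<Longrightarrow> f y = g y"
  shows "conv (moll \<epsilon>) f x = conv (moll \<epsilon>) g x"
  unfolding conv_def
proof (rule Bochner_Integration.integral_cong[OF refl])
  fix y
  show "moll \<epsilon> (x - y) *\<^sub>R f y = moll \<epsilon> (x - y) *\<^sub>R g y"
    using assms moll_zero[OF assms(1), of "x - y"] by (cases "norm (x - y) < \<epsilon>") auto
qed

text \<open>For |x| < R and \<epsilon> < 1 only the values of f in the ball of radius R + 1 are
  seen, so f may be cut off there.\<close>

lemma conv_moll_L1_local:
  fixes f :: "'a::euclidean_space \<Rightarrow> 'b::euclidean_space"
  assumes f: "locint f"
  shows "((\<lambda>\<epsilon>. (NN x. ennreal (norm (conv (moll \<epsilon>) f x - f x)) * indicator (ball 0 R) x)) \<longlongrightarrow> 0) (at_right 0)"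
proof -
  define g where "g x = indicator (ball 0 (R + 1)) x *\<^sub>R f x" for x
  have g: "integrable lborel g" using f unfolding g_def locint_def by blast
  have le: "\<forall>\<^sub>F \<epsilon> in at_right 0. (NN x. ennreal (norm (conv (moll \<epsilon>) f x - f x)) * indicator (ball 0 R) x)
      \<le> (NN x. ennreal (norm (conv (moll \<epsilon>) g x - g x)))"
  proof (rule eventually_at_rightI[of 0 1])
    fix \<epsilon> :: real assume \<epsilon>: "\<epsilon> \<in> {0<..<1}"
    show "(NN x. ennreal (norm (conv (moll \<epsilon>) f x - f x)) * indicator (ball 0 R) x)
      \<le> (NN x. ennreal (norm (conv (moll \<epsilon>) g x - g x)))"
    proof (rule nn_integral_mono)
      fix x :: 'a
      show "ennreal (norm (conv (moll \<epsilon>) f x - f x)) * indicator (ball 0 R) x \<le> ennreal (norm (conv (moll \<epsilon>) g x - g x))"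
      proof (cases "norm x < R")
        case True
        have "conv (moll \<epsilon>) f x = conv (moll \<epsilon>) g x"
        proof (rule conv_moll_cong_ball)
          fix y assume y: "norm (x - y) < \<epsilon>"
          have "norm y \<le> norm x + norm (x - y)" using norm_triangle_ineq2[of y x] by (simp add: norm_minus_commute)
          then show "f y = g y" using True y \<epsilon> by (simp add: g_def)
        qed (use \<epsilon> in auto)
        moreover have "f x = g x" using True by (simp add: g_def)
        ultimately show ?thesis using True by simp
      qed simp
    qed
  qed auto
  show ?thesis
    by (rule tendsto_sandwich[OF _ le tendsto_const conv_moll_L1[OF g]]) simp
qed

section \<open>Weak gradients\<close>

lemma test_function_zero:
  assumes "\<phi> \<in> test_functions \<Omega>" "x \<notin> supp \<phi>"
  shows "\<phi> x = 0" "partial_deriv b \<phi> x = 0"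
proof -
  have *: "\<phi> y = 0" if "y \<in> - supp \<phi>" for y
    using that closure_subset[of "{x. \<phi> x \<noteq> 0}"] by (auto simp: supp_def)
  then show "\<phi> x = 0" using assms by auto
  have "open (- supp \<phi>)" by (simp add: supp_def open_Compl)
  then show "partial_deriv b \<phi> x = 0"
    by (rule grad_zero_outside(2)) (use assms * in auto)
qed

lemma test_function_smooth:
  assumes "\<phi> \<in> test_functions \<Omega>" "b \<in> Basis"
  shows "continuous_on UNIV \<phi>" "continuous_on UNIV (partial_deriv b \<phi>)"
    "(\<phi> has_derivative (\<lambda>h. grad \<phi> x \<bullet> h)) (at x)"
proof -
  have "C_k (Suc 0) \<phi>" using assms unfolding test_functions_def by blast
  then show "continuous_on UNIV \<phi>" "continuous_on UNIV (partial_deriv b \<phi>)"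
    "(\<phi> has_derivative (\<lambda>h. grad \<phi> x \<bullet> h)) (at x)"
    using assms(2) C_k_imp_continuous[of "Suc 0" \<phi>] C_k_Suc_has_derivative[of 0 \<phi> x] by auto
qed

lemma test_function_support:
  assumes "\<phi> \<in> test_functions \<Omega>"
  shows "compact (supp \<phi>)" "supp \<phi> \<subseteq> \<Omega>"
  using assms by (auto simp: test_functions_def)

lemma grad_inner_Basis: "b \<in> Basis \<Longrightarrow> grad f x \<bullet> b = partial_deriv b f x"
  by (simp add: grad_def inner_sum_left_Basis)

section \<open>From Lebesgue measurable to Borel functions\<close>

lemma open_sigma_compact:
  fixes \<Omega> :: "'a::euclidean_space set"
  assumes "open \<Omega>"
  obtains C :: "nat \<Rightarrow> 'a set" where "\<And>n. compact (C n)" "\<And>n. C n \<subseteq> \<Omega>" "\<Omega> = (\<Union>n. C n)" "incseq C"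
proof -
  obtain C :: "nat \<Rightarrow> 'a set" where C: "\<And>n. compact (C n)" "\<And>n. C n \<subseteq> \<Omega>"
    "\<And>n. C n \<subseteq> interior (C (Suc n))" "\<Union>(range C) = \<Omega>"
    using open_Union_compact_subsets[OF assms] by metis
  have "incseq C" using C(3) interior_subset by (intro incseq_SucI) blast
  then show ?thesis using that C by blast
qed

text \<open>Restrictions to compact sets are integrable, hence measurable, and along a compact
  exhaustion of \<Omega> they converge pointwise.\<close>

lemma locally_integrable_on_measurable:
  fixes g :: "'a::euclidean_space \<Rightarrow> 'b::euclidean_space"
  assumes "open \<Omega>" "locally_integrable_on \<Omega> g"
  shows "g \<in> borel_measurable (lebesgue_on \<Omega>)"
proof -
  obtain C :: "nat \<Rightarrow> 'a set" where C: "\<And>n. compact (C n)" "\<And>n. C n \<subseteq> \<Omega>" "\<Omega> = (\<Union>n. C n)" "incseq C"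
    using open_sigma_compact[OF assms(1)] by blast
  have "(\<lambda>x. indicator (C n) x *\<^sub>R g x) \<in> borel_measurable lebesgue" for n
    using assms(2) C(1,2)[of n] unfolding locally_integrable_on_def set_integrable_def
    by (auto dest: borel_measurable_integrable)
  then have "(\<lambda>x. indicator \<Omega> x *\<^sub>R g x) \<in> borel_measurable lebesgue"
  proof (rule borel_measurable_LIMSEQ_metric)
    fix x
    show "(\<lambda>n. indicator (C n) x *\<^sub>R g x) \<longlonglongrightarrow> indicator \<Omega> x *\<^sub>R g x"
    proof (cases "x \<in> \<Omega>")
      case True
      then obtain n where n: "x \<in> C n" using C(3) by blast
      have "\<forall>\<^sub>F m in sequentially. indicator (C m) x *\<^sub>R g x = indicator \<Omega> x *\<^sub>R g x"
        unfolding eventually_sequentially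
      proof (intro exI allI impI)
        fix m assume "n \<le> m"
        then have "x \<in> C m" using C(4) n by (auto simp: incseq_def)
        then show "indicator (C m) x *\<^sub>R g x = indicator \<Omega> x *\<^sub>R g x" using True by simp
      qed
      then show ?thesis by (rule tendsto_eventually)
    next
      case False
      then have "x \<notin> C n" for n using C(2) by blast
      then show ?thesis using False by simp
    qed
  qed
  then show ?thesis using assms(1) by (subst borel_measurable_restrict_space_iff) auto
qed

lemma AE_lborel_imp_lebesgue: "AE x in lborel. P x \<Longrightarrow> AE x in lebesgue. P x"
  by (rule AE_completion)

lemma set_integrable_lebesgue_cong:
  fixes f F :: "'a::euclidean_space \<Rightarrow> 'b::euclidean_space"
  assumes "f \<in> borel_measurable (lebesgue_on \<Omega>)" "open \<Omega>" and [measurable]: "F \<in> Borel"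
    and ae: "AE x in lborel. x \<in> \<Omega> \<longrightarrow> f x = F x" and K: "compact K" "K \<subseteq> \<Omega>"
  shows "set_integrable lebesgue K f \<longleftrightarrow> integrable lborel (\<lambda>x. indicator K x *\<^sub>R F x)"
proof -
  have [measurable]: "K \<in> sets borel" using K(1) by (rule borel_compact)
  have f: "(\<lambda>x. indicator \<Omega> x *\<^sub>R f x) \<in> borel_measurable lebesgue"
    using assms(1,2) by (subst (asm) borel_measurable_restrict_space_iff) auto
  have "(\<lambda>x. indicator K x *\<^sub>R f x) = (\<lambda>x. indicator K x *\<^sub>R (indicator \<Omega> x *\<^sub>R f x))"
    using K by (auto simp: fun_eq_iff indicator_def)
  also have "\<dots> \<in> borel_measurable lebesgue" by (rule borel_measurable_scaleR[OF borel_measurable_indicator f]) (simp add: sets_completionI_sets)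
  finally have m: "(\<lambda>x. indicator K x *\<^sub>R f x) \<in> borel_measurable lebesgue" .
  have m': "(\<lambda>x. indicator K x *\<^sub>R F x) \<in> borel_measurable lborel" by measurable
  have "set_integrable lebesgue K f \<longleftrightarrow> integrable lebesgue (\<lambda>x. indicator K x *\<^sub>R F x)"
    unfolding set_integrable_def
  proof (rule integrable_cong_AE[OF m])
    show "(\<lambda>x. indicator K x *\<^sub>R F x) \<in> borel_measurable lebesgue" using m' by (rule measurable_completion)
    show "AE x in lebesgue. indicator K x *\<^sub>R f x = indicator K x *\<^sub>R F x"
      using AE_lborel_imp_lebesgue[OF ae] by eventually_elim (use K in \<open>auto simp: indicator_def\<close>)
  qed
  also have "\<dots> \<longleftrightarrow> integrable lborel (\<lambda>x. indicator K x *\<^sub>R F x)" using m' by (rule integrable_completion)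
  finally show ?thesis .
qed

lemma set_integral_lebesgue_mult_cong:
  fixes f F k :: "'a::euclidean_space \<Rightarrow> real"
  assumes "f \<in> borel_measurable (lebesgue_on \<Omega>)" "open \<Omega>" and [measurable]: "F \<in> Borel" "k \<in> Borel"
    and ae: "AE x in lborel. x \<in> \<Omega> \<longrightarrow> f x = F x" and k: "\<And>x. x \<notin> \<Omega> \<Longrightarrow> k x = 0"
  shows "(LINT x:\<Omega>|lebesgue. f x * k x) = (LL x. F x * k x)"
proof -
  have f: "(\<lambda>x. indicator \<Omega> x *\<^sub>R f x) \<in> borel_measurable lebesgue"
    using assms(1,2) by (subst (asm) borel_measurable_restrict_space_iff) auto
  have k': "k \<in> borel_measurable lebesgue" by (rule measurable_completion) simp
  have m': "(\<lambda>x. F x * k x) \<in> borel_measurable lborel" by measurable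
  have "(LINT x:\<Omega>|lebesgue. f x * k x) = (\<integral>x. (indicator \<Omega> x *\<^sub>R f x) * k x \<partial>lebesgue)"
    unfolding set_lebesgue_integral_def by (simp add: mult.assoc)
  also have "\<dots> = (\<integral>x. F x * k x \<partial>lebesgue)"
  proof (rule integral_cong_AE)
    show "(\<lambda>x. (indicator \<Omega> x *\<^sub>R f x) * k x) \<in> borel_measurable lebesgue" using f k' by (rule borel_measurable_times)
    show "(\<lambda>x. F x * k x) \<in> borel_measurable lebesgue" using m' by (rule measurable_completion)
    show "AE x in lebesgue. (indicator \<Omega> x *\<^sub>R f x) * k x = F x * k x"
      using AE_lborel_imp_lebesgue[OF ae] by eventually_elim (use k in \<open>auto simp: indicator_def\<close>)
  qed
  also have "\<dots> = (LL x. F x * k x)" using m' by (rule integral_completion)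
  finally show ?thesis .
qed

text \<open>The integral identity of a weak gradient, for Borel functions. The integrals extend over
  the whole space because test functions vanish off \<Omega>; local integrability is stated
  separately, in \<open>compactly_integrable\<close>.\<close>

definition wgrad :: "'a::euclidean_space set \<Rightarrow> ('a \<Rightarrow> real) \<Rightarrow> ('a \<Rightarrow> 'a) \<Rightarrow> bool" where
  "wgrad \<Omega> F G \<longleftrightarrow> (\<forall>\<phi>\<in>test_functions \<Omega>. \<forall>b\<in>Basis.
     (LL x. F x * partial_deriv b \<phi> x) = - (LL x. (G x \<bullet> b) * \<phi> x))"

definition compactly_integrable :: "'a::euclidean_space set \<Rightarrow> ('a \<Rightarrow> 'b::euclidean_space) \<Rightarrow> bool" where
  "compactly_integrable \<Omega> F \<longleftrightarrow> (\<forall>K. compact K \<and> K \<subseteq> \<Omega> \<longrightarrow> integrable lborel (\<lambda>x. indicator K x *\<^sub>R F x))"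

text \<open>The bridge between the definition in the theorem, with Lebesgue measurable functions and
  set integrals, and the Borel form in which the estimates are made.\<close>

lemma has_weak_gradient_iff:
  fixes f :: "'a::euclidean_space \<Rightarrow> real"
  assumes "open \<Omega>" and f: "f \<in> borel_measurable (lebesgue_on \<Omega>)" and g: "g \<in> borel_measurable (lebesgue_on \<Omega>)"
    and [measurable]: "F \<in> Borel" "G \<in> Borel"
    and F: "AE x in lborel. x \<in> \<Omega> \<longrightarrow> f x = F x" and G: "AE x in lborel. x \<in> \<Omega> \<longrightarrow> g x = G x"
  shows "has_weak_gradient \<Omega> f g \<longleftrightarrow> compactly_integrable \<Omega> F \<and> compactly_integrable \<Omega> G \<and> wgrad \<Omega> F G"
proof -
  have "locally_integrable_on \<Omega> f \<longleftrightarrow> compactly_integrable \<Omega> F"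
    unfolding locally_integrable_on_def compactly_integrable_def
    using set_integrable_lebesgue_cong[OF f \<open>open \<Omega>\<close> _ F] by auto
  moreover have "locally_integrable_on \<Omega> g \<longleftrightarrow> compactly_integrable \<Omega> G"
    unfolding locally_integrable_on_def compactly_integrable_def
    using set_integrable_lebesgue_cong[OF g \<open>open \<Omega>\<close> _ G] by auto
  moreover have "(LINT x:\<Omega>|lebesgue. f x * partial_deriv b \<phi> x) = (LL x. F x * partial_deriv b \<phi> x)"
    "(LINT x:\<Omega>|lebesgue. (g x \<bullet> b) * \<phi> x) = (LL x. (G x \<bullet> b) * \<phi> x)"
    if \<phi>: "\<phi> \<in> test_functions \<Omega>" and b: "b \<in> Basis" for \<phi> b
  proof -
    note test_function_smooth(1,2)[OF \<phi> b, THEN borel_measurable_continuous_onI, measurable]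
    have zero: "\<phi> x = 0" "partial_deriv b \<phi> x = 0" if "x \<notin> \<Omega>" for x
      using test_function_zero[OF \<phi>] test_function_support[OF \<phi>] that by blast+
    show "(LINT x:\<Omega>|lebesgue. f x * partial_deriv b \<phi> x) = (LL x. F x * partial_deriv b \<phi> x)"
      by (rule set_integral_lebesgue_mult_cong[OF f \<open>open \<Omega>\<close> _ _ F]) (use zero in auto)
    have "AE x in lborel. x \<in> \<Omega> \<longrightarrow> g x \<bullet> b = G x \<bullet> b" using G by eventually_elim auto
    moreover have "(\<lambda>x. g x \<bullet> b) \<in> borel_measurable (lebesgue_on \<Omega>)" using g by (intro borel_measurable_inner) auto
    ultimately show "(LINT x:\<Omega>|lebesgue. (g x \<bullet> b) * \<phi> x) = (LL x. (G x \<bullet> b) * \<phi> x)"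
      using \<open>open \<Omega>\<close> by (intro set_integral_lebesgue_mult_cong) (use zero in auto)
  qed
  ultimately show ?thesis unfolding has_weak_gradient_def wgrad_def by auto
qed

section \<open>Mollification of weak gradients\<close>

lemma moll_shift_partial:
  assumes "0 < \<epsilon>" "b \<in> Basis"
  shows "partial_deriv b (\<lambda>y. moll \<epsilon> (x - y)) y = - (grad (moll \<epsilon>) (x - y) \<bullet> b)"
proof -
  have "((\<lambda>y. x - y) has_derivative (\<lambda>h. - h)) (at y)" by (auto intro!: derivative_eq_intros)
  from has_derivative_compose[OF this moll_has_derivative[OF assms(1)]]
  have "((\<lambda>y. moll \<epsilon> (x - y)) has_derivative (\<lambda>h. grad (moll \<epsilon>) (x - y) \<bullet> (- h))) (at y)" .
  from frechet_derivative_at[OF this] show ?thesis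
    by (simp add: partial_deriv_def fun_eq_iff)
qed

text \<open>The weak gradient is tested with y -> \<open>moll \<epsilon> (x - y)\<close>, whose
  support lies in the closed \<epsilon>-ball about x and so in \<Omega>. The sign from the inner
  derivative cancels the one in the definition.\<close>

lemma wgrad_conv:
  fixes F :: "'a::euclidean_space \<Rightarrow> real"
  assumes w: "wgrad \<Omega> F G" and F: "locint F" and G: "locint G" and \<epsilon>: "0 < \<epsilon>" and x: "cball x \<epsilon> \<subseteq> \<Omega>"
  shows "grad_conv \<epsilon> F x = conv (moll \<epsilon>) G x"
proof (rule euclidean_eqI)
  fix b :: 'a assume b: "b \<in> Basis"
  have iF: "integrable lborel (\<lambda>y. F y *\<^sub>R grad (moll \<epsilon>) (x - y))"
    by (rule vector_conv_integrable[OF kern_grad_moll[OF \<epsilon>] F])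
  have iG: "integrable lborel (\<lambda>y. moll \<epsilon> (x - y) *\<^sub>R G y)"
    by (rule conv_integrable[OF kern_moll[OF \<epsilon>] G])
  have "grad_conv \<epsilon> F x \<bullet> b = (LL y. (F y *\<^sub>R grad (moll \<epsilon>) (x - y)) \<bullet> b)"
    unfolding grad_conv_def by (rule integral_inner_left[symmetric]) (rule iF)
  also have "\<dots> = - (LL y. F y * partial_deriv b (\<lambda>y. moll \<epsilon> (x - y)) y)"
    by (simp add: moll_shift_partial[OF \<epsilon> b])
  also have "\<dots> = (LL y. (G y \<bullet> b) * moll \<epsilon> (x - y))"
    using w b moll_test_function[OF \<epsilon> x] unfolding wgrad_def by simp
  also have "\<dots> = (LL y. (moll \<epsilon> (x - y) *\<^sub>R G y) \<bullet> b)" by (simp add: mult.commute)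
  also have "\<dots> = conv (moll \<epsilon>) G x \<bullet> b"
    unfolding conv_def by (rule integral_inner_left) (rule iG)
  finally show "grad_conv \<epsilon> F x \<bullet> b = conv (moll \<epsilon>) G x \<bullet> b" .
qed

text \<open>The fundamental lemma of the calculus of variations. At points of a compact K the
  mollifications of D are pairings with test functions, hence 0, while they converge in L^1 to
  D.\<close>

lemma null_if_orthogonal_to_test_functions:
  fixes D :: "'a::euclidean_space \<Rightarrow> 'a"
  assumes "open \<Omega>" and [measurable]: "D \<in> Borel" and D: "compactly_integrable \<Omega> D"
    and orth: "\<And>\<phi> b. \<phi> \<in> test_functions \<Omega> \<Longrightarrow> b \<in> Basis \<Longrightarrow> (LL x. (D x \<bullet> b) * \<phi> x) = 0"
  shows "AE x in lborel. x \<in> \<Omega> \<longrightarrow> D x = 0"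
proof -
  have AE_K: "AE x in lborel. x \<in> K \<longrightarrow> D x = 0" if K: "compact K" "K \<subseteq> \<Omega>" for K
  proof -
    obtain e where e: "e > 0" "(\<Union>x\<in>K. cball x e) \<subseteq> \<Omega>"
      using compact_subset_open_imp_cball_epsilon_subset[OF K(1) \<open>open \<Omega>\<close> K(2)] by blast
    \<comment> \<open>For \<epsilon> < e the mollification at a point of K uses only values of D on
      K', so D can be cut off to K', where it is integrable.\<close>
    define K' where "K' = (\<Union>x\<in>K. cball x e)"
    have K': "compact K'" "K' \<subseteq> \<Omega>" using e compact_minkowski_sum_cball[OF K(1)] unfolding K'_def by auto
    define D' where "D' x = indicator K' x *\<^sub>R D x" for x
    have iD': "integrable lborel D'" using D K' unfolding D'_def compactly_integrable_def by blast
    have [measurable]: "D' \<in> Borel" using iD' by auto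
    have [measurable]: "K \<in> sets borel" using K(1) by (rule borel_compact)
    have zero: "conv (moll \<epsilon>) D' x = 0" if \<epsilon>: "0 < \<epsilon>" "\<epsilon> < e" and x: "x \<in> K" for \<epsilon> x
    proof (rule euclidean_eqI)
      fix b :: 'a assume b: "b \<in> Basis"
      have sub: "cball x \<epsilon> \<subseteq> K'" using x \<epsilon> unfolding K'_def by force
      have "conv (moll \<epsilon>) D' x \<bullet> b = (LL y. (moll \<epsilon> (x - y) *\<^sub>R D' y) \<bullet> b)"
        unfolding conv_def
        by (rule integral_inner_left[symmetric]) (rule conv_integrable[OF kern_moll[OF \<epsilon>(1)] integrable_imp_locint[OF iD']])
      also have "\<dots> = (LL y. (D y \<bullet> b) * moll \<epsilon> (x - y))"
      proof (rule Bochner_Integration.integral_cong[OF refl])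
        fix y
        show "(moll \<epsilon> (x - y) *\<^sub>R D' y) \<bullet> b = (D y \<bullet> b) * moll \<epsilon> (x - y)"
        proof (cases "norm (x - y) < \<epsilon>")
          case True
          then have "y \<in> K'" using sub by (auto simp: dist_norm)
          then show ?thesis by (simp add: D'_def)
        next
          case False
          then show ?thesis using moll_zero[OF \<epsilon>(1), of "x - y"] by simp
        qed
      qed
      also have "\<dots> = 0" using sub K' by (intro orth[OF moll_test_function[OF \<epsilon>(1)] b]) auto
      finally show "conv (moll \<epsilon>) D' x \<bullet> b = 0 \<bullet> b" by simp
    qed
    have "(NN x. ennreal (norm (D' x)) * indicator K x) \<le> 0"
    proof (rule tendsto_lowerbound[OF conv_moll_L1[OF iD']])
      show "\<forall>\<^sub>F \<epsilon> in at_right 0. (NN x. ennreal (norm (D' x)) * indicator K x)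
          \<le> (NN x. ennreal (norm (conv (moll \<epsilon>) D' x - D' x)))"
      proof (rule eventually_at_rightI[of 0 e])
        fix \<epsilon> assume "\<epsilon> \<in> {0<..<e}"
        then show "(NN x. ennreal (norm (D' x)) * indicator K x) \<le> (NN x. ennreal (norm (conv (moll \<epsilon>) D' x - D' x)))"
          using zero by (intro nn_integral_mono) (auto split: split_indicator)
      qed (use e in auto)
    qed simp
    then have "(NN x. ennreal (norm (D' x)) * indicator K x) = 0" by simp
    then have ae: "AE x in lborel. ennreal (norm (D' x)) * indicator K x = 0"
      by (subst (asm) nn_integral_0_iff_AE) auto
    have sub: "K \<subseteq> K'" using e unfolding K'_def by force
    show ?thesis using ae
    proof eventually_elim
      case (elim x)
      then show ?case using sub by (cases "x \<in> K") (auto simp: D'_def subset_iff)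
    qed
  qed
  obtain C :: "nat \<Rightarrow> 'a set" where C: "\<And>n. compact (C n)" "\<And>n. C n \<subseteq> \<Omega>" "\<Omega> = (\<Union>n. C n)" "incseq C"
    using open_sigma_compact[OF assms(1)] by blast
  have "AE x in lborel. \<forall>n. x \<in> C n \<longrightarrow> D x = 0" using AE_K C by (subst AE_all_countable) auto
  then show ?thesis by eventually_elim (use C in auto)
qed

section \<open>The fundamental theorem of calculus for Sobolev functions\<close>

lemma conv_moll_measurable:
  fixes F :: "'a::euclidean_space \<Rightarrow> real"
  assumes "0 < \<epsilon>" "locint F"
  shows "conv (moll \<epsilon>) F \<in> Borel"
  by (intro borel_measurable_continuous_onI continuous_at_imp_continuous_on ballI
      has_derivative_continuous[OF conv_has_derivative[OF assms]])

lemma grad_conv_measurable: "0 < \<epsilon> \<Longrightarrow> locint F \<Longrightarrow> grad_conv \<epsilon> F \<in> Borel"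
  using grad_conv_continuous by (rule borel_measurable_continuous_onI)

lemma nn_integral_ball_shift_le:
  fixes a :: "'a::euclidean_space \<Rightarrow> ennreal"
  assumes [measurable]: "a \<in> Borel" and u: "norm u \<le> r"
  shows "(NN x. a (x + u) * indicator (ball 0 R) x) \<le> (NN x. a x * indicator (ball 0 (R + r)) x)"
proof -
  have "(NN x. a (x + u) * indicator (ball 0 R) x) \<le> (NN x. a (x + u) * indicator (ball 0 (R + r)) (x + u))"
  proof (rule nn_integral_mono)
    fix x
    have "norm (x + u) \<le> norm x + norm u" by (rule norm_triangle_ineq)
    then show "a (x + u) * indicator (ball 0 R) x \<le> a (x + u) * indicator (ball 0 (R + r)) (x + u)"
      using u by (auto split: split_indicator)
  qed
  also have "\<dots> = (NN x. a x * indicator (ball 0 (R + r)) x)"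
    using nn_integral_lborel_shift[of "\<lambda>x. a x * indicator (ball 0 (R + r)) x" u] by simp
  finally show ?thesis .
qed

text \<open>The inequality holds for the mollified function, which is C^1 with gradient the
  mollified G. Both sides converge in L^1 on balls, so it survives almost everywhere.\<close>

lemma sobolev_ftc_bound:
  fixes F :: "'a::euclidean_space \<Rightarrow> real"
  assumes w: "wgrad UNIV F G" and F: "locint F" and G: "locint G"
  shows "ftc_bound F G"
  unfolding ftc_bound_def
proof (intro conjI allI)
  show Fm [measurable]: "F \<in> Borel" and Gm [measurable]: "G \<in> Borel"
    using F G by (auto simp: locint_def)
  fix h :: 'a
  define \<Phi> where "\<Phi> x = ennreal \<bar>F (x + h) - F x\<bar>" for x
  define \<Psi> where "\<Psi> x = (\<integral>\<^sup>+t\<in>{0..1}. ennreal \<bar>G (x + t *\<^sub>R h) \<bullet> h\<bar> \<partial>lborel)" for x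
  have [measurable]: "\<Phi> \<in> Borel" "\<Psi> \<in> Borel"
    unfolding \<Phi>_def \<Psi>_def by measurable
  \<comment> \<open>The error on the ball of radius R: F enters at x and x + h, and G at points of
    the segment, all of which lie in the ball of radius R + |h|.\<close>
  define e where "e \<epsilon> R = 2 * (NN x. ennreal (norm (conv (moll \<epsilon>) F x - F x)) * indicator (ball 0 (R + norm h)) x)
      + ennreal (norm h) * (NN x. ennreal (norm (conv (moll \<epsilon>) G x - G x)) * indicator (ball 0 (R + norm h)) x)" for \<epsilon> R
  \<comment> \<open>Subtraction in ennreal is truncated at 0, so the integrand measures by how much
    the inequality fails.\<close>
  have bound: "(NN x. (\<Phi> x - \<Psi> x) * indicator (ball 0 R) x) \<le> e \<epsilon> R" if \<epsilon>: "0 < \<epsilon>" for \<epsilon> R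
  proof -
    let ?F = "conv (moll \<epsilon>) F" and ?G = "grad_conv \<epsilon> F"
    have GG: "?G x = conv (moll \<epsilon>) G x" for x by (rule wgrad_conv[OF w F G \<epsilon>]) simp
    have [measurable]: "?F \<in> Borel" "?G \<in> Borel"
      using conv_moll_measurable grad_conv_measurable \<epsilon> F by blast+
    define a where "a x = ennreal (norm (?F x - F x))" for x
    define c where "c x = ennreal (norm (?G x - G x))" for x
    have [measurable]: "a \<in> Borel" "c \<in> Borel" unfolding a_def c_def by measurable
    have "ftc_bound ?F ?G" by (rule ftc_bound_C1[OF conv_has_derivative[OF \<epsilon> F] grad_conv_continuous[OF \<epsilon> F]])
    then have "AE x in lborel. ennreal \<bar>?F (x + h) - ?F x\<bar> \<le> (\<integral>\<^sup>+t\<in>{0..1}. ennreal \<bar>?G (x + t *\<^sub>R h) \<bullet> h\<bar> \<partial>lborel)"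
      by (auto simp: ftc_bound_def)
    then have "AE x in lborel. \<Phi> x - \<Psi> x \<le> a (x + h) + a x + (\<integral>\<^sup>+t\<in>{0..1}. ennreal (norm h) * c (x + t *\<^sub>R h) \<partial>lborel)"
    proof eventually_elim
      case (elim x)
      have "\<Phi> x \<le> ennreal \<bar>?F (x + h) - ?F x\<bar> + (a (x + h) + a x)"
        unfolding \<Phi>_def a_def by (simp add: ennreal_plus[symmetric] ennreal_leI del: ennreal_plus)
      also have "\<dots> \<le> (\<integral>\<^sup>+t\<in>{0..1}. ennreal \<bar>?G (x + t *\<^sub>R h) \<bullet> h\<bar> \<partial>lborel) + (a (x + h) + a x)"
        by (intro add_right_mono elim)
      also have "(\<integral>\<^sup>+t\<in>{0..1}. ennreal \<bar>?G (x + t *\<^sub>R h) \<bullet> h\<bar> \<partial>lborel)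
         \<le> (NN t. ennreal \<bar>G (x + t *\<^sub>R h) \<bullet> h\<bar> * indicator {0..1} t + ennreal (norm h) * c (x + t *\<^sub>R h) * indicator {0..1} t)"
      proof (rule nn_integral_mono)
        fix t :: real
        let ?z = "x + t *\<^sub>R h"
        have "\<bar>(?G ?z - G ?z) \<bullet> h\<bar> \<le> norm (?G ?z - G ?z) * norm h" by (rule Cauchy_Schwarz_ineq2)
        then have "\<bar>?G ?z \<bullet> h\<bar> \<le> \<bar>G ?z \<bullet> h\<bar> + norm h * norm (?G ?z - G ?z)"
          by (simp add: inner_diff_left mult.commute)
        then have "ennreal \<bar>?G ?z \<bullet> h\<bar> \<le> ennreal \<bar>G ?z \<bullet> h\<bar> + ennreal (norm h) * c ?z"
          unfolding c_def by (simp add: ennreal_plus[symmetric] ennreal_mult[symmetric] ennreal_leI del: ennreal_plus)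
        then show "ennreal \<bar>?G ?z \<bullet> h\<bar> * indicator {0..1} t \<le> ennreal \<bar>G ?z \<bullet> h\<bar> * indicator {0..1} t + ennreal (norm h) * c ?z * indicator {0..1} t"
          by (auto split: split_indicator)
      qed
      also have "\<dots> = \<Psi> x + (\<integral>\<^sup>+t\<in>{0..1}. ennreal (norm h) * c (x + t *\<^sub>R h) \<partial>lborel)"
        unfolding \<Psi>_def by (rule nn_integral_add) measurable
      finally have "\<Phi> x \<le> \<Psi> x + (a (x + h) + a x + (\<integral>\<^sup>+t\<in>{0..1}. ennreal (norm h) * c (x + t *\<^sub>R h) \<partial>lborel))"
        by (simp add: add_ac)
      moreover have "\<Phi> x \<noteq> top" by (simp add: \<Phi>_def)
      ultimately show ?case by (simp add: ennreal_minus_le_iff)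
    qed
    then have "(NN x. (\<Phi> x - \<Psi> x) * indicator (ball 0 R) x)
       \<le> (NN x. (a (x + h) + a x + (\<integral>\<^sup>+t\<in>{0..1}. ennreal (norm h) * c (x + t *\<^sub>R h) \<partial>lborel)) * indicator (ball 0 R) x)"
      by (intro nn_integral_mono_AE) (auto elim!: eventually_mono intro!: mult_right_mono)
    also have "\<dots> = (NN x. a (x + h) * indicator (ball 0 R) x) + (NN x. a (x + 0) * indicator (ball 0 R) x)
        + (NN x. (NN t. ennreal (norm h) * indicator {0..1} t * (c (x + t *\<^sub>R h) * indicator (ball 0 R) x)))"
    proof -
      have inner: "(\<integral>\<^sup>+t\<in>{0..1}. ennreal (norm h) * c (x + t *\<^sub>R h) \<partial>lborel) * indicator (ball 0 R) x
        = (NN t. ennreal (norm h) * indicator {0..1} t * (c (x + t *\<^sub>R h) * indicator (ball 0 R) x))" for x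
        by (subst nn_integral_multc[symmetric], measurable) (simp only: mult_ac)
      have "(NN x. (a (x + h) + a x + (\<integral>\<^sup>+t\<in>{0..1}. ennreal (norm h) * c (x + t *\<^sub>R h) \<partial>lborel)) * indicator (ball 0 R) x)
        = (NN x. (a (x + h) * indicator (ball 0 R) x + a (x + 0) * indicator (ball 0 R) x)
          + (NN t. ennreal (norm h) * indicator {0..1} t * (c (x + t *\<^sub>R h) * indicator (ball 0 R) x)))"
        by (simp only: distrib_right inner add_0_right)
      then show ?thesis by (simp add: nn_integral_add)
    qed
    also have "(NN x. (NN t. ennreal (norm h) * indicator {0..1} t * (c (x + t *\<^sub>R h) * indicator (ball 0 R) x)))
       = (NN t. (NN x. ennreal (norm h) * indicator {0..1} t * (c (x + t *\<^sub>R h) * indicator (ball 0 R) x)))"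
      by (rule lborel_pair.Fubini') measurable
    also have "\<dots> \<le> (\<integral>\<^sup>+t. ennreal (norm h) * (NN x. c x * indicator (ball 0 (R + norm h)) x) * indicator {0..1} t \<partial>(lborel::real measure))"
    proof (rule nn_integral_mono)
      fix t :: real
      show "(NN x. ennreal (norm h) * indicator {0..1} t * (c (x + t *\<^sub>R h) * indicator (ball 0 R) x))
        \<le> ennreal (norm h) * (NN x. c x * indicator (ball 0 (R + norm h)) x) * indicator {0..1} t"
      proof (cases "t \<in> {0..1}")
        case True
        then have "t * norm h \<le> 1 * norm h" by (intro mult_right_mono) auto
        then have n: "norm (t *\<^sub>R h) \<le> norm h" using True by simp
        have "(NN x. ennreal (norm h) * indicator {0..1} t * (c (x + t *\<^sub>R h) * indicator (ball 0 R) x))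
          = ennreal (norm h) * (NN x. c (x + t *\<^sub>R h) * indicator (ball 0 R) x)"
          using True by (subst nn_integral_cmult[symmetric]) auto
        also have "\<dots> \<le> ennreal (norm h) * (NN x. c x * indicator (ball 0 (R + norm h)) x)"
          by (intro mult_left_mono nn_integral_ball_shift_le n) auto
        finally show ?thesis using True by simp
      qed simp
    qed
    also have "\<dots> = ennreal (norm h) * (NN x. c x * indicator (ball 0 (R + norm h)) x)"
      by (subst nn_integral_cmult_indicator) auto
    also have "(NN x. a (x + h) * indicator (ball 0 R) x) \<le> (NN x. a x * indicator (ball 0 (R + norm h)) x)"
      by (intro nn_integral_ball_shift_le) auto
    also have "(NN x. a (x + 0) * indicator (ball 0 R) x) \<le> (NN x. a x * indicator (ball 0 (R + norm h)) x)"
      by (intro nn_integral_ball_shift_le) auto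
    finally show ?thesis
      unfolding e_def a_def c_def GG by (simp add: mult_2 add_mono)
  qed
  have "AE x in lborel. x \<in> ball 0 R \<longrightarrow> \<Phi> x \<le> \<Psi> x" for R
  proof -
    have "((\<lambda>\<epsilon>. e \<epsilon> R) \<longlongrightarrow> 2 * 0 + ennreal (norm h) * 0) (at_right 0)"
      unfolding e_def
      by (intro tendsto_add ennreal_tendsto_cmult conv_moll_L1_local F G) auto
    moreover have "\<forall>\<^sub>F \<epsilon> in at_right 0. (NN x. (\<Phi> x - \<Psi> x) * indicator (ball 0 R) x) \<le> e \<epsilon> R"
      using eventually_at_right_less[of "0::real"] by eventually_elim (rule bound)
    ultimately have "(NN x. (\<Phi> x - \<Psi> x) * indicator (ball 0 R) x) \<le> 2 * 0 + ennreal (norm h) * 0"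
      by (rule tendsto_lowerbound) simp
    then have "(NN x. (\<Phi> x - \<Psi> x) * indicator (ball 0 R) x) = 0" by simp
    then have "AE x in lborel. (\<Phi> x - \<Psi> x) * indicator (ball 0 R) x = 0"
      by (subst (asm) nn_integral_0_iff_AE) auto
    then show ?thesis
    proof eventually_elim
      case (elim x)
      have "\<Phi> x \<noteq> top" by (simp add: \<Phi>_def)
      with elim show ?case using ennreal_minus_eq_0[of "\<Phi> x" "\<Psi> x"] by (auto simp: indicator_def split: if_splits)
    qed
  qed
  then have "AE x in lborel. \<forall>n::nat. x \<in> ball 0 (real n) \<longrightarrow> \<Phi> x \<le> \<Psi> x"
    by (subst AE_all_countable) auto
  then show "AE x in lborel. ennreal \<bar>F (x + h) - F x\<bar> \<le> (\<integral>\<^sup>+t\<in>{0..1}. ennreal \<bar>G (x + t *\<^sub>R h) \<bullet> h\<bar> \<partial>lborel)"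
  proof eventually_elim
    case (elim x)
    obtain n :: nat where n: "norm x < real n" using reals_Archimedean2 by blast
    have "\<Phi> x \<le> \<Psi> x" using elim[rule_format, of n] n by simp
    then show ?case unfolding \<Phi>_def \<Psi>_def .
  qed
qed

section \<open>The lower bound by mollification\<close>

lemma conv_moll_jensen:
  fixes F :: "'a::euclidean_space \<Rightarrow> real"
  assumes \<epsilon>: "0 < \<epsilon>" and F: "locint F" and p: "p \<ge> 1"
  shows "ennreal (\<bar>conv (moll \<epsilon>) F (x + h) - conv (moll \<epsilon>) F x\<bar> powr p)
    \<le> (NN y. ennreal (moll \<epsilon> y) * ennreal (\<bar>F (x - y + h) - F (x - y)\<bar> powr p))"
proof -
  have [measurable]: "F \<in> Borel" "moll \<epsilon> \<in> borel_measurable (borel :: 'a measure)"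
    using locint_measurable[OF F] moll_measurable[OF \<epsilon>] by auto
  \<comment> \<open>The mollifier is a probability density, so Jensen's inequality applies to the
    average of the translated increments.\<close>
  let ?M = "density lborel (\<lambda>y::'a. ennreal (moll \<epsilon> y))"
  let ?g = "\<lambda>y. \<bar>F (x - y + h) - F (x - y)\<bar>"
  have "ennreal \<bar>conv (moll \<epsilon>) F (x + h) - conv (moll \<epsilon>) F x\<bar> \<le> (\<integral>\<^sup>+y. ennreal (?g y) \<partial>?M)"
  proof -
    note i1 = conv_moll_eq(2)[OF \<epsilon> F, of "x + h"] and i2 = conv_moll_eq(2)[OF \<epsilon> F, of x]
    have "conv (moll \<epsilon>) F (x + h) - conv (moll \<epsilon>) F x = (LL y. moll \<epsilon> y *\<^sub>R F (x + h - y) - moll \<epsilon> y *\<^sub>R F (x - y))"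
      unfolding conv_moll_eq(1)[OF \<epsilon> F] by (rule Bochner_Integration.integral_diff[OF i1 i2, symmetric])
    then have "ennreal \<bar>conv (moll \<epsilon>) F (x + h) - conv (moll \<epsilon>) F x\<bar>
       \<le> (NN y. ennreal (norm (moll \<epsilon> y *\<^sub>R F (x + h - y) - moll \<epsilon> y *\<^sub>R F (x - y))))"
      using integral_norm_bound_ennreal[OF Bochner_Integration.integrable_diff[OF i1 i2]] by simp
    also have "\<dots> = (NN y. ennreal (moll \<epsilon> y) * ennreal (?g y))"
    proof (rule nn_integral_cong)
      fix y :: 'a
      have "moll \<epsilon> y *\<^sub>R F (x + h - y) - moll \<epsilon> y *\<^sub>R F (x - y) = moll \<epsilon> y * (F (x - y + h) - F (x - y))"
        by (simp add: algebra_simps)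
      then show "ennreal (norm (moll \<epsilon> y *\<^sub>R F (x + h - y) - moll \<epsilon> y *\<^sub>R F (x - y))) = ennreal (moll \<epsilon> y) * ennreal (?g y)"
        using moll_nonneg[OF \<epsilon>, of y] by (simp add: abs_mult ennreal_mult[symmetric])
    qed
    also have "\<dots> = (\<integral>\<^sup>+y. ennreal (?g y) \<partial>?M)" by (rule nn_integral_density[symmetric]) measurable
    finally show ?thesis .
  qed
  then have "ennreal (\<bar>conv (moll \<epsilon>) F (x + h) - conv (moll \<epsilon>) F x\<bar> powr p) \<le> (\<integral>\<^sup>+y. ennreal (?g y powr p) \<partial>?M)"
    using moll_nn_integral[OF \<epsilon>, where 'a='a] p
    by (intro powr_le_nn_integral) (auto simp: emeasure_density)
  also have "\<dots> = (NN y. ennreal (moll \<epsilon> y) * ennreal (?g y powr p))"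
    by (rule nn_integral_density) measurable
  finally show ?thesis .
qed

text \<open>For nonnegative exponents the weights decrease in the distance to the boundary, so that
  mollification costs only the replacement of $d_\Omega$ by $d_\Omega + 2\varepsilon$.\<close>

lemma mollified_energy_le:
  fixes \<Omega> :: "'a::euclidean_space set"
  assumes "open \<Omega>" "\<Omega> \<noteq> UNIV" and \<epsilon>: "0 < \<epsilon>" and F: "locint F" and p: "p \<ge> 1"
    and \<alpha>\<beta>: "0 \<le> \<alpha>" "0 \<le> \<beta>"
  shows "(NN x. NN h. ennreal (\<bar>conv (moll \<epsilon>) F (x + h) - conv (moll \<epsilon>) F x\<bar> powr p) * sker s p h
      * (indicator (ball 0 \<epsilon>) h * (ennreal ((bdist \<Omega> x + 2 * \<epsilon>) powr (- (\<alpha> + \<beta>))) * (if x \<in> \<Omega> \<and> 2 * \<epsilon> < bdist \<Omega> x then 1 else 0))))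
    \<le> gagliardo_energy \<Omega> s p \<alpha> \<beta> F"
proof -
  have [measurable]: "\<Omega> \<in> sets borel" using \<open>open \<Omega>\<close> by (rule borel_open)
  have [measurable]: "F \<in> Borel" "moll \<epsilon> \<in> borel_measurable (borel :: 'a measure)"
    using locint_measurable[OF F] moll_measurable[OF \<epsilon>] by auto
  define \<kappa> where "\<kappa> h = sker s p h" for h :: 'a
  define w where "w x = ennreal ((bdist \<Omega> x + 2 * \<epsilon>) powr (- (\<alpha> + \<beta>))) * (if x \<in> \<Omega> \<and> 2 * \<epsilon> < bdist \<Omega> x then 1 else 0)" for x
  have [measurable]: "\<kappa> \<in> Borel" "w \<in> Borel" unfolding \<kappa>_def w_def by measurable
  have ind[measurable]: "(\<lambda>h. indicator (ball 0 \<epsilon>) h :: ennreal) \<in> borel_measurable (borel :: 'a measure)" by simp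
  let ?D = "\<lambda>x h. ennreal (\<bar>F (x + h) - F x\<bar> powr p)"
  have "(NN x. NN h. ennreal (\<bar>conv (moll \<epsilon>) F (x + h) - conv (moll \<epsilon>) F x\<bar> powr p) * \<kappa> h * (indicator (ball 0 \<epsilon>) h * w x))
     \<le> (NN x. NN h. NN y. ennreal (moll \<epsilon> y) * (?D (x - y) h * \<kappa> h * (indicator (ball 0 \<epsilon>) h * w x)))"
  proof (intro nn_integral_mono)
    fix x h :: 'a
    have "ennreal (\<bar>conv (moll \<epsilon>) F (x + h) - conv (moll \<epsilon>) F x\<bar> powr p) * (\<kappa> h * (indicator (ball 0 \<epsilon>) h * w x))
      \<le> (NN y. ennreal (moll \<epsilon> y) * ?D (x - y) h) * (\<kappa> h * (indicator (ball 0 \<epsilon>) h * w x))"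
      by (intro mult_right_mono conv_moll_jensen[OF \<epsilon> F p]) auto
    also have "\<dots> = (NN y. ennreal (moll \<epsilon> y) * ?D (x - y) h * (\<kappa> h * (indicator (ball 0 \<epsilon>) h * w x)))"
      by (rule nn_integral_multc[symmetric]) measurable
    finally show "ennreal (\<bar>conv (moll \<epsilon>) F (x + h) - conv (moll \<epsilon>) F x\<bar> powr p) * \<kappa> h * (indicator (ball 0 \<epsilon>) h * w x)
      \<le> (NN y. ennreal (moll \<epsilon> y) * (?D (x - y) h * \<kappa> h * (indicator (ball 0 \<epsilon>) h * w x)))"
      by (simp only: mult.assoc)
  qed
  also have "\<dots> = (NN x. NN y. NN h. ennreal (moll \<epsilon> y) * (?D (x - y) h * \<kappa> h * (indicator (ball 0 \<epsilon>) h * w x)))"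
    by (intro nn_integral_cong lborel_pair.Fubini') measurable
  also have "\<dots> = (NN y. NN x. NN h. ennreal (moll \<epsilon> y) * (?D (x - y) h * \<kappa> h * (indicator (ball 0 \<epsilon>) h * w x)))"
    by (intro lborel_pair.Fubini') measurable
  also have "\<dots> \<le> (\<integral>\<^sup>+y. ennreal (moll \<epsilon> y) * gagliardo_energy \<Omega> s p \<alpha> \<beta> F \<partial>(lborel :: 'a measure))"
  proof (rule nn_integral_mono)
    fix y :: 'a
    show "(NN x. NN h. ennreal (moll \<epsilon> y) * (?D (x - y) h * \<kappa> h * (indicator (ball 0 \<epsilon>) h * w x)))
      \<le> ennreal (moll \<epsilon> y) * gagliardo_energy \<Omega> s p \<alpha> \<beta> F"
    proof (cases "norm y < \<epsilon>")
      case False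
      then show ?thesis using moll_zero[OF \<epsilon>, of y] by simp
    next
      case True
      have m: "(\<lambda>x. NN h. ?D x h * \<kappa> h * (indicator (ball 0 \<epsilon>) h * w (x + y))) \<in> Borel" by measurable
      have "(NN x. NN h. ennreal (moll \<epsilon> y) * (?D (x - y) h * \<kappa> h * (indicator (ball 0 \<epsilon>) h * w x)))
        = (NN x. ennreal (moll \<epsilon> y) * (NN h. ?D (x - y) h * \<kappa> h * (indicator (ball 0 \<epsilon>) h * w x)))"
        by (intro nn_integral_cong nn_integral_cmult) measurable
      also have "\<dots> = ennreal (moll \<epsilon> y) * (NN x. NN h. ?D (x - y) h * \<kappa> h * (indicator (ball 0 \<epsilon>) h * w x))"
        by (rule nn_integral_cmult) measurable
      also have "(NN x. NN h. ?D (x - y) h * \<kappa> h * (indicator (ball 0 \<epsilon>) h * w x))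
         = (NN x. NN h. ?D x h * \<kappa> h * (indicator (ball 0 \<epsilon>) h * w (x + y)))"
        using nn_integral_lborel_shift[OF m, of "- y"] by simp
      also have "\<dots> \<le> (NN x. NN h. energy_integrand \<Omega> s p \<alpha> \<beta> F x h)"
      proof (intro nn_integral_mono)
        fix x h :: 'a
        show "?D x h * \<kappa> h * (indicator (ball 0 \<epsilon>) h * w (x + y)) \<le> energy_integrand \<Omega> s p \<alpha> \<beta> F x h"
        proof (cases "norm h < \<epsilon> \<and> x + y \<in> \<Omega> \<and> 2 * \<epsilon> < bdist \<Omega> (x + y)")
          case h: True
          \<comment> \<open>The weight is tested at x + y, and |y|, |h| < \<epsilon>. So x and x + h
            are within 2 \<epsilon> of it; this keeps them in \<Omega> and their boundary distances
            below r.\<close>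
          have d1: "dist (x + y) x < \<epsilon>" using True by (simp add: dist_norm)
          have "norm (y - h) \<le> norm y + norm h" by (rule norm_triangle_ineq4)
          then have d2: "dist (x + y) (x + h) < 2 * \<epsilon>" using True h by (simp add: dist_norm)
          have x: "x \<in> \<Omega>" "x + h \<in> \<Omega>"
            using h d1 d2 \<epsilon> by (auto intro!: in_domain_if_near[of "x + y"])
          have pos: "0 < bdist \<Omega> x" "0 < bdist \<Omega> (x + h)" using x by (auto intro!: bdist_pos[OF assms(1,2)])
          define r where "r = bdist \<Omega> (x + y) + 2 * \<epsilon>"
          have r: "bdist \<Omega> x \<le> r" "bdist \<Omega> (x + h) \<le> r"
            using bdist_le_add[of \<Omega> x "x + y"] bdist_le_add[of \<Omega> "x + h" "x + y"] d1 d2 \<epsilon>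
            by (auto simp: r_def dist_commute)
          have "r powr (- \<alpha>) * r powr (- \<beta>) \<le> bdist \<Omega> x powr (- \<alpha>) * bdist \<Omega> (x + h) powr (- \<beta>)"
            using pos r \<alpha>\<beta> by (intro mult_mono powr_mono2') auto
          then have "ennreal (r powr (- (\<alpha> + \<beta>))) \<le> dist_weight \<Omega> \<alpha> x * dist_weight \<Omega> \<beta> (x + h)"
            using pos by (simp add: dist_weight_pos ennreal_mult[symmetric] ennreal_leI powr_add[symmetric])
          from mult_left_mono[OF this, of "?D x h * \<kappa> h"] show ?thesis
            using x h by (simp add: energy_integrand_def w_def r_def \<kappa>_def)
        qed (auto simp: w_def)
      qed
      also have "\<dots> = gagliardo_energy \<Omega> s p \<alpha> \<beta> F"
        by (rule gagliardo_energy_eq[symmetric]) (use \<open>open \<Omega>\<close> in auto)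
      finally show ?thesis by (simp add: mult_left_mono)
    qed
  qed
  also have "\<dots> = gagliardo_energy \<Omega> s p \<alpha> \<beta> F"
    using moll_nn_integral[OF \<epsilon>, where 'a='a] by (subst nn_integral_multc) auto
  finally show ?thesis unfolding \<kappa>_def w_def .
qed

text \<open>For fixed \<epsilon> the mollified function is differentiable, so the pointwise lower
  bound and Fatou's lemma apply as s tends to 1. The bound l is the same for all \<epsilon>; both
  the limit \<epsilon> -> 0 and the compactness argument rely on this.\<close>

lemma mollified_energy_lower:
  fixes \<Omega> :: "'a::euclidean_space set"
  assumes "open \<Omega>" "\<Omega> \<noteq> UNIV" and \<epsilon>: "0 < \<epsilon>" and F: "locint F" and p: "p \<ge> 1"
    and \<alpha>\<beta>: "0 \<le> \<alpha>" "0 \<le> \<beta>"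
    and S: "S \<longlonglongrightarrow> 1" "\<And>n. 0 < S n" "\<And>n. S n < 1"
    and le: "\<And>n. ennreal (1 - S n) * gagliardo_energy \<Omega> (S n) p \<alpha> \<beta> F \<le> l"
  shows "ennreal (K_const DIM('a) p) * (NN x. ennreal (norm (grad_conv \<epsilon> F x) powr p)
      * (ennreal ((bdist \<Omega> x + 2 * \<epsilon>) powr (- (\<alpha> + \<beta>))) * (if x \<in> \<Omega> \<and> 2 * \<epsilon> < bdist \<Omega> x then 1 else 0))) \<le> l"
proof -
  have [measurable]: "\<Omega> \<in> sets borel" using \<open>open \<Omega>\<close> by (rule borel_open)
  have [measurable]: "conv (moll \<epsilon>) F \<in> Borel" "grad_conv \<epsilon> F \<in> Borel"
    using conv_moll_measurable grad_conv_measurable \<epsilon> F by blast+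
  define w where "w x = ennreal ((bdist \<Omega> x + 2 * \<epsilon>) powr (- (\<alpha> + \<beta>))) * (if x \<in> \<Omega> \<and> 2 * \<epsilon> < bdist \<Omega> x then 1 else 0)" for x
  have [measurable]: "w \<in> Borel" unfolding w_def by measurable
  have wfin: "w x < top" for x by (simp add: w_def)
  have ind[measurable]: "(\<lambda>h. indicator (ball 0 \<epsilon>) h :: ennreal) \<in> borel_measurable (borel :: 'a measure)" by simp
  let ?e = "\<lambda>n x h. ennreal (\<bar>conv (moll \<epsilon>) F (x + h) - conv (moll \<epsilon>) F x\<bar> powr p) * sker (S n) p h"
  let ?I = "\<lambda>n x. ennreal (1 - S n) * (NN h. ?e n x h * (indicator (ball 0 \<epsilon>) h * w x))"
  have "ennreal (K_const DIM('a) p) * (NN x. ennreal (norm (grad_conv \<epsilon> F x) powr p) * w x)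
     = (NN x. ennreal (K_const DIM('a) p) * (ennreal (norm (grad_conv \<epsilon> F x) powr p) * w x))"
    by (rule nn_integral_cmult[symmetric]) measurable
  also have "\<dots> \<le> (NN x. liminf (\<lambda>n. ?I n x))"
  proof (rule nn_integral_mono)
    fix x
    let ?J = "\<lambda>n. ennreal (1 - S n) * (NN h. ennreal (\<bar>conv (moll \<epsilon>) F (x + h) - conv (moll \<epsilon>) F x\<bar> powr p) * indicator (ball 0 \<epsilon>) h
         * sker (S n) p h)"
    have "ennreal (K_const DIM('a) p) * (ennreal (norm (grad_conv \<epsilon> F x) powr p) * w x)
        = w x * ennreal (K_const DIM('a) p * norm (grad_conv \<epsilon> F x) powr p)"
      using K_const_nonneg[OF p, of "DIM('a)"] by (simp add: ennreal_mult mult_ac)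
    also have "\<dots> \<le> w x * liminf ?J"
      by (intro mult_left_mono kernel_liminf[OF conv_has_derivative[OF \<epsilon> F] _ p \<epsilon> S]) auto
    also have "\<dots> = liminf (\<lambda>n. w x * ?J n)"
      by (intro Liminf_compose_continuous_mono[symmetric, where f="\<lambda>y. w x * y"])
         (auto intro!: ennreal_continuous_on_cmult continuous_intros monoI mult_left_mono wfin)
    also have "(\<lambda>n. w x * ?J n) = (\<lambda>n. ?I n x)"
    proof
      fix n
      have "w x * ?J n = ennreal (1 - S n) * (w x * (NN h. ennreal (\<bar>conv (moll \<epsilon>) F (x + h) - conv (moll \<epsilon>) F x\<bar> powr p) * indicator (ball 0 \<epsilon>) h
         * sker (S n) p h))" by (simp only: mult_ac)
      also have "\<dots> = ?I n x"
        by (subst nn_integral_cmult[symmetric], measurable) (simp only: mult_ac)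
      finally show "w x * ?J n = ?I n x" .
    qed
    finally show "ennreal (K_const DIM('a) p) * (ennreal (norm (grad_conv \<epsilon> F x) powr p) * w x) \<le> liminf (\<lambda>n. ?I n x)" .
  qed
  also have "\<dots> \<le> liminf (\<lambda>n. NN x. ?I n x)"
    by (rule nn_integral_liminf) measurable
  also have "\<dots> \<le> liminf (\<lambda>n. l)"
  proof (intro Liminf_mono always_eventually allI)
    fix n
    have "(NN x. ?I n x) = ennreal (1 - S n) * (NN x. NN h. ?e n x h * (indicator (ball 0 \<epsilon>) h * w x))"
      by (rule nn_integral_cmult) measurable
    also have "\<dots> \<le> ennreal (1 - S n) * gagliardo_energy \<Omega> (S n) p \<alpha> \<beta> F"
      unfolding w_def by (intro mult_left_mono mollified_energy_le assms) auto
    also have "\<dots> \<le> l" by (rule le)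
    finally show "(NN x. ?I n x) \<le> l" .
  qed
  finally show ?thesis by (simp add: Liminf_const w_def)
qed

text \<open>The rate has two uses: summable errors give convergence almost everywhere, and the
  powers of 1/2 are the tolerances in the compactness argument.\<close>

lemma conv_moll_fast_sequence:
  fixes F :: "'a::euclidean_space \<Rightarrow> 'b::euclidean_space"
  assumes F: "locint F"
  obtains \<epsilon> :: "nat \<Rightarrow> real" where "\<And>k. 0 < \<epsilon> k" "\<And>k. \<epsilon> k \<le> inverse (real (Suc k))"
    "\<And>k. (NN x. ennreal (norm (conv (moll (\<epsilon> k)) F x - F x)) * indicator (ball 0 (real k)) x) \<le> ennreal ((1/2) ^ k)"
proof -
  have "\<exists>e. 0 < e \<and> e \<le> inverse (real (Suc k)) \<and>
    (NN x. ennreal (norm (conv (moll e) F x - F x)) * indicator (ball 0 (real k)) x) \<le> ennreal ((1/2) ^ k)" for k :: nat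
  proof -
    have "\<forall>\<^sub>F e in at_right 0. (NN x. ennreal (norm (conv (moll e) F x - F x)) * indicator (ball 0 (real k)) x) < ennreal ((1/2) ^ k)"
      by (intro order_tendstoD(2)[OF conv_moll_L1_local[OF F]]) simp
    moreover have "\<forall>\<^sub>F e in at_right 0. 0 < e \<and> e \<le> inverse (real (Suc k))"
      by (rule eventually_at_rightI[of 0 "inverse (real (Suc k))"]) auto
    ultimately have "\<forall>\<^sub>F e in at_right 0. 0 < e \<and> e \<le> inverse (real (Suc k)) \<and>
      (NN x. ennreal (norm (conv (moll e) F x - F x)) * indicator (ball 0 (real k)) x) \<le> ennreal ((1/2) ^ k)"
      by eventually_elim auto
    then show ?thesis using eventually_happens'[OF trivial_limit_at_right_real] by blast
  qed
  then show ?thesis using that by metis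
qed

text \<open>The errors have summable integrals over growing balls, so at almost every point they are
  summable and tend to 0.\<close>

lemma conv_moll_AE_sequence:
  fixes G :: "'a::euclidean_space \<Rightarrow> 'b::euclidean_space"
  assumes G: "locint G" and meas: "\<And>e. 0 < e \<Longrightarrow> conv (moll e) G \<in> Borel"
  obtains \<epsilon> :: "nat \<Rightarrow> real" where "\<And>k. 0 < \<epsilon> k" "\<epsilon> \<longlonglongrightarrow> 0"
    "AE x in lborel. (\<lambda>k. conv (moll (\<epsilon> k)) G x) \<longlonglongrightarrow> G x"
proof -
  obtain \<epsilon> :: "nat \<Rightarrow> real" where \<epsilon>: "\<And>k. 0 < \<epsilon> k" "\<And>k. \<epsilon> k \<le> inverse (real (Suc k))"
    "\<And>k. (NN x. ennreal (norm (conv (moll (\<epsilon> k)) G x - G x)) * indicator (ball 0 (real k)) x) \<le> ennreal ((1/2) ^ k)"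
    using conv_moll_fast_sequence[OF G] by blast
  have [measurable]: "conv (moll (\<epsilon> k)) G \<in> Borel" "G \<in> Borel" for k
    using meas[OF \<epsilon>(1)] locint_measurable[OF G] by auto
  define a where "a k x = norm (conv (moll (\<epsilon> k)) G x - G x) * indicator (ball 0 (real k)) x" for k x
  have [measurable]: "a k \<in> Borel" for k unfolding a_def by measurable
  have "(NN x. (\<Sum>k. ennreal (a k x))) = (\<Sum>k. NN x. ennreal (a k x))"
    by (rule nn_integral_suminf) measurable
  also have "\<dots> \<le> (\<Sum>k. ennreal ((1/2) ^ k))"
  proof (intro suminf_le allI)
    fix k
    show "(NN x. ennreal (a k x)) \<le> ennreal ((1/2) ^ k)"
      using \<epsilon>(3)[of k] unfolding a_def by (simp add: ennreal_mult' ennreal_indicator)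
  qed auto
  also have "\<dots> = ennreal (\<Sum>k. (1/2) ^ k)" by (rule suminf_ennreal_eq) (auto simp: summable_sums)
  finally have "(NN x. (\<Sum>k. ennreal (a k x))) \<noteq> \<infinity>" by (auto simp: top_unique)
  then have "AE x in lborel. (\<Sum>k. ennreal (a k x)) \<noteq> \<infinity>"
    by (intro nn_integral_PInf_AE) auto
  then have "AE x in lborel. (\<lambda>k. conv (moll (\<epsilon> k)) G x) \<longlonglongrightarrow> G x"
  proof eventually_elim
    case (elim x)
    have "summable (\<lambda>k. a k x)" using elim by (intro summable_suminf_not_top) (auto simp: a_def)
    then have lim: "(\<lambda>k. a k x) \<longlonglongrightarrow> 0" by (rule summable_LIMSEQ_zero)
    obtain n :: nat where n: "norm x < real n" using reals_Archimedean2 by blast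
    have "\<forall>\<^sub>F k in sequentially. a k x = norm (conv (moll (\<epsilon> k)) G x - G x)"
      using eventually_ge_at_top[of n] by eventually_elim (use n in \<open>auto simp: a_def\<close>)
    with lim have "(\<lambda>k. norm (conv (moll (\<epsilon> k)) G x - G x)) \<longlonglongrightarrow> 0"
      by (rule Lim_transform_eventually)
    then show ?case using LIM_zero_cancel tendsto_norm_zero_iff by blast
  qed
  moreover have "\<epsilon> \<longlonglongrightarrow> 0"
    by (rule tendsto_sandwich[OF _ _ tendsto_const LIMSEQ_inverse_real_of_nat])
       (use \<epsilon>(1,2) in \<open>auto simp: less_imp_le\<close>)
  ultimately show ?thesis using that \<epsilon>(1) by blast
qed

lemma conv_measurable_vector:
  fixes G :: "'a::euclidean_space \<Rightarrow> 'b::euclidean_space"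
  assumes e: "0 < e" and G: "locint G"
  shows "conv (moll e) G \<in> Borel"
proof -
  have [measurable]: "G \<in> Borel" "moll e \<in> borel_measurable (borel :: 'a measure)"
    using locint_measurable[OF G] moll_measurable[OF e] by auto
  show ?thesis unfolding conv_def[abs_def] by measurable
qed

text \<open>A further use of Fatou's lemma, now in \<epsilon>. At a point of \<Omega> the closed
  \<epsilon>-ball eventually lies in \<Omega>, so the mollified gradient is the convolution of G
  there and tends to G almost everywhere.\<close>

lemma sobolev_energy_lower:
  fixes \<Omega> :: "'a::euclidean_space set"
  assumes "open \<Omega>" "\<Omega> \<noteq> UNIV" and w: "wgrad \<Omega> F G" and F: "locint F" and G: "locint G" and p: "p \<ge> 1"
    and \<alpha>\<beta>: "0 \<le> \<alpha>" "0 \<le> \<beta>"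
    and S: "S \<longlonglongrightarrow> 1" "\<And>n. 0 < S n" "\<And>n. S n < 1"
    and le: "\<And>n. ennreal (1 - S n) * gagliardo_energy \<Omega> (S n) p \<alpha> \<beta> F \<le> l"
  shows "ennreal (K_const DIM('a) p) * (NN x. ennreal (norm (G x) powr p) * dist_weight \<Omega> (\<alpha> + \<beta>) x * indicator \<Omega> x) \<le> l"
proof -
  have [measurable]: "\<Omega> \<in> sets borel" using \<open>open \<Omega>\<close> by (rule borel_open)
  have [measurable]: "G \<in> Borel" using locint_measurable[OF G] .
  obtain \<epsilon> :: "nat \<Rightarrow> real" where \<epsilon>: "\<And>k. 0 < \<epsilon> k" "\<epsilon> \<longlonglongrightarrow> 0"
    "AE x in lborel. (\<lambda>k. conv (moll (\<epsilon> k)) G x) \<longlonglongrightarrow> G x"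
    using conv_moll_AE_sequence[OF G conv_measurable_vector[OF _ G]] by blast
  have [measurable]: "grad_conv (\<epsilon> k) F \<in> Borel" for k
    using grad_conv_measurable[OF \<epsilon>(1) F] .
  define W where "W k x = ennreal ((bdist \<Omega> x + 2 * \<epsilon> k) powr (- (\<alpha> + \<beta>))) * (if x \<in> \<Omega> \<and> 2 * \<epsilon> k < bdist \<Omega> x then 1 else 0)" for k x
  have [measurable]: "W k \<in> Borel" for k unfolding W_def by measurable
  let ?I = "\<lambda>k x. ennreal (K_const DIM('a) p) * (ennreal (norm (grad_conv (\<epsilon> k) F x) powr p) * W k x)"
  have "ennreal (K_const DIM('a) p) * (NN x. ennreal (norm (G x) powr p) * dist_weight \<Omega> (\<alpha> + \<beta>) x * indicator \<Omega> x)
    = (NN x. ennreal (K_const DIM('a) p) * (ennreal (norm (G x) powr p) * dist_weight \<Omega> (\<alpha> + \<beta>) x * indicator \<Omega> x))"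
    by (rule nn_integral_cmult[symmetric]) measurable
  also have "\<dots> \<le> (NN x. liminf (\<lambda>k. ?I k x))"
  proof (rule nn_integral_mono_AE)
    show "AE x in lborel. ennreal (K_const DIM('a) p) * (ennreal (norm (G x) powr p) * dist_weight \<Omega> (\<alpha> + \<beta>) x * indicator \<Omega> x) \<le> liminf (\<lambda>k. ?I k x)"
      using \<epsilon>(3)
    proof eventually_elim
      case (elim x)
      show ?case
      proof (cases "x \<in> \<Omega>")
        case True
        have dx: "0 < bdist \<Omega> x" by (rule bdist_pos[OF assms(1,2) True])
        have "(\<lambda>k. 2 * \<epsilon> k) \<longlonglongrightarrow> 2 * 0" by (intro tendsto_intros \<epsilon>(2))
        then have ev: "\<forall>\<^sub>F k in sequentially. 2 * \<epsilon> k < bdist \<Omega> x" using dx by (intro order_tendstoD(2)) auto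
        have "(\<lambda>k. ennreal (K_const DIM('a) p) * (ennreal (norm (conv (moll (\<epsilon> k)) G x) powr p * (bdist \<Omega> x + 2 * \<epsilon> k) powr (- (\<alpha> + \<beta>)))))
           \<longlonglongrightarrow> ennreal (K_const DIM('a) p) * (ennreal (norm (G x) powr p * (bdist \<Omega> x + 2 * 0) powr (- (\<alpha> + \<beta>))))"
          using dx p by (intro ennreal_tendsto_cmult tendsto_ennrealI tendsto_mult tendsto_powr' tendsto_norm elim tendsto_powr tendsto_intros \<epsilon>(2)) auto
        also have "ennreal (norm (G x) powr p * (bdist \<Omega> x + 2 * 0) powr (- (\<alpha> + \<beta>))) = ennreal (norm (G x) powr p) * dist_weight \<Omega> (\<alpha> + \<beta>) x * indicator \<Omega> x"
          using True dx by (simp add: dist_weight_pos ennreal_mult)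
        finally have lim: "(\<lambda>k. ennreal (K_const DIM('a) p) * (ennreal (norm (conv (moll (\<epsilon> k)) G x) powr p * (bdist \<Omega> x + 2 * \<epsilon> k) powr (- (\<alpha> + \<beta>)))))
           \<longlonglongrightarrow> ennreal (K_const DIM('a) p) * (ennreal (norm (G x) powr p) * dist_weight \<Omega> (\<alpha> + \<beta>) x * indicator \<Omega> x)" .
        have "\<forall>\<^sub>F k in sequentially. ennreal (K_const DIM('a) p) * (ennreal (norm (conv (moll (\<epsilon> k)) G x) powr p * (bdist \<Omega> x + 2 * \<epsilon> k) powr (- (\<alpha> + \<beta>)))) = ?I k x"
          using ev
        proof eventually_elim
          case (elim k)
          have "cball x (\<epsilon> k) \<subseteq> \<Omega>"
            using elim \<epsilon>(1)[of k] by (auto intro!: in_domain_if_near[OF True])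
          then have "grad_conv (\<epsilon> k) F x = conv (moll (\<epsilon> k)) G x" by (rule wgrad_conv[OF w F G \<epsilon>(1)])
          then show ?case using elim True by (simp add: W_def ennreal_mult)
        qed
        with lim have "(\<lambda>k. ?I k x) \<longlonglongrightarrow> ennreal (K_const DIM('a) p) * (ennreal (norm (G x) powr p) * dist_weight \<Omega> (\<alpha> + \<beta>) x * indicator \<Omega> x)"
          by (rule Lim_transform_eventually)
        then show ?thesis by (subst lim_imp_Liminf) auto
      qed simp
    qed
  qed
  also have "\<dots> \<le> liminf (\<lambda>k. NN x. ?I k x)"
    by (rule nn_integral_liminf) measurable
  also have "\<dots> \<le> liminf (\<lambda>k::nat. l)"
  proof (intro Liminf_mono always_eventually allI)
    fix k
    have "(NN x. ?I k x) = ennreal (K_const DIM('a) p) * (NN x. ennreal (norm (grad_conv (\<epsilon> k) F x) powr p) * W k x)"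
      by (rule nn_integral_cmult) measurable
    also have "\<dots> \<le> l"
      unfolding W_def by (rule mollified_energy_lower[OF assms(1,2) \<epsilon>(1) F p \<alpha>\<beta> S le])
    finally show "(NN x. ?I k x) \<le> l" .
  qed
  finally show ?thesis by (simp add: Liminf_const)
qed

section \<open>Integration by parts\<close>

lemma kern_integrable: "kern R k \<Longrightarrow> integrable lborel (k :: 'a::euclidean_space \<Rightarrow> 'b::euclidean_space)"
proof -
  assume k: "kern R k"
  have "integrable lborel (\<lambda>x. indicator (cball 0 R) x *\<^sub>R k x)"
    using k by (intro borel_integrable_compact) (auto simp: kern_def intro: continuous_on_subset)
  moreover have "(\<lambda>x. indicator (cball 0 R) x *\<^sub>R k x) = k"
    using k by (auto simp: fun_eq_iff kern_def indicator_def)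
  ultimately show ?thesis by simp
qed

text \<open>By translation invariance the increment of H over r b has integral 0. Its linear part is
  r times the integral of D . b, and the uniform remainder is at most e r |b| on a ball of fixed
  volume.\<close>

lemma integral_derivative_zero:
  fixes H :: "'a::euclidean_space \<Rightarrow> real"
  assumes der: "\<And>x. (H has_derivative (\<lambda>h. D x \<bullet> h)) (at x)" and D: "kern R D" and H: "kern R H"
  shows "(LL x. D x \<bullet> b) = 0"
proof (cases "b = 0")
  case False
  have iD: "integrable lborel (\<lambda>x. D x \<bullet> b)" by (intro integrable_inner_left kern_integrable[OF D])
  have iH: "integrable lborel H" by (rule kern_integrable[OF H])
  have [measurable]: "H \<in> Borel" using kern_measurable[OF H] .
  define V where "V = measure lborel (ball (0::'a) (R + 1))"
  have "\<bar>(LL x. D x \<bullet> b)\<bar> \<le> e * (norm b * V)" if e: "e > 0" for e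
  proof -
    obtain \<delta> where \<delta>: "0 < \<delta>" "\<delta> \<le> 1" "\<And>u h. norm h < \<delta> \<Longrightarrow> \<bar>H (u + h) - H u - D u \<bullet> h\<bar> \<le> e * norm h"
      using uniformly_differentiable[OF der D e] by blast
    \<comment> \<open>The increment r b has length \<delta> / 2, within the range of uniform
      differentiability.\<close>
    define r where "r = \<delta> / (2 * norm b)"
    have r: "r > 0" "norm (r *\<^sub>R b) < \<delta>" using False \<delta> by (auto simp: r_def)
    have iH': "integrable lborel (\<lambda>x. H (x + r *\<^sub>R b))"
    proof -
      have "integrable (distr lborel borel (\<lambda>x. x + r *\<^sub>R b)) H" using iH by (simp add: lborel_distr_shift)
      then show ?thesis by (subst (asm) integrable_distr_eq) auto
    qed
    have eqH: "(LL x. H (x + r *\<^sub>R b)) = (LL x. H x)"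
      by (subst (2) lborel_distr_shift[of "r *\<^sub>R b", symmetric]) (simp add: integral_distr)
    have iDr: "integrable lborel (\<lambda>x. D x \<bullet> (r *\<^sub>R b))" using iD by simp
    have "r * (LL x. D x \<bullet> b) = - (LL x. H (x + r *\<^sub>R b) - H x - D x \<bullet> (r *\<^sub>R b))"
    proof -
      have "(LL x. H (x + r *\<^sub>R b) - H x - D x \<bullet> (r *\<^sub>R b)) = (LL x. H (x + r *\<^sub>R b)) - (LL x. H x) - (LL x. D x \<bullet> (r *\<^sub>R b))"
        by (simp only: Bochner_Integration.integral_diff[OF Bochner_Integration.integrable_diff[OF iH' iH] iDr] Bochner_Integration.integral_diff[OF iH' iH])
      then show ?thesis by (simp add: eqH)
    qed
    then have "r * \<bar>(LL x. D x \<bullet> b)\<bar> = \<bar>(LL x. H (x + r *\<^sub>R b) - H x - D x \<bullet> (r *\<^sub>R b))\<bar>"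
      using r by (metis abs_minus_cancel abs_mult abs_of_pos)
    also have "\<dots> \<le> (LL x. indicator (ball (0::'a) (R + 1)) x * (e * (r * norm b)))"
    proof (rule Bochner_Integration.integral_abs_bound_integral)
      show "integrable lborel (\<lambda>x. H (x + r *\<^sub>R b) - H x - D x \<bullet> (r *\<^sub>R b))"
        by (intro Bochner_Integration.integrable_diff iH' iH iDr)
      show "integrable lborel (\<lambda>x::'a. indicator (ball 0 (R + 1)) x * (e * (r * norm b)))"
        by (intro integrable_mult_left integrable_real_indicator) (use emeasure_bounded_finite[OF bounded_ball, of "0::'a" "R + 1"] in auto)
      fix x :: 'a
      show "\<bar>H (x + r *\<^sub>R b) - H x - D x \<bullet> (r *\<^sub>R b)\<bar> \<le> indicator (ball 0 (R + 1)) x * (e * (r * norm b))"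
      proof (cases "norm x < R + 1")
        case True
        then show ?thesis using \<delta>(3)[OF r(2), of x] r by simp
      next
        case False
        have "norm x \<le> norm (x + r *\<^sub>R b) + norm (r *\<^sub>R b)"
          using norm_triangle_ineq4[of "x + r *\<^sub>R b" "r *\<^sub>R b"] by simp
        then have "R \<le> norm (x + r *\<^sub>R b)" "R \<le> norm x" using False r \<delta>(2) by linarith+
        then have "H (x + r *\<^sub>R b) = 0" "H x = 0" "D x = 0" using D H unfolding kern_def by blast+
        then show ?thesis using False by simp
      qed
    qed
    also have "\<dots> = r * (e * (norm b * V))" by (simp add: V_def)
    finally show ?thesis using r by simp
  qed
  then have ev: "\<forall>\<^sub>F e in at_right 0. \<bar>(LL x. D x \<bullet> b)\<bar> \<le> e * (norm b * V)"
    by (auto intro: eventually_mono[OF eventually_at_right_less])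
  have "((\<lambda>e. e * (norm b * V)) \<longlongrightarrow> 0 * (norm b * V)) (at_right 0)" by (intro tendsto_intros)
  from tendsto_lowerbound[OF this ev] have "\<bar>(LL x. D x \<bullet> b)\<bar> \<le> 0" by simp
  then show ?thesis by simp
qed simp

text \<open>The product of the mollified function with \<phi> is C^1 with compact support, so the
  integral of its derivative vanishes.\<close>

lemma conv_integration_by_parts:
  fixes F :: "'a::euclidean_space \<Rightarrow> real"
  assumes \<epsilon>: "0 < \<epsilon>" and F: "locint F" and \<phi>: "\<phi> \<in> test_functions \<Omega>" and b: "b \<in> Basis"
  shows "(LL x. conv (moll \<epsilon>) F x * partial_deriv b \<phi> x) = - (LL x. (grad_conv \<epsilon> F x \<bullet> b) * \<phi> x)"
proof -
  let ?f = "conv (moll \<epsilon>) F" and ?v = "grad_conv \<epsilon> F"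
  obtain R where R: "\<And>x. R \<le> norm x \<Longrightarrow> x \<notin> supp \<phi>"
  proof -
    obtain B where "\<And>x. x \<in> supp \<phi> \<Longrightarrow> norm x \<le> B"
      using compact_imp_bounded[OF test_function_support(1)[OF \<phi>]] unfolding bounded_iff by blast
    then show ?thesis by (intro that[of "B + 1"]) force
  qed
  have "C_k (Suc 0) \<phi>" using \<phi> by (simp add: test_functions_def)
  then have cg: "continuous_on UNIV (grad \<phi>)" by (rule C_k_Suc_continuous_grad)
  have cf: "continuous_on UNIV ?f"
    by (intro continuous_at_imp_continuous_on ballI has_derivative_continuous[OF conv_has_derivative[OF \<epsilon> F]])
  note cv = grad_conv_continuous[OF \<epsilon> F]
  note sm = test_function_smooth[OF \<phi> b]
  have z: "\<phi> x = 0" "partial_deriv c \<phi> x = 0" if "R \<le> norm x" for x c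
    using test_function_zero[OF \<phi> R[OF that]] by auto
  then have zg: "grad \<phi> x = 0" if "R \<le> norm x" for x using that by (simp add: grad_def)
  let ?D = "\<lambda>x. ?f x *\<^sub>R grad \<phi> x + \<phi> x *\<^sub>R ?v x"
  have "(LL x. ?D x \<bullet> b) = 0"
  proof (rule integral_derivative_zero[where H="\<lambda>x. ?f x * \<phi> x" and R=R])
    show "((\<lambda>x. ?f x * \<phi> x) has_derivative (\<lambda>h. ?D x \<bullet> h)) (at x)" for x
      using has_derivative_mult[OF conv_has_derivative[OF \<epsilon> F, of x] sm(3)]
      by (simp add: inner_add_left mult.commute)
    show "kern R ?D" unfolding kern_def using z zg by (auto intro!: continuous_intros cf cg cv sm)
    show "kern R (\<lambda>x. ?f x * \<phi> x)" unfolding kern_def using z by (auto intro!: continuous_intros cf sm)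
  qed
  moreover have "integrable lborel (\<lambda>x. ?f x * partial_deriv b \<phi> x)"
    by (rule kern_integrable[of R]) (use z in \<open>auto simp: kern_def intro!: continuous_intros cf sm\<close>)
  moreover have "integrable lborel (\<lambda>x. (?v x \<bullet> b) * \<phi> x)"
    by (rule kern_integrable[of R]) (use z in \<open>auto simp: kern_def intro!: continuous_intros cv sm\<close>)
  moreover have "?D x \<bullet> b = ?f x * partial_deriv b \<phi> x + (?v x \<bullet> b) * \<phi> x" for x
    using b by (simp add: inner_add_left grad_inner_Basis mult.commute)
  ultimately show ?thesis by simp
qed

section \<open>A gradient from bounded energies\<close>

lemma powr_strict_convex:
  fixes x y p :: real
  assumes p: "p > 1" and "0 \<le> x" "x < y"
  shows "((x + y) / 2) powr p < (x powr p + y powr p) / 2"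
proof (cases "x = 0")
  case True
  have "(1/2::real) powr p < (1/2) powr 1" using p by (intro powr_less_mono') auto
  then have "y powr p * (1/2) powr p < y powr p * (1/2)" using assms by (intro mult_strict_left_mono) auto
  moreover have "(y / 2) powr p = y powr p * (1/2) powr p" using assms powr_mult[of y "1/2" p] by simp
  ultimately show ?thesis using True by simp
next
  case False
  then have x: "0 < x" using assms by simp
  define m where "m = (x + y) / 2"
  have m: "x < m" "m < y" using assms by (auto simp: m_def)
  have der: "((\<lambda>t. t powr p) has_real_derivative p * t powr (p - 1)) (at t)" if "0 < t" for t
    using that by (auto intro!: derivative_eq_intros)
  \<comment> \<open>The two halves of the interval have equal length and the derivative is strictly
    increasing, so the increment on the right half is larger.\<close>
  obtain z where z: "m < z" "z < y" "y powr p - m powr p = (y - m) * (p * z powr (p - 1))"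
    using MVT2[OF m(2), of "\<lambda>t. t powr p" "\<lambda>t. p * t powr (p - 1)"] der x m by force
  obtain w where w: "x < w" "w < m" "m powr p - x powr p = (m - x) * (p * w powr (p - 1))"
    using MVT2[OF m(1), of "\<lambda>t. t powr p" "\<lambda>t. p * t powr (p - 1)"] der x by force
  have "w powr (p - 1) < z powr (p - 1)" using w z x p by (intro powr_less_mono2) auto
  then have "(m - x) * (p * w powr (p - 1)) < (y - m) * (p * z powr (p - 1))"
  proof -
    have eq: "m - x = y - m" by (simp add: m_def field_simps)
    show ?thesis unfolding eq using \<open>w powr (p - 1) < z powr (p - 1)\<close> p m
      by (intro mult_strict_left_mono) auto
  qed
  then show ?thesis using w z by (simp add: m_def)
qed

text \<open>If the norms differ, strict convexity of t^p decides; if they agree, the parallelogram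
  law makes the midpoint strictly shorter.\<close>

lemma norm_powr_midpoint_less:
  fixes a b :: "'a::real_inner"
  assumes p: "p > 1" and "a \<noteq> b"
  shows "norm ((1/2) *\<^sub>R (a + b)) powr p < (norm a powr p + norm b powr p) / 2"
proof -
  have tri: "norm ((1/2) *\<^sub>R (a + b)) \<le> (norm a + norm b) / 2"
    using norm_triangle_ineq[of a b] by simp
  consider "norm a < norm b" | "norm b < norm a" | "norm a = norm b" by linarith
  then show ?thesis
  proof cases
    case 1
    have "norm ((1/2) *\<^sub>R (a + b)) powr p \<le> ((norm a + norm b) / 2) powr p" using tri p by (intro powr_mono2) auto
    also have "\<dots> < (norm a powr p + norm b powr p) / 2" using 1 p by (intro powr_strict_convex) auto
    finally show ?thesis .
  next
    case 2
    have "norm ((1/2) *\<^sub>R (a + b)) powr p \<le> ((norm b + norm a) / 2) powr p" using tri p by (intro powr_mono2) auto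
    also have "\<dots> < (norm b powr p + norm a powr p) / 2" using 2 p by (intro powr_strict_convex) auto
    finally show ?thesis by simp
  next
    case 3
    have "(norm (a + b))\<^sup>2 + (norm (a - b))\<^sup>2 = 2 * (norm a)\<^sup>2 + 2 * (norm b)\<^sup>2"
      by (simp add: power2_norm_eq_inner inner_add_left inner_add_right inner_diff_left inner_diff_right)
    moreover have "0 < (norm (a - b))\<^sup>2" using assms by simp
    moreover have "(2 * norm a)\<^sup>2 = 2 * (norm a)\<^sup>2 + 2 * (norm b)\<^sup>2" using 3 by (simp add: power_mult_distrib)
    ultimately have "(norm (a + b))\<^sup>2 < (2 * norm a)\<^sup>2" by linarith
    then have "norm (a + b) < 2 * norm a" by (rule power2_less_imp_less) simp
    then have "norm ((1/2) *\<^sub>R (a + b)) powr p < norm a powr p" using p by (intro powr_less_mono2) auto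
    then show ?thesis using 3 by simp
  qed
qed

text \<open>The free error \<tau> lets one compactness argument cover all p > 1. Pairs with |a - b|
  small against |a| + |b| are absorbed by \<tau>; all others reduce by homogeneity to the compact
  set C, on which the convexity defect is bounded below by a positive number.\<close>

lemma norm_powr_uniformly_convex:
  assumes p: "p > 1" and \<tau>: "\<tau> > 0"
  obtains c where "c > 0" "\<And>a b::'a::euclidean_space.
    norm ((1/2) *\<^sub>R (a + b)) powr p + c * norm (a - b) powr p \<le> (1/2 + c * \<tau>) * (norm a powr p + norm b powr p)"
proof -
  \<comment> \<open>Chosen so that |a - b| < \<eta> (|a| + |b|) gives |a - b|^p <= \<tau> (|a|^p +
    |b|^p); the factor 2^(p-1) comes from (|a| + |b|)^p <= 2^(p-1) (|a|^p + |b|^p).\<close>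
  define \<eta> where "\<eta> = (\<tau> / 2 powr (p - 1)) powr (1 / p)"
  have \<eta>: "\<eta> > 0" "\<eta> powr p = \<tau> / 2 powr (p - 1)" using \<tau> p by (auto simp: \<eta>_def powr_powr)
  define C where "C = {(a, b::'a). norm a + norm b = 1 \<and> \<eta> \<le> norm (a - b)}"
  define \<phi> where "\<phi> = (\<lambda>(a, b::'a). (norm a powr p + norm b powr p) / 2 - norm ((1/2) *\<^sub>R (a + b)) powr p)"
  have "compact C"
  proof -
    have "closed C" unfolding C_def case_prod_beta'
      by (intro closed_Collect_conj closed_Collect_eq closed_Collect_le continuous_intros)
    moreover have "C \<subseteq> cball 0 1 \<times> cball 0 1"
    proof
      fix z assume "z \<in> C"
      then have "norm (fst z) + norm (snd z) = 1" by (auto simp: C_def)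
      then have "norm (fst z) \<le> 1" "norm (snd z) \<le> 1" using norm_ge_zero[of "fst z"] norm_ge_zero[of "snd z"] by linarith+
      then show "z \<in> cball 0 1 \<times> cball 0 1" by (simp add: mem_Times_iff)
    qed
    ultimately show ?thesis
      using compact_Int_closed[OF compact_Times[OF compact_cball compact_cball], of C "0::'a" 1 "0::'a" 1]
      by (simp add: Int_absorb1)
  qed
  have cont: "continuous_on C \<phi>"
    unfolding \<phi>_def case_prod_beta' using p by (intro continuous_intros continuous_on_powr') auto
  have pos: "0 < \<phi> z" if "z \<in> C" for z
  proof -
    obtain x y where z: "z = (x, y)" by (cases z)
    have "x \<noteq> y" using that \<eta>(1) by (auto simp: C_def z)
    from norm_powr_midpoint_less[OF p this] show ?thesis by (simp add: \<phi>_def z)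
  qed
  obtain \<delta> where \<delta>: "\<delta> > 0" "\<And>z. z \<in> C \<Longrightarrow> \<delta> \<le> \<phi> z"
  proof (cases "C = {}")
    case True
    then show ?thesis using that[of 1] by auto
  next
    case False
    then obtain z where "z \<in> C" "\<And>y. y \<in> C \<Longrightarrow> \<phi> z \<le> \<phi> y"
      using continuous_attains_inf[OF \<open>compact C\<close> _ cont] by blast
    then show ?thesis using that[of "\<phi> z"] pos by auto
  qed
  define c where "c = \<delta> / 2 powr p"
  have c: "c > 0" using \<delta> by (simp add: c_def)
  have "norm ((1/2) *\<^sub>R (a + b)) powr p + c * norm (a - b) powr p \<le> (1/2 + c * \<tau>) * (norm a powr p + norm b powr p)" for a b :: 'a
  proof -
    let ?N = "norm a powr p + norm b powr p"
    have N: "?N \<ge> 0" by simp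
    have sum_le: "(norm a + norm b) powr p \<le> 2 powr (p - 1) * ?N"
      using powr_add_le_convex[of p "norm a" "norm b" "1/2"] p
      by (simp add: powr_divide powr_diff field_simps)
    show ?thesis
    proof (cases "norm (a - b) < \<eta> * (norm a + norm b)")
      case True
      have "norm ((1/2) *\<^sub>R (a + b)) powr p \<le> ?N / 2"
        using norm_powr_midpoint_less[OF p, of a b] by (cases "a = b") (auto simp: scaleR_2[symmetric] less_imp_le)
      moreover have "norm (a - b) powr p \<le> \<tau> * ?N"
      proof -
        have "norm (a - b) powr p \<le> (\<eta> * (norm a + norm b)) powr p" using True p by (intro powr_mono2) auto
        also have "\<dots> = \<tau> / 2 powr (p - 1) * (norm a + norm b) powr p" using \<eta> by (simp add: powr_mult)
        also have "\<dots> \<le> \<tau> / 2 powr (p - 1) * (2 powr (p - 1) * ?N)" using \<tau> by (intro mult_left_mono sum_le) auto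
        finally show ?thesis by simp
      qed
      then have "c * norm (a - b) powr p \<le> c * (\<tau> * ?N)" using c by (intro mult_left_mono) auto
      ultimately show ?thesis by (simp add: algebra_simps)
    next
      case False
      show ?thesis
      proof (cases "norm a + norm b = 0")
        case True
        then have "a = 0" "b = 0" using norm_ge_zero[of a] norm_ge_zero[of b] by (auto simp: add_nonneg_eq_0_iff)
        then show ?thesis by simp
      next
        case nz: False
        define t where "t = norm a + norm b"
        have t: "t > 0" using nz norm_ge_zero[of a] norm_ge_zero[of b] unfolding t_def by linarith
        have sc: "norm ((1/t) *\<^sub>R a) = norm a / t" "norm ((1/t) *\<^sub>R b) = norm b / t" "norm ((1/t) *\<^sub>R a - (1/t) *\<^sub>R b) = norm (a - b) / t"
          "norm ((1/2) *\<^sub>R ((1/t) *\<^sub>R a + (1/t) *\<^sub>R b)) = norm ((1/2) *\<^sub>R (a + b)) / t"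
          using t by (auto simp flip: scaleR_diff_right scaleR_add_right)
        have "((1/t) *\<^sub>R a, (1/t) *\<^sub>R b) \<in> C"
          using t False by (simp add: C_def sc add_divide_distrib[symmetric] pos_le_divide_eq) (simp add: t_def)
        from \<delta>(2)[OF this] have "\<delta> \<le> ((norm a / t) powr p + (norm b / t) powr p) / 2 - (norm ((1/2) *\<^sub>R (a + b)) / t) powr p"
          unfolding \<phi>_def prod.case sc .
        then have "\<delta> * t powr p \<le> (((norm a / t) powr p + (norm b / t) powr p) / 2 - (norm ((1/2) *\<^sub>R (a + b)) / t) powr p) * t powr p"
          by (intro mult_right_mono) auto
        also have "\<dots> = ?N / 2 - norm ((1/2) *\<^sub>R (a + b)) powr p"
          using t by (simp add: powr_divide field_simps)
        finally have "norm ((1/2) *\<^sub>R (a + b)) powr p + \<delta> * t powr p \<le> ?N / 2" by linarith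
        moreover have "c * norm (a - b) powr p \<le> \<delta> * t powr p"
        proof (rule mult_mono)
          show "c \<le> \<delta>" using \<delta>(1) p ge_one_powr_ge_zero[of 2 p] by (simp add: c_def divide_le_eq)
          show "norm (a - b) powr p \<le> t powr p" using p norm_triangle_ineq4[of a b] by (intro powr_mono2) (auto simp: t_def)
        qed (use \<delta> in auto)
        moreover have "0 \<le> c * \<tau> * ?N" using c \<tau> by simp
        ultimately show ?thesis by (simp add: algebra_simps)
      qed
    qed
  qed
  then show ?thesis using that c by blast
qed

lemma K_const_pos: "p \<ge> 1 \<Longrightarrow> K_const d p > 0"
  unfolding K_const_def by (intro mult_pos_pos divide_pos_pos Gamma_real_pos) (auto intro: add_pos_nonneg)

text \<open>A substitute for weak compactness in $L^p$: almost minimizers of the norm in a decreasing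
  sequence of bounded midpoint convex sets form a Cauchy sequence, by uniform convexity.\<close>

lemma midpoint_convex_almost_minimizers:
  fixes A :: "nat \<Rightarrow> ('x \<Rightarrow> 'a::euclidean_space) set" and M :: "'x measure"
  assumes p: "p > 1"
    and meas: "\<And>n u. u \<in> A n \<Longrightarrow> u \<in> borel_measurable M"
    and dec: "decseq A"
    and mid: "\<And>n u v. u \<in> A n \<Longrightarrow> v \<in> A n \<Longrightarrow> (\<lambda>x. (1/2) *\<^sub>R (u x + v x)) \<in> A n"
    and bdd: "\<And>n. \<exists>u\<in>A n. (\<integral>\<^sup>+x. ennreal (norm (u x) powr p) \<partial>M) \<le> B" and B: "B < \<infinity>"
  obtains h L where "\<And>n. h n \<in> A n" "\<And>n. (\<integral>\<^sup>+x. ennreal (norm (h n x) powr p) \<partial>M) \<le> ennreal L"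
    "\<And>e::real. e > 0 \<Longrightarrow> \<exists>N. \<forall>i\<ge>N. \<forall>j\<ge>N. (\<integral>\<^sup>+x. ennreal (norm (h i x - h j x) powr p) \<partial>M) \<le> ennreal e"
proof -
  define E where "E u = (\<integral>\<^sup>+x. ennreal (norm (u x) powr p) \<partial>M)" for u :: "'x \<Rightarrow> 'a"
  define m where "m n = (INF u\<in>A n. E u)" for n
  have mB: "m n \<le> B" for n
    using bdd[of n] unfolding m_def E_def by (auto intro: INF_lower2)
  have m_inc: "m i \<le> m j" if "i \<le> j" for i j
    unfolding m_def using dec that by (intro INF_superset_mono) (auto simp: decseq_def)
  define \<mu> where "\<mu> n = enn2real (m n)" for n
  have mfin: "m n < \<infinity>" for n using mB[of n] B by (rule le_less_trans)
  have m_eq: "m n = ennreal (\<mu> n)" for n using mfin[of n] by (simp add: \<mu>_def)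
  have \<mu>0: "0 \<le> \<mu> n" for n by (simp add: \<mu>_def)
  have \<mu>_inc: "incseq \<mu>" using m_inc m_eq \<mu>0 by (auto simp: incseq_def)
  have \<mu>B: "\<mu> n \<le> enn2real B" for n using mB[of n] B unfolding \<mu>_def by (intro enn2real_mono) auto
  obtain \<mu>' where lim: "\<mu> \<longlonglongrightarrow> \<mu>'" using incseq_convergent[OF \<mu>_inc, of "enn2real B"] \<mu>B by blast
  have \<mu>': "\<mu> n \<le> \<mu>'" for n using incseq_le[OF \<mu>_inc lim] .
  \<comment> \<open>The infima increase with n and are bounded by B, hence converge to \<mu>'; the
    n-th element is minimal in \<open>A n\<close> up to 1 / (n + 1).\<close>
  have "\<exists>u\<in>A n. E u \<le> ennreal (\<mu> n + inverse (real (Suc n)))" for n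
  proof -
    have "(INF u\<in>A n. E u) < ennreal (\<mu> n + inverse (real (Suc n)))"
      unfolding m_def[symmetric] m_eq using \<mu>0[of n] by (intro ennreal_lessI) (auto intro: add_nonneg_pos)
    then show ?thesis by (auto simp: INF_less_iff intro: less_imp_le)
  qed
  then obtain h where h: "\<And>n. h n \<in> A n" "\<And>n. E (h n) \<le> ennreal (\<mu> n + inverse (real (Suc n)))" by metis
  have [measurable]: "h n \<in> borel_measurable M" for n by (rule meas[OF h(1)])
  define L where "L = \<mu>' + 1"
  have L: "L > 0" using \<mu>'[of 0] \<mu>0[of 0] by (simp add: L_def)
  have hL: "E (h n) \<le> ennreal (\<mu>' + inverse (real (Suc N)))" if "N \<le> n" for n N
  proof -
    have "inverse (real (Suc n)) \<le> inverse (real (Suc N))" using that by (intro le_imp_inverse_le) auto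
    then show ?thesis using h(2)[of n] \<mu>'[of n] by (auto elim!: order_trans intro!: ennreal_leI add_mono)
  qed
  have cauchy: "\<exists>N. \<forall>i\<ge>N. \<forall>j\<ge>N. E (\<lambda>x. h i x - h j x) \<le> ennreal e" if e: "e > 0" for e :: real
  proof -
    \<comment> \<open>L bounds the energies, so the error 2 c \<tau> L in the convexity inequality
      is c e / 2; the other half of c e is left for the gap between the infima.\<close>
    define \<tau> where "\<tau> = e / (4 * L)"
    have \<tau>: "\<tau> > 0" using e L by (simp add: \<tau>_def)
    obtain c where c: "c > 0" "\<And>a b::'a. norm ((1/2) *\<^sub>R (a + b)) powr p + c * norm (a - b) powr p \<le> (1/2 + c * \<tau>) * (norm a powr p + norm b powr p)"
      using norm_powr_uniformly_convex[OF p \<tau>, where 'a='a] by blast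
    have "(\<lambda>N. \<mu>' - \<mu> N + inverse (real (Suc N))) \<longlonglongrightarrow> \<mu>' - \<mu>' + 0"
      by (intro tendsto_intros lim LIMSEQ_inverse_real_of_nat)
    then have "\<forall>\<^sub>F N in sequentially. \<mu>' - \<mu> N + inverse (real (Suc N)) < c * e / 2"
      using c(1) e by (intro order_tendstoD(2)) auto
    then obtain N where N: "\<mu>' - \<mu> N + inverse (real (Suc N)) < c * e / 2"
      by (auto simp: eventually_sequentially)
    have "E (\<lambda>x. h i x - h j x) \<le> ennreal e" if ij: "N \<le> i" "N \<le> j" for i j
    proof -
      \<comment> \<open>The sets decrease, so the midpoint lies in \<open>A N\<close> too and its
        energy is at least \<mu> N. This lower bound forces the difference to be small.\<close>
      have "h i \<in> A N" "h j \<in> A N" using h(1) dec ij by (auto simp: decseq_def)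
      then have "(\<lambda>x. (1/2) *\<^sub>R (h i x + h j x)) \<in> A N" by (rule mid)
      then have "m N \<le> E (\<lambda>x. (1/2) *\<^sub>R (h i x + h j x))" unfolding m_def by (rule INF_lower)
      then have "ennreal (\<mu> N) + ennreal c * E (\<lambda>x. h i x - h j x) \<le> E (\<lambda>x. (1/2) *\<^sub>R (h i x + h j x)) + ennreal c * E (\<lambda>x. h i x - h j x)"
        by (simp add: m_eq add_right_mono)
      also have "\<dots> = (\<integral>\<^sup>+x. ennreal (norm ((1/2) *\<^sub>R (h i x + h j x)) powr p) + ennreal c * ennreal (norm (h i x - h j x) powr p) \<partial>M)"
        unfolding E_def by (simp add: nn_integral_add nn_integral_cmult)
      also have "\<dots> \<le> (\<integral>\<^sup>+x. ennreal (1/2 + c * \<tau>) * (ennreal (norm (h i x) powr p) + ennreal (norm (h j x) powr p)) \<partial>M)"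
      proof (rule nn_integral_mono)
        fix x
        show "ennreal (norm ((1/2) *\<^sub>R (h i x + h j x)) powr p) + ennreal c * ennreal (norm (h i x - h j x) powr p)
          \<le> ennreal (1/2 + c * \<tau>) * (ennreal (norm (h i x) powr p) + ennreal (norm (h j x) powr p))"
          using c(1) \<tau> ennreal_leI[OF c(2)[of "h i x" "h j x"]]
          by (simp add: ennreal_mult[symmetric] ennreal_plus[symmetric] del: ennreal_plus)
      qed
      also have "\<dots> = ennreal (1/2 + c * \<tau>) * (E (h i) + E (h j))"
        unfolding E_def by (simp add: nn_integral_add nn_integral_cmult)
      also have "\<dots> \<le> ennreal (1/2 + c * \<tau>) * (ennreal (\<mu>' + inverse (real (Suc N))) + ennreal (\<mu>' + inverse (real (Suc N))))"
        by (intro mult_left_mono add_mono hL ij) auto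
      also have "\<dots> = ennreal ((1 + 2 * c * \<tau>) * (\<mu>' + inverse (real (Suc N))))"
      proof -
        have "0 \<le> \<mu>' + inverse (real (Suc N))" using \<mu>'[of 0] \<mu>0[of 0] by (intro add_nonneg_nonneg) auto
        then show ?thesis using c(1) \<tau> by (simp add: ennreal_mult[symmetric] ennreal_plus[symmetric] algebra_simps del: ennreal_plus)
      qed
      finally have le: "ennreal (\<mu> N) + ennreal c * E (\<lambda>x. h i x - h j x) \<le> ennreal ((1 + 2 * c * \<tau>) * (\<mu>' + inverse (real (Suc N))))" .
      have bound: "(1 + 2 * c * \<tau>) * (\<mu>' + inverse (real (Suc N))) - \<mu> N \<le> c * e"
      proof -
        have "\<mu>' + inverse (real (Suc N)) \<le> L" unfolding L_def by (simp add: inverse_le_1_iff)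
        then have "2 * c * \<tau> * (\<mu>' + inverse (real (Suc N))) \<le> 2 * c * \<tau> * L" using c(1) \<tau> by (intro mult_left_mono) auto
        also have "\<dots> = c * e / 2" using L by (simp add: \<tau>_def)
        finally show ?thesis using N by (simp add: algebra_simps)
      qed
      show ?thesis
      proof (cases "E (\<lambda>x. h i x - h j x)")
        case (real D)
        then have "ennreal (\<mu> N + c * D) \<le> ennreal ((1 + 2 * c * \<tau>) * (\<mu>' + inverse (real (Suc N))))"
          using le \<mu>0[of N] c(1) by (simp add: ennreal_mult[symmetric] ennreal_plus[symmetric] del: ennreal_plus)
        moreover have "0 \<le> (1 + 2 * c * \<tau>) * (\<mu>' + inverse (real (Suc N)))"
          using \<mu>'[of 0] \<mu>0[of 0] c(1) \<tau> by (intro mult_nonneg_nonneg add_nonneg_nonneg) auto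
        ultimately have "\<mu> N + c * D \<le> (1 + 2 * c * \<tau>) * (\<mu>' + inverse (real (Suc N)))"
          by (simp add: ennreal_le_iff)
        then have "c * D \<le> c * e" using bound by linarith
        then show ?thesis using real c(1) by (simp add: ennreal_leI)
      next
        case top
        then show ?thesis using le c(1) by (simp add: ennreal_mult_top top_unique)
      qed
    qed
    then show ?thesis by blast
  qed
  have "E (h n) \<le> ennreal L" for n using hL[of 0 n] by (simp add: L_def)
  then show ?thesis using that[of h L] h(1) cauchy unfolding E_def by blast
qed

text \<open>Completeness of L^p in the vector-valued case: a rapidly converging subsequence
  converges almost everywhere, and Fatou's lemma gives the norm bound for the limit and the
  convergence of the whole sequence.\<close>

lemma Lp_cauchy_limit:
  fixes h :: "nat \<Rightarrow> 'x \<Rightarrow> 'a::euclidean_space" and M :: "'x measure"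
  assumes p: "p > 1" and meas [measurable]: "\<And>n. h n \<in> borel_measurable M"
    and bdd: "\<And>n. (\<integral>\<^sup>+x. ennreal (norm (h n x) powr p) \<partial>M) \<le> ennreal L"
    and cauchy: "\<And>e::real. e > 0 \<Longrightarrow> \<exists>N. \<forall>i\<ge>N. \<forall>j\<ge>N. (\<integral>\<^sup>+x. ennreal (norm (h i x - h j x) powr p) \<partial>M) \<le> ennreal e"
  obtains g where "g \<in> borel_measurable M" "(\<integral>\<^sup>+x. ennreal (norm (g x) powr p) \<partial>M) \<le> ennreal L"
    "(\<lambda>n. \<integral>\<^sup>+x. ennreal (norm (h n x - g x) powr p) \<partial>M) \<longlonglongrightarrow> 0"
proof -
  \<comment> \<open>The second factor compensates 2^k in \<open>2 ^ k * a k x\<close> after raising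
    to the power p; the first one makes the integrals summable.\<close>
  define e where "e k = (1/2) ^ k * ((1/2) ^ k) powr p" for k :: nat
  have "\<exists>N. \<forall>k. \<forall>i\<ge>N k. \<forall>j\<ge>N k. (\<integral>\<^sup>+x. ennreal (norm (h i x - h j x) powr p) \<partial>M) \<le> ennreal (e k)"
    by (intro choice allI cauchy) (simp add: e_def)
  then obtain N where N: "\<And>k i j. N k \<le> i \<Longrightarrow> N k \<le> j \<Longrightarrow> (\<integral>\<^sup>+x. ennreal (norm (h i x - h j x) powr p) \<partial>M) \<le> ennreal (e k)"
    by blast
  \<comment> \<open>Partial sums make the indices monotone and at least \<open>N k\<close>; the
    added 1 gives \<open>k \<le> r k\<close>.\<close>
  define r where "r k = (\<Sum>l\<le>k. N l + 1)" for k
  have rN: "N k \<le> r k" "r k \<le> r (Suc k)" "k \<le> r k" for k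
  proof -
    have "N k + 1 \<le> r k" unfolding r_def by (intro member_le_sum) auto
    then show "N k \<le> r k" by simp
    show "r k \<le> r (Suc k)" by (simp add: r_def)
    have "(\<Sum>l\<le>k. 1) \<le> r k" unfolding r_def by (intro sum_mono) auto
    then show "k \<le> r k" by simp
  qed
  define a where "a k x = norm (h (r (Suc k)) x - h (r k) x)" for k x
  have [measurable]: "a k \<in> borel_measurable M" for k unfolding a_def by measurable
  have "(\<integral>\<^sup>+x. (\<Sum>k. ennreal ((2 ^ k * a k x) powr p)) \<partial>M) = (\<Sum>k. \<integral>\<^sup>+x. ennreal ((2 ^ k * a k x) powr p) \<partial>M)"
    by (rule nn_integral_suminf) measurable
  also have "\<dots> \<le> (\<Sum>k. ennreal ((1/2) ^ k))"
  proof (intro suminf_le allI)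
    fix k
    have "(\<integral>\<^sup>+x. ennreal ((2 ^ k * a k x) powr p) \<partial>M) = (\<integral>\<^sup>+x. ennreal ((2 ^ k) powr p) * ennreal (a k x powr p) \<partial>M)"
      by (intro nn_integral_cong) (simp add: powr_mult a_def ennreal_mult)
    also have "\<dots> = ennreal ((2 ^ k) powr p) * (\<integral>\<^sup>+x. ennreal (a k x powr p) \<partial>M)" by (rule nn_integral_cmult) measurable
    also have "\<dots> \<le> ennreal ((2 ^ k) powr p) * ennreal (e k)"
      unfolding a_def using rN[of k] by (intro mult_left_mono N) auto
    also have "\<dots> = ennreal ((1/2) ^ k)"
    proof -
      have "(2 ^ k) powr p * ((1/2) ^ k) powr p = ((2::real) ^ k * (1/2) ^ k) powr p" by (rule powr_mult[symmetric])
      also have "(2::real) ^ k * (1/2) ^ k = 1" by (simp add: power_mult_distrib[symmetric])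
      finally show ?thesis by (simp add: e_def ennreal_mult[symmetric] mult_ac)
    qed
    finally show "(\<integral>\<^sup>+x. ennreal ((2 ^ k * a k x) powr p) \<partial>M) \<le> ennreal ((1/2) ^ k)" .
  qed auto
  also have "\<dots> = ennreal (\<Sum>k. (1/2) ^ k)" by (rule suminf_ennreal_eq) (auto simp: summable_sums)
  finally have "(\<integral>\<^sup>+x. (\<Sum>k. ennreal ((2 ^ k * a k x) powr p)) \<partial>M) \<noteq> \<infinity>" by (auto simp: top_unique)
  then have "AE x in M. (\<Sum>k. ennreal ((2 ^ k * a k x) powr p)) \<noteq> \<infinity>"
    by (intro nn_integral_PInf_AE) auto
  then have conv: "AE x in M. convergent (\<lambda>k. h (r k) x)"
  proof eventually_elim
    case (elim x)
    have "summable (\<lambda>k. (2 ^ k * a k x) powr p)" using elim by (intro summable_suminf_not_top) auto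
    then have "(\<lambda>k. (2 ^ k * a k x) powr p) \<longlonglongrightarrow> 0" by (rule summable_LIMSEQ_zero)
    then have "\<forall>\<^sub>F k in sequentially. (2 ^ k * a k x) powr p < 1" by (rule order_tendstoD(2)) simp
    then have "\<forall>\<^sub>F k in sequentially. norm (h (r (Suc k)) x - h (r k) x) \<le> (1/2) ^ k"
    proof eventually_elim
      case (elim k)
      have "2 ^ k * a k x \<le> 1"
      proof (rule ccontr)
        assume "\<not> 2 ^ k * a k x \<le> 1"
        then have "1 \<le> (2 ^ k * a k x) powr p" using p by (intro ge_one_powr_ge_zero) auto
        then show False using elim by simp
      qed
      then show ?case by (simp add: a_def power_one_over field_simps)
    qed
    then have "summable (\<lambda>k. h (r (Suc k)) x - h (r k) x)"
      by (rule summable_comparison_test_ev) (simp add: summable_geometric)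
    then have "convergent (\<lambda>n. \<Sum>k<n. h (r (Suc k)) x - h (r k) x)" by (simp add: summable_iff_convergent)
    then have "convergent (\<lambda>n. h (r n) x - h (r 0) x)" by (simp add: sum_lessThan_telescope[where f="\<lambda>k. h (r k) x"])
    then have "convergent (\<lambda>n. (h (r n) x - h (r 0) x) + h (r 0) x)" by (intro convergent_add convergent_const)
    then show ?case by simp
  qed
  define g where "g x = lim (\<lambda>k. h (r k) x)" for x
  have [measurable]: "g \<in> borel_measurable M" unfolding g_def by (rule borel_measurable_lim_metric) measurable
  have g: "AE x in M. (\<lambda>k. h (r k) x) \<longlonglongrightarrow> g x"
    using conv by eventually_elim (simp add: g_def convergent_LIMSEQ_iff)
  \<comment> \<open>Used with u = 0 for the norm bound and with u = \<open>h n\<close> for the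
    convergence.\<close>
  have fatou: "(\<integral>\<^sup>+x. ennreal (norm (u x - g x) powr p) \<partial>M) \<le> l"
    if [measurable]: "u \<in> borel_measurable M" and le: "\<forall>\<^sub>F k in sequentially. (\<integral>\<^sup>+x. ennreal (norm (u x - h (r k) x) powr p) \<partial>M) \<le> l" for u l
  proof -
    have "(\<integral>\<^sup>+x. ennreal (norm (u x - g x) powr p) \<partial>M) \<le> (\<integral>\<^sup>+x. liminf (\<lambda>k. ennreal (norm (u x - h (r k) x) powr p)) \<partial>M)"
    proof (rule nn_integral_mono_AE)
      show "AE x in M. ennreal (norm (u x - g x) powr p) \<le> liminf (\<lambda>k. ennreal (norm (u x - h (r k) x) powr p))"
        using g
      proof eventually_elim
        case (elim x)
        have "(\<lambda>k. ennreal (norm (u x - h (r k) x) powr p)) \<longlonglongrightarrow> ennreal (norm (u x - g x) powr p)"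
          using p by (intro tendsto_ennrealI tendsto_powr' tendsto_norm tendsto_diff tendsto_const elim) auto
        then show ?case by (subst lim_imp_Liminf) auto
      qed
    qed
    also have "\<dots> \<le> liminf (\<lambda>k. \<integral>\<^sup>+x. ennreal (norm (u x - h (r k) x) powr p) \<partial>M)"
      by (rule nn_integral_liminf) measurable
    also have "\<dots> \<le> liminf (\<lambda>k. l)" by (rule Liminf_mono[OF le])
    finally show ?thesis by (simp add: Liminf_const)
  qed
  have "(\<integral>\<^sup>+x. ennreal (norm (0 - g x) powr p) \<partial>M) \<le> ennreal L"
    by (rule fatou) (use bdd in auto)
  moreover have "(\<lambda>n. \<integral>\<^sup>+x. ennreal (norm (h n x - g x) powr p) \<partial>M) \<longlonglongrightarrow> 0"
  proof (rule order_tendstoI)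
    fix y :: ennreal assume y: "0 < y"
    obtain y' where y': "0 < y'" "y' < y" using dense[OF y] by blast
    then obtain c where c: "0 < c" "ennreal c < y" by (cases y') auto
    obtain N' where N': "\<And>i j. N' \<le> i \<Longrightarrow> N' \<le> j \<Longrightarrow> (\<integral>\<^sup>+x. ennreal (norm (h i x - h j x) powr p) \<partial>M) \<le> ennreal c"
      using cauchy[OF c(1)] by blast
    have "(\<integral>\<^sup>+x. ennreal (norm (h n x - g x) powr p) \<partial>M) < y" if "N' \<le> n" for n
    proof -
      have "\<forall>\<^sub>F k in sequentially. (\<integral>\<^sup>+x. ennreal (norm (h n x - h (r k) x) powr p) \<partial>M) \<le> ennreal c"
        using eventually_ge_at_top[of N']
      proof eventually_elim
        case (elim k)
        then show ?case using rN(3)[of k] by (intro N' that) simp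
      qed
      from fatou[OF _ this] show ?thesis using c(2) by (auto intro: le_less_trans)
    qed
    then show "\<forall>\<^sub>F n in sequentially. (\<integral>\<^sup>+x. ennreal (norm (h n x - g x) powr p) \<partial>M) < y"
      using eventually_sequentially by blast
  qed simp
  ultimately show ?thesis using that[of g] by simp
qed

text \<open>For \<epsilon> <= 1 and \<gamma> >= 0 this weight is below all the weights (d + 2
  \<epsilon>)^(-\<gamma>) of the mollified bounds, so one measure serves every \<epsilon>. It is
  bounded below on bounded parts of \<Omega> and therefore still controls local integrals.\<close>

definition damped_measure :: "'a::euclidean_space set \<Rightarrow> real \<Rightarrow> 'a measure" where
  "damped_measure \<Omega> \<gamma> = density lborel (\<lambda>x. ennreal ((bdist \<Omega> x + 2) powr (- \<gamma>)) * indicator \<Omega> x)"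

lemma borel_measurable_damped [simp]: "borel_measurable (damped_measure \<Omega> \<gamma>) = borel_measurable borel"
  unfolding damped_measure_def by (simp cong: measurable_cong_sets)

lemma nn_integral_damped:
  assumes "open \<Omega>" "u \<in> Borel"
  shows "(\<integral>\<^sup>+x. u x \<partial>damped_measure \<Omega> \<gamma>) = (NN x. ennreal ((bdist \<Omega> x + 2) powr (- \<gamma>)) * indicator \<Omega> x * u x)"
proof -
  have [measurable]: "\<Omega> \<in> sets borel" using assms(1) by (rule borel_open)
  show ?thesis unfolding damped_measure_def using assms(2) by (intro nn_integral_density) auto
qed

section \<open>Local integrals and pairings under the damped weight\<close>

lemma le_add_powr:
  fixes t \<tau> p :: real
  assumes "p > 1" "\<tau> > 0" "t \<ge> 0"
  shows "t \<le> \<tau> + \<tau> powr (1 - p) * t powr p"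
proof (cases "t \<le> \<tau>")
  case True
  then show ?thesis by (simp add: add_increasing2)
next
  case False
  then have "t = t powr (1 - p) * t powr p" using assms by (simp flip: powr_add)
  also have "\<dots> \<le> \<tau> powr (1 - p) * t powr p" using False assms by (intro mult_right_mono powr_mono2') auto
  finally show ?thesis using assms by simp
qed

text \<open>A linear inequality in place of Hoelder's: t <= \<tau> + \<tau>^(1-p) t^p. The first
  term is small by the choice of \<tau> and the second by convergence in L^p, so the estimate also
  yields local L^1 convergence.\<close>

lemma damped_L1_le:
  fixes u :: "'a::euclidean_space \<Rightarrow> 'b::euclidean_space"
  assumes "open \<Omega>" and [measurable]: "u \<in> Borel" and p: "p > 1" and \<tau>: "\<tau> > 0" and \<gamma>: "\<gamma> \<ge> 0" and R: "R \<ge> 0"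
  shows "(NN x. ennreal (norm (u x)) * indicator (ball 0 R \<inter> \<Omega>) x)
    \<le> ennreal (\<tau> * measure lborel (ball (0::'a) R))
      + ennreal (\<tau> powr (1 - p) * (bdist \<Omega> 0 + R + 2) powr \<gamma>) * (\<integral>\<^sup>+x. ennreal (norm (u x) powr p) \<partial>damped_measure \<Omega> \<gamma>)"
proof -
  have [measurable]: "\<Omega> \<in> sets borel" using \<open>open \<Omega>\<close> by (rule borel_open)
  let ?D = "bdist \<Omega> 0 + R + 2"
  have D: "?D > 0" using R bdist_nonneg[of \<Omega> 0] by simp
  have "(NN x. ennreal (norm (u x)) * indicator (ball 0 R \<inter> \<Omega>) x)
    \<le> (NN x. ennreal \<tau> * indicator (ball 0 R) x + ennreal (\<tau> powr (1 - p) * ?D powr \<gamma>) * (ennreal ((bdist \<Omega> x + 2) powr (- \<gamma>)) * indicator \<Omega> x * ennreal (norm (u x) powr p)))"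
  proof (rule nn_integral_mono)
    fix x :: 'a
    show "ennreal (norm (u x)) * indicator (ball 0 R \<inter> \<Omega>) x \<le> ennreal \<tau> * indicator (ball 0 R) x + ennreal (\<tau> powr (1 - p) * ?D powr \<gamma>) * (ennreal ((bdist \<Omega> x + 2) powr (- \<gamma>)) * indicator \<Omega> x * ennreal (norm (u x) powr p))"
    proof (cases "x \<in> ball 0 R \<inter> \<Omega>")
      case True
      \<comment> \<open>On the ball the boundary distance exceeds that of the origin by at most R,
        which bounds the damped weight from below.\<close>
      have "bdist \<Omega> x + 2 \<le> ?D" using bdist_le_add[of \<Omega> x 0] True by (simp add: dist_norm)
      then have "(bdist \<Omega> x + 2) powr \<gamma> \<le> ?D powr \<gamma>" using \<gamma> bdist_nonneg[of \<Omega> x] by (intro powr_mono2) auto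
      then have "(bdist \<Omega> x + 2) powr \<gamma> * (bdist \<Omega> x + 2) powr (- \<gamma>) \<le> ?D powr \<gamma> * (bdist \<Omega> x + 2) powr (- \<gamma>)"
        by (intro mult_right_mono) auto
      then have 1: "1 \<le> ?D powr \<gamma> * (bdist \<Omega> x + 2) powr (- \<gamma>)" using bdist_nonneg[of \<Omega> x] by (simp flip: powr_add)
      have "norm (u x) \<le> \<tau> + \<tau> powr (1 - p) * norm (u x) powr p * 1" using le_add_powr[OF p \<tau>, of "norm (u x)"] by simp
      also have "\<dots> \<le> \<tau> + \<tau> powr (1 - p) * norm (u x) powr p * (?D powr \<gamma> * (bdist \<Omega> x + 2) powr (- \<gamma>))"
        using 1 by (intro add_left_mono mult_left_mono) auto
      finally have "ennreal (norm (u x)) \<le> ennreal (\<tau> + \<tau> powr (1 - p) * ?D powr \<gamma> * ((bdist \<Omega> x + 2) powr (- \<gamma>) * norm (u x) powr p))"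
        by (intro ennreal_leI) (simp add: mult_ac)
      then show ?thesis using True \<tau> by (simp add: ennreal_mult)
    qed simp
  qed
  also have "\<dots> = ennreal \<tau> * emeasure lborel (ball (0::'a) R) + ennreal (\<tau> powr (1 - p) * ?D powr \<gamma>) * (\<integral>\<^sup>+x. ennreal (norm (u x) powr p) \<partial>damped_measure \<Omega> \<gamma>)"
    using \<open>open \<Omega>\<close> by (subst nn_integral_add) (auto simp: nn_integral_cmult nn_integral_cmult_indicator nn_integral_damped)
  also have "emeasure lborel (ball (0::'a) R) = ennreal (measure lborel (ball (0::'a) R))"
    using emeasure_bounded_finite[OF bounded_ball, of "0::'a" R] by (intro emeasure_eq_ennreal_measure) auto
  finally show ?thesis using \<tau> by (simp add: ennreal_mult)
qed

lemma damped_locint: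
  fixes u :: "'a::euclidean_space \<Rightarrow> 'b::euclidean_space"
  assumes "open \<Omega>" and [measurable]: "u \<in> Borel" and p: "p > 1" and \<gamma>: "\<gamma> \<ge> 0"
    and fin: "(\<integral>\<^sup>+x. ennreal (norm (u x) powr p) \<partial>damped_measure \<Omega> \<gamma>) < \<infinity>"
  shows "locint (\<lambda>x. indicator \<Omega> x *\<^sub>R u x)"
  unfolding locint_def
proof (intro conjI allI)
  have [measurable]: "\<Omega> \<in> sets borel" using \<open>open \<Omega>\<close> by (rule borel_open)
  show "(\<lambda>x. indicator \<Omega> x *\<^sub>R u x) \<in> Borel" by measurable
  fix R :: real
  show "integrable lborel (\<lambda>x. indicator (ball 0 R) x *\<^sub>R (indicator \<Omega> x *\<^sub>R u x))"
  proof (cases "R \<ge> 0")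
    case True
    have "(NN x. ennreal (norm (indicator (ball 0 R) x *\<^sub>R (indicator \<Omega> x *\<^sub>R u x))))
       = (NN x. ennreal (norm (u x)) * indicator (ball 0 R \<inter> \<Omega>) x)"
      by (intro nn_integral_cong) (auto split: split_indicator)
    also have "\<dots> \<le> ennreal (1 * measure lborel (ball (0::'a) R))
      + ennreal (1 powr (1 - p) * (bdist \<Omega> 0 + R + 2) powr \<gamma>) * (\<integral>\<^sup>+x. ennreal (norm (u x) powr p) \<partial>damped_measure \<Omega> \<gamma>)"
      by (rule damped_L1_le) (use assms True in auto)
    also have "\<dots> < \<infinity>" using fin by (simp add: ennreal_mult_less_top)
    finally show ?thesis by (intro integrableI_bounded) auto
  next
    case False
    then have "ball (0::'a) R = {}" by simp
    then show ?thesis by (simp del: ball_eq_empty)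
  qed
qed

lemma test_function_bounds:
  assumes \<phi>: "\<phi> \<in> test_functions \<Omega>" and b: "b \<in> Basis"
  obtains R C where "R > 0" "C \<ge> 0" "supp \<phi> \<subseteq> ball 0 R" "\<And>x. \<bar>\<phi> x\<bar> \<le> C" "\<And>x. \<bar>partial_deriv b \<phi> x\<bar> \<le> C"
    "kern R \<phi>" "kern R (partial_deriv b \<phi>)"
proof -
  obtain B where B: "\<And>x. x \<in> supp \<phi> \<Longrightarrow> norm x \<le> B"
    using compact_imp_bounded[OF test_function_support(1)[OF \<phi>]] unfolding bounded_iff by blast
  define R where "R = \<bar>B\<bar> + 1"
  have R: "R > 0" "supp \<phi> \<subseteq> ball 0 R" using B by (force simp: R_def)+
  have z: "\<phi> x = 0 \<and> partial_deriv b \<phi> x = 0" if "R \<le> norm x" for x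
  proof -
    have "x \<notin> supp \<phi>" using R(2) that by auto
    then show ?thesis using test_function_zero[OF \<phi>, of x] by auto
  qed
  have k: "kern R \<phi>" "kern R (partial_deriv b \<phi>)"
    using z test_function_smooth[OF \<phi> b] by (auto simp: kern_def)
  obtain C1 C2 where C1: "C1 \<ge> 0" "\<And>x. norm (\<phi> x) \<le> C1" and C2: "C2 \<ge> 0" "\<And>x. norm (partial_deriv b \<phi> x) \<le> C2"
    using kern_bounded[OF k(1)] kern_bounded[OF k(2)] by metis
  show ?thesis
    by (rule that[of R "max C1 C2"]) (use R C1 C2 k in \<open>auto simp: le_max_iff_disj\<close>)
qed

lemma test_pairing_integrable:
  fixes u :: "'a::euclidean_space \<Rightarrow> 'a"
  assumes u: "locint u" and \<phi>: "\<phi> \<in> test_functions \<Omega>" and b: "b \<in> Basis"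
  shows "integrable lborel (\<lambda>x. (u x \<bullet> b) * \<phi> x)"
proof -
  obtain R C where RC: "R > 0" "C \<ge> 0" "\<And>x. \<bar>\<phi> x\<bar> \<le> C" "kern R \<phi>"
    using test_function_bounds[OF \<phi> b] by metis
  have [measurable]: "u \<in> Borel" "\<phi> \<in> Borel"
    using locint_measurable[OF u] kern_measurable[OF RC(4)] by auto
  show ?thesis
  proof (rule locint_dominated(1)[OF u])
    show "norm ((u y \<bullet> b) * \<phi> y) \<le> C * (indicator (ball 0 R) y * norm (u y))" for y
    proof (cases "norm y < R")
      case True
      have "\<bar>u y \<bullet> b\<bar> \<le> norm (u y)" by (rule Basis_le_norm[OF b])
      then show ?thesis using True RC(2) RC(3)[of y] mult_mono[of "\<bar>u y \<bullet> b\<bar>" "norm (u y)" "\<bar>\<phi> y\<bar>" C]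
        by (simp add: abs_mult mult.commute)
    next
      case False
      then show ?thesis using RC(4) by (simp add: kern_def)
    qed
  qed measurable
qed

lemma test_pairing_integrable':
  assumes F: "locint F" and \<phi>: "\<phi> \<in> test_functions \<Omega>" and b: "b \<in> Basis"
  shows "integrable lborel (\<lambda>x. F x * partial_deriv b \<phi> x)"
proof -
  obtain R C where RC: "R > 0" "C \<ge> 0" "\<And>x. \<bar>partial_deriv b \<phi> x\<bar> \<le> C" "kern R (partial_deriv b \<phi>)"
    using test_function_bounds[OF \<phi> b] by metis
  have [measurable]: "F \<in> Borel" "partial_deriv b \<phi> \<in> Borel"
    using locint_measurable[OF F] kern_measurable[OF RC(4)] by auto
  show ?thesis
  proof (rule locint_dominated(1)[OF F])
    show "norm (F y * partial_deriv b \<phi> y) \<le> C * (indicator (ball 0 R) y * norm (F y))" for y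
    proof (cases "norm y < R")
      case True
      then show ?thesis using RC(2) RC(3)[of y] mult_left_mono[of "\<bar>partial_deriv b \<phi> y\<bar>" C "\<bar>F y\<bar>"]
        by (simp add: abs_mult mult.commute)
    next
      case False
      then show ?thesis using RC(4) by (simp add: kern_def)
    qed
  qed measurable
qed

lemma damped_pairing_integrable:
  fixes u :: "'a::euclidean_space \<Rightarrow> 'a"
  assumes "open \<Omega>" "u \<in> Borel" and p: "p > 1" and \<gamma>: "\<gamma> \<ge> 0"
    and fin: "(\<integral>\<^sup>+x. ennreal (norm (u x) powr p) \<partial>damped_measure \<Omega> \<gamma>) < \<infinity>"
    and \<phi>: "\<phi> \<in> test_functions \<Omega>" and b: "b \<in> Basis"
  shows "integrable lborel (\<lambda>x. (u x \<bullet> b) * \<phi> x)"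
proof -
  have "\<phi> x = 0" if "x \<notin> \<Omega>" for x
    using test_function_zero(1)[OF \<phi>, of x] test_function_support(2)[OF \<phi>] that by blast
  then have "(\<lambda>x. ((indicator \<Omega> x *\<^sub>R u x) \<bullet> b) * \<phi> x) = (\<lambda>x. (u x \<bullet> b) * \<phi> x)"
    by (force simp: indicator_def)
  moreover have "integrable lborel (\<lambda>x. ((indicator \<Omega> x *\<^sub>R u x) \<bullet> b) * \<phi> x)"
    by (rule test_pairing_integrable[OF damped_locint \<phi> b]) (use assms in auto)
  ultimately show ?thesis by simp
qed

text \<open>A test function is bounded and supported in a ball, so the pairings differ by at most C
  times the local L^1 distance. \<tau> is chosen so that its term costs at most half of the
  tolerance y.\<close>

lemma damped_pairing_tendsto:
  fixes h :: "nat \<Rightarrow> 'a::euclidean_space \<Rightarrow> 'a"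
  assumes "open \<Omega>" and [measurable]: "\<And>n. h n \<in> Borel" "g \<in> Borel" and p: "p > 1" and \<gamma>: "\<gamma> \<ge> 0"
    and fin: "\<And>n. (\<integral>\<^sup>+x. ennreal (norm (h n x) powr p) \<partial>damped_measure \<Omega> \<gamma>) < \<infinity>" "(\<integral>\<^sup>+x. ennreal (norm (g x) powr p) \<partial>damped_measure \<Omega> \<gamma>) < \<infinity>"
    and lim: "(\<lambda>n. \<integral>\<^sup>+x. ennreal (norm (h n x - g x) powr p) \<partial>damped_measure \<Omega> \<gamma>) \<longlonglongrightarrow> 0"
    and \<phi>: "\<phi> \<in> test_functions \<Omega>" and b: "b \<in> Basis"
  shows "(\<lambda>n. LL x. (h n x \<bullet> b) * \<phi> x) \<longlonglongrightarrow> (LL x. (g x \<bullet> b) * \<phi> x)"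
proof -
  obtain R C where RC: "R > 0" "C \<ge> 0" "supp \<phi> \<subseteq> ball 0 R" "\<And>x. \<bar>\<phi> x\<bar> \<le> C" "kern R \<phi>"
    using test_function_bounds[OF \<phi> b] by metis
  have [measurable]: "\<Omega> \<in> sets borel" using \<open>open \<Omega>\<close> by (rule borel_open)
  have [measurable]: "\<phi> \<in> Borel" using kern_measurable[OF RC(5)] .
  have z: "\<phi> x = 0" if "x \<notin> ball 0 R \<inter> \<Omega>" for x
    using test_function_zero(1)[OF \<phi>, of x] test_function_support(2)[OF \<phi>] RC(3) that by blast
  note int = damped_pairing_integrable[OF \<open>open \<Omega>\<close> _ p \<gamma> _ \<phi> b]
  define V where "V = measure lborel (ball (0::'a) R)"
  have V: "V \<ge> 0" by (simp add: V_def)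
  let ?d = "\<lambda>n. \<bar>(LL x. (h n x \<bullet> b) * \<phi> x) - (LL x. (g x \<bullet> b) * \<phi> x)\<bar>"
  have d: "ennreal (?d n) \<le> ennreal C * (NN x. ennreal (norm (h n x - g x)) * indicator (ball 0 R \<inter> \<Omega>) x)" for n
  proof -
    note ih = int[of "h n", OF _ fin(1)] and ig = int[of g, OF _ fin(2)]
    have "ennreal (?d n) = ennreal (norm (LL x. (h n x \<bullet> b) * \<phi> x - (g x \<bullet> b) * \<phi> x))"
      by (subst Bochner_Integration.integral_diff[OF ih ig]) auto
    also have "\<dots> \<le> (NN x. ennreal (norm ((h n x \<bullet> b) * \<phi> x - (g x \<bullet> b) * \<phi> x)))"
      by (rule integral_norm_bound_ennreal) (intro Bochner_Integration.integrable_diff ih ig, auto)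
    also have "\<dots> \<le> (NN x. ennreal C * (ennreal (norm (h n x - g x)) * indicator (ball 0 R \<inter> \<Omega>) x))"
    proof (rule nn_integral_mono)
      fix x
      show "ennreal (norm ((h n x \<bullet> b) * \<phi> x - (g x \<bullet> b) * \<phi> x)) \<le> ennreal C * (ennreal (norm (h n x - g x)) * indicator (ball 0 R \<inter> \<Omega>) x)"
      proof (cases "x \<in> ball 0 R \<inter> \<Omega>")
        case True
        have "\<bar>(h n x - g x) \<bullet> b\<bar> * \<bar>\<phi> x\<bar> \<le> norm (h n x - g x) * C"
          by (intro mult_mono Basis_le_norm b RC) auto
        moreover have "(h n x \<bullet> b) * \<phi> x - (g x \<bullet> b) * \<phi> x = ((h n x - g x) \<bullet> b) * \<phi> x" by (simp add: inner_diff_left left_diff_distrib)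
        ultimately show ?thesis using True RC(2) by (simp add: abs_mult ennreal_mult[symmetric] ennreal_leI mult.commute)
      next
        case False
        then show ?thesis using z by simp
      qed
    qed
    also have "\<dots> = ennreal C * (NN x. ennreal (norm (h n x - g x)) * indicator (ball 0 R \<inter> \<Omega>) x)"
      by (rule nn_integral_cmult) measurable
    finally show ?thesis .
  qed
  have "?d \<longlonglongrightarrow> 0"
  proof (rule order_tendstoI)
    fix y :: real assume y: "0 < y"
    define \<tau> where "\<tau> = y / (2 * (C + 1) * (V + 1))"
    have \<tau>: "\<tau> > 0" using y RC(2) V by (simp add: \<tau>_def)
    define c where "c = \<tau> powr (1 - p) * (bdist \<Omega> 0 + R + 2) powr \<gamma>"
    have "(\<lambda>n. ennreal (C * c) * (\<integral>\<^sup>+x. ennreal (norm (h n x - g x) powr p) \<partial>damped_measure \<Omega> \<gamma>)) \<longlonglongrightarrow> ennreal (C * c) * 0"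
      by (intro ennreal_tendsto_cmult lim) auto
    then have "\<forall>\<^sub>F n in sequentially. ennreal (C * c) * (\<integral>\<^sup>+x. ennreal (norm (h n x - g x) powr p) \<partial>damped_measure \<Omega> \<gamma>) < ennreal (y / 2)"
      using y by (intro order_tendstoD(2)) auto
    then show "\<forall>\<^sub>F n in sequentially. ?d n < y"
    proof eventually_elim
      case (elim n)
      have "ennreal (?d n) \<le> ennreal C * (ennreal (\<tau> * V) + ennreal c * (\<integral>\<^sup>+x. ennreal (norm (h n x - g x) powr p) \<partial>damped_measure \<Omega> \<gamma>))"
        unfolding V_def c_def using assms(1) p \<tau> \<gamma> RC(1)
        by (intro order_trans[OF d] mult_left_mono damped_L1_le) auto
      also have "\<dots> = ennreal (C * (\<tau> * V)) + ennreal (C * c) * (\<integral>\<^sup>+x. ennreal (norm (h n x - g x) powr p) \<partial>damped_measure \<Omega> \<gamma>)"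
        using RC(2) by (simp add: distrib_left ennreal_mult' mult.assoc)
      also have "\<dots> < ennreal (C * (\<tau> * V)) + ennreal (y / 2)"
        using elim by (subst ennreal_add_left_cancel_less) auto
      also have "\<dots> \<le> ennreal y"
      proof -
        have "C * (\<tau> * V) \<le> (C + 1) * (\<tau> * (V + 1))" using RC(2) V \<tau> by (intro mult_mono) auto
        also have "\<dots> = y / 2" using RC(2) V by (simp add: \<tau>_def divide_simps)
        finally show ?thesis using y RC(2) V \<tau> by (simp add: ennreal_plus[symmetric] ennreal_leI del: ennreal_plus)
      qed
      finally show ?case by (simp add: ennreal_less_iff)
    qed
  qed (intro always_eventually allI, linarith)
  then show ?thesis by (simp add: tendsto_rabs_zero_iff LIM_zero_cancel)
qed

lemma locint_continuous:
  fixes f :: "'a::euclidean_space \<Rightarrow> 'b::euclidean_space"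
  assumes "continuous_on UNIV f"
  shows "locint f"
  unfolding locint_def
proof (intro conjI allI)
  show [measurable]: "f \<in> Borel" using assms by (rule borel_measurable_continuous_onI)
  fix R :: real
  have 1: "integrable lborel (\<lambda>x. indicator (cball 0 R) x *\<^sub>R f x)"
    using assms by (intro borel_integrable_compact compact_cball) (rule continuous_on_subset, auto)
  show "integrable lborel (\<lambda>x. indicator (ball 0 R) x *\<^sub>R f x)"
    by (rule Bochner_Integration.integrable_bound[OF 1]) (auto split: split_indicator)
qed

lemma test_function_support_interior:
  fixes \<Omega> :: "'a::euclidean_space set"
  assumes "open \<Omega>" "\<Omega> \<noteq> UNIV" and \<phi>: "\<phi> \<in> test_functions \<Omega>"
  shows "\<forall>\<^sub>F n in sequentially. supp \<phi> \<subseteq> {x\<in>\<Omega>. 2 * inverse (real (Suc n)) < bdist \<Omega> x} \<inter> ball 0 (real n)"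
proof (cases "supp \<phi> = {}")
  case False
  obtain x0 where x0: "x0 \<in> supp \<phi>" "\<And>x. x \<in> supp \<phi> \<Longrightarrow> bdist \<Omega> x0 \<le> bdist \<Omega> x"
    using continuous_attains_inf[OF test_function_support(1)[OF \<phi>] False continuous_bdist] by metis
  have pos: "0 < bdist \<Omega> x0" using x0(1) test_function_support(2)[OF \<phi>] by (intro bdist_pos[OF assms(1,2)]) auto
  obtain B where B: "\<And>x. x \<in> supp \<phi> \<Longrightarrow> norm x \<le> B"
    using compact_imp_bounded[OF test_function_support(1)[OF \<phi>]] unfolding bounded_iff by blast
  have "(\<lambda>n. 2 * inverse (real (Suc n))) \<longlonglongrightarrow> 2 * 0" by (intro tendsto_intros LIMSEQ_inverse_real_of_nat)
  then have "\<forall>\<^sub>F n in sequentially. 2 * inverse (real (Suc n)) < bdist \<Omega> x0" using pos by (intro order_tendstoD(2)) auto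
  moreover have "\<forall>\<^sub>F n in sequentially. B < real n"
    using filterlim_real_sequentially unfolding filterlim_at_top_dense by blast
  ultimately show ?thesis
  proof eventually_elim
    case (elim n)
    have "x \<in> {x\<in>\<Omega>. 2 * inverse (real (Suc n)) < bdist \<Omega> x} \<inter> ball 0 (real n)" if "x \<in> supp \<phi>" for x
      using elim x0(2)[OF that] B[OF that] test_function_support(2)[OF \<phi>] that by auto
    then show ?case by blast
  qed
qed simp

text \<open>\<open>A n\<close> collects the fields that satisfy the weak gradient identity up to c
  2^(-n) on test functions supported in \<open>D n\<close>. The condition is affine in the field,
  hence midpoint convex, and the n-th mollified gradient satisfies it. Almost minimizers converge in
  L^p, and their limit satisfies the identity exactly.\<close>

lemma sobolev_compactness:
  fixes \<Omega> :: "'a::euclidean_space set"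
  assumes "open \<Omega>" "\<Omega> \<noteq> UNIV" and F: "locint F" and p: "p > 1"
    and \<alpha>\<beta>: "0 \<le> \<alpha>" "0 \<le> \<beta>"
    and S: "S \<longlonglongrightarrow> 1" "\<And>n. 0 < S n" "\<And>n. S n < 1"
    and le: "\<And>n. ennreal (1 - S n) * gagliardo_energy \<Omega> (S n) p \<alpha> \<beta> F \<le> l" and l: "l < \<infinity>"
  obtains G where "locint G" "wgrad \<Omega> F G"
proof -
  have [measurable]: "\<Omega> \<in> sets borel" using \<open>open \<Omega>\<close> by (rule borel_open)
  define \<gamma> where "\<gamma> = \<alpha> + \<beta>"
  have \<gamma>: "\<gamma> \<ge> 0" using \<alpha>\<beta> by (simp add: \<gamma>_def)
  define M where "M = damped_measure \<Omega> \<gamma>"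
  \<comment> \<open>The ball of radius n is the one on which \<open>\<epsilon> n\<close> controls
    the mollification error.\<close>
  define D where "D n = {x\<in>\<Omega>. 2 * inverse (real (Suc n)) < bdist \<Omega> x} \<inter> ball 0 (real n)" for n
  have D_mono: "D m \<subseteq> D n" if "m \<le> n" for m n
  proof -
    have "inverse (real (Suc n)) \<le> inverse (real (Suc m))" using that by (simp add: le_imp_inverse_le)
    then have "2 * inverse (real (Suc n)) < t" if "2 * inverse (real (Suc m)) < t" for t
      using that by linarith
    then show ?thesis using that unfolding D_def by auto
  qed
  define A where "A n = {u. u \<in> Borel \<and> (\<integral>\<^sup>+x. ennreal (norm (u x) powr p) \<partial>M) < \<infinity> \<and>
    (\<forall>\<phi>\<in>test_functions \<Omega>. \<forall>b\<in>Basis. \<forall>c. supp \<phi> \<subseteq> D n \<and> (\<forall>x. \<bar>partial_deriv b \<phi> x\<bar> \<le> c) \<longrightarrow>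
      \<bar>(LL x. F x * partial_deriv b \<phi> x) + (LL x. (u x \<bullet> b) * \<phi> x)\<bar> \<le> c * (1/2) ^ n)}" for n
  have AI: "\<bar>(LL x. F x * partial_deriv b \<phi> x) + (LL x. (u x \<bullet> b) * \<phi> x)\<bar> \<le> c * (1/2) ^ n"
    if "u \<in> A n" "\<phi> \<in> test_functions \<Omega>" "b \<in> Basis" "supp \<phi> \<subseteq> D n" "\<And>x. \<bar>partial_deriv b \<phi> x\<bar> \<le> c" for u n \<phi> b c
    using that unfolding A_def by blast
  have Am: "u \<in> Borel" "(\<integral>\<^sup>+x. ennreal (norm (u x) powr p) \<partial>M) < \<infinity>" if "u \<in> A n" for u n
    using that unfolding A_def by auto
  have Mm: "borel_measurable M = borel_measurable borel" by (simp add: M_def)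
  obtain \<epsilon> :: "nat \<Rightarrow> real" where \<epsilon>: "\<And>k. 0 < \<epsilon> k" "\<And>k. \<epsilon> k \<le> inverse (real (Suc k))"
    "\<And>k. (NN x. ennreal (norm (conv (moll (\<epsilon> k)) F x - F x)) * indicator (ball 0 (real k)) x) \<le> ennreal ((1/2) ^ k)"
    using conv_moll_fast_sequence[OF F] by blast
  \<comment> \<open>The mollified gradient is cut off to the region where its energy is bounded; on
    \<open>D n\<close> the cut-off has no effect, as \<open>\<epsilon> n\<close> is at most 1 / (n +
    1).\<close>
  define u where "u n x = (if x \<in> \<Omega> \<and> 2 * \<epsilon> n < bdist \<Omega> x then grad_conv (\<epsilon> n) F x else 0)" for n x
  have [measurable]: "grad_conv (\<epsilon> k) F \<in> Borel" for k
    using grad_conv_measurable[OF \<epsilon>(1) F] .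
  have [measurable]: "u n \<in> Borel" for n unfolding u_def by measurable
  have K: "K_const DIM('a) p > 0" using p by (intro K_const_pos) simp
  define B where "B = ennreal (1 / K_const DIM('a) p) * l"
  have B: "B < \<infinity>" using l by (simp add: B_def ennreal_mult_less_top)
  have uB: "(\<integral>\<^sup>+x. ennreal (norm (u n x) powr p) \<partial>M) \<le> B" for n
  proof -
    let ?J = "NN x. ennreal (norm (grad_conv (\<epsilon> n) F x) powr p)
      * (ennreal ((bdist \<Omega> x + 2 * \<epsilon> n) powr (- (\<alpha> + \<beta>))) * (if x \<in> \<Omega> \<and> 2 * \<epsilon> n < bdist \<Omega> x then 1 else 0))"
    have "inverse (real (Suc n)) \<le> 1" by (simp add: inverse_le_1_iff)
    then have e1: "\<epsilon> n \<le> 1" using \<epsilon>(2)[of n] by linarith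
    have "(\<integral>\<^sup>+x. ennreal (norm (u n x) powr p) \<partial>M) = (NN x. ennreal ((bdist \<Omega> x + 2) powr (- \<gamma>)) * indicator \<Omega> x * ennreal (norm (u n x) powr p))"
      unfolding M_def by (intro nn_integral_damped \<open>open \<Omega>\<close>) measurable
    also have "\<dots> \<le> ?J"
    proof (rule nn_integral_mono)
      fix x
      have "(bdist \<Omega> x + 2) powr (- \<gamma>) \<le> (bdist \<Omega> x + 2 * \<epsilon> n) powr (- \<gamma>)"
        using e1 \<epsilon>(1)[of n] bdist_nonneg[of \<Omega> x] \<gamma> by (intro powr_mono2') auto
      then show "ennreal ((bdist \<Omega> x + 2) powr (- \<gamma>)) * indicator \<Omega> x * ennreal (norm (u n x) powr p)
        \<le> ennreal (norm (grad_conv (\<epsilon> n) F x) powr p)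
      * (ennreal ((bdist \<Omega> x + 2 * \<epsilon> n) powr (- (\<alpha> + \<beta>))) * (if x \<in> \<Omega> \<and> 2 * \<epsilon> n < bdist \<Omega> x then 1 else 0))"
        using p by (auto simp: u_def \<gamma>_def ennreal_mult[symmetric] mult.commute intro!: ennreal_leI mult_left_mono)
    qed
    also have "\<dots> = ennreal (1 / K_const DIM('a) p) * (ennreal (K_const DIM('a) p) * ?J)"
      using K by (simp add: mult.assoc[symmetric] ennreal_mult[symmetric])
    also have "\<dots> \<le> B" unfolding B_def
      by (intro mult_left_mono mollified_energy_lower[OF assms(1,2) \<epsilon>(1) F _ \<alpha>\<beta> S le]) (use p in auto)
    finally show ?thesis .
  qed
  have uA: "u n \<in> A n" for n
  proof -
    have "\<bar>(LL x. F x * partial_deriv b \<phi> x) + (LL x. (u n x \<bullet> b) * \<phi> x)\<bar> \<le> c * (1/2) ^ n"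
      if \<phi>: "\<phi> \<in> test_functions \<Omega>" and b: "b \<in> Basis" and supp: "supp \<phi> \<subseteq> D n" and c: "\<And>x. \<bar>partial_deriv b \<phi> x\<bar> \<le> c" for \<phi> b c
    proof -
      have c0: "c \<ge> 0" using c[of 0] by linarith
      note [measurable] = conv_moll_measurable[OF \<epsilon>(1) F] locint_measurable[OF F]
      have z: "\<phi> x = 0 \<and> partial_deriv b \<phi> x = 0" if "x \<notin> D n" for x
        using test_function_zero[OF \<phi>, of x] supp that by blast
      have cF: "locint (conv (moll (\<epsilon> n)) F)"
        by (intro locint_continuous continuous_at_imp_continuous_on ballI
            has_derivative_continuous[OF conv_has_derivative[OF \<epsilon>(1) F]])
      have "(LL x. (u n x \<bullet> b) * \<phi> x) = (LL x. (grad_conv (\<epsilon> n) F x \<bullet> b) * \<phi> x)"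
      proof (rule Bochner_Integration.integral_cong)
        fix x
        show "(u n x \<bullet> b) * \<phi> x = (grad_conv (\<epsilon> n) F x \<bullet> b) * \<phi> x"
        proof (cases "x \<in> D n")
          case True
          then have "x \<in> \<Omega>" "2 * \<epsilon> n < bdist \<Omega> x" using \<epsilon>(2)[of n] by (auto simp: D_def)
          then show ?thesis by (simp add: u_def)
        qed (use z in simp)
      qed simp
      \<comment> \<open>After integration by parts the defect is the pairing of the mollification
        error of F with the derivative of \<phi>.\<close>
      also have "\<dots> = - (LL x. conv (moll (\<epsilon> n)) F x * partial_deriv b \<phi> x)"
        using conv_integration_by_parts[OF \<epsilon>(1) F \<phi> b] by simp
      finally have "\<bar>(LL x. F x * partial_deriv b \<phi> x) + (LL x. (u n x \<bullet> b) * \<phi> x)\<bar>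
        = norm (LL x. F x * partial_deriv b \<phi> x - conv (moll (\<epsilon> n)) F x * partial_deriv b \<phi> x)"
        by (simp add: Bochner_Integration.integral_diff[OF test_pairing_integrable'[OF F \<phi> b] test_pairing_integrable'[OF cF \<phi> b]])
      then have "ennreal \<bar>(LL x. F x * partial_deriv b \<phi> x) + (LL x. (u n x \<bullet> b) * \<phi> x)\<bar>
        \<le> (NN x. ennreal (norm (F x * partial_deriv b \<phi> x - conv (moll (\<epsilon> n)) F x * partial_deriv b \<phi> x)))"
        by (simp only:) (intro integral_norm_bound_ennreal Bochner_Integration.integrable_diff test_pairing_integrable'[OF F \<phi> b] test_pairing_integrable'[OF cF \<phi> b])
      also have "\<dots> \<le> (NN x. ennreal c * (ennreal (norm (conv (moll (\<epsilon> n)) F x - F x)) * indicator (ball 0 (real n)) x))"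
      proof (rule nn_integral_mono)
        fix x
        show "ennreal (norm (F x * partial_deriv b \<phi> x - conv (moll (\<epsilon> n)) F x * partial_deriv b \<phi> x))
          \<le> ennreal c * (ennreal (norm (conv (moll (\<epsilon> n)) F x - F x)) * indicator (ball 0 (real n)) x)"
        proof (cases "x \<in> D n")
          case True
          have "\<bar>conv (moll (\<epsilon> n)) F x - F x\<bar> * \<bar>partial_deriv b \<phi> x\<bar> \<le> \<bar>conv (moll (\<epsilon> n)) F x - F x\<bar> * c"
            by (intro mult_left_mono c) simp
          moreover have "\<bar>F x * partial_deriv b \<phi> x - conv (moll (\<epsilon> n)) F x * partial_deriv b \<phi> x\<bar>
            = \<bar>conv (moll (\<epsilon> n)) F x - F x\<bar> * \<bar>partial_deriv b \<phi> x\<bar>"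
            by (simp add: left_diff_distrib[symmetric] abs_mult abs_minus_commute)
          moreover have "x \<in> ball 0 (real n)" using True by (simp add: D_def)
          ultimately show ?thesis using c0 by (simp add: ennreal_mult[symmetric] mult.commute ennreal_leI)
        qed (use z in simp)
      qed
      also have "\<dots> = ennreal c * (NN x. ennreal (norm (conv (moll (\<epsilon> n)) F x - F x)) * indicator (ball 0 (real n)) x)"
        by (rule nn_integral_cmult) measurable
      also have "\<dots> \<le> ennreal c * ennreal ((1/2) ^ n)" by (intro mult_left_mono \<epsilon>(3)) simp
      also have "\<dots> = ennreal (c * (1/2) ^ n)" using c0 by (simp add: ennreal_mult)
      finally show ?thesis using c0 by (simp add: ennreal_le_iff)
    qed
    moreover have "(\<integral>\<^sup>+x. ennreal (norm (u n x) powr p) \<partial>M) < \<infinity>" using uB[of n] B by (rule le_less_trans)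
    ultimately show ?thesis unfolding A_def by auto
  qed
  note int = damped_pairing_integrable[OF \<open>open \<Omega>\<close> _ p \<gamma>]
  obtain h L where h: "\<And>n. h n \<in> A n" "\<And>n. (\<integral>\<^sup>+x. ennreal (norm (h n x) powr p) \<partial>M) \<le> ennreal L"
    "\<And>e::real. e > 0 \<Longrightarrow> \<exists>N. \<forall>i\<ge>N. \<forall>j\<ge>N. (\<integral>\<^sup>+x. ennreal (norm (h i x - h j x) powr p) \<partial>M) \<le> ennreal e"
  proof (rule midpoint_convex_almost_minimizers[of p A M B])
    show "\<And>n u. u \<in> A n \<Longrightarrow> u \<in> borel_measurable M" using Am(1) Mm by blast
    \<comment> \<open>A larger index means more test functions and a smaller tolerance.\<close>
    show "decseq A"
    proof (intro decseq_SucI subsetI)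
      fix n v assume v: "v \<in> A (Suc n)"
      have "\<bar>(LL x. F x * partial_deriv b \<phi> x) + (LL x. (v x \<bullet> b) * \<phi> x)\<bar> \<le> c * (1/2) ^ n"
        if \<phi>: "\<phi> \<in> test_functions \<Omega>" and b: "b \<in> Basis" and supp: "supp \<phi> \<subseteq> D n" and c: "\<And>x. \<bar>partial_deriv b \<phi> x\<bar> \<le> c" for \<phi> b c
      proof -
        have "c \<ge> 0" using c[of 0] by linarith
        have "supp \<phi> \<subseteq> D (Suc n)" using supp D_mono[of n "Suc n"] by auto
        from AI[OF v \<phi> b this c] have "\<bar>(LL x. F x * partial_deriv b \<phi> x) + (LL x. (v x \<bullet> b) * \<phi> x)\<bar> \<le> c * (1/2) ^ Suc n" .
        also have "\<dots> \<le> c * (1/2) ^ n" using \<open>c \<ge> 0\<close> by (intro mult_left_mono) auto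
        finally show ?thesis .
      qed
      then show "v \<in> A n" using Am[OF v] unfolding A_def by auto
    qed
    show "(\<lambda>x. (1/2) *\<^sub>R (v x + w x)) \<in> A n" if v: "v \<in> A n" and w: "w \<in> A n" for n v w
    proof -
      note [measurable] = Am(1)[OF v] Am(1)[OF w]
      have "(\<integral>\<^sup>+x. ennreal (norm ((1/2) *\<^sub>R (v x + w x)) powr p) \<partial>M)
        \<le> (\<integral>\<^sup>+x. ennreal (norm (v x) powr p) + ennreal (norm (w x) powr p) \<partial>M)"
      proof (rule nn_integral_mono)
        fix x
        have "norm ((1/2) *\<^sub>R (v x + w x)) \<le> max (norm (v x)) (norm (w x))"
          using norm_triangle_ineq[of "v x" "w x"] by simp
        then have "norm ((1/2) *\<^sub>R (v x + w x)) powr p \<le> max (norm (v x)) (norm (w x)) powr p"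
          using p by (intro powr_mono2) auto
        also have "\<dots> \<le> norm (v x) powr p + norm (w x) powr p" by (simp add: max_def)
        finally show "ennreal (norm ((1/2) *\<^sub>R (v x + w x)) powr p) \<le> ennreal (norm (v x) powr p) + ennreal (norm (w x) powr p)"
          by (simp add: ennreal_plus[symmetric] ennreal_leI del: ennreal_plus)
      qed
      also have "\<dots> = (\<integral>\<^sup>+x. ennreal (norm (v x) powr p) \<partial>M) + (\<integral>\<^sup>+x. ennreal (norm (w x) powr p) \<partial>M)"
        by (intro nn_integral_add) (simp_all add: Mm)
      also have "\<dots> < \<infinity>" using Am(2)[OF v] Am(2)[OF w] by simp
      finally have fin: "(\<integral>\<^sup>+x. ennreal (norm ((1/2) *\<^sub>R (v x + w x)) powr p) \<partial>M) < \<infinity>" .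
      have "\<bar>(LL x. F x * partial_deriv b \<phi> x) + (LL x. (((1/2) *\<^sub>R (v x + w x)) \<bullet> b) * \<phi> x)\<bar> \<le> c * (1/2) ^ n"
        if \<phi>: "\<phi> \<in> test_functions \<Omega>" and b: "b \<in> Basis" and supp: "supp \<phi> \<subseteq> D n" and c: "\<And>x. \<bar>partial_deriv b \<phi> x\<bar> \<le> c" for \<phi> b c
      proof -
        have i: "integrable lborel (\<lambda>x. (v x \<bullet> b) * \<phi> x)" "integrable lborel (\<lambda>x. (w x \<bullet> b) * \<phi> x)"
          using Am(2)[OF v] Am(2)[OF w] unfolding M_def by (auto intro!: int \<phi> b)
        have "(LL x. (((1/2) *\<^sub>R (v x + w x)) \<bullet> b) * \<phi> x) = (LL x. (1/2) * ((v x \<bullet> b) * \<phi> x + (w x \<bullet> b) * \<phi> x))"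
          by (intro Bochner_Integration.integral_cong) (auto simp: inner_add_left algebra_simps add_divide_distrib)
        also have "\<dots> = (1/2) * ((LL x. (v x \<bullet> b) * \<phi> x) + (LL x. (w x \<bullet> b) * \<phi> x))"
          by (simp only: integral_mult_right_zero Bochner_Integration.integral_add[OF i])
        finally have eq: "(LL x. (((1/2) *\<^sub>R (v x + w x)) \<bullet> b) * \<phi> x) = (1/2) * ((LL x. (v x \<bullet> b) * \<phi> x) + (LL x. (w x \<bullet> b) * \<phi> x))" .
        have avg: "\<bar>I + (1/2) * (s + t)\<bar> \<le> e" if "\<bar>I + s\<bar> \<le> e" "\<bar>I + t\<bar> \<le> e" for I s t e :: real
          using that unfolding abs_le_iff by (simp add: field_simps)
        show ?thesis unfolding eq by (rule avg[OF AI[OF v \<phi> b supp c] AI[OF w \<phi> b supp c]])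
      qed
      then show ?thesis using fin unfolding A_def by auto
    qed
    show "\<exists>u\<in>A n. (\<integral>\<^sup>+x. ennreal (norm (u x) powr p) \<partial>M) \<le> B" for n using uA uB by blast
  qed (use p B in auto)
  obtain g where g: "g \<in> borel_measurable M" "(\<integral>\<^sup>+x. ennreal (norm (g x) powr p) \<partial>M) \<le> ennreal L"
    "(\<lambda>n. \<integral>\<^sup>+x. ennreal (norm (h n x - g x) powr p) \<partial>M) \<longlonglongrightarrow> 0"
    by (rule Lp_cauchy_limit[OF p _ h(2) h(3)]) (use Am(1)[OF h(1)] in \<open>auto simp: M_def\<close>)
  have gm: "g \<in> Borel" using g(1) by (simp add: M_def)
  have gf: "(\<integral>\<^sup>+x. ennreal (norm (g x) powr p) \<partial>damped_measure \<Omega> \<gamma>) < \<infinity>"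
    using g(2) unfolding M_def by (rule le_less_trans) simp
  show ?thesis
  proof (rule that)
    show "locint (\<lambda>x. indicator \<Omega> x *\<^sub>R g x)" by (rule damped_locint[OF \<open>open \<Omega>\<close> gm p \<gamma> gf])
    show "wgrad \<Omega> F (\<lambda>x. indicator \<Omega> x *\<^sub>R g x)"
      unfolding wgrad_def
    proof (intro ballI)
      fix \<phi> :: "'a \<Rightarrow> real" and b :: 'a assume \<phi>: "\<phi> \<in> test_functions \<Omega>" and b: "b \<in> Basis"
      have "\<phi> x = 0" if "x \<notin> \<Omega>" for x
        using test_function_zero(1)[OF \<phi>, of x] test_function_support(2)[OF \<phi>] that by blast
      then have eq: "(\<lambda>x. ((indicator \<Omega> x *\<^sub>R g x) \<bullet> b) * \<phi> x) = (\<lambda>x. (g x \<bullet> b) * \<phi> x)"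
        by (force simp: indicator_def)
      obtain R c where c: "\<And>x. \<bar>partial_deriv b \<phi> x\<bar> \<le> c" using test_function_bounds[OF \<phi> b] by metis
      let ?I = "LL x. F x * partial_deriv b \<phi> x"
      have "(\<lambda>n. LL x. (h n x \<bullet> b) * \<phi> x) \<longlonglongrightarrow> (LL x. (g x \<bullet> b) * \<phi> x)"
        by (rule damped_pairing_tendsto[OF \<open>open \<Omega>\<close> Am(1)[OF h(1)] gm p \<gamma> _ gf _ \<phi> b])
           (use Am(2)[OF h(1)] g(3) in \<open>auto simp: M_def\<close>)
      moreover have "(\<lambda>n. LL x. (h n x \<bullet> b) * \<phi> x) \<longlonglongrightarrow> - ?I"
      proof (rule LIM_zero_cancel, rule Lim_null_comparison)
        show "\<forall>\<^sub>F n in sequentially. norm ((LL x. (h n x \<bullet> b) * \<phi> x) - - ?I) \<le> c * (1/2) ^ n"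
          using test_function_support_interior[OF assms(1,2) \<phi>]
        proof eventually_elim
          case (elim n)
          then have "supp \<phi> \<subseteq> D n" by (simp add: D_def)
          from AI[OF h(1) \<phi> b this c] show ?case by (simp add: add.commute)
        qed
        have "(\<lambda>n. c * (1/2) ^ n) \<longlonglongrightarrow> c * 0" by (intro tendsto_mult tendsto_const LIMSEQ_realpow_zero) auto
        then show "(\<lambda>n. c * (1/2) ^ n) \<longlonglongrightarrow> 0" by simp
      qed
      ultimately have "(LL x. (g x \<bullet> b) * \<phi> x) = - ?I" by (rule LIMSEQ_unique)
      then show "?I = - (LL x. ((indicator \<Omega> x *\<^sub>R g x) \<bullet> b) * \<phi> x)" unfolding eq by simp
    qed
  qed
qed

section \<open>Muckenhoupt weights\<close>

lemma emeasure_cube: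
  fixes a :: "'a::euclidean_space"
  shows "l > 0 \<Longrightarrow> emeasure lborel (cbox a (a + l *\<^sub>R One)) = ennreal (l ^ DIM('a))"
  by (simp add: emeasure_lborel_cbox_eq inner_add_left)

lemma AE_lebesgue_imp_lborel:
  assumes "AE x in lebesgue. P x"
  shows "AE x in lborel. P x"
  using assms by (simp add: AE_completion_iff)

text \<open>A violation at a point of continuity persists on an open neighbourhood. As y is in the
  closure of the open box, the neighbourhood meets the box in a nonempty open set, which is not a
  null set. This includes points on the faces of the cube.\<close>

lemma le_at_point_if_AE_le:
  fixes u :: "'a::euclidean_space \<Rightarrow> ennreal"
  assumes ae: "AE y in lborel. y \<in> cbox a b \<longrightarrow> c \<le> u y" and "box a b \<noteq> {}" and y: "y \<in> cbox a b" and cont: "isCont u y"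
  shows "c \<le> u y"
proof (rule ccontr)
  assume "\<not> c \<le> u y"
  then have "u y < c" by simp
  then have "\<forall>\<^sub>F z in nhds y. u z < c" using cont unfolding isCont_def
    by (metis order_tendstoD(2) tendsto_at_iff_tendsto_nhds)
  then obtain V where V: "open V" "y \<in> V" "\<And>z. z \<in> V \<Longrightarrow> u z < c" unfolding eventually_nhds by blast
  have "y \<in> closure (box a b)" using y closure_box[OF assms(2)] by simp
  then have ne: "V \<inter> box a b \<noteq> {}" using V(1,2) open_Int_closure_eq_empty by blast
  have o: "open (V \<inter> box a b)" using V(1) by (intro open_Int open_box)
  have "AE z in lborel. z \<notin> V \<inter> box a b"
    using ae by eventually_elim (use V(3) box_subset_cbox[of a b] in \<open>auto simp: not_le[symmetric]\<close>)
  then have "V \<inter> box a b \<in> null_sets lborel" using o by (subst AE_iff_null_sets) auto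
  then have "negligible (V \<inter> box a b)" by (simp add: negligible_iff_null_sets null_sets_completionI)
  then show False using open_not_negligible[OF o ne] by simp
qed

text \<open>Off the boundary the weight is a power of a positive continuous function; for negative
  \<gamma> the power is positive and continuity extends to the boundary.\<close>

lemma isCont_dist_weight:
  assumes "0 < bdist \<Omega> y \<or> \<gamma> < 0"
  shows "isCont (dist_weight \<Omega> \<gamma>) y"
proof -
  have "isCont (\<lambda>x. ennreal (bdist \<Omega> x powr (-\<gamma>))) y"
  proof -
    have c: "isCont (bdist \<Omega>) y" using continuous_bdist[of UNIV \<Omega>] by (simp add: continuous_on_eq_continuous_at)
    have "isCont (\<lambda>x. bdist \<Omega> x powr (-\<gamma>)) y"
    proof (cases "0 < bdist \<Omega> y")
      case True
      then show ?thesis using c by (intro continuous_intros) auto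
    next
      case False
      then have "\<gamma> < 0" using assms by simp
      then show ?thesis unfolding isCont_def using c bdist_nonneg
        by (intro tendsto_powr') (auto simp: isCont_def intro!: always_eventually)
    qed
    then show ?thesis unfolding isCont_def by (rule tendsto_ennrealI)
  qed
  moreover have "\<forall>\<^sub>F x in nhds y. ennreal (bdist \<Omega> x powr (-\<gamma>)) = dist_weight \<Omega> \<gamma> x"
    using assms
  proof
    assume "0 < bdist \<Omega> y"
    moreover have "isCont (bdist \<Omega>) y" using continuous_bdist[of UNIV \<Omega>] by (simp add: continuous_on_eq_continuous_at)
    ultimately have "\<forall>\<^sub>F x in nhds y. 0 < bdist \<Omega> x"
      unfolding isCont_def by (metis order_tendstoD(1) tendsto_at_iff_tendsto_nhds)
    then show ?thesis by eventually_elim (simp add: dist_weight_pos)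
  next
    assume "\<gamma> < 0"
    then have "ennreal (bdist \<Omega> x powr (-\<gamma>)) = dist_weight \<Omega> \<gamma> x" for x
      by (cases "0 < bdist \<Omega> x") (use bdist_nonneg[of \<Omega> x] in \<open>auto simp: dist_weight_pos dist_weight_zero order.order_iff_strict\<close>)
    then show ?thesis by simp
  qed
  ultimately show ?thesis by (subst isCont_cong[of _ "\<lambda>x. ennreal (bdist \<Omega> x powr (-\<gamma>))"]) (auto elim: eventually_mono)
qed

text \<open>The bound passes to the points of continuity of the weight. It will be applied at points
  that are prescribed as the place where a gradient is taken. |C| + 1 replaces C to have a positive
  constant.\<close>

lemma muckenhoupt_A1_pointwise:
  fixes \<Omega> :: "'a::euclidean_space set"
  assumes "muckenhoupt_A1 (dist_weight \<Omega> \<gamma>)"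
  obtains C :: real where "C > 0" "\<And>(a::'a) l y. l > 0 \<Longrightarrow> y \<in> cbox a (a + l *\<^sub>R One) \<Longrightarrow> 0 < bdist \<Omega> y \<or> \<gamma> < 0 \<Longrightarrow>
    (NN x. dist_weight \<Omega> \<gamma> x * indicator (cbox a (a + l *\<^sub>R One)) x) \<le> ennreal (C * l ^ DIM('a)) * dist_weight \<Omega> \<gamma> y"
proof -
  obtain C :: real where C: "\<And>Q. Q \<in> cubes \<Longrightarrow> AE y in lebesgue. y \<in> Q \<longrightarrow>
        (\<integral>\<^sup>+x\<in>Q. dist_weight \<Omega> \<gamma> x \<partial>lebesgue) / emeasure lebesgue Q \<le> ennreal C * dist_weight \<Omega> \<gamma> y"
    using assms unfolding muckenhoupt_A1_def by blast
  have "(NN x. dist_weight \<Omega> \<gamma> x * indicator (cbox a (a + l *\<^sub>R One)) x) \<le> ennreal ((\<bar>C\<bar> + 1) * l ^ DIM('a)) * dist_weight \<Omega> \<gamma> y"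
    if l: "l > 0" and y: "y \<in> cbox a (a + l *\<^sub>R One)" and d: "0 < bdist \<Omega> y \<or> \<gamma> < 0" for a :: 'a and l y
  proof -
    let ?Q = "cbox a (a + l *\<^sub>R One)"
    let ?I = "NN x. dist_weight \<Omega> \<gamma> x * indicator ?Q x"
    have Q: "?Q \<in> cubes" using l unfolding cubes_def by blast
    have I: "(\<integral>\<^sup>+x\<in>?Q. dist_weight \<Omega> \<gamma> x \<partial>lebesgue) = ?I"
      by (rule nn_integral_completion) measurable
    have "AE y in lebesgue. y \<in> ?Q \<longrightarrow> ?I \<le> ennreal ((\<bar>C\<bar> + 1) * l ^ DIM('a)) * dist_weight \<Omega> \<gamma> y"
      using C[OF Q]
    proof eventually_elim
      case (elim y)
      show ?case
      proof
        assume "y \<in> ?Q"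
        then have "?I / ennreal (l ^ DIM('a)) \<le> ennreal C * dist_weight \<Omega> \<gamma> y"
          using elim emeasure_cube[OF l, of a] by (simp add: I)
        then have "ennreal (l ^ DIM('a)) * (?I / ennreal (l ^ DIM('a))) \<le> ennreal (l ^ DIM('a)) * (ennreal C * dist_weight \<Omega> \<gamma> y)"
          by (rule mult_left_mono) simp
        moreover have "ennreal (l ^ DIM('a)) * (?I / ennreal (l ^ DIM('a))) = ?I"
          using l by (subst ennreal_times_divide, subst mult.commute, subst ennreal_mult_divide_eq) auto
        moreover have "ennreal (l ^ DIM('a)) * (ennreal C * dist_weight \<Omega> \<gamma> y) \<le> ennreal ((\<bar>C\<bar> + 1) * l ^ DIM('a)) * dist_weight \<Omega> \<gamma> y"
        proof -
          have "ennreal (l ^ DIM('a)) * ennreal C \<le> ennreal ((\<bar>C\<bar> + 1) * l ^ DIM('a))"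
            using l by (subst ennreal_mult'[symmetric]) (auto intro!: ennreal_leI simp: mult.commute mult_right_mono)
          then show ?thesis by (simp only: mult.assoc[symmetric]) (rule mult_right_mono, simp_all)
        qed
        ultimately show "?I \<le> ennreal ((\<bar>C\<bar> + 1) * l ^ DIM('a)) * dist_weight \<Omega> \<gamma> y" by simp
      qed
    qed
    then have "AE y in lborel. y \<in> ?Q \<longrightarrow> ?I \<le> ennreal ((\<bar>C\<bar> + 1) * l ^ DIM('a)) * dist_weight \<Omega> \<gamma> y"
      by (rule AE_lebesgue_imp_lborel)
    moreover have "box a (a + l *\<^sub>R One) \<noteq> {}" using l by (simp add: box_ne_empty inner_add_left inner_sum_left inner_Basis)
    moreover have "isCont (\<lambda>y. ennreal ((\<bar>C\<bar> + 1) * l ^ DIM('a)) * dist_weight \<Omega> \<gamma> y) y"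
      using isCont_dist_weight[OF d] unfolding isCont_def by (intro ennreal_tendsto_cmult) auto
    ultimately show ?thesis using y by (intro le_at_point_if_AE_le[where u="\<lambda>y. ennreal ((\<bar>C\<bar> + 1) * l ^ DIM('a)) * dist_weight \<Omega> \<gamma> y"]) auto
  qed
  then show ?thesis by (intro that[of "\<bar>C\<bar> + 1"]) auto
qed

lemma mem_centered_cube:
  fixes z :: "'a::euclidean_space"
  assumes "dist z x \<le> r"
  shows "x \<in> cbox (z - r *\<^sub>R One) (z - r *\<^sub>R One + (2 * r) *\<^sub>R One)"
proof -
  have "\<bar>(z - x) \<bullet> b\<bar> \<le> r" if "b \<in> Basis" for b
    using Basis_le_norm[OF that, of "z - x"] assms by (simp add: dist_norm)
  then have "z \<bullet> b - r \<le> x \<bullet> b \<and> x \<bullet> b \<le> z \<bullet> b - r + 2 * r" if "b \<in> Basis" for b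
    using that by (simp add: inner_diff_left abs_le_iff) (smt (verit))
  then show ?thesis by (simp add: mem_box inner_diff_left inner_add_left)
qed

text \<open>A weight of negative exponent is continuous and 0 at a boundary point z. The bound at z
  makes its integral over a cube about z vanish, although it is positive on the nonempty open set
  where a ball about z meets \<Omega>.\<close>

lemma muckenhoupt_A1_exponent_nonneg:
  fixes \<Omega> :: "'a::euclidean_space set"
  assumes "open \<Omega>" "\<Omega> \<noteq> {}" "\<Omega> \<noteq> UNIV" and A1: "muckenhoupt_A1 (dist_weight \<Omega> \<gamma>)"
  shows "\<gamma> \<ge> 0"
proof (rule ccontr)
  assume "\<not> \<gamma> \<ge> 0"
  then have \<gamma>: "\<gamma> < 0" by simp
  obtain z where z: "z \<in> frontier \<Omega>" using frontier_nonempty[OF assms(2,3)] by blast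
  then have dz: "bdist \<Omega> z = 0" unfolding bdist_def by simp
  let ?Q = "cbox (z - 1 *\<^sub>R One) (z - 1 *\<^sub>R One + (2 * 1) *\<^sub>R One)"
  obtain C :: real where "C > 0" and C: "\<And>(a::'a) l y. l > 0 \<Longrightarrow> y \<in> cbox a (a + l *\<^sub>R One) \<Longrightarrow> 0 < bdist \<Omega> y \<or> \<gamma> < 0 \<Longrightarrow>
    (NN x. dist_weight \<Omega> \<gamma> x * indicator (cbox a (a + l *\<^sub>R One)) x) \<le> ennreal (C * l ^ DIM('a)) * dist_weight \<Omega> \<gamma> y"
    by (rule muckenhoupt_A1_pointwise[OF A1]) (rule that)
  have "z \<in> ?Q" by (rule mem_centered_cube) simp
  then have "(NN x. dist_weight \<Omega> \<gamma> x * indicator ?Q x) \<le> ennreal (C * (2 * 1) ^ DIM('a)) * dist_weight \<Omega> \<gamma> z"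
    by (intro C) (use \<gamma> in auto)
  then have "(NN x. dist_weight \<Omega> \<gamma> x * indicator ?Q x) = 0"
    using \<gamma> dz by (simp add: dist_weight_zero)
  then have "AE x in lborel. dist_weight \<Omega> \<gamma> x * indicator ?Q x = 0"
    by (subst (asm) nn_integral_0_iff_AE) auto
  moreover have "dist_weight \<Omega> \<gamma> x * indicator ?Q x \<noteq> 0" if "x \<in> ball z 1 \<inter> \<Omega>" for x
    using that bdist_pos[OF assms(1,3), of x] mem_centered_cube[of z x 1] by (simp add: dist_weight_pos)
  ultimately have "AE x in lborel. x \<notin> ball z 1 \<inter> \<Omega>" by (auto elim: eventually_mono)
  moreover have o: "open (ball z 1 \<inter> \<Omega>)" using assms(1) by (intro open_Int open_ball)
  ultimately have "ball z 1 \<inter> \<Omega> \<in> null_sets lborel" by (subst AE_iff_null_sets) auto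
  then have "negligible (ball z 1 \<inter> \<Omega>)" by (simp add: negligible_iff_null_sets null_sets_completionI)
  moreover have "ball z 1 \<inter> \<Omega> \<noteq> {}"
  proof -
    have "z \<in> closure \<Omega>" using z by (simp add: frontier_def)
    then have "z \<in> ball z 1 \<inter> closure \<Omega>" by simp
    then show ?thesis using open_Int_closure_eq_empty[OF open_ball, of z 1 \<Omega>] by blast
  qed
  ultimately show False using open_not_negligible[OF o] by blast
qed

text \<open>The common form to which both alternatives of the weight condition are reduced. It is
  asked for off the boundary, where the weight is finite and continuous, and with centred balls,
  which suit radial kernels.\<close>

definition pointwise_A1 :: "'a::euclidean_space set \<Rightarrow> real \<Rightarrow> real \<Rightarrow> bool" where
  "pointwise_A1 \<Omega> \<gamma> C \<longleftrightarrow> 0 \<le> C \<and> (\<forall>z r. 0 < r \<longrightarrow> 0 < bdist \<Omega> z \<longrightarrow>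
     (NN x. dist_weight \<Omega> \<gamma> x * indicator (ball z r) x) \<le> ennreal (C * r ^ DIM('a)) * dist_weight \<Omega> \<gamma> z)"

lemma cube_contains_ball:
  fixes z :: "'a::euclidean_space"
  shows "(NN x. w x * indicator (ball z r) x) \<le> (NN x. w x * indicator (cbox (z - r *\<^sub>R One) (z - r *\<^sub>R One + (2 * r) *\<^sub>R One)) x)"
  using mem_centered_cube[of z _ r] by (intro nn_integral_mono) (auto split: split_indicator simp: less_imp_le)

text \<open>The ball of radius r about z lies in the cube of side 2 r about z, whence the factor
  2^d.\<close>

lemma muckenhoupt_A1_imp_pointwise:
  fixes \<Omega> :: "'a::euclidean_space set"
  assumes A1: "muckenhoupt_A1 (dist_weight \<Omega> \<gamma>)"
  shows "\<exists>C. pointwise_A1 \<Omega> \<gamma> C"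
proof -
  obtain C :: real where "C > 0" and C: "\<And>(a::'a) l y. l > 0 \<Longrightarrow> y \<in> cbox a (a + l *\<^sub>R One) \<Longrightarrow> 0 < bdist \<Omega> y \<or> \<gamma> < 0 \<Longrightarrow>
    (NN x. dist_weight \<Omega> \<gamma> x * indicator (cbox a (a + l *\<^sub>R One)) x) \<le> ennreal (C * l ^ DIM('a)) * dist_weight \<Omega> \<gamma> y"
    by (rule muckenhoupt_A1_pointwise[OF A1]) (rule that)
  have "pointwise_A1 \<Omega> \<gamma> (C * 2 ^ DIM('a))"
    unfolding pointwise_A1_def
  proof (intro conjI allI impI)
    fix z :: 'a and r :: real assume "0 < r" "0 < bdist \<Omega> z"
    then have "(NN x. dist_weight \<Omega> \<gamma> x * indicator (cbox (z - r *\<^sub>R One) (z - r *\<^sub>R One + (2 * r) *\<^sub>R One)) x)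
      \<le> ennreal (C * (2 * r) ^ DIM('a)) * dist_weight \<Omega> \<gamma> z"
      by (intro C mem_centered_cube) auto
    from order_trans[OF cube_contains_ball this]
    show "(NN x. dist_weight \<Omega> \<gamma> x * indicator (ball z r) x) \<le> ennreal (C * 2 ^ DIM('a) * r ^ DIM('a)) * dist_weight \<Omega> \<gamma> z"
      by (simp add: power_mult_distrib mult.assoc)
  qed (use \<open>C > 0\<close> in simp)
  then show ?thesis ..
qed

section \<open>From A_p to the pointwise bound\<close>

lemma epowr_lower:
  assumes "0 < y" "ennreal y \<le> Y" "0 < q"
  shows "ennreal (y powr q) \<le> epowr Y q"
proof (cases Y)
  case (real v)
  then have "y \<le> v" using assms by (simp add: ennreal_le_iff)
  then have "y powr q \<le> v powr q" using assms by (intro powr_mono2) auto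
  then show ?thesis using real assms \<open>y \<le> v\<close> by (auto simp: epowr_def ennreal_leI)
qed (use assms in \<open>auto simp: epowr_def\<close>)

lemma le_if_epowr_le:
  assumes p: "p > 0" and le: "epowr X (1 / p) \<le> ennreal t" and t: "t \<ge> 0"
  shows "X \<le> ennreal (t powr p)"
proof (cases X)
  case (real x)
  show ?thesis
  proof (cases "x = 0")
    case False
    then have x: "x > 0" using real by simp
    then have "ennreal (x powr (1 / p)) \<le> ennreal t" using le real p by (simp add: epowr_def)
    then have "x powr (1 / p) \<le> t" using t by (simp add: ennreal_le_iff)
    then have "(x powr (1 / p)) powr p \<le> t powr p" using p by (intro powr_mono2) auto
    then show ?thesis using real x p by (simp add: powr_powr ennreal_leI)
  qed (use real in simp)
qed (use le p in \<open>auto simp: epowr_def top_unique\<close>)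

text \<open>On a cube \<open>Q\<close> with \<open>m = sup d\<close>, the \<open>A\<^sub>1\<close> bound for \<open>d\<^sup>-\<^sup>\<alpha>\<close> forces \<open>d \<ge> \<lambda> m\<close> on half
  of \<open>Q\<close>; this bounds the dual factor in the \<open>A\<^sub>p\<close> condition from below.\<close>

lemma muckenhoupt_Ap_imp_pointwise:
  fixes \<Omega> :: "'a::euclidean_space set"
  assumes p: "p > 1" and \<alpha>: "\<alpha> > 0" and \<gamma>: "\<gamma> > 0"
    and A1: "muckenhoupt_A1 (dist_weight \<Omega> \<alpha>)" and Ap: "muckenhoupt_Ap p (dist_weight \<Omega> \<gamma>)"
  shows "\<exists>C. pointwise_A1 \<Omega> \<gamma> C"
proof -
  obtain C0 :: real where C0: "C0 > 0" and C: "\<And>(a::'a) l y. l > 0 \<Longrightarrow> y \<in> cbox a (a + l *\<^sub>R One) \<Longrightarrow> 0 < bdist \<Omega> y \<or> \<alpha> < 0 \<Longrightarrow>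
    (NN x. dist_weight \<Omega> \<alpha> x * indicator (cbox a (a + l *\<^sub>R One)) x) \<le> ennreal (C0 * l ^ DIM('a)) * dist_weight \<Omega> \<alpha> y"
    by (rule muckenhoupt_A1_pointwise[OF A1]) (rule that)
  define S where "S = (SUP Q\<in>(cubes :: 'a set set).
        epowr (\<integral>\<^sup>+x\<in>Q. dist_weight \<Omega> \<gamma> x \<partial>lebesgue) (1 / p)
          * epowr (\<integral>\<^sup>+x\<in>Q. epowr (dist_weight \<Omega> \<gamma> x) (- 1 / (p - 1)) \<partial>lebesgue) ((p - 1) / p)
          / emeasure lebesgue Q)"
  have "S < \<infinity>" using Ap unfolding muckenhoupt_Ap_def S_def by blast
  then obtain S' where S': "S = ennreal S'" "S' \<ge> 0" by (cases S) auto
  \<comment> \<open>Chosen to make \<open>C0 * \<mu> powr \<alpha>\<close> equal to 1/2. By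
    Chebyshev's inequality the set E, where d < \<mu> m, then has at most half the volume of the
    cube.\<close>
  define \<mu> where "\<mu> = (2 * C0) powr (- (1 / \<alpha>))"
  have \<mu>: "\<mu> > 0" using C0 by (simp add: \<mu>_def)
  have "\<mu> powr \<alpha> = (2 * C0) powr (- 1)" using \<alpha> by (simp add: \<mu>_def powr_powr)
  then have \<mu>\<alpha>: "C0 * \<mu> powr \<alpha> = 1 / 2" using C0 by (simp add: powr_minus_divide)
  define C1 where "C1 = S' powr p * 2 powr (p - 1) * \<mu> powr (- \<gamma>)"
  have C1: "C1 \<ge> 0" by (simp add: C1_def)
  have main: "(NN x. dist_weight \<Omega> \<gamma> x * indicator (ball z r) x) \<le> ennreal (C1 * 2 ^ DIM('a) * r ^ DIM('a)) * dist_weight \<Omega> \<gamma> z"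
    if r: "0 < r" and z: "0 < bdist \<Omega> z" for z :: 'a and r
  proof -
    let ?Q = "cbox (z - r *\<^sub>R One) (z - r *\<^sub>R One + (2 * r) *\<^sub>R One)"
    define V where "V = (2 * r) ^ DIM('a)"
    have V: "V > 0" using r by (simp add: V_def)
    have emQ: "emeasure lborel ?Q = ennreal V" unfolding V_def using r by (intro emeasure_cube) simp
    have emQ': "emeasure lebesgue ?Q = ennreal V" using emQ by simp
    have zQ: "z \<in> ?Q" using r by (intro mem_centered_cube) simp
    \<comment> \<open>The A_1 bound for \<alpha> is used at the point of the cube farthest from the
      boundary, where its right-hand side is smallest.\<close>
    obtain y0 where y0: "y0 \<in> ?Q" "\<And>x. x \<in> ?Q \<Longrightarrow> bdist \<Omega> x \<le> bdist \<Omega> y0"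
      using continuous_attains_sup[OF compact_cbox _ continuous_bdist, of "z - r *\<^sub>R One" "z - r *\<^sub>R One + (2 * r) *\<^sub>R One" \<Omega>] zQ by blast
    define m where "m = bdist \<Omega> y0"
    have zm: "bdist \<Omega> z \<le> m" using y0(2)[OF zQ] by (simp add: m_def)
    then have m: "m > 0" using z by linarith
    define E where "E = {x\<in>?Q. bdist \<Omega> x < \<mu> * m}"
    define H where "H = {x\<in>?Q. \<not> bdist \<Omega> x < \<mu> * m}"
    have [measurable]: "E \<in> sets borel" "H \<in> sets borel" unfolding E_def H_def by measurable
    have "ennreal ((\<mu> * m) powr (- \<alpha>)) * emeasure lborel E = (NN x. ennreal ((\<mu> * m) powr (- \<alpha>)) * indicator E x)"
      by (simp add: nn_integral_cmult_indicator)
    also have "\<dots> \<le> (NN x. dist_weight \<Omega> \<alpha> x * indicator ?Q x)"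
    proof (rule nn_integral_mono)
      fix x
      show "ennreal ((\<mu> * m) powr (- \<alpha>)) * indicator E x \<le> dist_weight \<Omega> \<alpha> x * indicator ?Q x"
      proof (cases "x \<in> E")
        case True
        have "ennreal ((\<mu> * m) powr (- \<alpha>)) \<le> dist_weight \<Omega> \<alpha> x"
        proof (cases "bdist \<Omega> x = 0")
          case True
          then show ?thesis using \<alpha> by (simp add: dist_weight_zero)
        next
          case False
          then have "0 < bdist \<Omega> x" using bdist_nonneg[of \<Omega> x] by simp
          moreover have "bdist \<Omega> x \<le> \<mu> * m" using \<open>x \<in> E\<close> by (simp add: E_def)
          ultimately show ?thesis using \<alpha> by (simp add: dist_weight_pos ennreal_leI powr_mono2')
        qed
        then show ?thesis using True by (simp add: E_def)
      qed simp
    qed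
    also have "\<dots> \<le> ennreal (C0 * V) * dist_weight \<Omega> \<alpha> y0"
      unfolding V_def by (rule C) (use r y0(1) m in \<open>auto simp: m_def\<close>)
    also have "\<dots> = ennreal (C0 * V * m powr (- \<alpha>))" using m C0 V by (simp add: dist_weight_pos m_def ennreal_mult)
    finally have "ennreal ((\<mu> * m) powr \<alpha>) * (ennreal ((\<mu> * m) powr (- \<alpha>)) * emeasure lborel E) \<le> ennreal ((\<mu> * m) powr \<alpha>) * ennreal (C0 * V * m powr (- \<alpha>))"
      by (rule mult_left_mono) simp
    moreover have "ennreal ((\<mu> * m) powr \<alpha>) * (ennreal ((\<mu> * m) powr (- \<alpha>)) * emeasure lborel E) = emeasure lborel E"
      using \<mu> m by (simp add: mult.assoc[symmetric] ennreal_mult[symmetric] powr_add[symmetric])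
    moreover have "ennreal ((\<mu> * m) powr \<alpha>) * ennreal (C0 * V * m powr (- \<alpha>)) = ennreal (V / 2)"
    proof -
      have "(\<mu> * m) powr \<alpha> * (C0 * V * m powr (- \<alpha>)) = (C0 * \<mu> powr \<alpha>) * V * (m powr \<alpha> * m powr (- \<alpha>))"
        using \<mu> m by (simp add: powr_mult mult_ac)
      also have "\<dots> = V / 2" using m by (simp add: \<mu>\<alpha> flip: powr_add)
      finally show ?thesis using C0 V by (simp flip: ennreal_mult)
    qed
    ultimately have E: "emeasure lborel E \<le> ennreal (V / 2)" by simp
    have H: "ennreal (V / 2) \<le> emeasure lborel H"
    proof -
      have "emeasure lborel ?Q = emeasure lborel E + emeasure lborel H"
        by (subst plus_emeasure) (auto simp: E_def H_def intro!: arg_cong[where f="emeasure lborel"])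
      then have "ennreal (V / 2) + ennreal (V / 2) \<le> ennreal (V / 2) + emeasure lborel H"
        using E V emQ by (simp add: ennreal_plus[symmetric] add_right_mono del: ennreal_plus)
      then show ?thesis by (simp add: ennreal_add_left_cancel_le)
    qed
    \<comment> \<open>On the other half of the cube d >= \<mu> m, so the dual weight
      d^(\<gamma>/(p-1)) is at least (\<mu> m)^(\<gamma>/(p-1)) there.\<close>
    define y1 where "y1 = V / 2 * (\<mu> * m) powr (\<gamma> / (p - 1))"
    have y1: "y1 > 0" using V \<mu> m by (simp add: y1_def)
    let ?X = "NN x. dist_weight \<Omega> \<gamma> x * indicator ?Q x"
    let ?Y = "NN x. epowr (dist_weight \<Omega> \<gamma> x) (- 1 / (p - 1)) * indicator ?Q x"
    have "ennreal y1 = ennreal ((\<mu> * m) powr (\<gamma> / (p - 1))) * ennreal (V / 2)" using V by (simp add: y1_def ennreal_mult[symmetric] mult.commute)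
    also have "\<dots> \<le> ennreal ((\<mu> * m) powr (\<gamma> / (p - 1))) * emeasure lborel H" by (intro mult_left_mono H) simp
    also have "\<dots> = (NN x. ennreal ((\<mu> * m) powr (\<gamma> / (p - 1))) * indicator H x)"
      by (simp add: nn_integral_cmult_indicator)
    also have "\<dots> \<le> ?Y"
    proof (rule nn_integral_mono)
      fix x
      show "ennreal ((\<mu> * m) powr (\<gamma> / (p - 1))) * indicator H x \<le> epowr (dist_weight \<Omega> \<gamma> x) (- 1 / (p - 1)) * indicator ?Q x"
      proof (cases "x \<in> H")
        case True
        then have le: "\<mu> * m \<le> bdist \<Omega> x" "x \<in> ?Q" by (auto simp: H_def)
        then have d: "0 < bdist \<Omega> x" using \<mu> m by (meson less_le_trans mult_pos_pos)
        have "epowr (dist_weight \<Omega> \<gamma> x) (- 1 / (p - 1)) = ennreal ((bdist \<Omega> x powr (- \<gamma>)) powr (- 1 / (p - 1)))"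
          using d p by (simp add: dist_weight_pos epowr_def)
        also have "(bdist \<Omega> x powr (- \<gamma>)) powr (- 1 / (p - 1)) = bdist \<Omega> x powr (\<gamma> / (p - 1))"
          by (simp add: powr_powr)
        finally show ?thesis using le True \<mu> m p \<gamma> by (simp add: ennreal_leI powr_mono2)
      qed simp
    qed
    finally have Y: "ennreal y1 \<le> ?Y" .
    define c where "c = y1 powr ((p - 1) / p)"
    have c: "c > 0" using y1 by (simp add: c_def)
    have "?Q \<in> cubes" using r unfolding cubes_def by (intro CollectI exI[of _ "z - r *\<^sub>R One"] exI[of _ "2 * r"]) auto
    then have "epowr ?X (1 / p) * epowr ?Y ((p - 1) / p) / ennreal V \<le> S"
      unfolding S_def nn_integral_completion emQ'[symmetric] by (rule SUP_upper)
    then have "epowr ?X (1 / p) * epowr ?Y ((p - 1) / p) / ennreal V * ennreal V \<le> ennreal S' * ennreal V"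
      unfolding S' by (rule mult_right_mono) simp
    then have "epowr ?X (1 / p) * epowr ?Y ((p - 1) / p) \<le> ennreal (S' * V)"
      using V S' by (simp add: ennreal_divide_times ennreal_mult_divide_eq ennreal_mult)
    moreover have "epowr ?X (1 / p) * ennreal c \<le> epowr ?X (1 / p) * epowr ?Y ((p - 1) / p)"
      unfolding c_def using p by (intro mult_left_mono epowr_lower y1 Y) auto
    ultimately have "epowr ?X (1 / p) * ennreal c \<le> ennreal (S' * V)" by simp
    then have "epowr ?X (1 / p) * ennreal c * ennreal (1 / c) \<le> ennreal (S' * V) * ennreal (1 / c)" by (rule mult_right_mono) simp
    then have "epowr ?X (1 / p) \<le> ennreal (S' * V / c)"
      using c S' V by (simp add: mult.assoc ennreal_mult[symmetric])
    then have "?X \<le> ennreal ((S' * V / c) powr p)" using p S' V c by (intro le_if_epowr_le) auto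
    also have "(S' * V / c) powr p = C1 * V * m powr (- \<gamma>)"
    proof -
      have "c powr p = y1 powr (p - 1)" using p by (simp add: c_def powr_powr)
      also have "\<dots> = (V / 2) powr (p - 1) * ((\<mu> * m) powr (\<gamma> / (p - 1))) powr (p - 1)" unfolding y1_def by (rule powr_mult)
      also have "((\<mu> * m) powr (\<gamma> / (p - 1))) powr (p - 1) = (\<mu> * m) powr \<gamma>" using p by (simp only: powr_powr) simp
      finally have "(S' * V / c) powr p = S' powr p * (V powr p / (V / 2) powr (p - 1)) / (\<mu> * m) powr \<gamma>"
        using V S' c by (simp add: powr_divide powr_mult)
      also have "V powr p / (V / 2) powr (p - 1) = 2 powr (p - 1) * V"
        using V by (simp add: powr_divide powr_diff field_simps)
      also have "S' powr p * (2 powr (p - 1) * V) / (\<mu> * m) powr \<gamma> = C1 * V * m powr (- \<gamma>)"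
        using \<mu> m by (simp add: C1_def powr_mult powr_minus field_simps)
      finally show ?thesis .
    qed
    \<comment> \<open>As d(z) <= m and \<gamma> > 0, the bound by m^(-\<gamma>) is also one by the
      weight at z.\<close>
    also have "ennreal (C1 * V * m powr (- \<gamma>)) \<le> ennreal (C1 * V * bdist \<Omega> z powr (- \<gamma>))"
      using zm z \<gamma> C1 V by (intro ennreal_leI mult_left_mono powr_mono2') auto
    also have "\<dots> = ennreal (C1 * 2 ^ DIM('a) * r ^ DIM('a)) * dist_weight \<Omega> \<gamma> z"
      using z C1 r by (simp add: dist_weight_pos V_def power_mult_distrib ennreal_mult[symmetric] mult.assoc)
    finally show ?thesis using cube_contains_ball by (rule order_trans[rotated])
  qed
  have "pointwise_A1 \<Omega> \<gamma> (C1 * 2 ^ DIM('a))" using main C1 by (simp add: pointwise_A1_def)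
  then show ?thesis ..
qed

text \<open>In alternative (ii) the signs follow from \<alpha> + \<beta> >= 0 and \<alpha> \<beta>
  >= 0. In (i) the bound for \<alpha> + \<beta>, unless assumed, comes from A_p together with A_1
  for \<alpha>; if \<alpha> = 0 it is the assumption on \<beta>.\<close>

lemma weight_condition_consequences:
  fixes \<Omega> :: "'a::euclidean_space set"
  assumes "open \<Omega>" "\<Omega> \<noteq> {}" "\<Omega> \<noteq> UNIV" and w: "weight_condition \<Omega> \<alpha> \<beta>"
    and A: "p > 1 \<and> muckenhoupt_Ap p (dist_weight \<Omega> (\<alpha> + \<beta>)) \<or> muckenhoupt_A1 (dist_weight \<Omega> (\<alpha> + \<beta>))"
  shows "0 \<le> \<alpha>" "0 \<le> \<beta>" "\<exists>C. pointwise_A1 \<Omega> (\<alpha> + \<beta>) C"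
proof -
  note nn = muckenhoupt_A1_exponent_nonneg[OF assms(1-3)]
  have *: "0 \<le> \<alpha> \<and> 0 \<le> \<beta> \<and> (\<exists>C. pointwise_A1 \<Omega> (\<alpha> + \<beta>) C)"
    using w unfolding weight_condition_def
  proof (elim disjE conjE)
    assume a: "muckenhoupt_A1 (dist_weight \<Omega> \<alpha>)" and b: "muckenhoupt_A1 (dist_weight \<Omega> \<beta>)"
    have "\<exists>C. pointwise_A1 \<Omega> (\<alpha> + \<beta>) C"
    proof (cases "muckenhoupt_A1 (dist_weight \<Omega> (\<alpha> + \<beta>))")
      case False
      then have "\<alpha> \<noteq> 0" "p > 1" "muckenhoupt_Ap p (dist_weight \<Omega> (\<alpha> + \<beta>))" using A b by auto
      then show ?thesis using nn[OF a] nn[OF b] a by (intro muckenhoupt_Ap_imp_pointwise) auto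
    qed (rule muckenhoupt_A1_imp_pointwise)
    then show ?thesis using nn[OF a] nn[OF b] by simp
  next
    assume ab: "0 \<le> \<alpha> * \<beta>" and g: "muckenhoupt_A1 (dist_weight \<Omega> (\<alpha> + \<beta>))"
    have "0 \<le> \<alpha> + \<beta>" by (rule nn[OF g])
    then have "0 \<le> \<alpha> \<and> 0 \<le> \<beta>" using ab by (auto simp: zero_le_mult_iff)
    then show ?thesis using muckenhoupt_A1_imp_pointwise[OF g] by simp
  qed
  then show "0 \<le> \<alpha>" "0 \<le> \<beta>" "\<exists>C. pointwise_A1 \<Omega> (\<alpha> + \<beta>) C" by auto
qed

section \<open>The upper bound for Sobolev functions\<close>

text \<open>Both factors are largest at the smaller of the two distances, where their product is the
  weight of exponent \<alpha> + \<beta>. From here on there is one weight, taken at one endpoint at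
  a time.\<close>

lemma weight_product_le:
  assumes x: "0 < bdist \<Omega> x" and y: "0 < bdist \<Omega> y" and "0 \<le> \<alpha>" "0 \<le> \<beta>"
  shows "dist_weight \<Omega> \<alpha> x * dist_weight \<Omega> \<beta> y \<le> dist_weight \<Omega> (\<alpha> + \<beta>) x + dist_weight \<Omega> (\<alpha> + \<beta>) y"
proof -
  have le: "a powr (-\<alpha>) * b powr (-\<beta>) \<le> a powr (-(\<alpha> + \<beta>)) + b powr (-(\<alpha> + \<beta>))" if "0 < a" "0 < b" for a b :: real
  proof -
    define m where "m = min a b"
    have m: "0 < m" "m \<le> a" "m \<le> b" using that by (auto simp: m_def)
    have "a powr (-\<alpha>) * b powr (-\<beta>) \<le> m powr (-\<alpha>) * m powr (-\<beta>)"
      using m assms by (intro mult_mono powr_mono2') auto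
    also have "\<dots> = m powr (-(\<alpha> + \<beta>))" by (simp add: powr_add[symmetric])
    also have "\<dots> \<le> a powr (-(\<alpha> + \<beta>)) + b powr (-(\<alpha> + \<beta>))" by (simp add: m_def min_def)
    finally show ?thesis .
  qed
  show ?thesis using le[OF x y] x y
    by (simp add: dist_weight_pos ennreal_mult[symmetric] ennreal_plus[symmetric] ennreal_leI del: ennreal_plus minus_add_distrib)
qed

text \<open>The map h -> z + \<tau> h scales radii by |\<tau>| and volumes by |\<tau>|^d, and these
  cancel, so the constant is independent of \<tau>. The endpoints of the segment are z - t h and z +
  (1 - t) h.\<close>

lemma pointwise_A1_shift:
  fixes \<Omega> :: "'a::euclidean_space set"
  assumes A: "pointwise_A1 \<Omega> \<gamma> C" and z: "0 < bdist \<Omega> z" and r: "0 < r" and \<tau>: "\<tau> \<noteq> 0"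
  shows "(NN h. dist_weight \<Omega> \<gamma> (z + \<tau> *\<^sub>R h) * indicator (ball 0 r) h) \<le> ennreal (C * r ^ DIM('a)) * dist_weight \<Omega> \<gamma> z"
proof -
  have C: "C \<ge> 0" using A by (simp add: pointwise_A1_def)
  define I where "I = (NN h. dist_weight \<Omega> \<gamma> (z + \<tau> *\<^sub>R h) * indicator (ball 0 r) h)"
  have "ennreal (\<bar>\<tau>\<bar> ^ DIM('a)) * I = (NN x. dist_weight \<Omega> \<gamma> x * indicator (ball z (\<bar>\<tau>\<bar> * r)) x)"
  proof -
    have "dist z (z + \<tau> *\<^sub>R h) < \<bar>\<tau>\<bar> * r \<longleftrightarrow> norm h < r" for h :: 'a using \<tau> by (simp add: dist_norm)
    then show ?thesis unfolding I_def
      using nn_integral_lborel_affine[of "\<lambda>x. dist_weight \<Omega> \<gamma> x * indicator (ball z (\<bar>\<tau>\<bar> * r)) x" \<tau> z] \<tau>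
      by (simp add: indicator_def)
  qed
  also have "\<dots> \<le> ennreal (C * (\<bar>\<tau>\<bar> * r) ^ DIM('a)) * dist_weight \<Omega> \<gamma> z"
    using A z r \<tau> by (simp add: pointwise_A1_def)
  also have "\<dots> = ennreal (\<bar>\<tau>\<bar> ^ DIM('a)) * (ennreal (C * r ^ DIM('a)) * dist_weight \<Omega> \<gamma> z)"
    using C r by (simp add: ennreal_mult power_mult_distrib mult_ac)
  finally show ?thesis unfolding I_def[symmetric] using \<tau> by (subst (asm) ennreal_mult_le_mult_iff) auto
qed

text \<open>Two bounds with different uses: d / p is uniform in s and comes from the power integral
  over the unit ball; the other tends to 0 as s -> 1 for fixed a, because the kernel is bounded on
  |h| >= a. Their minimum prepares dominated convergence.\<close>

lemma mid_kernel_bound: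
  fixes \<Omega> :: "'a::euclidean_space set"
  assumes A: "pointwise_A1 \<Omega> \<gamma> C" and z: "0 < bdist \<Omega> z" and \<tau>: "\<tau> \<noteq> 0" and a: "0 < a" and p: "p \<ge> 1"
    and s: "s < 1" "p * (1 - s) \<le> 1 / 2"
  shows "ennreal (1 - s) * (NN h. ennreal (norm h powr p) * sker s p h
      * (if norm h < 1 \<and> a \<le> norm h then 1 else 0) * dist_weight \<Omega> \<gamma> (z + \<tau> *\<^sub>R h))
    \<le> ennreal (C * min (real DIM('a) / p) ((1 - s) * a powr (- real DIM('a)))) * dist_weight \<Omega> \<gamma> z"
proof -
  have C: "C \<ge> 0" using A by (simp add: pointwise_A1_def)
  define wz where "wz = bdist \<Omega> z powr (- \<gamma>)"
  have wz: "dist_weight \<Omega> \<gamma> z = ennreal wz" "wz \<ge> 0" using z by (auto simp: wz_def dist_weight_pos)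
  define q where "q = real DIM('a) + s * p - p"
  \<comment> \<open>With d >= 1 and p (1 - s) <= 1/2 the net exponent q = d - p (1 - s) is positive,
    as the power integral requires.\<close>
  have d1: "1 \<le> real DIM('a)" using DIM_positive[where 'a='a] by linarith
  have q3: "real DIM('a) - q = p * (1 - s)" by (simp add: q_def algebra_simps)
  moreover have "p * (1 - s) > 0" using s p by simp
  ultimately have q: "0 < q" "q < real DIM('a)" using s(2) d1 by linarith+
  have kq: "norm h powr p * norm h powr (- (real DIM('a) + s * p)) = norm h powr (- q)" for h :: 'a
    by (simp only: q_def powr_add[symmetric]) (simp add: algebra_simps)
  then have kE: "ennreal (norm h powr p) * sker s p h = ennreal (norm h powr (- q))" for h :: 'a
    by (simp only: ennreal_mult'[OF powr_ge_zero, symmetric])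
  let ?W = "\<lambda>h. dist_weight \<Omega> \<gamma> (z + \<tau> *\<^sub>R h)"
  let ?I = "NN h. ennreal (norm h powr p) * sker s p h
      * (if norm h < 1 \<and> a \<le> norm h then 1 else 0) * ?W h"
  have W: "(NN h. ?W h * indicator (ball 0 r) h) \<le> ennreal (C * wz) * ennreal (r powr real DIM('a))" if "0 < r" for r
    using pointwise_A1_shift[OF A z that \<tau>] that C wz by (simp add: powr_realpow ennreal_mult[symmetric] mult_ac)
  have "?I \<le> (NN h. ?W h * indicator (ball 0 1) h * ennreal (norm h powr (- q)))"
    unfolding kE by (rule nn_integral_mono) (auto simp: mult.commute)
  also have "\<dots> \<le> ennreal (C * wz) * ennreal (real DIM('a) / (real DIM('a) - q) * 1 powr (real DIM('a) - q))"
    using q W by (intro nn_integral_powr_ball_le) auto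
  finally have "ennreal (1 - s) * ?I \<le> ennreal (1 - s) * (ennreal (C * wz) * ennreal (real DIM('a) / (real DIM('a) - q) * 1 powr (real DIM('a) - q)))"
    by (rule mult_left_mono) simp
  also have "\<dots> = ennreal (C * (real DIM('a) / p) * wz)"
    unfolding q3 using s p C wz by (simp add: ennreal_mult[symmetric])
  finally have 1: "ennreal (1 - s) * ?I \<le> ennreal (C * (real DIM('a) / p) * wz)" .
  have "?I \<le> (NN h. ennreal (a powr (- real DIM('a))) * (?W h * indicator (ball 0 1) h))"
  proof (rule nn_integral_mono)
    fix h :: 'a
    show "ennreal (norm h powr p) * sker s p h
      * (if norm h < 1 \<and> a \<le> norm h then 1 else 0) * ?W h \<le> ennreal (a powr (- real DIM('a))) * (?W h * indicator (ball 0 1) h)"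
    proof (cases "norm h < 1 \<and> a \<le> norm h")
      case True
      have "norm h powr (- q) \<le> a powr (- q)" using True a q by (intro powr_mono2') auto
      also have "\<dots> \<le> a powr (- real DIM('a))" using True a q by (intro powr_mono') auto
      finally have "ennreal (norm h powr (- q)) * ?W h \<le> ennreal (a powr (- real DIM('a))) * ?W h"
        by (intro mult_right_mono ennreal_leI) auto
      then show ?thesis using True by (simp add: kE del: minus_add_distrib)
    qed auto
  qed
  also have "\<dots> = ennreal (a powr (- real DIM('a))) * (NN h. ?W h * indicator (ball 0 1) h)"
    by (rule nn_integral_cmult) measurable
  also have "\<dots> \<le> ennreal (a powr (- real DIM('a))) * (ennreal (C * wz) * ennreal (1 powr real DIM('a)))"
    by (intro mult_left_mono W) auto
  finally have "ennreal (1 - s) * ?I \<le> ennreal (1 - s) * (ennreal (a powr (- real DIM('a))) * (ennreal (C * wz) * ennreal (1 powr real DIM('a))))"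
    by (rule mult_left_mono) simp
  also have "\<dots> = ennreal (C * ((1 - s) * a powr (- real DIM('a))) * wz)"
    using s C wz by (simp add: ennreal_mult[symmetric] mult_ac)
  finally have "ennreal (1 - s) * ?I \<le> ennreal (C * min (real DIM('a) / p) ((1 - s) * a powr (- real DIM('a))) * wz)"
    using 1 by (simp add: min_def)
  then show ?thesis using C wz s p by (simp add: ennreal_mult)
qed

section \<open>The contribution of boundary points\<close>

lemma singular_kernel_ball_le:
  assumes "p \<ge> 1" "0 < s" "s < 1"
  shows "ennreal (1 - s) * (NN (h::'a::euclidean_space). ennreal (norm h powr p) * sker s p h * indicator (ball 0 1) h)
    \<le> ennreal (unit_ball_vol DIM('a) * (real DIM('a) + p) / p)"
proof -
  have "ennreal (1 - s) * (NN (h::'a). ennreal (norm h powr p) * sker s p h * indicator (ball 0 1) h)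
    \<le> ennreal (1 - s) * ennreal (unit_ball_vol DIM('a) * (real DIM('a) + p) / (p * (1 - s)) * 1 powr (p * (1 - s)))"
    using kernel_integral_norm[OF assms, of 1, where 'a='a] by (intro mult_left_mono) (auto simp: mult_ac)
  also have "\<dots> = ennreal (unit_ball_vol DIM('a) * (real DIM('a) + p) / p)"
    using assms by (simp add: ennreal_mult[symmetric])
  finally show ?thesis .
qed

lemma shift_dist_le:
  assumes [measurable]: "u \<in> Borel"
  shows "shift_dist u v \<le> 2 * (NN x. ennreal (norm (u x)))"
proof -
  have "shift_dist u v \<le> (NN x. ennreal (norm (u (x + v))) + ennreal (norm (u x)))"
    unfolding shift_dist_def
    by (intro nn_integral_mono) (simp add: ennreal_plus[symmetric] norm_triangle_ineq4 ennreal_leI del: ennreal_plus)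
  also have "\<dots> = 2 * (NN x. ennreal (norm (u x)))"
    using nn_integral_lborel_shift[of "\<lambda>x. ennreal (norm (u x))" v] by (subst nn_integral_add) (auto simp: mult_2)
  finally show ?thesis .
qed

text \<open>1 - s times the kernel has bounded mass and concentrates at 0. For |h| < \<delta> the
  translations of u are small in L^1; for \<delta> <= |h| < 1 the kernel is bounded and the factor 1
  - s wins.\<close>

lemma shifted_kernel_tendsto:
  fixes u :: "'a::euclidean_space \<Rightarrow> real"
  assumes u: "integrable lborel u" and p: "p \<ge> 1"
  shows "((\<lambda>s. ennreal (1 - s) * (\<integral>\<^sup>+t\<in>{0..1}. (NN h. ennreal (norm h powr p) * sker s p h
      * indicator (ball 0 1) h * shift_dist u (- (t *\<^sub>R h))) \<partial>(lborel :: real measure))) \<longlongrightarrow> 0) (at_left 1)"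
proof (rule order_tendstoI)
  have [measurable]: "u \<in> Borel" using u by simp
  define N where "N = 2 * (NN x. ennreal (norm (u x)))"
  have N: "N < \<infinity>" using u by (simp add: N_def integrable_iff_bounded ennreal_mult_less_top)
  let ?k = "\<lambda>s (h::'a). ennreal (norm h powr p) * sker s p h * indicator (ball 0 1) h"
  define c where "c = unit_ball_vol DIM('a) * (real DIM('a) + p) / p"
  have c: "c \<ge> 0" using p by (simp add: c_def)
  fix y :: ennreal assume y: "0 < y"
  obtain y' where y': "0 < y'" "y' < y" using dense[OF y] by blast
  then obtain e where e: "0 < e" "ennreal e < y" by (cases y') auto
  define \<epsilon> where "\<epsilon> = e / (2 * (c + 1))"
  have \<epsilon>: "\<epsilon> > 0" using e c by (simp add: \<epsilon>_def)
  have "\<forall>\<^sub>F v in at 0. shift_dist u v < ennreal \<epsilon>"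
    using shift_dist_tendsto_0[OF u] \<epsilon> by (intro order_tendstoD(2)) auto
  then obtain \<delta>0 where \<delta>0: "\<delta>0 > 0" "\<And>v. v \<noteq> 0 \<Longrightarrow> norm v < \<delta>0 \<Longrightarrow> shift_dist u v < ennreal \<epsilon>"
    unfolding eventually_at by (auto simp: dist_norm)
  define \<delta> where "\<delta> = min \<delta>0 1"
  have \<delta>: "0 < \<delta>" "\<delta> \<le> 1" "\<delta> \<le> \<delta>0" using \<delta>0(1) by (auto simp: \<delta>_def)
  define M where "M = ennreal (\<delta> powr (- (real DIM('a) + p))) * N * ennreal (unit_ball_vol DIM('a))"
  have M: "M < \<infinity>" using N by (simp add: M_def ennreal_mult_less_top)
  have small: "shift_dist u v \<le> ennreal \<epsilon>" if "norm v < \<delta>" for v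
  proof (cases "v = 0")
    case True
    then show ?thesis by (simp add: shift_dist_def)
  next
    case False
    then show ?thesis using \<delta>0(2)[of v] that \<delta> by auto
  qed
  have bound: "ennreal (1 - s) * (\<integral>\<^sup>+t\<in>{0..1}. (NN h. ?k s h * shift_dist u (- (t *\<^sub>R h))) \<partial>(lborel :: real measure))
    \<le> ennreal (e / 2) + ennreal (1 - s) * M" if s: "0 < s" "s < 1" for s
  proof -
    have inner: "(NN h. ?k s h * shift_dist u (- (t *\<^sub>R h))) \<le> ennreal \<epsilon> * (NN h. ?k s h) + M" if t: "t \<in> {0..1}" for t
    proof -
      have "(NN h. ?k s h * shift_dist u (- (t *\<^sub>R h)))
        \<le> (NN h. ennreal \<epsilon> * ?k s h + ennreal (\<delta> powr (- (real DIM('a) + p))) * N * indicator (ball 0 1) h)"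
      proof (rule nn_integral_mono)
        fix h :: 'a
        show "?k s h * shift_dist u (- (t *\<^sub>R h)) \<le> ennreal \<epsilon> * ?k s h + ennreal (\<delta> powr (- (real DIM('a) + p))) * N * indicator (ball 0 1) h"
        proof (cases "norm h < \<delta>")
          case True
          have "norm (t *\<^sub>R h) \<le> norm h" using t by (simp add: mult_left_le_one_le)
          then have "?k s h * shift_dist u (- (t *\<^sub>R h)) \<le> ?k s h * ennreal \<epsilon>" using True by (intro mult_left_mono small) auto
          then show ?thesis by (simp add: mult.commute add_increasing2)
        next
          case False
          show ?thesis
          proof (cases "norm h < 1")
            case True
            have sp: "0 \<le> s * p" "s * p \<le> p" using s p by (auto simp: mult_left_le_one_le)
            have "norm h powr (- (real DIM('a) + s * p)) \<le> \<delta> powr (- (real DIM('a) + s * p))"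
              using False \<delta> sp by (intro powr_mono2') auto
            also have "\<dots> \<le> \<delta> powr (- (real DIM('a) + p))" using \<delta> sp by (intro powr_mono') auto
            finally have "norm h powr p * norm h powr (- (real DIM('a) + s * p)) \<le> 1 powr p * \<delta> powr (- (real DIM('a) + p))"
              using True p by (intro mult_mono powr_mono2) auto
            then have "ennreal (norm h powr p * norm h powr (- (real DIM('a) + s * p))) * shift_dist u (- (t *\<^sub>R h)) \<le> ennreal (\<delta> powr (- (real DIM('a) + p))) * N"
              unfolding N_def by (intro mult_mono shift_dist_le ennreal_leI) auto
            then have "?k s h * shift_dist u (- (t *\<^sub>R h)) \<le> ennreal (\<delta> powr (- (real DIM('a) + p))) * N * indicator (ball 0 1) h"
              using True by (simp add: ennreal_mult)
            then show ?thesis by (rule add_increasing[OF zero_le])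
          qed simp
        qed
      qed
      also have "\<dots> = ennreal \<epsilon> * (NN h. ?k s h) + M"
        unfolding M_def by (subst nn_integral_add) (auto simp: nn_integral_cmult nn_integral_cmult_indicator emeasure_ball)
      finally show ?thesis .
    qed
    have "(\<integral>\<^sup>+t\<in>{0..1}. (NN h. ?k s h * shift_dist u (- (t *\<^sub>R h))) \<partial>(lborel :: real measure))
      \<le> (\<integral>\<^sup>+t\<in>{0..1}. ennreal \<epsilon> * (NN h. ?k s h) + M \<partial>(lborel :: real measure))"
      using inner by (intro nn_integral_mono) (auto split: split_indicator)
    also have "\<dots> = ennreal \<epsilon> * (NN h. ?k s h) + M" by (simp add: nn_integral_cmult_indicator)
    finally have "ennreal (1 - s) * (\<integral>\<^sup>+t\<in>{0..1}. (NN h. ?k s h * shift_dist u (- (t *\<^sub>R h))) \<partial>(lborel :: real measure))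
      \<le> ennreal (1 - s) * (ennreal \<epsilon> * (NN h. ?k s h) + M)" by (rule mult_left_mono) simp
    also have "\<dots> = ennreal \<epsilon> * (ennreal (1 - s) * (NN h. ?k s h)) + ennreal (1 - s) * M"
      by (simp only: distrib_left mult_ac)
    also have "\<dots> \<le> ennreal \<epsilon> * ennreal c + ennreal (1 - s) * M"
      unfolding c_def by (intro add_right_mono mult_left_mono singular_kernel_ball_le p s) simp
    also have "ennreal \<epsilon> * ennreal c \<le> ennreal (e / 2)"
    proof -
      have "\<epsilon> * c \<le> \<epsilon> * (c + 1)" using \<epsilon> by simp
      also have "\<dots> = e / 2" using c by (simp add: \<epsilon>_def divide_simps)
      finally show ?thesis using \<epsilon> c by (simp add: ennreal_mult[symmetric] ennreal_leI)
    qed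
    finally show ?thesis by (simp add: add_right_mono)
  qed
  have "\<forall>\<^sub>F s in at_left 1. ennreal (1 - s) * M < ennreal (e / 2)"
    using tendsto_one_minus_mult[OF M] e by (intro order_tendstoD(2)) auto
  moreover have "\<forall>\<^sub>F s in at_left (1::real). 0 < s \<and> s < 1" by (rule eventually_at_leftI[of 0]) auto
  ultimately show "\<forall>\<^sub>F s in at_left 1. ennreal (1 - s) * (\<integral>\<^sup>+t\<in>{0..1}. (NN h. ?k s h * shift_dist u (- (t *\<^sub>R h))) \<partial>(lborel :: real measure)) < y"
  proof eventually_elim
    case (elim s)
    have "ennreal (1 - s) * (\<integral>\<^sup>+t\<in>{0..1}. (NN h. ?k s h * shift_dist u (- (t *\<^sub>R h))) \<partial>(lborel :: real measure))
      \<le> ennreal (e / 2) + ennreal (1 - s) * M" using elim by (intro bound) auto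
    also have "\<dots> \<le> ennreal (e / 2) + ennreal (e / 2)" using elim by (intro add_left_mono) auto
    also have "\<dots> = ennreal e" using e by (simp add: ennreal_plus[symmetric] del: ennreal_plus)
    finally show ?case using e(2) by simp
  qed
qed (simp only: not_less_zero)

text \<open>Where z - v lies in \<Omega>, u vanishes at z - v, so u(z) is itself an increment of
  u.\<close>

lemma frontier_shift_le:
  fixes u :: "'a::euclidean_space \<Rightarrow> real"
  assumes "open \<Omega>" and u: "\<And>x. x \<in> \<Omega> \<Longrightarrow> u x = 0" "\<And>x. 0 \<le> u x" and [measurable]: "u \<in> Borel"
  shows "(NN z. ennreal (u z) * indicator \<Omega> (z - v)) \<le> shift_dist u (- v)"
  unfolding shift_dist_def
proof (rule nn_integral_mono)
  fix z show "ennreal (u z) * indicator \<Omega> (z - v) \<le> ennreal (norm (u (z + - v) - u z))"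
    using u(1)[of "z - v"] u(2)[of z] by (cases "z - v \<in> \<Omega>") auto
qed

text \<open>If \<open>\<alpha> + \<beta> = 0\<close>, the boundary may have positive measure, and the \<open>A\<^sub>1\<close> bound says nothing
  on it. There continuity of translations in \<open>L\<^sup>1\<close> is used instead: points \<open>x \<in> \<Omega>\<close> and \<open>z\<close> in the boundary
  are in disjoint sets.\<close>

lemma mid_energy_le:
  fixes \<Omega> :: "'a::euclidean_space set"
  assumes "open \<Omega>" "\<Omega> \<noteq> {}" "\<Omega> \<noteq> UNIV" and FG: "ftc_bound F G" and p: "p \<ge> 1" and \<theta>: "0 < \<theta>"
    and \<alpha>\<beta>: "0 \<le> \<alpha>" "0 \<le> \<beta>" and A: "pointwise_A1 \<Omega> (\<alpha> + \<beta>) C"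
    and fin: "(NN z. ennreal (norm (G z) powr p) * dist_weight \<Omega> (\<alpha> + \<beta>) z) < \<infinity>"
    and s: "s < 1" "p * (1 - s) \<le> 1 / 2"
  shows "ennreal (1 - s) * (NN x. NN h. energy_integrand \<Omega> s p \<alpha> \<beta> F x h
            * (if norm h < 1 \<and> \<theta> * bdist \<Omega> x \<le> norm h then 1 else 0))
    \<le> (NN z. ennreal (norm (G z) powr p) * dist_weight \<Omega> (\<alpha> + \<beta>) z
          * (ennreal (2 * (C * min (real DIM('a) / p) ((1 - s) * (\<theta> / (1 + \<theta>) * bdist \<Omega> z) powr (- real DIM('a)))))
             * (if 0 < bdist \<Omega> z then 1 else 0)))
      + 2 * (ennreal (1 - s) * (\<integral>\<^sup>+t\<in>{0..1}. (NN h. ennreal (norm h powr p) * sker s p h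
          * indicator (ball 0 1) h * shift_dist (\<lambda>z. norm (G z) powr p * indicator (frontier \<Omega>) z) (- (t *\<^sub>R h))) \<partial>(lborel :: real measure)))"
    (is "ennreal (1 - s) * ?E \<le> ?M + 2 * (ennreal (1 - s) * ?S)")
proof -
  have [measurable]: "\<Omega> \<in> sets borel" using \<open>open \<Omega>\<close> by (rule borel_open)
  have [measurable]: "F \<in> Borel" "G \<in> Borel"
    using FG by (auto simp: ftc_bound_def)
  have [measurable]: "frontier \<Omega> \<in> sets borel" by (rule borel_closed) simp
  have C: "C \<ge> 0" using A by (simp add: pointwise_A1_def)
  let ?w = "dist_weight \<Omega> (\<alpha> + \<beta>)"
  define u where "u z = norm (G z) powr p * indicator (frontier \<Omega>) z" for z
  have [measurable]: "u \<in> Borel" unfolding u_def by measurable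
  \<comment> \<open>From \<theta> d(z - t h) <= |h| and d(z) <= d(z - t h) + |h| follows |h| >=
    \<eta> d(z).\<close>
  define \<eta> where "\<eta> = \<theta> / (1 + \<theta>)"
  have \<eta>: "\<eta> > 0" using \<theta> by (simp add: \<eta>_def)
  define K where "K h = ennreal (norm h powr p) * sker s p h" for h :: 'a
  have [measurable]: "K \<in> Borel" unfolding K_def by measurable
  define k where "k x h = sker s p h
     * (indicator \<Omega> x * (?w x + ?w (x + h)))
     * (if norm h < 1 \<and> \<theta> * bdist \<Omega> x \<le> norm h then 1 else 0)" for x h
  have [measurable]: "case_prod k \<in> borel_measurable (borel \<Otimes>\<^sub>M borel)"
    unfolding k_def by measurable
  define B where "B z = ennreal (norm (G z) powr p) * ?w z
          * (ennreal (2 * (C * min (real DIM('a) / p) ((1 - s) * (\<eta> * bdist \<Omega> z) powr (- real DIM('a)))))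
             * (if 0 < bdist \<Omega> z then 1 else 0))" for z
  have [measurable]: "B \<in> Borel" unfolding B_def by measurable
  \<comment> \<open>The contribution of a boundary point z if \<alpha> + \<beta> = 0; it is
    estimated only after integration in z.\<close>
  define T where "T t z = (NN h. K h * indicator (ball 0 1) h * (ennreal (u z) * indicator \<Omega> (z - t *\<^sub>R h)))" for t :: real and z
  have Gh: "ennreal (\<bar>G z \<bullet> h\<bar> powr p) * (sker s p h) \<le> ennreal (norm (G z) powr p) * K h" for z h
  proof -
    have "\<bar>G z \<bullet> h\<bar> powr p \<le> (norm (G z) * norm h) powr p" using p by (intro powr_mono2 Cauchy_Schwarz_ineq2) auto
    also have "\<dots> = norm (G z) powr p * norm h powr p" by (simp add: powr_mult)
    finally have "\<bar>G z \<bullet> h\<bar> powr p * norm h powr (- (real DIM('a) + s * p)) \<le> norm (G z) powr p * norm h powr p * norm h powr (- (real DIM('a) + s * p))"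
      by (rule mult_right_mono) simp
    then show ?thesis unfolding K_def by (simp add: ennreal_mult[symmetric] ennreal_leI mult.assoc del: minus_add_distrib)
  qed
  \<comment> \<open>For \<alpha> + \<beta> > 0 the weight is infinite on the boundary, so finiteness
    of the weighted integral makes G vanish almost everywhere there.\<close>
  have null: "AE z in lborel. \<not> (bdist \<Omega> z = 0 \<and> \<alpha> + \<beta> > 0 \<and> G z \<noteq> 0)"
  proof -
    have "AE z in lborel. ennreal (norm (G z) powr p) * ?w z \<noteq> \<infinity>"
      using fin by (intro nn_integral_PInf_AE) auto
    then show ?thesis by eventually_elim (auto simp: dist_weight_zero ennreal_mult_top split: if_splits)
  qed
  have pt: "AE z in lborel. ennreal (1 - s) * (NN h. ennreal (\<bar>G z \<bullet> h\<bar> powr p) * k (z - t *\<^sub>R h) h)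
      \<le> B z + 2 * (ennreal (1 - s) * T t z)" if t: "0 < t" "t < 1" for t
    using null
  proof eventually_elim
    case (elim z)
    consider "0 < bdist \<Omega> z" | "bdist \<Omega> z = 0" "\<alpha> + \<beta> = 0" | "bdist \<Omega> z = 0" "\<alpha> + \<beta> > 0"
      using bdist_nonneg[of \<Omega> z] \<alpha>\<beta> by fastforce
    then show ?case
    proof cases
      case 1
      define a where "a = \<eta> * bdist \<Omega> z"
      have a: "a > 0" using 1 \<eta> by (simp add: a_def)
      define b where "b = ennreal (C * min (real DIM('a) / p) ((1 - s) * a powr (- real DIM('a))))"
      let ?J = "\<lambda>\<tau>. (NN h. K h * (if norm h < 1 \<and> a \<le> norm h then 1 else 0) * ?w (z + \<tau> *\<^sub>R h))"
      have J: "ennreal (1 - s) * ?J \<tau> \<le> b * ?w z" if "\<tau> \<noteq> 0" for \<tau>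
        unfolding K_def b_def by (rule mid_kernel_bound[OF A 1 that a p s])
      have "(NN h. ennreal (\<bar>G z \<bullet> h\<bar> powr p) * k (z - t *\<^sub>R h) h)
        \<le> (NN h. ennreal (norm (G z) powr p) * (K h * (if norm h < 1 \<and> a \<le> norm h then 1 else 0) * ?w (z + (- t) *\<^sub>R h)
             + K h * (if norm h < 1 \<and> a \<le> norm h then 1 else 0) * ?w (z + (1 - t) *\<^sub>R h)))"
      proof (rule nn_integral_mono)
        fix h :: 'a
        show "ennreal (\<bar>G z \<bullet> h\<bar> powr p) * k (z - t *\<^sub>R h) h
          \<le> ennreal (norm (G z) powr p) * (K h * (if norm h < 1 \<and> a \<le> norm h then 1 else 0) * ?w (z + (- t) *\<^sub>R h)
             + K h * (if norm h < 1 \<and> a \<le> norm h then 1 else 0) * ?w (z + (1 - t) *\<^sub>R h))"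
        proof (cases "norm h < 1 \<and> \<theta> * bdist \<Omega> (z - t *\<^sub>R h) \<le> norm h")
          case True
          have th: "t * norm h \<le> norm h" using t by (simp add: mult_left_le_one_le)
          have "bdist \<Omega> z \<le> bdist \<Omega> (z - t *\<^sub>R h) + t * norm h"
            using bdist_le_add[of \<Omega> z "z - t *\<^sub>R h"] t by (simp add: dist_norm)
          then have "bdist \<Omega> z \<le> bdist \<Omega> (z - t *\<^sub>R h) + norm h" using th by linarith
          then have "\<theta> * bdist \<Omega> z \<le> \<theta> * bdist \<Omega> (z - t *\<^sub>R h) + \<theta> * norm h" using \<theta> by (simp add: distrib_left[symmetric])
          then have "\<theta> * bdist \<Omega> z \<le> (1 + \<theta>) * norm h" using True by (simp add: distrib_right)
          then have ah: "a \<le> norm h" using \<theta> by (simp add: a_def \<eta>_def divide_le_eq mult.commute)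
          have eq: "z + (- t) *\<^sub>R h = z - t *\<^sub>R h" "z + (1 - t) *\<^sub>R h = z - t *\<^sub>R h + h" by (simp_all add: scaleR_diff_left)
          have "ennreal (\<bar>G z \<bullet> h\<bar> powr p) * k (z - t *\<^sub>R h) h
            \<le> (ennreal (\<bar>G z \<bullet> h\<bar> powr p) * sker s p h) * (?w (z - t *\<^sub>R h) + ?w (z - t *\<^sub>R h + h))"
            unfolding k_def using True by (auto split: split_indicator simp: mult.assoc)
          also have "\<dots> \<le> (ennreal (norm (G z) powr p) * K h) * (?w (z - t *\<^sub>R h) + ?w (z - t *\<^sub>R h + h))"
            by (rule mult_right_mono[OF Gh]) simp
          finally show ?thesis using True ah unfolding eq by (simp add: distrib_left mult.assoc)
        qed (auto simp: k_def)
      qed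
      also have "\<dots> = ennreal (norm (G z) powr p) * (?J (- t) + ?J (1 - t))"
        by (subst nn_integral_cmult, measurable, subst nn_integral_add, measurable)
      finally have "ennreal (1 - s) * (NN h. ennreal (\<bar>G z \<bullet> h\<bar> powr p) * k (z - t *\<^sub>R h) h)
        \<le> ennreal (1 - s) * (ennreal (norm (G z) powr p) * (?J (- t) + ?J (1 - t)))" by (rule mult_left_mono) simp
      also have "\<dots> = ennreal (norm (G z) powr p) * (ennreal (1 - s) * ?J (- t) + ennreal (1 - s) * ?J (1 - t))"
        by (simp only: distrib_left mult_ac)
      also have "\<dots> \<le> ennreal (norm (G z) powr p) * (b * ?w z + b * ?w z)"
        by (intro mult_left_mono add_mono J) (use t in auto)
      also have "\<dots> = B z"
      proof -
        have "ennreal (2 * (C * min (real DIM('a) / p) ((1 - s) * a powr (- real DIM('a))))) = b + b"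
          unfolding b_def by (subst mult_2, rule ennreal_plus) (use C p s in auto)
        then show ?thesis using 1 by (simp add: B_def a_def[symmetric] distrib_left distrib_right mult_ac)
      qed
      finally show ?thesis by (simp add: add_increasing2)
    next
      case 2
      have z: "z \<in> frontier \<Omega>" using 2 bdist_pos_iff[OF assms(2,3), of z] by auto
      have "(NN h. ennreal (\<bar>G z \<bullet> h\<bar> powr p) * k (z - t *\<^sub>R h) h)
        \<le> (NN h. 2 * (K h * indicator (ball 0 1) h * (ennreal (u z) * indicator \<Omega> (z - t *\<^sub>R h))))"
      proof (rule nn_integral_mono)
        fix h :: 'a
        have "ennreal (\<bar>G z \<bullet> h\<bar> powr p) * k (z - t *\<^sub>R h) h
          \<le> (ennreal (\<bar>G z \<bullet> h\<bar> powr p) * sker s p h) * (2 * (indicator \<Omega> (z - t *\<^sub>R h) * indicator (ball 0 1) h))"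
          unfolding k_def using 2 by (auto split: split_indicator simp: mult_ac)
        also have "\<dots> \<le> (ennreal (norm (G z) powr p) * K h) * (2 * (indicator \<Omega> (z - t *\<^sub>R h) * indicator (ball 0 1) h))"
          by (rule mult_right_mono[OF Gh]) simp
        finally show "ennreal (\<bar>G z \<bullet> h\<bar> powr p) * k (z - t *\<^sub>R h) h
          \<le> 2 * (K h * indicator (ball 0 1) h * (ennreal (u z) * indicator \<Omega> (z - t *\<^sub>R h)))"
          using z by (simp add: u_def mult_ac)
      qed
      also have "\<dots> = 2 * T t z" unfolding T_def by (rule nn_integral_cmult) measurable
      finally have "ennreal (1 - s) * (NN h. ennreal (\<bar>G z \<bullet> h\<bar> powr p) * k (z - t *\<^sub>R h) h) \<le> ennreal (1 - s) * (2 * T t z)"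
        by (rule mult_left_mono) simp
      also have "\<dots> = 2 * (ennreal (1 - s) * T t z)" by (simp only: mult_ac)
      finally show ?thesis by (simp add: add_increasing)
    next
      case 3
      then have "G z = 0" using elim by blast
      then show ?thesis by simp
    qed
  qed
  have ST: "(NN z. T t z) \<le> (NN h. K h * indicator (ball 0 1) h * shift_dist u (- (t *\<^sub>R h)))" for t
  proof -
    have "(NN z. T t z) = (NN h. NN z. K h * indicator (ball 0 1) h * (ennreal (u z) * indicator \<Omega> (z - t *\<^sub>R h)))"
      unfolding T_def by (rule lborel_pair.Fubini') measurable
    also have "\<dots> = (NN h. K h * indicator (ball 0 1) h * (NN z. ennreal (u z) * indicator \<Omega> (z - t *\<^sub>R h)))"
      by (intro nn_integral_cong nn_integral_cmult) measurable
    also have "\<dots> \<le> (NN h. K h * indicator (ball 0 1) h * shift_dist u (- (t *\<^sub>R h)))"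
    proof (intro nn_integral_mono mult_left_mono frontier_shift_le \<open>open \<Omega>\<close>)
      show "u x = 0" if "x \<in> \<Omega>" for x
        using that \<open>open \<Omega>\<close> by (simp add: u_def frontier_def interior_open)
    qed (auto simp: u_def)
    finally show ?thesis .
  qed
  have [measurable]: "T t \<in> Borel" for t unfolding T_def by measurable
  have "?E \<le> (NN x. NN h. ennreal (\<bar>F (x + h) - F x\<bar> powr p) * k x h)"
  proof (intro nn_integral_mono)
    fix x h :: 'a
    show "energy_integrand \<Omega> s p \<alpha> \<beta> F x h * (if norm h < 1 \<and> \<theta> * bdist \<Omega> x \<le> norm h then 1 else 0)
      \<le> ennreal (\<bar>F (x + h) - F x\<bar> powr p) * k x h"
    proof (cases "x \<in> \<Omega> \<and> x + h \<in> \<Omega>")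
      case True
      then have "dist_weight \<Omega> \<alpha> x * dist_weight \<Omega> \<beta> (x + h) \<le> ?w x + ?w (x + h)"
        by (intro weight_product_le bdist_pos[OF assms(1,3)] \<alpha>\<beta>) auto
      then have "ennreal (\<bar>F (x + h) - F x\<bar> powr p) * sker s p h * (dist_weight \<Omega> \<alpha> x * dist_weight \<Omega> \<beta> (x + h))
        \<le> ennreal (\<bar>F (x + h) - F x\<bar> powr p) * sker s p h * (?w x + ?w (x + h))"
        by (rule mult_left_mono) simp
      then show ?thesis using True by (simp add: energy_integrand_def k_def mult.assoc)
    qed (auto simp: energy_integrand_def)
  qed
  also have "\<dots> \<le> (\<integral>\<^sup>+t\<in>{0..1}. (NN z. NN h. ennreal (\<bar>G z \<bullet> h\<bar> powr p) * k (z - t *\<^sub>R h) h) \<partial>lborel)"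
    by (rule ftc_bound_energy[OF FG p]) measurable
  finally have "ennreal (1 - s) * ?E \<le> ennreal (1 - s) * (\<integral>\<^sup>+t\<in>{0..1}. (NN z. NN h. ennreal (\<bar>G z \<bullet> h\<bar> powr p) * k (z - t *\<^sub>R h) h) \<partial>(lborel::real measure))"
    by (rule mult_left_mono) simp
  also have "\<dots> = (\<integral>\<^sup>+t\<in>{0..1}. (NN z. ennreal (1 - s) * (NN h. ennreal (\<bar>G z \<bullet> h\<bar> powr p) * k (z - t *\<^sub>R h) h)) \<partial>(lborel::real measure))"
  proof -
    have [measurable]: "(\<lambda>(t, z). NN h. ennreal (\<bar>G z \<bullet> h\<bar> powr p) * k (z - t *\<^sub>R h) h) \<in> borel_measurable (borel \<Otimes>\<^sub>M borel)"
      unfolding k_def by measurable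
    show ?thesis by (simp add: nn_integral_cmult mult.assoc)
  qed
  also have "\<dots> \<le> (\<integral>\<^sup>+t\<in>{0..1}. ?M + 2 * (ennreal (1 - s) * (NN h. K h * indicator (ball 0 1) h * shift_dist u (- (t *\<^sub>R h)))) \<partial>(lborel::real measure))"
  proof (rule nn_integral_mono_AE)
    \<comment> \<open>At t = 0 or t = 1 one endpoint is z itself, and the shifted bound has no
      averaging in h.\<close>
    have "AE t in (lborel::real measure). t \<noteq> 0 \<and> t \<noteq> 1" using AE_lborel_singleton[of 0] AE_lborel_singleton[of 1] by eventually_elim auto
    then show "AE t in lborel. (NN z. ennreal (1 - s) * (NN h. ennreal (\<bar>G z \<bullet> h\<bar> powr p) * k (z - t *\<^sub>R h) h)) * indicator {0..1} t
      \<le> (?M + 2 * (ennreal (1 - s) * (NN h. K h * indicator (ball 0 1) h * shift_dist u (- (t *\<^sub>R h))))) * indicator {0..1} t"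
    proof eventually_elim
      case (elim t)
      show ?case
      proof (cases "t \<in> {0..1}")
        case True
        then have t: "0 < t" "t < 1" using elim by auto
        have "(NN z. ennreal (1 - s) * (NN h. ennreal (\<bar>G z \<bullet> h\<bar> powr p) * k (z - t *\<^sub>R h) h))
          \<le> (NN z. B z + 2 * (ennreal (1 - s) * T t z))"
          by (rule nn_integral_mono_AE[OF pt[OF t]])
        also have "\<dots> = (NN z. B z) + 2 * (ennreal (1 - s) * (NN z. T t z))"
          by (simp add: nn_integral_add nn_integral_cmult)
        also have "\<dots> \<le> (NN z. B z) + 2 * (ennreal (1 - s) * (NN h. K h * indicator (ball 0 1) h * shift_dist u (- (t *\<^sub>R h))))"
          by (intro add_left_mono mult_left_mono ST) auto
        finally show ?thesis using True unfolding B_def \<eta>_def by simp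
      qed simp
    qed
  qed
  also have "\<dots> = ?M + 2 * (ennreal (1 - s) * (\<integral>\<^sup>+t\<in>{0..1}. (NN h. K h * indicator (ball 0 1) h * shift_dist u (- (t *\<^sub>R h))) \<partial>(lborel::real measure)))"
  proof -
    have [measurable]: "(\<lambda>t::real. NN h. K h * indicator (ball 0 1) h * shift_dist u (- (t *\<^sub>R h))) \<in> Borel"
      unfolding shift_dist_def by measurable
    have gen: "(\<integral>\<^sup>+t\<in>{0..1}. m + 2 * (c * S t) \<partial>(lborel::real measure)) = m + 2 * (c * (\<integral>\<^sup>+t\<in>{0..1}. S t \<partial>lborel))"
      if [measurable]: "S \<in> Borel" for m c :: ennreal and S
      by (simp add: distrib_right nn_integral_add nn_integral_cmult nn_integral_cmult_indicator mult.assoc)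
    show ?thesis by (rule gen) measurable
  qed
  finally show ?thesis unfolding K_def u_def .
qed

text \<open>For z off the boundary the minimum tends to 0 with 1 - s, and it is never larger than d
  / p, so a multiple of g is a majorant.\<close>

lemma mid_bound_tendsto:
  fixes \<Omega> :: "'a::euclidean_space set" and g :: "'a \<Rightarrow> ennreal"
  assumes [measurable]: "g \<in> Borel" and g: "(NN z. g z) < \<infinity>" and C: "C \<ge> 0" and p: "p \<ge> 1" and \<eta>: "\<eta> > 0"
  shows "((\<lambda>s. NN z. g z * (ennreal (2 * (C * min (real DIM('a) / p) ((1 - s) * (\<eta> * bdist \<Omega> z) powr (- real DIM('a)))))
             * (if 0 < bdist \<Omega> z then 1 else 0))) \<longlongrightarrow> 0) (at_left 1)"
    (is "((\<lambda>s. NN z. ?f s z) \<longlongrightarrow> 0) _")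
  unfolding tendsto_at_iff_sequentially
proof (intro allI impI)
  fix X :: "nat \<Rightarrow> real" assume X: "\<forall>i. X i \<in> {..<1} - {1}" "X \<longlonglongrightarrow> 1"
  have "(\<lambda>i. NN z. ?f (X i) z) \<longlonglongrightarrow> (NN (z::'a). 0)"
  proof (rule nn_integral_dominated_convergence[where w="\<lambda>z. g z * ennreal (2 * (C * (real DIM('a) / p)))"])
    show "(NN z. g z * ennreal (2 * (C * (real DIM('a) / p)))) < \<infinity>"
      using g by (simp add: nn_integral_multc ennreal_mult_less_top)
    show "AE z in lborel. ?f (X i) z \<le> g z * ennreal (2 * (C * (real DIM('a) / p)))" for i
    proof (intro always_eventually allI mult_left_mono)
      fix z
      have "C * min (real DIM('a) / p) t \<le> C * (real DIM('a) / p)" for t using C by (intro mult_left_mono) auto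
      then have "2 * (C * min (real DIM('a) / p) t) \<le> 2 * (C * (real DIM('a) / p))" for t by (rule mult_left_mono) simp
      then show "ennreal (2 * (C * min (real DIM('a) / p) ((1 - X i) * (\<eta> * bdist \<Omega> z) powr (- real DIM('a)))))
             * (if 0 < bdist \<Omega> z then 1 else 0) \<le> ennreal (2 * (C * (real DIM('a) / p)))"
        by (auto intro: ennreal_leI)
    qed simp
    have "AE z in lborel. g z \<noteq> \<infinity>" using g by (intro nn_integral_PInf_AE) auto
    then show "AE z in lborel. (\<lambda>i. ?f (X i) z) \<longlonglongrightarrow> 0"
    proof eventually_elim
      case (elim z)
      show ?case
      proof (cases "0 < bdist \<Omega> z")
        case True
        have "(\<lambda>i. 2 * (C * min (real DIM('a) / p) ((1 - X i) * (\<eta> * bdist \<Omega> z) powr (- real DIM('a)))))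
           \<longlonglongrightarrow> 2 * (C * min (real DIM('a) / p) ((1 - 1) * (\<eta> * bdist \<Omega> z) powr (- real DIM('a))))"
          by (intro tendsto_intros X)
        then have "(\<lambda>i. g z * ennreal (2 * (C * min (real DIM('a) / p) ((1 - X i) * (\<eta> * bdist \<Omega> z) powr (- real DIM('a))))))
           \<longlonglongrightarrow> g z * ennreal (2 * (C * min (real DIM('a) / p) ((1 - 1) * (\<eta> * bdist \<Omega> z) powr (- real DIM('a)))))"
          using elim by (intro ennreal_tendsto_cmult tendsto_ennrealI) (auto simp: top.not_eq_extremum)
        moreover have "min (real DIM('a) / p) 0 = 0" using p by simp
        ultimately show ?thesis using True by simp
      qed simp
    qed
  qed measurable
  then show "((\<lambda>s. NN z. ?f s z) \<circ> X) \<longlonglongrightarrow> 0" by (simp add: o_def)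
qed

section \<open>Increments of length at least one\<close>

lemma nn_integral_powr_outside_ball_le:
  fixes W :: "'a::euclidean_space \<Rightarrow> ennreal"
  assumes [measurable]: "W \<in> Borel" and \<sigma>: "\<sigma> > 0"
    and W: "\<And>r. r > 0 \<Longrightarrow> (NN h. W h * indicator (ball 0 r) h) \<le> A * ennreal (r ^ DIM('a))"
  shows "(NN h. W h * (ennreal (norm h powr (- (real DIM('a) + \<sigma>))) * (if 1 \<le> norm h then 1 else 0)))
    \<le> A * ennreal ((real DIM('a) + \<sigma>) / \<sigma>)"
proof -
  define q where "q = real DIM('a) + \<sigma>"
  have q: "q > 0" using \<sigma> by (simp add: q_def add_nonneg_pos)
  have "(NN h. W h * (ennreal (norm h powr (- q)) * (if 1 \<le> norm h then 1 else 0)))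
    = (NN h. (W h * (if 1 \<le> norm h then 1 else 0)) * ennreal (norm h powr (- q)))"
    by (intro nn_integral_cong) (simp add: mult_ac)
  also have "\<dots> = (NN r. ennreal (q * r powr (- q - 1)) * indicator {0<..} r * (NN h. (W h * (if 1 \<le> norm h then 1 else 0)) * indicator (ball 0 r) h))"
    by (rule layer_cake_powr[OF _ q]) measurable
  also have "\<dots> \<le> (NN r. A * (ennreal (q / \<sigma>) * (ennreal (\<sigma> * r powr (- \<sigma> - 1)) * indicator {1<..} r)))"
  proof (rule nn_integral_mono)
    \<comment> \<open>For r <= 1 the ball contains no h with |h| >= 1. For r > 1 the mass r^d
      against r^(-d-\<sigma>-1) is integrable at infinity.\<close>
    fix r :: real
    show "ennreal (q * r powr (- q - 1)) * indicator {0<..} r * (NN h. (W h * (if 1 \<le> norm h then 1 else 0)) * indicator (ball 0 r) h)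
      \<le> A * (ennreal (q / \<sigma>) * (ennreal (\<sigma> * r powr (- \<sigma> - 1)) * indicator {1<..} r))"
    proof (cases "r > 1")
      case True
      have "(NN h. (W h * (if 1 \<le> norm h then 1 else 0)) * indicator (ball 0 r) h) \<le> (NN h. W h * indicator (ball 0 r) h)"
        by (rule nn_integral_mono) auto
      also have "\<dots> \<le> A * ennreal (r ^ DIM('a))" using True by (intro W) simp
      finally have "ennreal (q * r powr (- q - 1)) * (NN h. (W h * (if 1 \<le> norm h then 1 else 0)) * indicator (ball 0 r) h)
        \<le> ennreal (q * r powr (- q - 1)) * (A * ennreal (r ^ DIM('a)))" by (rule mult_left_mono) simp
      also have "\<dots> = A * (ennreal (q * r powr (- q - 1)) * ennreal (r powr real DIM('a)))"
        using True by (simp add: powr_realpow mult_ac)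
      also have "ennreal (q * r powr (- q - 1)) * ennreal (r powr real DIM('a)) = ennreal (q / \<sigma>) * ennreal (\<sigma> * r powr (- \<sigma> - 1))"
      proof -
        have "r powr (- q - 1) * r powr real DIM('a) = r powr (- \<sigma> - 1)"
          by (simp only: powr_add[symmetric]) (simp add: q_def)
        then show ?thesis using q \<sigma> by (simp add: ennreal_mult'[symmetric] mult.assoc)
      qed
      finally show ?thesis using True by simp
    next
      case False
      then have "(W h * (if 1 \<le> norm h then 1 else 0)) * indicator (ball 0 r) h = 0" for h :: 'a by (auto split: split_indicator)
      then show ?thesis by (simp only: nn_integral_const mult_zero_left mult_zero_right zero_le)
    qed
  qed
  also have "\<dots> = A * (ennreal (q / \<sigma>) * (NN r. ennreal (\<sigma> * r powr (- \<sigma> - 1)) * indicator {1<..} r))"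
    by (simp add: nn_integral_cmult)
  also have "(NN r. ennreal (\<sigma> * r powr (- \<sigma> - 1)) * indicator {1<..} r) = ennreal (1 powr (- \<sigma>))"
    by (rule nn_integral_powr_tail) (use \<sigma> in auto)
  finally show ?thesis unfolding q_def by simp
qed

text \<open>The increment is bounded by the values at both ends, and each value meets each weight.
  Value and weight at the same point leave the integral of the kernel; at different points the A_1
  bound moves the weight to the point of the value.\<close>

lemma tail_energy_bounded:
  fixes \<Omega> :: "'a::euclidean_space set"
  assumes "open \<Omega>" "\<Omega> \<noteq> UNIV" and [measurable]: "F \<in> Borel" and p: "p \<ge> 1"
    and \<alpha>\<beta>: "0 \<le> \<alpha>" "0 \<le> \<beta>" and A: "pointwise_A1 \<Omega> (\<alpha> + \<beta>) C"
    and fin: "(NN z. ennreal (\<bar>F z\<bar> powr p) * dist_weight \<Omega> (\<alpha> + \<beta>) z * indicator \<Omega> z) < \<infinity>"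
  obtains T where "T < \<infinity>" "\<And>s. 1 / 2 \<le> s \<Longrightarrow> (NN x. NN h. energy_integrand \<Omega> s p \<alpha> \<beta> F x h
            * (if 1 \<le> norm h then 1 else 0)) \<le> T"
proof -
  have [measurable]: "\<Omega> \<in> sets borel" using \<open>open \<Omega>\<close> by (rule borel_open)
  have C: "C \<ge> 0" using A by (simp add: pointwise_A1_def)
  let ?w = "dist_weight \<Omega> (\<alpha> + \<beta>)"
  define g where "g x = ennreal (\<bar>F x\<bar> powr p) * indicator \<Omega> x" for x
  have [measurable]: "g \<in> Borel" unfolding g_def by measurable
  define N where "N = (NN x. g x * ?w x)"
  have N: "N < \<infinity>" using fin by (simp add: N_def g_def mult_ac)
  \<comment> \<open>For s >= 1/2 and |h| >= 1 the kernel is below the one with s p replaced by p /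
    2, so one bound serves all such s.\<close>
  define \<sigma> where "\<sigma> = p / 2"
  have \<sigma>: "\<sigma> > 0" using p by (simp add: \<sigma>_def)
  define K where "K h = ennreal (norm h powr (- (real DIM('a) + \<sigma>))) * (if 1 \<le> norm h then 1 else 0)" for h :: 'a
  have [measurable]: "K \<in> Borel" unfolding K_def by measurable
  define \<kappa> where "\<kappa> = ennreal ((real DIM('a) + \<sigma>) / \<sigma>)"
  have K1: "(NN h. K h) \<le> ennreal (unit_ball_vol DIM('a)) * \<kappa>"
    using nn_integral_powr_outside_ball_le[of "\<lambda>_::'a. 1" \<sigma> "ennreal (unit_ball_vol DIM('a))"] \<sigma>
    by (simp add: K_def \<kappa>_def emeasure_ball ennreal_mult)
  have Kw: "(NN h. ?w (x + \<tau> *\<^sub>R h) * K h) \<le> ennreal C * ?w x * \<kappa>" if x: "x \<in> \<Omega>" and \<tau>: "\<tau> \<noteq> 0" for x \<tau>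
    unfolding K_def \<kappa>_def
  proof (rule nn_integral_powr_outside_ball_le)
    fix r :: real assume "r > 0"
    then show "(NN h. ?w (x + \<tau> *\<^sub>R h) * indicator (ball 0 r) h) \<le> ennreal C * ?w x * ennreal (r ^ DIM('a))"
      using pointwise_A1_shift[OF A bdist_pos[OF assms(1,2) x] _ \<tau>, of r] C by (simp add: ennreal_mult mult_ac)
  qed (use \<sigma> in auto)
  define T where "T = ennreal (2 powr p) * (2 * (N * (ennreal (unit_ball_vol DIM('a)) * \<kappa>)) + 2 * (N * (ennreal C * \<kappa>)))"
  have "T < \<infinity>" using N by (simp add: T_def \<kappa>_def ennreal_mult_less_top)
  moreover have "(NN x. NN h. energy_integrand \<Omega> s p \<alpha> \<beta> F x h * (if 1 \<le> norm h then 1 else 0)) \<le> T" if s: "1 / 2 \<le> s" for s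
  proof -
    have "(NN x. NN h. energy_integrand \<Omega> s p \<alpha> \<beta> F x h * (if 1 \<le> norm h then 1 else 0))
      \<le> (NN x. NN h. ennreal (2 powr p) * ((g x * ?w x * K h + g (x + h) * ?w (x + h) * K h)
            + (g x * ?w (x + h) * K h + g (x + h) * ?w x * K h)))"
    proof (intro nn_integral_mono)
      fix x h :: 'a
      show "energy_integrand \<Omega> s p \<alpha> \<beta> F x h * (if 1 \<le> norm h then 1 else 0)
        \<le> ennreal (2 powr p) * ((g x * ?w x * K h + g (x + h) * ?w (x + h) * K h)
            + (g x * ?w (x + h) * K h + g (x + h) * ?w x * K h))"
      proof (cases "x \<in> \<Omega> \<and> x + h \<in> \<Omega> \<and> 1 \<le> norm h")
        case True
        have "\<bar>F (x + h) - F x\<bar> powr p \<le> (2 * max \<bar>F x\<bar> \<bar>F (x + h)\<bar>) powr p" using p by (intro powr_mono2) auto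
        also have "\<dots> = 2 powr p * max \<bar>F x\<bar> \<bar>F (x + h)\<bar> powr p" by (rule powr_mult)
        also have "\<dots> \<le> 2 powr p * (\<bar>F x\<bar> powr p + \<bar>F (x + h)\<bar> powr p)" by (intro mult_left_mono) (auto simp: max_def)
        finally have 1: "ennreal (\<bar>F (x + h) - F x\<bar> powr p) \<le> ennreal (2 powr p) * (g x + g (x + h))"
          using True by (simp add: g_def ennreal_mult[symmetric] ennreal_plus[symmetric] ennreal_leI del: ennreal_plus)
        have "1 / 2 * p \<le> s * p" using s p by (intro mult_right_mono) auto
        then have 2: "sker s p h \<le> K h"
          using True unfolding K_def by (auto simp: \<sigma>_def intro!: ennreal_leI powr_mono)
        have 3: "dist_weight \<Omega> \<alpha> x * dist_weight \<Omega> \<beta> (x + h) \<le> ?w x + ?w (x + h)"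
          using True by (intro weight_product_le bdist_pos[OF assms(1,2)] \<alpha>\<beta>) auto
        have "energy_integrand \<Omega> s p \<alpha> \<beta> F x h \<le> (ennreal (2 powr p) * (g x + g (x + h))) * K h * (?w x + ?w (x + h))"
          unfolding energy_integrand_def using True 1 2 3 by (simp add: mult_mono)
        also have "\<dots> = ennreal (2 powr p) * ((g x * ?w x * K h + g (x + h) * ?w (x + h) * K h)
            + (g x * ?w (x + h) * K h + g (x + h) * ?w x * K h))"
          by (simp only: distrib_left distrib_right mult_ac add_ac)
        finally show ?thesis using True by simp
      qed (auto simp: energy_integrand_def)
    qed
    also have "\<dots> = ennreal (2 powr p) * (((NN x. NN h. g x * ?w x * K h) + (NN x. NN h. g (x + h) * ?w (x + h) * K h))
        + ((NN x. NN h. g x * ?w (x + h) * K h) + (NN x. NN h. g (x + h) * ?w x * K h)))"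
      by (simp add: nn_integral_cmult nn_integral_add)
    also have "\<dots> \<le> ennreal (2 powr p) * ((N * (ennreal (unit_ball_vol DIM('a)) * \<kappa>) + N * (ennreal (unit_ball_vol DIM('a)) * \<kappa>))
        + (N * (ennreal C * \<kappa>) + N * (ennreal C * \<kappa>)))"
    proof (intro mult_left_mono add_mono)
      have "(NN x. NN h. g x * ?w x * K h) = N * (NN h. K h)"
        by (simp add: N_def nn_integral_cmult nn_integral_multc)
      then show "(NN x. NN h. g x * ?w x * K h) \<le> N * (ennreal (unit_ball_vol DIM('a)) * \<kappa>)"
        using K1 by (simp add: mult_left_mono)
      have "(NN x. NN h. g (x + h) * ?w (x + h) * K h) = (NN h. NN x. g (x + h) * ?w (x + h) * K h)"
        by (rule lborel_pair.Fubini') measurable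
      also have "\<dots> = N * (NN h. K h)"
        using nn_integral_lborel_shift[of "\<lambda>x. g x * ?w x"] by (simp add: N_def nn_integral_cmult nn_integral_multc)
      finally show "(NN x. NN h. g (x + h) * ?w (x + h) * K h) \<le> N * (ennreal (unit_ball_vol DIM('a)) * \<kappa>)"
        using K1 by (simp add: mult_left_mono)
      have gw: "g x * (NN h. ?w (x + \<tau> *\<^sub>R h) * K h) \<le> g x * ?w x * (ennreal C * \<kappa>)" if "\<tau> \<noteq> 0" for x \<tau>
      proof (cases "x \<in> \<Omega>")
        case True
        have "g x * (NN h. ?w (x + \<tau> *\<^sub>R h) * K h) \<le> g x * (ennreal C * ?w x * \<kappa>)" by (intro mult_left_mono Kw True that) simp
        then show ?thesis by (simp only: mult_ac)
      qed (simp add: g_def)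
      have gwN: "(NN x. g x * (NN h. ?w (x + \<tau> *\<^sub>R h) * K h)) \<le> N * (ennreal C * \<kappa>)" if "\<tau> \<noteq> 0" for \<tau>
      proof -
        have "(NN x. g x * (NN h. ?w (x + \<tau> *\<^sub>R h) * K h)) \<le> (NN x. g x * ?w x * (ennreal C * \<kappa>))"
          by (intro nn_integral_mono gw that)
        then show ?thesis by (simp add: N_def nn_integral_multc)
      qed
      have "(NN x. NN h. g x * ?w (x + h) * K h) = (NN x. g x * (NN h. ?w (x + 1 *\<^sub>R h) * K h))"
        by (simp add: nn_integral_cmult mult.assoc)
      also have "\<dots> \<le> N * (ennreal C * \<kappa>)" by (rule gwN) simp
      finally show "(NN x. NN h. g x * ?w (x + h) * K h) \<le> N * (ennreal C * \<kappa>)" .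
      have "(NN x. NN h. g (x + h) * ?w x * K h) = (NN h. NN x. g (x + h) * ?w x * K h)"
        by (rule lborel_pair.Fubini') measurable
      also have "\<dots> = (NN h. NN x. g x * ?w (x + (- 1) *\<^sub>R h) * K h)"
      proof (rule nn_integral_cong)
        fix h :: 'a
        show "(NN x. g (x + h) * ?w x * K h) = (NN x. g x * ?w (x + (- 1) *\<^sub>R h) * K h)"
          using nn_integral_lborel_shift[of "\<lambda>x. g x * ?w (x + (- 1) *\<^sub>R h) * K h" h] by simp
      qed
      also have "\<dots> = (NN x. NN h. g x * ?w (x + (- 1) *\<^sub>R h) * K h)"
        by (rule lborel_pair.Fubini') measurable
      also have "\<dots> = (NN x. g x * (NN h. ?w (x + (- 1) *\<^sub>R h) * K h))"
        by (intro nn_integral_cong) (simp add: nn_integral_cmult mult.assoc)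
      also have "\<dots> \<le> N * (ennreal C * \<kappa>)" by (rule gwN) simp
      finally show "(NN x. NN h. g (x + h) * ?w x * K h) \<le> N * (ennreal C * \<kappa>)" .
    qed simp
    also have "\<dots> = T" unfolding T_def by (simp only: mult_2)
    finally show ?thesis .
  qed
  ultimately show ?thesis using that by blast
qed

text \<open>The near part gives the limit, the middle part tends to 0 and the tail is bounded, hence
  removed by 1 - s. G is the gradient of an extension: it is integrable with the weight over the
  whole space, while the limit contains only its restriction to \<Omega>.\<close>

lemma sobolev_energy_upper:
  fixes \<Omega> :: "'a::euclidean_space set"
  assumes "open \<Omega>" "\<Omega> \<noteq> {}" "\<Omega> \<noteq> UNIV" and FG: "ftc_bound F G" and p: "p \<ge> 1"
    and \<alpha>\<beta>: "0 \<le> \<alpha>" "0 \<le> \<beta>" and A: "pointwise_A1 \<Omega> (\<alpha> + \<beta>) C"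
    and F: "(NN z. ennreal (\<bar>F z\<bar> powr p) * dist_weight \<Omega> (\<alpha> + \<beta>) z * indicator \<Omega> z) < \<infinity>"
    and G: "(NN z. ennreal (norm (G z) powr p) * dist_weight \<Omega> (\<alpha> + \<beta>) z) < \<infinity>"
    and l: "ennreal (K_const DIM('a) p) * (NN z. ennreal (norm (G z) powr p) * dist_weight \<Omega> (\<alpha> + \<beta>) z * indicator \<Omega> z) < l"
      (is "?L < l")
  shows "\<forall>\<^sub>F s in at_left 1. ennreal (1 - s) * gagliardo_energy \<Omega> s p \<alpha> \<beta> F < l"
proof (rule upper_limitI[OF near_constant_tendsto[of "\<bar>\<alpha>\<bar> + \<bar>\<beta>\<bar>"] _ l])
  fix \<theta> :: real assume \<theta>: "0 < \<theta>" "\<theta> < 1"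
  have [measurable]: "\<Omega> \<in> sets borel" using \<open>open \<Omega>\<close> by (rule borel_open)
  have [measurable]: "F \<in> Borel" "G \<in> Borel"
    using FG by (auto simp: ftc_bound_def)
  have [measurable]: "frontier \<Omega> \<in> sets borel" by (rule borel_closed) simp
  have C: "C \<ge> 0" using A by (simp add: pointwise_A1_def)
  obtain T where T: "T < \<infinity>" "\<And>s. 1 / 2 \<le> s \<Longrightarrow> (NN x. NN h. energy_integrand \<Omega> s p \<alpha> \<beta> F x h
            * (if 1 \<le> norm h then 1 else 0)) \<le> T"
    by (rule tail_energy_bounded[OF assms(1,3) \<open>F \<in> Borel\<close> p \<alpha>\<beta> A F]) (rule that)
  let ?w = "dist_weight \<Omega> (\<alpha> + \<beta>)"
  let ?u = "\<lambda>z. norm (G z) powr p * indicator (frontier \<Omega>) z"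
  define M where "M s = (NN z. ennreal (norm (G z) powr p) * ?w z
          * (ennreal (2 * (C * min (real DIM('a) / p) ((1 - s) * (\<theta> / (1 + \<theta>) * bdist \<Omega> z) powr (- real DIM('a)))))
             * (if 0 < bdist \<Omega> z then 1 else 0)))" for s
  define N where "N s = ennreal (1 - s) * (\<integral>\<^sup>+t\<in>{0..1}. (NN h. ennreal (norm h powr p) * sker s p h
          * indicator (ball 0 1) h * shift_dist ?u (- (t *\<^sub>R h))) \<partial>(lborel :: real measure))" for s
  have "(M \<longlongrightarrow> 0) (at_left 1)"
    unfolding M_def by (rule mid_bound_tendsto) (use G C p \<theta> in auto)
  moreover have "(N \<longlongrightarrow> 0) (at_left 1)"
    unfolding N_def
  proof (rule shifted_kernel_tendsto[OF _ p])
    \<comment> \<open>As \<alpha> + \<beta> >= 0, the weight on the boundary is 1 or infinite, so it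
      can be inserted.\<close>
    have "(NN z. ennreal (norm (?u z))) \<le> (NN z. ennreal (norm (G z) powr p) * ?w z)"
    proof (rule nn_integral_mono)
      fix z
      show "ennreal (norm (?u z)) \<le> ennreal (norm (G z) powr p) * ?w z"
      proof (cases "z \<in> frontier \<Omega>")
        case True
        then have "bdist \<Omega> z = 0" by (simp add: bdist_def)
        then have "1 \<le> ?w z" using \<alpha>\<beta> by (auto simp: dist_weight_zero)
        then have "ennreal (norm (G z) powr p) * 1 \<le> ennreal (norm (G z) powr p) * ?w z" by (intro mult_left_mono) auto
        then show ?thesis using True by simp
      qed simp
    qed
    also have "\<dots> < \<infinity>" by (rule G)
    finally show "integrable lborel ?u" by (intro integrableI_bounded) auto
  qed
  moreover have "((\<lambda>s. ennreal (1 - s) * T) \<longlongrightarrow> 0) (at_left 1)" by (rule tendsto_one_minus_mult[OF T(1)])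
  ultimately have "((\<lambda>s. (M s + 2 * N s) + ennreal (1 - s) * T) \<longlongrightarrow> (0 + 2 * 0) + 0) (at_left 1)"
    by (intro tendsto_add ennreal_tendsto_cmult) auto
  moreover have "\<forall>\<^sub>F s in at_left 1. ennreal (1 - s) * gagliardo_energy \<Omega> s p \<alpha> \<beta> F
     \<le> ennreal (((1 + \<theta>) / (1 - \<theta>)) powr (\<bar>\<alpha>\<bar> + \<bar>\<beta>\<bar>)) * ?L + ((M s + 2 * N s) + ennreal (1 - s) * T)"
  \<comment> \<open>Beyond this point both p (1 - s) <= 1/2, for the middle part, and s >= 1/2, for
    the tail, hold.\<close>
  proof (rule eventually_at_leftI[of "1 - 1 / (2 * p)"])
    fix s assume s: "s \<in> {1 - 1 / (2 * p)<..<1}"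
    have "1 / (2 * p) \<le> 1 / 2" using p by (simp add: field_simps)
    then have s2: "1 / 2 \<le> s" "0 < s" "s < 1" using s by auto
    have s3: "p * (1 - s) \<le> 1 / 2"
    proof -
      have "1 - s \<le> 1 / (2 * p)" using s by auto
      then have "p * (1 - s) \<le> p * (1 / (2 * p))" using p by (intro mult_left_mono) auto
      then show ?thesis using p by simp
    qed
    let ?e = "energy_integrand \<Omega> s p \<alpha> \<beta> F"
    let ?near = "\<lambda>x h. if norm h < 1 \<and> norm h < \<theta> * bdist \<Omega> x then 1 else 0 :: ennreal"
    let ?mid = "\<lambda>x h. if norm h < 1 \<and> \<theta> * bdist \<Omega> x \<le> norm h then 1 else 0 :: ennreal"
    let ?tail = "\<lambda>h::'a. if 1 \<le> norm h then 1 else 0 :: ennreal"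
    have [measurable]: "(\<lambda>(x, h). ?e x h) \<in> borel_measurable (borel \<Otimes>\<^sub>M borel)"
      unfolding energy_integrand_def by measurable
    have [measurable]: "?e x \<in> Borel" for x
      unfolding energy_integrand_def by measurable
    have "gagliardo_energy \<Omega> s p \<alpha> \<beta> F \<le> (NN x. NN h. (?e x h * ?near x h + ?e x h * ?mid x h) + ?e x h * ?tail h)"
      unfolding gagliardo_energy_eq[OF \<open>F \<in> Borel\<close> assms(1)]
      by (intro nn_integral_mono) auto
    also have "\<dots> = ((NN x. NN h. ?e x h * ?near x h) + (NN x. NN h. ?e x h * ?mid x h))
        + (NN x. NN h. ?e x h * ?tail h)"
      by (simp add: nn_integral_add)
    finally have "ennreal (1 - s) * gagliardo_energy \<Omega> s p \<alpha> \<beta> F \<le> ennreal (1 - s) * \<dots>"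
      by (intro mult_left_mono) auto
    also have "\<dots> = (ennreal (1 - s) * (NN x. NN h. ?e x h * ?near x h) + ennreal (1 - s) * (NN x. NN h. ?e x h * ?mid x h))
        + ennreal (1 - s) * (NN x. NN h. ?e x h * ?tail h)" by (simp only: distrib_left)
    also have "\<dots> \<le> (ennreal (((1 + \<theta>) / (1 - \<theta>)) powr (\<bar>\<alpha>\<bar> + \<bar>\<beta>\<bar>)) * ?L + (M s + 2 * N s)) + ennreal (1 - s) * T"
    proof (intro add_mono mult_left_mono T(2) s2)
      let ?W = "NN z. ennreal (norm (G z) powr p) * ?w z * indicator \<Omega> z"
      have "ennreal (1 - s) * (NN x. NN h. ?e x h * ?near x h)
        \<le> ennreal (1 - s) * (ennreal (((1 + \<theta>) / (1 - \<theta>)) powr (\<bar>\<alpha>\<bar> + \<bar>\<beta>\<bar>)) * ennreal (K_const DIM('a) p / (1 - s)) * ?W)"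
        by (intro mult_left_mono near_energy_le[OF assms(1,3) FG p \<theta> s2(2,3)]) simp
      also have "\<dots> = ennreal (((1 + \<theta>) / (1 - \<theta>)) powr (\<bar>\<alpha>\<bar> + \<bar>\<beta>\<bar>)) * ((ennreal (1 - s) * ennreal (K_const DIM('a) p / (1 - s))) * ?W)"
        by (simp only: mult_ac)
      also have "ennreal (1 - s) * ennreal (K_const DIM('a) p / (1 - s)) = ennreal (K_const DIM('a) p)"
        using s2 K_const_nonneg[OF p, of "DIM('a)"] by (simp add: ennreal_mult[symmetric])
      finally show "ennreal (1 - s) * (NN x. NN h. ?e x h * ?near x h)
        \<le> ennreal (((1 + \<theta>) / (1 - \<theta>)) powr (\<bar>\<alpha>\<bar> + \<bar>\<beta>\<bar>)) * ?L" .
      show "ennreal (1 - s) * (NN x. NN h. ?e x h * ?mid x h) \<le> M s + 2 * N s"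
        unfolding M_def N_def by (rule mid_energy_le[OF assms(1-3) FG p \<theta>(1) \<alpha>\<beta> A G s2(3) s3])
    qed simp
    finally show "ennreal (1 - s) * gagliardo_energy \<Omega> s p \<alpha> \<beta> F
     \<le> ennreal (((1 + \<theta>) / (1 - \<theta>)) powr (\<bar>\<alpha>\<bar> + \<bar>\<beta>\<bar>)) * ?L + ((M s + 2 * N s) + ennreal (1 - s) * T)"
      by (simp only: add.assoc)
  qed (use p in simp)
  ultimately show "\<exists>R. (R \<longlongrightarrow> 0) (at_left 1) \<and> (\<forall>\<^sub>F s in at_left 1. ennreal (1 - s) * gagliardo_energy \<Omega> s p \<alpha> \<beta> F
     \<le> ennreal (((1 + \<theta>) / (1 - \<theta>)) powr (\<bar>\<alpha>\<bar> + \<bar>\<beta>\<bar>)) * ?L + R s)"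
    by (intro exI[of _ "\<lambda>s. (M s + 2 * N s) + ennreal (1 - s) * T"]) simp
qed

section \<open>The limit for Sobolev functions\<close>

lemma compactly_integrable_imp_locint:
  assumes "F \<in> Borel" "compactly_integrable UNIV F"
  shows "locint F"
  unfolding locint_def
proof (intro conjI allI assms(1))
  fix R :: real
  have [measurable]: "F \<in> Borel" by (rule assms(1))
  have 1: "integrable lborel (\<lambda>x. indicator (cball 0 R) x *\<^sub>R F x)" using assms(2) by (simp add: compactly_integrable_def)
  show "integrable lborel (\<lambda>x. indicator (ball 0 R) x *\<^sub>R F x)"
    by (rule Bochner_Integration.integrable_bound[OF 1]) (auto split: split_indicator)
qed

lemma locint_imp_compactly_integrable:
  fixes F :: "'a::euclidean_space \<Rightarrow> 'b::euclidean_space"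
  assumes F: "locint F"
  shows "compactly_integrable \<Omega> F"
  unfolding compactly_integrable_def
proof (intro allI impI, elim conjE)
  fix K :: "'a set" assume K: "compact K"
  have [measurable]: "K \<in> sets borel" using K by (rule borel_compact)
  have [measurable]: "F \<in> Borel" using F by (rule locint_measurable)
  obtain R where R: "K \<subseteq> ball 0 R" using compact_imp_bounded[OF K] bounded_subset_ballD by blast
  have 1: "integrable lborel (\<lambda>x. indicator (ball 0 R) x *\<^sub>R F x)" using F by (simp add: locint_def)
  show "integrable lborel (\<lambda>x. indicator K x *\<^sub>R F x)"
    by (rule Bochner_Integration.integrable_bound[OF 1]) (use R in \<open>auto split: split_indicator intro!: always_eventually\<close>)
qed

lemma compactly_integrable_pairing:
  fixes u :: "'a::euclidean_space \<Rightarrow> 'a"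
  assumes u: "compactly_integrable \<Omega> u" and \<phi>: "\<phi> \<in> test_functions \<Omega>" and b: "b \<in> Basis"
  shows "integrable lborel (\<lambda>x. (u x \<bullet> b) * \<phi> x)"
proof -
  have "integrable lborel (\<lambda>x. indicator (supp \<phi>) x *\<^sub>R u x)"
    using u test_function_support[OF \<phi>] by (simp add: compactly_integrable_def)
  then have "integrable lborel (\<lambda>x. ((indicator (supp \<phi>) x *\<^sub>R u x) \<bullet> b) * \<phi> x)"
    by (intro test_pairing_integrable[OF integrable_imp_locint \<phi> b])
  moreover have "(\<lambda>x. ((indicator (supp \<phi>) x *\<^sub>R u x) \<bullet> b) * \<phi> x) = (\<lambda>x. (u x \<bullet> b) * \<phi> x)"
    using test_function_zero(1)[OF \<phi>] by (force simp: indicator_def)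
  ultimately show ?thesis by simp
qed

text \<open>The difference is orthogonal to all test functions. This identifies the gradient picked
  by \<open>weak_grad\<close> with that of the extension on \<Omega>.\<close>

lemma wgrad_unique:
  fixes F :: "'a::euclidean_space \<Rightarrow> real"
  assumes "open \<Omega>" and [measurable]: "G \<in> Borel" "H \<in> Borel"
    and c: "compactly_integrable \<Omega> G" "compactly_integrable \<Omega> H" and w: "wgrad \<Omega> F G" "wgrad \<Omega> F H"
  shows "AE x in lborel. x \<in> \<Omega> \<longrightarrow> G x = H x"
proof -
  have "AE x in lborel. x \<in> \<Omega> \<longrightarrow> G x - H x = 0"
  proof (rule null_if_orthogonal_to_test_functions[OF \<open>open \<Omega>\<close>])
    show "compactly_integrable \<Omega> (\<lambda>x. G x - H x)"
      using c by (auto simp: compactly_integrable_def scaleR_diff_right)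
    fix \<phi> :: "'a \<Rightarrow> real" and b :: 'a assume \<phi>: "\<phi> \<in> test_functions \<Omega>" and b: "b \<in> Basis"
    note i = compactly_integrable_pairing[OF c(1) \<phi> b] compactly_integrable_pairing[OF c(2) \<phi> b]
    have "(LL x. ((G x - H x) \<bullet> b) * \<phi> x) = (LL x. (G x \<bullet> b) * \<phi> x - (H x \<bullet> b) * \<phi> x)"
      by (simp add: inner_diff_left left_diff_distrib)
    also have "\<dots> = (LL x. (G x \<bullet> b) * \<phi> x) - (LL x. (H x \<bullet> b) * \<phi> x)"
      by (rule Bochner_Integration.integral_diff[OF i])
    also have "\<dots> = 0" using w \<phi> b by (simp add: wgrad_def)
    finally show "(LL x. ((G x - H x) \<bullet> b) * \<phi> x) = 0" .
  qed measurable
  then show ?thesis by simp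
qed

lemma wgrad_mono: "wgrad UNIV F G \<Longrightarrow> wgrad \<Omega> F G"
  by (auto simp: wgrad_def test_functions_def)

lemma weighted_energy_cong_AE:
  assumes "AE x in lborel. x \<in> \<Omega> \<longrightarrow> f x = g x"
  shows "weighted_energy \<Omega> p w f = (NN x. ennreal (norm (g x) powr p) * w x * indicator \<Omega> x)"
  unfolding weighted_energy_def nn_integral_completion
  using assms by (intro nn_integral_cong_AE) (auto elim!: eventually_mono split: split_indicator)

lemma sobolev_borel_representative:
  fixes f :: "'a::euclidean_space \<Rightarrow> real"
  assumes f: "f \<in> weighted_W1p UNIV p w"
  obtains F G where "AE x in lborel. f x = F x" "locint F" "locint G" "wgrad UNIV F G"
    "(NN x. ennreal (norm (G x) powr p) * w x) < \<infinity>"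
proof -
  obtain g where g: "has_weak_gradient UNIV f g" "weighted_energy UNIV p w g < \<infinity>"
    and fm: "f \<in> borel_measurable (lebesgue_on UNIV)"
    using f by (auto simp: weighted_W1p_def weighted_Lp_def)
  have gm: "g \<in> borel_measurable (lebesgue_on UNIV)"
    using g(1) by (intro locally_integrable_on_measurable) (auto simp: has_weak_gradient_def)
  obtain F where F: "F \<in> Borel" "AE x in lborel. x \<in> UNIV \<longrightarrow> f x = F x"
    by (rule borel_measurable_imp_ae_borel[OF fm open_UNIV]) (rule that)
  obtain G where G: "G \<in> Borel" "AE x in lborel. x \<in> UNIV \<longrightarrow> g x = G x"
    by (rule borel_measurable_imp_ae_borel[OF gm open_UNIV]) (rule that)
  have c: "compactly_integrable UNIV F" "compactly_integrable UNIV G" "wgrad UNIV F G"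
    using g(1) has_weak_gradient_iff[OF open_UNIV fm gm F(1) G(1) F(2) G(2)] by auto
  show ?thesis
  proof (rule that)
    show "(NN x. ennreal (norm (G x) powr p) * w x) < \<infinity>"
      using g(2) unfolding weighted_energy_cong_AE[OF G(2)] by simp
  qed (use F G c compactly_integrable_imp_locint in auto)
qed

text \<open>f is replaced by a Borel representative F of its extension, with gradient G on the whole
  space. The energies see only \<Omega>, where F equals f and G equals \<open>weak_grad\<close>
  almost everywhere. The upper bound follows segments outside \<Omega>; the lower bound stays
  inside.\<close>

lemma sobolev_limit:
  fixes \<Omega> :: "'a::euclidean_space set" and f :: "'a \<Rightarrow> real"
  assumes "open \<Omega>" "\<Omega> \<noteq> {}" "\<Omega> \<noteq> UNIV" and p: "p \<ge> 1"
    and \<alpha>\<beta>: "0 \<le> \<alpha>" "0 \<le> \<beta>" and A: "pointwise_A1 \<Omega> (\<alpha> + \<beta>) C"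
    and ext: "W1p_extension_domain \<Omega> p (\<alpha> + \<beta>)" and f: "f \<in> W1p_dist \<Omega> p (\<alpha> + \<beta>)"
  shows "((\<lambda>s. ennreal (1 - s) * gagliardo_energy \<Omega> s p \<alpha> \<beta> f)
           \<longlongrightarrow> ennreal (K_const DIM('a) p) * weighted_energy \<Omega> p (dist_weight \<Omega> (\<alpha> + \<beta>)) (weak_grad \<Omega> f)) (at_left 1)"
    and "weighted_energy \<Omega> p (dist_weight \<Omega> (\<alpha> + \<beta>)) (weak_grad \<Omega> f) < \<infinity>"
proof -
  let ?w = "dist_weight \<Omega> (\<alpha> + \<beta>)"
  obtain f' where f': "f' \<in> weighted_W1p UNIV p ?w" "AE x in lborel. x \<in> \<Omega> \<longrightarrow> f' x = f x"
    using ext f AE_lebesgue_imp_lborel unfolding W1p_extension_domain_def W1p_extension_operator_def by metis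
  obtain F G where F: "AE x in lborel. f' x = F x" "locint F" and G: "locint G" and FG: "wgrad UNIV F G"
    and Gfin: "(NN x. ennreal (norm (G x) powr p) * ?w x) < \<infinity>"
    by (rule sobolev_borel_representative[OF f'(1)]) (rule that)
  have fF: "AE x in lborel. x \<in> \<Omega> \<longrightarrow> f x = F x" using f'(2) F(1) by eventually_elim auto
  have fm: "f \<in> borel_measurable (lebesgue_on \<Omega>)" and ffin: "weighted_energy \<Omega> p ?w f < \<infinity>"
    and ex: "\<exists>g. has_weak_gradient \<Omega> f g"
    using f by (auto simp: W1p_dist_def weighted_W1p_def weighted_Lp_def)
  have g: "has_weak_gradient \<Omega> f (weak_grad \<Omega> f)" unfolding weak_grad_def using ex by (rule someI_ex)
  then have gm: "weak_grad \<Omega> f \<in> borel_measurable (lebesgue_on \<Omega>)"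
    using assms(1) by (intro locally_integrable_on_measurable) (auto simp: has_weak_gradient_def)
  obtain H where H: "H \<in> Borel" "AE x in lborel. x \<in> \<Omega> \<longrightarrow> weak_grad \<Omega> f x = H x"
    by (rule borel_measurable_imp_ae_borel[OF gm assms(1)]) (rule that)
  have "compactly_integrable \<Omega> H" "wgrad \<Omega> F H"
    using g has_weak_gradient_iff[OF assms(1) fm gm locint_measurable[OF F(2)] H(1) fF H(2)] by auto
  then have "AE x in lborel. x \<in> \<Omega> \<longrightarrow> G x = H x"
    by (intro wgrad_unique[OF assms(1) locint_measurable[OF G] H(1) locint_imp_compactly_integrable[OF G] _ wgrad_mono[OF FG]])
  with H(2) have "AE x in lborel. x \<in> \<Omega> \<longrightarrow> weak_grad \<Omega> f x = G x" by eventually_elim auto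
  note W = weighted_energy_cong_AE[OF this]
  have E: "gagliardo_energy \<Omega> s p \<alpha> \<beta> f = gagliardo_energy \<Omega> s p \<alpha> \<beta> F" for s by (rule gagliardo_energy_cong_AE[OF fF])
  have Ffin: "(NN z. ennreal (\<bar>F z\<bar> powr p) * ?w z * indicator \<Omega> z) < \<infinity>"
    using ffin unfolding weighted_energy_cong_AE[OF fF] by simp
  show "((\<lambda>s. ennreal (1 - s) * gagliardo_energy \<Omega> s p \<alpha> \<beta> f)
           \<longlongrightarrow> ennreal (K_const DIM('a) p) * weighted_energy \<Omega> p ?w (weak_grad \<Omega> f)) (at_left 1)"
    unfolding E W
  proof (rule tendsto_at_left_1I)
    fix l assume l: "ennreal (K_const DIM('a) p) * (NN z. ennreal (norm (G z) powr p) * ?w z * indicator \<Omega> z) < l"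
    show "\<forall>\<^sub>F s in at_left 1. ennreal (1 - s) * gagliardo_energy \<Omega> s p \<alpha> \<beta> F < l"
      by (rule sobolev_energy_upper[OF assms(1-3) sobolev_ftc_bound[OF FG F(2) G] p \<alpha>\<beta> A Ffin Gfin l])
  next
    fix S :: "nat \<Rightarrow> real" and l
    assume "S \<longlonglongrightarrow> 1" "\<And>n. 0 < S n" "\<And>n. S n < 1" "\<And>n. ennreal (1 - S n) * gagliardo_energy \<Omega> (S n) p \<alpha> \<beta> F \<le> l"
    then show "ennreal (K_const DIM('a) p) * (NN z. ennreal (norm (G z) powr p) * ?w z * indicator \<Omega> z) \<le> l"
      by (rule sobolev_energy_lower[OF assms(1,3) wgrad_mono[OF FG] F(2) G p \<alpha>\<beta>])
  qed
  show "weighted_energy \<Omega> p ?w (weak_grad \<Omega> f) < \<infinity>"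
    unfolding W by (rule le_less_trans[OF nn_integral_mono Gfin]) (auto split: split_indicator)
qed

text \<open>On \<Omega> the damped weight is below the given one, so f extended by zero is locally
  integrable. Compactness then yields a weak gradient, and the lower bound applied to it shows that
  its weighted energy is finite.\<close>

lemma W1p_if_energy_bounded:
  fixes \<Omega> :: "'a::euclidean_space set" and f :: "'a \<Rightarrow> real"
  assumes "open \<Omega>" "\<Omega> \<noteq> UNIV" and p: "p > 1" and \<alpha>\<beta>: "0 \<le> \<alpha>" "0 \<le> \<beta>"
    and f: "f \<in> weighted_Lp \<Omega> p (dist_weight \<Omega> (\<alpha> + \<beta>))"
    and S: "S \<longlonglongrightarrow> 1" "\<And>n. 0 < S n" "\<And>n. S n < 1"
    and le: "\<And>n. ennreal (1 - S n) * gagliardo_energy \<Omega> (S n) p \<alpha> \<beta> f \<le> l" and l: "l < \<infinity>"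
  shows "f \<in> W1p_dist \<Omega> p (\<alpha> + \<beta>)"
proof -
  let ?w = "dist_weight \<Omega> (\<alpha> + \<beta>)"
  have fm: "f \<in> borel_measurable (lebesgue_on \<Omega>)" and ffin: "weighted_energy \<Omega> p ?w f < \<infinity>"
    using f by (auto simp: weighted_Lp_def)
  obtain F where Fm [measurable]: "F \<in> Borel" and fF: "AE x in lborel. x \<in> \<Omega> \<longrightarrow> f x = F x"
    and F0: "\<And>x. x \<notin> \<Omega> \<Longrightarrow> F x = 0"
    by (rule borel_measurable_imp_ae_borel[OF fm assms(1)]) (rule that)
  have E: "gagliardo_energy \<Omega> s p \<alpha> \<beta> f = gagliardo_energy \<Omega> s p \<alpha> \<beta> F" for s by (rule gagliardo_energy_cong_AE[OF fF])
  have F: "locint F"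
  proof -
    have "(\<integral>\<^sup>+x. ennreal (norm (F x) powr p) \<partial>damped_measure \<Omega> (\<alpha> + \<beta>))
      = (NN x. ennreal ((bdist \<Omega> x + 2) powr (- (\<alpha> + \<beta>))) * indicator \<Omega> x * ennreal (norm (F x) powr p))"
      by (intro nn_integral_damped assms(1)) measurable
    also have "\<dots> \<le> weighted_energy \<Omega> p ?w f"
      unfolding weighted_energy_cong_AE[OF fF]
    proof (rule nn_integral_mono)
      fix x
      show "ennreal ((bdist \<Omega> x + 2) powr (- (\<alpha> + \<beta>))) * indicator \<Omega> x * ennreal (norm (F x) powr p)
        \<le> ennreal (norm (F x) powr p) * ?w x * indicator \<Omega> x"
      proof (cases "x \<in> \<Omega>")
        case True
        have d: "0 < bdist \<Omega> x" by (rule bdist_pos[OF assms(1,2) True])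
        then have "(bdist \<Omega> x + 2) powr (- (\<alpha> + \<beta>)) \<le> bdist \<Omega> x powr (- (\<alpha> + \<beta>))" using \<alpha>\<beta> by (intro powr_mono2') auto
        then have "ennreal ((bdist \<Omega> x + 2) powr (- (\<alpha> + \<beta>))) \<le> ?w x" unfolding dist_weight_pos[OF d] by (rule ennreal_leI)
        from mult_right_mono[OF this, of "ennreal (norm (F x) powr p)"]
        show ?thesis using True by (simp add: mult.commute del: minus_add_distrib)
      qed simp
    qed
    finally have "locint (\<lambda>x. indicator \<Omega> x *\<^sub>R F x)"
      using ffin p \<alpha>\<beta> by (intro damped_locint[OF assms(1) Fm p, of "\<alpha> + \<beta>"]) auto
    moreover have "(\<lambda>x. indicator \<Omega> x *\<^sub>R F x) = F" using F0 by (force simp: indicator_def)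
    ultimately show ?thesis by simp
  qed
  obtain G where G: "locint G" "wgrad \<Omega> F G"
    by (rule sobolev_compactness[OF assms(1,2) F p \<alpha>\<beta> S le[unfolded E] l]) (rule that)
  have Gm: "G \<in> Borel" by (rule locint_measurable[OF G(1)])
  have Gl: "G \<in> borel_measurable (lebesgue_on \<Omega>)"
    using Gm by (intro measurable_restrict_space1 measurable_completion) simp
  have "has_weak_gradient \<Omega> f G"
    using has_weak_gradient_iff[OF assms(1) fm Gl Fm Gm fF] G locint_imp_compactly_integrable[OF F] locint_imp_compactly_integrable[OF G(1)]
    by auto
  moreover have "weighted_energy \<Omega> p ?w G < \<infinity>"
  proof -
    have "ennreal (K_const DIM('a) p) * weighted_energy \<Omega> p ?w G \<le> l"
      unfolding weighted_energy_cong_AE[of \<Omega> G G, simplified]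
      by (rule sobolev_energy_lower[OF assms(1,2) G(2) F G(1) _ \<alpha>\<beta> S le[unfolded E]]) (use p in simp)
    then have "ennreal (K_const DIM('a) p) * weighted_energy \<Omega> p ?w G < \<infinity>" using l by (rule le_less_trans)
    then show ?thesis using K_const_pos[of p "DIM('a)"] p by (auto simp: ennreal_mult_less_top)
  qed
  ultimately show ?thesis using f by (auto simp: W1p_dist_def weighted_W1p_def)
qed

theorem theorem1:
  fixes \<Omega> :: "'a::euclidean_space set" and p :: real
  assumes "p \<ge> 1" and "open \<Omega>" and "\<Omega> \<noteq> {}" and "\<Omega> \<noteq> UNIV"
  shows
    "(\<forall>(f :: 'a \<Rightarrow> real) (U :: (real \<times> real) set).
        f \<in> C2c_closure \<Omega> \<and> open U \<and> U \<noteq> {} \<and>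
        (\<exists>s0\<in>{0<..<1}. \<forall>(\<alpha>, \<beta>)\<in>U. \<forall>s\<in>{s0<..<1}. gagliardo_seminorm \<Omega> s p \<alpha> \<beta> f < \<infinity>)
        \<longrightarrow> (\<forall>(\<alpha>, \<beta>)\<in>U.
              ((\<lambda>s. ennreal (1 - s) * gagliardo_energy \<Omega> s p \<alpha> \<beta> f)
                \<longlongrightarrow> ennreal (K_const DIM('a) p)
                      * weighted_energy \<Omega> p (dist_weight \<Omega> (\<alpha> + \<beta>)) (grad f)) (at_left 1)))
     \<and> (p > 1 \<longrightarrow>
         (\<forall>\<alpha> \<beta>.
            W1p_extension_domain \<Omega> p (\<alpha> + \<beta>) \<and>
            muckenhoupt_Ap p (dist_weight \<Omega> (\<alpha> + \<beta>)) \<and>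
            weight_condition \<Omega> \<alpha> \<beta>
            \<longrightarrow> (\<forall>f\<in>weighted_Lp \<Omega> p (dist_weight \<Omega> (\<alpha> + \<beta>)).
                  ((\<lambda>s. ennreal (1 - s) * gagliardo_energy \<Omega> s p \<alpha> \<beta> f)
                    \<longlongrightarrow> (if f \<in> W1p_dist \<Omega> p (\<alpha> + \<beta>)
                          then ennreal (K_const DIM('a) p)
                                 * weighted_energy \<Omega> p (dist_weight \<Omega> (\<alpha> + \<beta>)) (weak_grad \<Omega> f)
                          else \<infinity>)) (at_left 1)
                  \<and> (f \<in> W1p_dist \<Omega> p (\<alpha> + \<beta>) \<longleftrightarrow>
                      Liminf (at_left 1)
                        (\<lambda>s. ennreal (1 - s) * gagliardo_energy \<Omega> s p \<alpha> \<beta> f) < \<infinity>))))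
     \<and> (p = 1 \<longrightarrow>
         (\<forall>\<alpha> \<beta>.
            W1p_extension_domain \<Omega> 1 (\<alpha> + \<beta>) \<and>
            muckenhoupt_A1 (dist_weight \<Omega> (\<alpha> + \<beta>)) \<and>
            weight_condition \<Omega> \<alpha> \<beta>
            \<longrightarrow> (\<forall>f\<in>W1p_dist \<Omega> 1 (\<alpha> + \<beta>).
                  ((\<lambda>s. ennreal (1 - s) * gagliardo_energy \<Omega> s 1 \<alpha> \<beta> f)
                    \<longlongrightarrow> ennreal (K_const DIM('a) 1)
                          * weighted_energy \<Omega> 1 (dist_weight \<Omega> (\<alpha> + \<beta>)) (weak_grad \<Omega> f))
                  (at_left 1))))"
proof -
  note \<Omega> = \<open>open \<Omega>\<close> \<open>\<Omega> \<noteq> {}\<close> \<open>\<Omega> \<noteq> UNIV\<close>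
  have b: "((\<lambda>s. ennreal (1 - s) * gagliardo_energy \<Omega> s p \<alpha> \<beta> f)
        \<longlongrightarrow> (if f \<in> W1p_dist \<Omega> p (\<alpha> + \<beta>)
              then ennreal (K_const DIM('a) p) * weighted_energy \<Omega> p (dist_weight \<Omega> (\<alpha> + \<beta>)) (weak_grad \<Omega> f)
              else \<infinity>)) (at_left 1)
      \<and> (f \<in> W1p_dist \<Omega> p (\<alpha> + \<beta>) \<longleftrightarrow> Liminf (at_left 1) (\<lambda>s. ennreal (1 - s) * gagliardo_energy \<Omega> s p \<alpha> \<beta> f) < \<infinity>)"
    if p: "p > 1" and ext: "W1p_extension_domain \<Omega> p (\<alpha> + \<beta>)" and Ap: "muckenhoupt_Ap p (dist_weight \<Omega> (\<alpha> + \<beta>))"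
      and w: "weight_condition \<Omega> \<alpha> \<beta>" and f: "f \<in> weighted_Lp \<Omega> p (dist_weight \<Omega> (\<alpha> + \<beta>))" for \<alpha> \<beta> f
  proof -
    have wc: "p > 1 \<and> muckenhoupt_Ap p (dist_weight \<Omega> (\<alpha> + \<beta>)) \<or> muckenhoupt_A1 (dist_weight \<Omega> (\<alpha> + \<beta>))" using p Ap by simp
    note \<alpha>\<beta> = weight_condition_consequences(1,2)[OF \<Omega> w wc]
    obtain C where A: "pointwise_A1 \<Omega> (\<alpha> + \<beta>) C" using weight_condition_consequences(3)[OF \<Omega> w wc] by blast
    let ?X = "\<lambda>s. ennreal (1 - s) * gagliardo_energy \<Omega> s p \<alpha> \<beta> f"
    show ?thesis
    proof (cases "f \<in> W1p_dist \<Omega> p (\<alpha> + \<beta>)")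
      case True
      note lim = sobolev_limit[OF \<Omega> \<open>p \<ge> 1\<close> \<alpha>\<beta> A ext True]
      have "Liminf (at_left 1) ?X < \<infinity>"
        using lim_imp_Liminf[OF trivial_limit_at_left_real lim(1)] lim(2) by (simp add: ennreal_mult_less_top)
      then show ?thesis using True lim(1) by simp
    next
      case False
      \<comment> \<open>Without divergence some sequence tending to 1 would have bounded energies,
        and f would lie in the Sobolev space.\<close>
      have lim: "(?X \<longlongrightarrow> \<infinity>) (at_left 1)"
      proof (rule tendsto_at_left_1I)
        fix S :: "nat \<Rightarrow> real" and l
        assume "S \<longlonglongrightarrow> 1" "\<And>n. 0 < S n" "\<And>n. S n < 1" "l < \<infinity>" "\<And>n. ?X (S n) \<le> l"
        then have "f \<in> W1p_dist \<Omega> p (\<alpha> + \<beta>)" by (intro W1p_if_energy_bounded[OF \<Omega>(1,3) p \<alpha>\<beta> f])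
        then show "\<infinity> \<le> l" using False by simp
      qed simp
      have "Liminf (at_left 1) ?X = \<infinity>" by (rule lim_imp_Liminf[OF trivial_limit_at_left_real lim])
      then show ?thesis using False lim by simp
    qed
  qed
  have c: "((\<lambda>s. ennreal (1 - s) * gagliardo_energy \<Omega> s 1 \<alpha> \<beta> f)
        \<longlongrightarrow> ennreal (K_const DIM('a) 1) * weighted_energy \<Omega> 1 (dist_weight \<Omega> (\<alpha> + \<beta>)) (weak_grad \<Omega> f)) (at_left 1)"
    if ext: "W1p_extension_domain \<Omega> 1 (\<alpha> + \<beta>)" and A1: "muckenhoupt_A1 (dist_weight \<Omega> (\<alpha> + \<beta>))"
      and w: "weight_condition \<Omega> \<alpha> \<beta>" and f: "f \<in> W1p_dist \<Omega> 1 (\<alpha> + \<beta>)" for \<alpha> \<beta> f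
    using weight_condition_consequences[OF \<Omega> w disjI2[OF A1]] sobolev_limit(1)[OF \<Omega> order_refl _ _ _ ext f] by blast
  show ?thesis
  proof (intro conjI allI impI ballI, goal_cases)
    case (1 f U x)
    then show ?case using smooth_case[OF \<open>p \<ge> 1\<close> \<Omega>(1,3), of f U] by (cases x) blast
  next
    case (2 \<alpha> \<beta> f)
    then show ?case using b[of \<alpha> \<beta> f] by blast
  next
    case (3 \<alpha> \<beta> f)
    then show ?case using b[of \<alpha> \<beta> f] by blast
  next
    case (4 \<alpha> \<beta> f)
    then show ?case using c[of \<alpha> \<beta> f] by blast
  qed
qed

end
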